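(* There exist smooth boundary data $\phi(\cdot,\tau)$, $\tau\in\partial\mathbb D$, on $\mathbb P^1\times\partial\mathbb D$ for which the solution to the Dirichlet problem for the Homogeneous Monge-Ampère equation on $\mathbb P^1\times\overline{\mathbb D}$ has the following property: there exists an open set $U$ in $\mathbb P^1\times\overline{\mathbb D}$ meeting $\mathbb P^1\times\partial\mathbb D$ such that no harmonic disc intersects $U$.
   Context: $\mathbb D\subset\mathbb C$ is the open unit disc. $\omega_{FS}$ is the Fubini-Study form on $\mathbb P^1=\mathbb C\cup\{\infty\}$, with $\omega_{FS}=dd^c\ln(1+|z|^2)$ on $\mathbb C$ and $dd^c$ normalized so that $dd^c\ln|z|^2=\delta_0$. $\pi\colon\mathbb P^1\times\overline{\mathbb D}\to\mathbb P^1$ is the projection. Smooth boundary data: a smooth real function $\phi(z,\tau)$ on $\mathbb P^1\times\partial\mathbb D$ such that $\omega_{FS}+dd^c\phi(\cdot,\tau)$ is a Kähler form for each $\tau\in\partial\mathbb D$. Solution of the HMAE with this boundary data: $$\Phi=\sup\{\psi:\psi\text{ usc on }\mathbb P^1\times\overline{\mathbb D},\ \pi^*\omega_{FS}+dd^c\psi\ge0,\ \psi(\cdot,\tau)\le\phi(\cdot,\tau)\text{ for }\tau\in\partial\mathbb D\}.$$ Harmonic disc: for $g\colon\mathbb D\to\mathbb P^1$ holomorphic, the graph $\{(g(\tau),\tau):\tau\in\mathbb D\}$ is a harmonic disc (with respect to $\Phi$) if the restriction of $\pi^*\omega_{FS}+dd^c\Phi$ to it vanishes, i.e. $g^*\omega_{FS}+dd^c_\tau\big(\Phi(g(\tau),\tau)\big)=0$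 on $\mathbb D$. *)

theory Defs
  imports "HOL-Complex_Analysis.Complex_Analysis"
begin

section \<open>The complex projective line\<close>

datatype p1 = Fin complex | Infty

definition chart_Infty :: "complex \<Rightarrow> p1" where
  "chart_Infty w = (if w = 0 then Infty else Fin (1 / w))"

text \<open>The two standard parametrisations of the projective line by the complex plane. They are
  injective, so a coordinate function is obtained as \<^term>\<open>inv c\<close> on \<^term>\<open>range c\<close>.\<close>

definition charts :: "(complex \<Rightarrow> p1) set" where
  "charts = {Fin, chart_Infty}"

instantiation p1 :: topological_space
begin

definition open_p1 :: "p1 set \<Rightarrow> bool" where
  "open_p1 U \<longleftrightarrow> (\<forall>c\<in>charts. open (c -` U))"

instance
proof
  show "open (UNIV :: p1 set)"
    by (simp add: open_p1_def)
next
  fix S T :: "p1 set"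
  assume "open S" "open T"
  then show "open (S \<inter> T)"
    by (auto simp: open_p1_def vimage_Int)
next
  fix K :: "p1 set set"
  assume "\<forall>S\<in>K. open S"
  then show "open (\<Union>K)"
    by (auto simp: open_p1_def vimage_Union)
qed

end

definition holomorphic_to_p1 :: "(complex \<Rightarrow> p1) \<Rightarrow> complex set \<Rightarrow> bool" where
  "holomorphic_to_p1 g S \<longleftrightarrow>
     continuous_on S g \<and>
     (\<forall>c\<in>charts. (\<lambda>\<tau>. inv c (g \<tau>)) holomorphic_on {\<tau>\<in>S. g \<tau> \<in> range c})"

section \<open>Smooth functions and the operator $dd^c$\<close>

fun C_k :: "nat \<Rightarrow> ('a::euclidean_space \<Rightarrow> real) \<Rightarrow> bool" where
  "C_k 0 f \<longleftrightarrow> continuous_on UNIV f"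
| "C_k (Suc k) f \<longleftrightarrow>
     (\<forall>x. f differentiable (at x)) \<and> (\<forall>v. C_k k (\<lambda>x. frechet_derivative f (at x) v))"

definition smooth :: "('a::euclidean_space \<Rightarrow> real) \<Rightarrow> bool" where
  "smooth f \<longleftrightarrow> (\<forall>k. C_k k f)"

definition laplacian :: "(complex \<Rightarrow> real) \<Rightarrow> complex \<Rightarrow> real" where
  "laplacian f z =
     (\<Sum>b\<in>Basis. frechet_derivative (\<lambda>x. frechet_derivative f (at x) b) (at z) b)"

text \<open>Forms of top degree on the plane are identified with their densities with respect to
  Lebesgue measure. As the Laplacian of $\ln |z|^2$ is $4 \pi \delta_0$, the normalisation
  $dd^c \ln |z|^2 = \delta_0$ means that $dd^c$ is the Laplacian divided by $4 \pi$.\<close>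

definition ddc :: "(complex \<Rightarrow> real) \<Rightarrow> complex \<Rightarrow> real" where
  "ddc f z = laplacian f z / (4 * pi)"

text \<open>The Fubini-Study potential. Since $\ln (1 + |z|^2)$ and $\ln (1 + |1/z|^2)$ differ by
  the function $\ln |z|^2$, which is harmonic on $z \neq 0$, the same expression
  is a potential in the coordinate at infinity.\<close>

definition fs_potential :: "complex \<Rightarrow> real" where
  "fs_potential z = ln (1 + (cmod z)\<^sup>2)"

definition fs_density :: "complex \<Rightarrow> real" where
  "fs_density z = ddc fs_potential z"

definition fs_pullback :: "(complex \<Rightarrow> p1) \<Rightarrow> complex \<Rightarrow> real" where
  "fs_pullback g \<tau> =
     (let c = (if g \<tau> = Infty then chart_Infty else Fin)
      in fs_density (inv c (g \<tau>)) * (cmod (deriv (\<lambda>t. inv c (g t)) \<tau>))\<^sup>2)"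

definition test_function :: "complex set \<Rightarrow> (complex \<Rightarrow> real) \<Rightarrow> bool" where
  "test_function S \<eta> \<longleftrightarrow>
     smooth \<eta> \<and> compact (closure {z. \<eta> z \<noteq> 0}) \<and> closure {z. \<eta> z \<noteq> 0} \<subseteq> S"

text \<open>The equation $dd^c u = \rho$ on the open set \<open>S\<close>, in the sense of currents. A weak
  formulation is needed because solutions of the Monge-Ampere equation need not be twice
  differentiable.\<close>

definition weak_ddc_eq :: "complex set \<Rightarrow> (complex \<Rightarrow> real) \<Rightarrow> (complex \<Rightarrow> real) \<Rightarrow> bool" where
  "weak_ddc_eq S u \<rho> \<longleftrightarrow>
     (\<forall>K. compact K \<and> K \<subseteq> S \<longrightarrow> set_integrable lborel K u) \<and>
     (\<forall>\<eta>. test_function S \<eta> \<longrightarrow>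
        (LINT z|lborel. u z * ddc \<eta> z) = (LINT z|lborel. \<eta> z * \<rho> z))"

section \<open>Plurisubharmonic functions\<close>

definition usc_on :: "'a::topological_space set \<Rightarrow> ('a \<Rightarrow> ereal) \<Rightarrow> bool" where
  "usc_on S f \<longleftrightarrow>
     (\<forall>x\<in>S. f x < \<infinity>) \<and> (\<forall>r. openin (top_of_set S) {x\<in>S. f x < r})"

text \<open>The mean over the circle \<open>{a + \<zeta> b | \<bar>\<zeta>\<bar> = 1}\<close>, as the difference of the integrals of the
  positive and the negative part. If \<open>u\<close> is upper semicontinuous, the first of these is finite,
  whereas the second one may be infinite.\<close>

definition circle_mean ::
    "(complex \<times> complex \<Rightarrow> ereal) \<Rightarrow> complex \<times> complex \<Rightarrow> complex \<times> complex \<Rightarrow> ereal" where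
  "circle_mean u a b =
     (let v = (\<lambda>\<theta>. u (fst a + cis \<theta> * fst b, snd a + cis \<theta> * snd b))
      in ereal (1 / (2 * pi)) *
         (enn2ereal (\<integral>\<^sup>+\<theta>\<in>{0..2 * pi}. e2ennreal (max 0 (v \<theta>)) \<partial>lborel) -
          enn2ereal (\<integral>\<^sup>+\<theta>\<in>{0..2 * pi}. e2ennreal (max 0 (- v \<theta>)) \<partial>lborel)))"

text \<open>The constant function $-\infty$ is admitted; this does not affect suprema.\<close>

definition psh_on :: "(complex \<times> complex) set \<Rightarrow> (complex \<times> complex \<Rightarrow> ereal) \<Rightarrow> bool" where
  "psh_on S u \<longleftrightarrow>
     usc_on S u \<and>
     (\<forall>a b. (\<forall>\<zeta>\<in>cball 0 1. (fst a + \<zeta> * fst b, snd a + \<zeta> * snd b) \<in> S) \<longrightarrow>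
        u a \<le> circle_mean u a b)"

text \<open>For \<open>\<psi>\<close> on the product of the projective line with the closed unit disc: the condition
  $\pi^* \omega_{FS} + dd^c \psi \ge 0$ over the open unit disc, that is, adding a local potential
  of $\pi^* \omega_{FS}$ to \<open>\<psi>\<close> gives a plurisubharmonic function.\<close>

definition fs_psh :: "(p1 \<times> complex \<Rightarrow> ereal) \<Rightarrow> bool" where
  "fs_psh \<psi> \<longleftrightarrow>
     (\<forall>c\<in>charts. psh_on (UNIV \<times> ball 0 1)
        (\<lambda>(z, \<tau>). \<psi> (c z, \<tau>) + ereal (fs_potential z)))"

section \<open>The Dirichlet problem for the homogeneous Monge-Ampere equation\<close>

text \<open>Only the values of \<open>\<phi> (z, \<tau>)\<close> with \<open>\<bar>\<tau>\<bar> = 1\<close> matter. The unit circle is parametrised by its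
  universal covering \<open>cis\<close>, which is a local diffeomorphism.\<close>

definition smooth_boundary_data :: "(p1 \<times> complex \<Rightarrow> real) \<Rightarrow> bool" where
  "smooth_boundary_data \<phi> \<longleftrightarrow>
     (\<forall>c\<in>charts. smooth (\<lambda>(z, \<theta>::real). \<phi> (c z, cis \<theta>))) \<and>
     (\<forall>\<tau>\<in>sphere 0 1. \<forall>c\<in>charts. \<forall>z. fs_density z + ddc (\<lambda>z. \<phi> (c z, \<tau>)) z > 0)"

definition hmae_solution :: "(p1 \<times> complex \<Rightarrow> real) \<Rightarrow> p1 \<times> complex \<Rightarrow> ereal" where
  "hmae_solution \<phi> p =
     (SUP \<psi> \<in> {\<psi>. usc_on (UNIV \<times> cball 0 1) \<psi> \<and> fs_psh \<psi> \<and>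
                   (\<forall>z. \<forall>\<tau>\<in>sphere 0 1. \<psi> (z, \<tau>) \<le> ereal (\<phi> (z, \<tau>)))}. \<psi> p)"

definition disc_graph :: "(complex \<Rightarrow> p1) \<Rightarrow> (p1 \<times> complex) set" where
  "disc_graph g = (\<lambda>\<tau>. (g \<tau>, \<tau>)) ` ball 0 1"

text \<open>The solution lies between the minimum and the maximum of the boundary data, so
  \<open>real_of_ereal\<close> loses nothing here.\<close>

definition harmonic_disc :: "(p1 \<times> complex \<Rightarrow> ereal) \<Rightarrow> (complex \<Rightarrow> p1) \<Rightarrow> bool" where
  "harmonic_disc \<Phi> g \<longleftrightarrow>
     holomorphic_to_p1 g (ball 0 1) \<and>
     weak_ddc_eq (ball 0 1) (\<lambda>\<tau>. real_of_ereal (\<Phi> (g \<tau>, \<tau>))) (\<lambda>\<tau>. - fs_pullback g \<tau>)"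

end

theory Submission
  imports Defs
begin

text \<open>In the coordinate $y = 1 - \tau z$ the potential $\phi + \ln(1 + |z|^2)$ of the boundary data is
  $u(y) = \frac12 \ln((E + |y|^2)(1 + E |y|^2))$ on every fibre, with a small $E$. Adding the
  Fubini-Study potential to \<open>\<Phi>\<close> gives a function $Q(y, \tau) \ge u(y)$ that is psh in the original
  coordinates and invariant under rotations of $\tau$ for fixed $y$; hence it is convex in
  $s = - \ln |\tau|^2$, and $Q \le u + s$.

  Along a harmonic disc $g$, put $f = 1 - \tau g$. Then $Q(f(\tau), \tau)$ is harmonic (Weyl's lemma), and
  Kiselman's minimum principle applies: if $c$ is a slope of $Q(f(\tau_0), \cdot)$ at one $\tau_0$, then
  for every $\tau$ the function $\zeta \mapsto Q(f(\tau), \zeta) + c \ln |\zeta|^2$ has its minimum at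
  $\zeta = \tau$. For a disc through the open set, $\frac14 \le c < 1$. The lower bound comes from a
  competitor, built with Buzano's inequality, that shows $Q \ge u + s/4$ near $y = -E$.
  On the other hand $Q = u + s$ at two points $y = -r, -1/r$, and $Q(y, 1/4)$ is nearly $0$ for $|y| = 1$. So
  $f$ omits $-r$ and $-1/r$, and $|f| \neq 1$ on $|\tau| = 1/2$. But $f(0) = 1$, so
  $(f + r)/(1 + r f)$ is holomorphic without zeros, equals $1$ at $0$ and does not have
  modulus $1$ on that circle, against the maximum modulus principle for it or its inverse.\<close>

section \<open>Means over circles\<close>

text \<open>The obstruction is topological. For a slope c let v(y) be the infimum over \<zeta> of
  \<open>Q y \<zeta>\<close> + c ln|\<zeta>|^2. Heuristically v solves an obstacle problem for u
  with a logarithmic pole of weight c at y = 1 (a Hele-Shaw flow), and a disc of slope c would have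
  to sweep out {v < u}, which would then be simply connected. The data are built to prevent this:
  the mass of dd^c u sits near y = 0 and y = \<infinity>, in between u is nearly ln|y|, and so the
  flow from y = 1 closes up around |y| = 1 before it reaches the contact points -r and -1/r on the
  two sides of that circle.

  The other obstacle is regularity: \<Phi> is merely a supremum, and a disc satisfies only a weak
  equation. So subharmonicity is tested throughout by continuous majorants on circles, which avoids
  integrals of functions with value -\<infinity>; upper bounds for \<Phi> come from explicit discs,
  lower bounds from logarithms of explicit forms, and regularity along a disc comes from the disc
  equation itself.\<close>

definition amean :: "(real \<Rightarrow> real) \<Rightarrow> real" where
  "amean f = (LINT t:{0..2*pi}|lborel. f t) / (2 * pi)"

lemma set_integrable_cont:
  fixes f :: "real \<Rightarrow> real"
  shows "continuous_on {0..2*pi} f \<Longrightarrow> set_integrable lborel {0..2*pi} f"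
  by (rule borel_integrable_atLeastAtMost')

lemma amean_integral: "continuous_on {0..2*pi} f \<Longrightarrow> amean f = integral {0..2*pi} f / (2*pi)"
  unfolding amean_def by (subst set_borel_integral_eq_integral) (auto intro: set_integrable_cont)

lemma amean_const [simp]: "amean (\<lambda>t. c) = c"
  by (subst amean_integral) auto

lemma amean_add:
  assumes "continuous_on {0..2*pi} f" "continuous_on {0..2*pi} g"
  shows "amean (\<lambda>t. f t + g t) = amean f + amean g"
  using assms unfolding amean_def
  by (subst set_integral_add) (auto intro: set_integrable_cont simp: add_divide_distrib)

lemma amean_diff:
  assumes "continuous_on {0..2*pi} f" "continuous_on {0..2*pi} g"
  shows "amean (\<lambda>t. f t - g t) = amean f - amean g"
  using assms unfolding amean_def
  by (subst set_integral_diff) (auto intro: set_integrable_cont simp: diff_divide_distrib)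

lemma amean_cmult: "amean (\<lambda>t. c * f t) = c * amean f"
  unfolding amean_def by simp

lemma amean_cong: "(\<And>t. 0 \<le> t \<Longrightarrow> t \<le> 2*pi \<Longrightarrow> f t = g t) \<Longrightarrow> amean f = amean g"
  unfolding amean_def by (auto intro!: arg_cong[where f="\<lambda>x. x/(2*pi)"] set_lebesgue_integral_cong)

lemma amean_mono:
  assumes "continuous_on {0..2*pi} f" "continuous_on {0..2*pi} g"
    and "\<And>t. 0 \<le> t \<Longrightarrow> t \<le> 2*pi \<Longrightarrow> f t \<le> g t"
  shows "amean f \<le> amean g"
  unfolding amean_def using assms
  by (intro divide_right_mono set_integral_mono set_integrable_cont) auto

lemma continuous_on_circle:
  assumes "continuous_on (sphere a r) w" "0 \<le> r"
  shows "continuous_on S (\<lambda>t. w (a + complex_of_real r * cis t))"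
  by (rule continuous_on_compose2[OF assms(1)])
     (use assms(2) in \<open>auto intro!: continuous_intros simp: dist_norm norm_mult\<close>)

lemma amean_holomorphic:
  assumes h: "continuous_on (cball a r) h" "h holomorphic_on ball a r" and r: "0 < r"
  shows "amean (\<lambda>t. Re (h (a + of_real r * cis t))) = Re (h a)"
proof -
  have ch: "continuous_on S (\<lambda>t. h (a + of_real r * cis t))" for S
    by (rule continuous_on_compose2[OF h(1)])
     (use r in \<open>auto intro!: continuous_intros simp: dist_norm norm_mult\<close>)
  have "((\<lambda>u. h u / (u - a)) has_contour_integral (2 * of_real pi * \<i> * h a)) (circlepath a r)"
    by (rule Cauchy_integral_circlepath[OF h]) (use r in auto)
  then have "2 * of_real pi * \<i> * h a = contour_integral (part_circlepath a r 0 (2*pi)) (\<lambda>u. h u / (u - a))"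
    by (simp add: circlepath_def contour_integral_unique)
  also have "\<dots> = integral {0..2*pi} (\<lambda>t. h (a + r * cis t) / (a + r * cis t - a) * r * \<i> * cis t)"
    by (rule contour_integral_part_circlepath_eq) simp
  also have "\<dots> = integral {0..2*pi} (\<lambda>t. \<i> * h (a + r * cis t))"
    by (rule integral_cong) (use r in \<open>auto simp: field_simps\<close>)
  also have "\<dots> = \<i> * integral {0..2*pi} (\<lambda>t. h (a + r * cis t))"
    by (simp add: integral_mult_right)
  finally have eq: "integral {0..2*pi} (\<lambda>t. h (a + r * cis t)) = 2 * of_real pi * h a"
    by (simp add: mult.assoc)
  have "((\<lambda>t. h (a + r * cis t)) has_integral (2 * of_real pi * h a)) {0..2*pi}"
    unfolding eq[symmetric] by (intro integrable_integral integrable_continuous_real ch)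
  then have "((\<lambda>t. Re (h (a + r * cis t))) has_integral Re (2 * of_real pi * h a)) {0..2*pi}"
    by (rule has_integral_Re)
  then have "integral {0..2*pi} (\<lambda>t. Re (h (a + r * cis t))) = 2 * pi * Re (h a)"
    by (simp add: integral_unique)
  then show ?thesis
    by (subst amean_integral) (auto intro!: continuous_intros ch)
qed

lemma amean_holomorphic_open:
  assumes "h holomorphic_on S" "cball a r \<subseteq> S" "0 < r"
  shows "amean (\<lambda>t. Re (h (a + of_real r * cis t))) = Re (h a)"
proof (rule amean_holomorphic)
  show "continuous_on (cball a r) h"
    using assms by (auto intro: holomorphic_on_subset holomorphic_on_imp_continuous_on)
  show "h holomorphic_on ball a r"
    by (rule holomorphic_on_subset[OF assms(1)]) (use assms(2) ball_subset_cball[of a r] in auto)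
qed fact

section \<open>Upper semicontinuous functions\<close>

lemma usc_onD_less: "usc_on S f \<Longrightarrow> x \<in> S \<Longrightarrow> f x < \<infinity>"
  by (simp add: usc_on_def)

lemma usc_on_iff:
  fixes f :: "'a::metric_space \<Rightarrow> ereal"
  shows "usc_on S f \<longleftrightarrow> (\<forall>x\<in>S. f x < \<infinity>) \<and>
     (\<forall>x\<in>S. \<forall>r. f x < r \<longrightarrow> (\<exists>d>0. \<forall>y\<in>S. dist y x < d \<longrightarrow> f y < r))"
proof -
  have "openin (top_of_set S) {x\<in>S. f x < r} \<longleftrightarrow>
      (\<forall>x\<in>S. f x < r \<longrightarrow> (\<exists>d>0. \<forall>y\<in>S. dist y x < d \<longrightarrow> f y < r))" for r
    unfolding openin_euclidean_subtopology_iff by (auto 0 3)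
  then show ?thesis unfolding usc_on_def by auto
qed

lemma usc_onD:
  fixes f :: "'a::metric_space \<Rightarrow> ereal"
  assumes "usc_on S f" "x \<in> S" "f x < r"
  obtains d where "d > 0" "\<And>y. y \<in> S \<Longrightarrow> dist y x < d \<Longrightarrow> f y < r"
  using assms unfolding usc_on_iff by metis

lemma usc_on_subset: "usc_on S f \<Longrightarrow> T \<subseteq> S \<Longrightarrow> usc_on T f"
proof -
  assume *: "usc_on S f" "T \<subseteq> S"
  show ?thesis unfolding usc_on_def
  proof (intro conjI ballI allI)
    fix r
    obtain V where V: "open V" "{x \<in> S. f x < r} = S \<inter> V" using *(1) unfolding usc_on_def openin_open by blast
    then have "{x \<in> T. f x < r} = T \<inter> V" using *(2) by blast
    then show "openin (top_of_set T) {x \<in> T. f x < r}" using V(1) by (auto simp: openin_open)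
  qed (use * in \<open>auto simp: usc_on_def\<close>)
qed

lemma usc_on_compose:
  assumes f: "usc_on S f" and g: "continuous_on T g" "g ` T \<subseteq> S"
  shows "usc_on T (\<lambda>x. f (g x))"
  unfolding usc_on_def
proof (intro conjI ballI allI)
  fix x assume "x \<in> T" then show "f (g x) < \<infinity>" using f g by (auto simp: usc_on_def)
next
  fix r
  have "{x \<in> T. f (g x) < r} = T \<inter> g -` {y \<in> S. f y < r}" using g by auto
  moreover have "openin (top_of_set T) \<dots>"
    by (rule continuous_openin_preimage[OF g(1), of S]) (use g f in \<open>auto simp: usc_on_def\<close>)
  ultimately show "openin (top_of_set T) {x \<in> T. f (g x) < r}" by simp
qed

lemma usc_on_add_continuous:
  fixes f :: "'a::metric_space \<Rightarrow> ereal"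
  assumes f: "usc_on S f" and h: "continuous_on S h"
  shows "usc_on S (\<lambda>x. f x + ereal (h x))"
  unfolding usc_on_iff
proof (intro conjI ballI allI impI)
  fix x assume "x \<in> S" then show "f x + ereal (h x) < \<infinity>" using usc_onD_less[OF f] by auto
next
  fix x r assume x: "x \<in> S" "f x + ereal (h x) < r"
  have fi: "f x < \<infinity>" using usc_onD_less[OF f x(1)] .
  \<comment> \<open>The real q and the slack e also serve the cases f x = -\<infinity> and r =
    \<infinity>, where no real difference r - f x is available.\<close>
  have "\<exists>q e. f x < ereal q \<and> 0 < e \<and> ereal (q + h x + e) \<le> r"
  proof (cases "f x")
    case (real fx)
    show ?thesis
    proof (cases r)
      case (real r')
      with \<open>f x = ereal fx\<close> x(2) have "fx + h x < r'" by simp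
      then show ?thesis using \<open>f x = ereal fx\<close> real
        by (intro exI[of _ "fx + (r' - fx - h x)/2"] exI[of _ "(r' - fx - h x)/2"]) (auto simp: field_simps)
    next
      case PInf
      then show ?thesis using \<open>f x = ereal fx\<close> by (intro exI[of _ "fx+1"] exI[of _ 1]) auto
    qed (use x(2) in auto)
  next
    case MInf
    show ?thesis
    proof (cases r)
      case (real r')
      then show ?thesis using MInf by (intro exI[of _ "r' - h x - 1"] exI[of _ 1]) auto
    next
      case PInf
      then show ?thesis using MInf by (intro exI[of _ 0] exI[of _ 1]) auto
    qed (use x(2) in auto)
  qed (use fi in auto)
  then obtain q e where q: "f x < ereal q" "0 < e" "ereal (q + h x + e) \<le> r" by blast
  obtain d1 where d1: "d1 > 0" "\<And>y. y \<in> S \<Longrightarrow> dist y x < d1 \<Longrightarrow> f y < ereal q"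
    using usc_onD[OF f x(1) q(1)] by blast
  obtain d2 where d2: "d2 > 0" "\<And>y. y \<in> S \<Longrightarrow> dist y x < d2 \<Longrightarrow> dist (h y) (h x) < e"
    using h x(1) q(2) unfolding continuous_on_iff by metis
  show "\<exists>d>0. \<forall>y\<in>S. dist y x < d \<longrightarrow> f y + ereal (h y) < r"
  proof (intro exI[of _ "min d1 d2"] conjI ballI impI)
    fix y assume y: "y \<in> S" "dist y x < min d1 d2"
    have "f y < ereal q" "h y < h x + e" using d1(2)[OF y(1)] d2(2)[OF y(1)] y(2) by (auto simp: dist_real_def)
    then have "f y + ereal (h y) < ereal (q + h x + e)" by (cases "f y") auto
    then show "f y + ereal (h y) < r" using q(3) by (rule less_le_trans)
  qed (use d1 d2 in auto)
qed

text \<open>If no maximum exists, the relatively open sets {z. f z < f x} cover C. Among the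
  finitely many x of a subcover take one with the largest f x: no set of the subcover contains
  it.\<close>

lemma usc_attains_sup:
  fixes f :: "'a::metric_space \<Rightarrow> ereal"
  assumes f: "usc_on C f" and C: "compact C" "C \<noteq> {}"
  shows "\<exists>x\<in>C. \<forall>y\<in>C. f y \<le> f x"
proof (rule ccontr)
  assume neg: "\<not> ?thesis"
  define \<F> where "\<F> = (\<lambda>x. {z\<in>C. f z < f x}) ` C"
  have op: "openin (top_of_set C) U" if "U \<in> \<F>" for U
    using that f unfolding \<F>_def usc_on_def by auto
  have "C \<subseteq> \<Union>\<F>"
    unfolding \<F>_def using neg by (auto simp: not_le)
  then obtain \<G> where G: "finite \<G>" "\<G> \<subseteq> \<F>" "C \<subseteq> \<Union>\<G>"
    using compact_eq_openin_cover[of C] C(1) op by metis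
  obtain X where X: "finite X" "X \<subseteq> C" "\<G> = (\<lambda>x. {z\<in>C. f z < f x}) ` X"
    using G(1,2) unfolding \<F>_def by (auto dest: finite_subset_image)
  have "X \<noteq> {}" using X G C by auto
  then have "Max (f ` X) \<in> f ` X" using X(1) by auto
  then obtain x where x: "x \<in> X" "f x = Max (f ` X)" by auto
  then have "x \<in> C" using X by auto
  then obtain y where "y \<in> X" "f x < f y" using G(3) X(3) by auto
  moreover have "f y \<le> f x" using x(2) X(1) \<open>y \<in> X\<close> by simp
  ultimately show False by simp
qed

text \<open>The approximating functions are sup-convolutions with multiples of the distance.\<close>

lemma usc_approx:
  fixes f :: "'a::metric_space \<Rightarrow> ereal"
  assumes f: "usc_on C f" and C: "compact C" "C \<noteq> {}"
  obtains w :: "nat \<Rightarrow> 'a \<Rightarrow> real" where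
    "\<And>n. continuous_on C (w n)" "\<And>n x. x \<in> C \<Longrightarrow> f x \<le> ereal (w n x)"
    "\<And>x. x \<in> C \<Longrightarrow> decseq (\<lambda>n. w n x)" "\<And>x. x \<in> C \<Longrightarrow> (\<lambda>n. ereal (w n x)) \<longlonglongrightarrow> f x"
proof -
  obtain m where m: "m \<in> C" "\<And>y. y \<in> C \<Longrightarrow> f y \<le> f m" using usc_attains_sup[OF assms] by auto
  have "f m < \<infinity>" using usc_onD_less[OF f m(1)] .
  then obtain B where B: "f m \<le> ereal B" by (cases "f m") auto
  have fB: "f y \<le> ereal B" if "y \<in> C" for y using m(2)[OF that] B by order
  \<comment> \<open>Truncation at -n keeps the suprema real where f is -\<infinity>; it decreases
    with n, and so does the penalised supremum.\<close>
  define F where "F = (\<lambda>n y. real_of_ereal (max (f y) (ereal (- real n))))"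
  have F: "ereal (F n y) = max (f y) (ereal (- real n))" if "y \<in> C" for n y
    using fB[OF that] unfolding F_def by (cases "f y") (auto simp: max_def)
  have FB: "F n y \<le> max B 0" if "y \<in> C" for n y
  proof -
    have "ereal (F n y) \<le> ereal (max B 0)" unfolding F[OF that] using fB[OF that]
      by (cases "f y") (auto simp: max_def)
    then show ?thesis by (auto simp: max_def split: if_splits)
  qed
  define w where "w = (\<lambda>n x. SUP y\<in>C. F n y - real n * dist x y)"
  have bdd: "bdd_above ((\<lambda>y. F n y - real n * dist x y) ` C)" for n x
    by (intro bdd_aboveI2[of _ _ "max B 0"]) (use FB in \<open>smt (verit) mult_nonneg_nonneg of_nat_0_le_iff zero_le_dist\<close>)
  have lip: "w n x \<le> w n x' + real n * dist x x'" for n x x'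
    unfolding w_def
  proof (rule cSUP_least)
    fix y assume y: "y \<in> C"
    have "F n y - real n * dist x' y \<le> (SUP y\<in>C. F n y - real n * dist x' y)"
      by (rule cSUP_upper[OF y bdd])
    moreover have "real n * dist x' y \<le> real n * (dist x x' + dist x y)"
      by (intro mult_left_mono) (auto simp: dist_triangle3)
    ultimately show "F n y - real n * dist x y \<le> (SUP y\<in>C. F n y - real n * dist x' y) + real n * dist x x'"
      by (simp add: algebra_simps)
  qed fact
  have 1: "continuous_on C (w n)" for n
  proof (rule continuous_onI)
    fix x e :: 'a and \<epsilon> :: real assume "0 < \<epsilon>"
    have *: "\<bar>w n x' - w n x\<bar> \<le> real n * dist x' x" for x'
      using lip[of n x' x] lip[of n x x'] by (auto simp: dist_commute abs_le_iff)
    show "\<exists>d>0. \<forall>x'\<in>C. dist x' x < d \<longrightarrow> dist (w n x') (w n x) \<le> \<epsilon>"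
    proof (intro exI[of _ "\<epsilon> / (real n + 1)"] conjI ballI impI)
      fix x' assume "dist x' x < \<epsilon> / (real n + 1)"
      then have "(real n + 1) * dist x' x < \<epsilon>" by (simp add: field_simps)
      moreover have "real n * dist x' x \<le> (real n + 1) * dist x' x" by (simp add: algebra_simps)
      ultimately show "dist (w n x') (w n x) \<le> \<epsilon>" using *[of x'] by (simp add: dist_real_def)
    qed (use \<open>0 < \<epsilon>\<close> in auto)
  qed
  have Fw: "F n x \<le> w n x" if "x \<in> C" for n x
    using cSUP_upper[OF that bdd, of n x] unfolding w_def by simp
  have 2: "f x \<le> ereal (w n x)" if "x \<in> C" for n x
  proof -
    have "f x \<le> ereal (F n x)" unfolding F[OF that] by simp
    also have "\<dots> \<le> ereal (w n x)" using Fw[OF that] by simp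
    finally show ?thesis .
  qed
  have Fdec: "F (Suc n) y \<le> F n y" if "y \<in> C" for n y
  proof -
    have "ereal (F (Suc n) y) \<le> ereal (F n y)" unfolding F[OF that] by (intro max.mono) auto
    then show ?thesis by simp
  qed
  have 3: "decseq (\<lambda>n. w n x)" if "x \<in> C" for x
  proof (rule decseq_SucI)
    fix n show "w (Suc n) x \<le> w n x"
      unfolding w_def
      by (rule cSUP_mono[OF C(2) bdd]) (use Fdec in \<open>force intro!: diff_mono mult_right_mono\<close>)
  qed
  have 4: "(\<lambda>n. ereal (w n x)) \<longlonglongrightarrow> f x" if x: "x \<in> C" for x
  proof (rule order_tendstoI)
    fix a assume "a < f x" then show "\<forall>\<^sub>F n in sequentially. a < ereal (w n x)"
      using 2[OF x] by (intro always_eventually) (auto intro: less_le_trans)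
  next
    fix a assume "f x < a"
    then obtain q where q: "f x < ereal q" "ereal q < a" using ereal_dense2 by blast
    obtain d where d: "d > 0" "\<And>y. y \<in> C \<Longrightarrow> dist y x < d \<Longrightarrow> f y < ereal q"
      using usc_onD[OF f x q(1)] by blast
    \<comment> \<open>From N on the truncation level lies below q, and the penalty at distance d
      exceeds the drop from the upper bound \<open>max B 0\<close> to q.\<close>
    obtain N :: nat where N: "real N > \<bar>q\<bar>" "real N * d > max B 0 - q"
    proof -
      obtain N :: nat where N: "real N > max \<bar>q\<bar> ((max B 0 - q) / d)" using reals_Archimedean2 by blast
      then show ?thesis using d(1) by (intro that[of N]) (auto simp: field_simps)
    qed
    have "w n x \<le> q" if n: "n \<ge> N" for n
      unfolding w_def
    proof (rule cSUP_least)
      fix y assume y: "y \<in> C"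
      show "F n y - real n * dist x y \<le> q"
      proof (cases "dist y x < d")
        case True
        have "ereal (F n y) \<le> ereal q" unfolding F[OF y] using d(2)[OF y True] N(1) n by auto
        then have "F n y \<le> q" by simp
        then show ?thesis by (smt (verit) mult_nonneg_nonneg of_nat_0_le_iff zero_le_dist)
      next
        case False
        have "real N * d \<le> real n * dist x y" by (intro mult_mono) (use False n d in \<open>auto simp: dist_commute\<close>)
        then show ?thesis using FB[OF y, of n] N(2) by linarith
      qed
    qed fact
    then show "\<forall>\<^sub>F n in sequentially. ereal (w n x) < a"
      using q(2) by (auto simp: eventually_sequentially intro!: exI[of _ N] le_less_trans[of _ "ereal q"])
  qed
  show thesis using that[OF 1 2 3 4] .
qed

section \<open>Harmonic polynomials are dense in the continuous functions on a circle\<close>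

definition trig_poly :: "(complex \<Rightarrow> real) \<Rightarrow> bool" where
  "trig_poly f \<longleftrightarrow> (\<exists>p. p holomorphic_on UNIV \<and> (\<forall>z\<in>sphere 0 1. f z = Re (p z)))"

lemma trig_poly_add: "trig_poly f \<Longrightarrow> trig_poly g \<Longrightarrow> trig_poly (\<lambda>z. f z + g z)"
  unfolding trig_poly_def
proof clarify
  fix p q assume "p holomorphic_on UNIV" "\<forall>z\<in>sphere 0 1. f z = Re (p z)"
    "q holomorphic_on UNIV" "\<forall>z\<in>sphere 0 1. g z = Re (q z)"
  then show "\<exists>p. p holomorphic_on UNIV \<and> (\<forall>z\<in>sphere 0 1. f z + g z = Re (p z))"
    by (intro exI[of _ "\<lambda>z. p z + q z"]) (auto intro: holomorphic_intros)
qed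

text \<open>Trigonometric polynomials as functions on the unit circle. Negative powers are covered,
  because on the circle Re (c z^(-n)) equals Re (cnj c z^n). The span is an algebra containing Re z
  and Im z, which is what Stone-Weierstrass asks for.\<close>

inductive trig_span :: "(complex \<Rightarrow> real) \<Rightarrow> bool" where
  mono: "trig_span (\<lambda>z. Re (c * z ^ n))"
| add: "trig_span f \<Longrightarrow> trig_span g \<Longrightarrow> trig_span (\<lambda>z. f z + g z)"
| cong: "trig_span f \<Longrightarrow> (\<And>z. cmod z = 1 \<Longrightarrow> g z = f z) \<Longrightarrow> trig_span g"

lemma trig_span_imp_poly: "trig_span f \<Longrightarrow> trig_poly f"
proof (induction rule: trig_span.induct)
  case (mono c n)
  show ?case unfolding trig_poly_def
    by (intro exI[of _ "\<lambda>z. c * z ^ n"]) (auto intro!: holomorphic_intros)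
next
  case (add f g)
  then show ?case by (simp add: trig_poly_add)
next
  case (cong f g)
  then show ?case unfolding trig_poly_def by auto
qed

lemma Re_mult_eq: "Re u * Re v = (Re (u * v) + Re (u * cnj v)) / 2"
  by (simp add: algebra_simps)

text \<open>On the circle cnj z is 1/z, so \<open>Re_mult_eq\<close> turns the product into powers n
  + m and n - m. Symmetry allows m \<le> n, which keeps the exponent n - m natural.\<close>

lemma trig_span_mono_mult: "trig_span (\<lambda>z. Re (c * z ^ n) * Re (d * z ^ m))"
proof -
  have *: "trig_span (\<lambda>z. Re (c * z ^ n) * Re (d * z ^ m))" if "m \<le> n" for c d n m
  proof (rule trig_span.cong[OF trig_span.add[OF trig_span.mono[of "c*d/2" "n+m"] trig_span.mono[of "c*cnj d/2" "n-m"]]])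
    fix z :: complex assume z: "cmod z = 1"
    then have "z * cnj z = 1" by (metis complex_norm_square of_real_1 power_one)
    then have "z ^ m * cnj z ^ m = 1" by (metis power_mult_distrib power_one)
    then have "z ^ n * cnj z ^ m = z ^ (n - m)"
    proof -
      have "z ^ n = z ^ (n - m) * z ^ m" using that by (simp flip: power_add)
      then show ?thesis using \<open>z ^ m * cnj z ^ m = 1\<close> by (simp add: mult.assoc)
    qed
    then have 1: "(c * z ^ n) * cnj (d * z ^ m) = 2 * (c * cnj d / 2 * z ^ (n - m))"
      by (simp add: algebra_simps)
    have 2: "(c * z ^ n) * (d * z ^ m) = 2 * (c * d / 2 * z ^ (n + m))"
      by (simp add: power_add)
    have 3: "Re (2 * x) = 2 * Re x" for x by simp
    show "Re (c * z ^ n) * Re (d * z ^ m) = Re (c * d / 2 * z ^ (n + m)) + Re (c * cnj d / 2 * z ^ (n - m))"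
      unfolding Re_mult_eq 1 2 3 by (simp only: add_divide_distrib)
  qed
  show ?thesis
  proof (cases "m \<le> n")
    case False
    then have "trig_span (\<lambda>z. Re (d * z ^ m) * Re (c * z ^ n))" by (intro *) auto
    then show ?thesis by (simp add: mult.commute)
  qed (rule *)
qed

lemma trig_span_mult: "trig_span f \<Longrightarrow> trig_span g \<Longrightarrow> trig_span (\<lambda>z. f z * g z)"
proof (induction f rule: trig_span.induct)
  case (mono c n)
  from mono show ?case
  proof (induction g rule: trig_span.induct)
    case (mono d m)
    show ?case by (rule trig_span_mono_mult)
  next
    case (add f g)
    then show ?case using trig_span.add[OF add.IH] by (simp add: algebra_simps)
  next
    case (cong f g)
    show ?case by (rule trig_span.cong[OF cong.IH]) (use cong.hyps in auto)
  qed
next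
  case (add f1 f2)
  then show ?case using trig_span.add[OF add.IH] by (simp add: algebra_simps)
next
  case (cong f1 f2)
  show ?case by (rule trig_span.cong[OF cong.IH[OF cong.prems]]) (use cong.hyps in auto)
qed

lemma real_polynomial_trig_span: "real_polynomial_function f \<Longrightarrow> trig_span f"
proof (induction rule: real_polynomial_function.induct)
  case (linear f)
  then interpret bounded_linear f .
  have "f z = Re ((of_real (f 1) - \<i> * of_real (f \<i>)) * z ^ 1)" for z
  proof -
    have "f z = f (Re z *\<^sub>R 1 + Im z *\<^sub>R \<i>)"
      by (rule arg_cong[where f=f]) (simp add: complex_eq_iff)
    also have "\<dots> = Re z * f 1 + Im z * f \<i>" by (simp only: add scaleR) simp
    finally show ?thesis by simp
  qed
  then show ?case by (intro trig_span.cong[OF trig_span.mono])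
next
  case (const c)
  show ?case by (rule trig_span.cong[OF trig_span.mono[of "of_real c" 0]]) simp
qed (auto intro: trig_span.add trig_span_mult)

text \<open>Takes the place of the Poisson integral: up to e, every continuous function on a circle
  has a harmonic extension that is the real part of an entire function.\<close>

lemma circle_approx:
  fixes w :: "complex \<Rightarrow> real"
  assumes w: "continuous_on (sphere a r) w" and r: "0 < r" and e: "0 < e"
  obtains p where "p holomorphic_on UNIV" "\<And>z. z \<in> sphere a r \<Longrightarrow> \<bar>w z - Re (p z)\<bar> < e"
proof -
  have "continuous_on (sphere 0 1) (\<lambda>z. w (a + of_real r * z))"
    by (rule continuous_on_compose2[OF w]) (use r in \<open>auto intro!: continuous_intros simp: dist_norm norm_mult\<close>)
  then obtain g where g: "real_polynomial_function g" "\<And>z. z \<in> sphere 0 1 \<Longrightarrow> \<bar>w (a + of_real r * z) - g z\<bar> < e"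
    using Stone_Weierstrass_real_polynomial_function[OF compact_sphere _ e] by blast
  then obtain q where q: "q holomorphic_on UNIV" "\<forall>z\<in>sphere 0 1. g z = Re (q z)"
    using trig_span_imp_poly[OF real_polynomial_trig_span[OF g(1)]] unfolding trig_poly_def by blast
  show thesis
  proof (rule that[of "\<lambda>z. q ((z - a) / of_real r)"])
    show "(\<lambda>z. q ((z - a) / of_real r)) holomorphic_on UNIV"
      using r by (intro holomorphic_on_compose_gen[OF _ q(1), unfolded o_def]) (auto intro!: holomorphic_intros)
    fix z assume z: "z \<in> sphere a r"
    then have 1: "(z - a) / of_real r \<in> sphere 0 1" using r by (auto simp: dist_norm norm_divide norm_minus_commute)
    from g(2)[OF 1] q(2)[rule_format, OF 1] show "\<bar>w z - Re (q ((z - a) / of_real r))\<bar> < e"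
      using r by simp
  qed
qed

section \<open>Subharmonicity and the maximum principle\<close>

text \<open>Subharmonicity near a, stated with continuous majorants of v on small circles instead of
  the integral of v, so that neither measurability nor the value -\<infinity> causes trouble. For
  upper semicontinuous v nothing is lost, since v is a decreasing limit of such majorants.\<close>

definition sub_at :: "(complex \<Rightarrow> ereal) \<Rightarrow> complex \<Rightarrow> bool" where
  "sub_at v a \<longleftrightarrow> (\<exists>R>0. \<forall>r w. 0 < r \<and> r < R \<and> continuous_on (sphere a r) w \<and>
      (\<forall>z\<in>sphere a r. v z \<le> ereal (w z)) \<longrightarrow> v a \<le> ereal (amean (\<lambda>t. w (a + of_real r * cis t))))"

text \<open>The condition on the comparison function in the maximum principle; real parts of
  holomorphic functions meet it with equality.\<close>

definition super_mean_at :: "(complex \<Rightarrow> real) \<Rightarrow> complex \<Rightarrow> bool" where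
  "super_mean_at h a \<longleftrightarrow> (\<exists>R>0. \<forall>r. 0 < r \<and> r < R \<longrightarrow>
      continuous_on (sphere a r) h \<and> amean (\<lambda>t. h (a + of_real r * cis t)) \<le> h a)"

lemma super_mean_at_holomorphic:
  assumes "p holomorphic_on S" "open S" "a \<in> S"
  shows "super_mean_at (\<lambda>z. Re (p z)) a"
proof -
  obtain R where R: "R > 0" "cball a R \<subseteq> S" using assms(2,3) open_contains_cball by blast
  have sub: "cball a r \<subseteq> S" if "r < R" for r using R that subset_cball[of r R a] by auto
  show ?thesis unfolding super_mean_at_def
  proof (intro exI[of _ R] conjI allI impI R(1))
    fix r assume r: "0 < r \<and> r < R"
    have "sphere a r \<subseteq> S" using sub[of r] r sphere_cball[of a r] by auto
    then show "continuous_on (sphere a r) (\<lambda>z. Re (p z))"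
      using assms(1) by (auto intro!: continuous_intros intro: holomorphic_on_imp_continuous_on continuous_on_subset)
    show "amean (\<lambda>t. Re (p (a + of_real r * cis t))) \<le> Re (p a)"
      using amean_holomorphic_open[OF assms(1) sub[of r]] r by simp
  qed
qed

lemma super_mean_at_add:
  assumes "super_mean_at f a" "super_mean_at g a"
  shows "super_mean_at (\<lambda>z. f z + g z) a"
proof -
  obtain R1 R2 where R: "R1 > 0" "R2 > 0"
    and f: "\<And>r. 0 < r \<Longrightarrow> r < R1 \<Longrightarrow> continuous_on (sphere a r) f \<and> amean (\<lambda>t. f (a + of_real r * cis t)) \<le> f a"
    and g: "\<And>r. 0 < r \<Longrightarrow> r < R2 \<Longrightarrow> continuous_on (sphere a r) g \<and> amean (\<lambda>t. g (a + of_real r * cis t)) \<le> g a"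
    using assms unfolding super_mean_at_def by metis
  show ?thesis unfolding super_mean_at_def
  proof (intro exI[of _ "min R1 R2"] conjI allI impI)
    fix r assume r: "0 < r \<and> r < min R1 R2"
    then have fr: "continuous_on (sphere a r) f" "amean (\<lambda>t. f (a + of_real r * cis t)) \<le> f a"
      and gr: "continuous_on (sphere a r) g" "amean (\<lambda>t. g (a + of_real r * cis t)) \<le> g a"
      using f[of r] g[of r] by auto
    show "continuous_on (sphere a r) (\<lambda>z. f z + g z)" using fr gr by (intro continuous_intros)
    show "amean (\<lambda>t. f (a + of_real r * cis t) + g (a + of_real r * cis t)) \<le> f a + g a"
      using fr gr r by (subst amean_add) (auto intro!: continuous_on_circle)
  qed (use R in auto)
qed

lemma super_mean_at_const: "super_mean_at (\<lambda>z. c) a"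
  unfolding super_mean_at_def by (auto intro: exI[of _ 1])

text \<open>The last summand is the real part of a linear function vanishing at a, so it averages to
  0. Hence the mean of |z - b|^2 over a circle exceeds the value at the centre by exactly r^2: a
  strictly subharmonic perturbation.\<close>

lemma norm_circle_sq:
  "(cmod (a + of_real r * cis t - b))\<^sup>2 = (cmod (a - b))\<^sup>2 + r\<^sup>2 + Re ((2 * cnj (a - b)) * ((a + of_real r * cis t) - a))"
proof -
  have "(x + r * cos t)\<^sup>2 + (y + r * sin t)\<^sup>2 = x\<^sup>2 + y\<^sup>2 + r\<^sup>2 + 2 * r * (x * cos t + y * sin t)" for x y
  proof -
    have "(x + r * cos t)\<^sup>2 + (y + r * sin t)\<^sup>2 = x\<^sup>2 + y\<^sup>2 + r\<^sup>2 * ((cos t)\<^sup>2 + (sin t)\<^sup>2) + 2 * r * (x * cos t + y * sin t)"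
      by algebra
    then show ?thesis by simp
  qed
  from this[of "Re (a - b)" "Im (a - b)"] show ?thesis
    unfolding cmod_power2 by (simp add: algebra_simps)
qed

lemma amean_norm_circle_sq:
  assumes "0 < r"
  shows "amean (\<lambda>t. (cmod (a + of_real r * cis t - b))\<^sup>2) = (cmod (a - b))\<^sup>2 + r\<^sup>2"
proof -
  let ?h = "\<lambda>z. (2 * cnj (a - b)) * (z - a)"
  have "amean (\<lambda>t. (cmod (a + of_real r * cis t - b))\<^sup>2)
      = amean (\<lambda>t. ((cmod (a - b))\<^sup>2 + r\<^sup>2) + Re (?h (a + of_real r * cis t)))"
    unfolding norm_circle_sq ..
  also have "\<dots> = (cmod (a - b))\<^sup>2 + r\<^sup>2 + amean (\<lambda>t. Re (?h (a + of_real r * cis t)))"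
    by (subst amean_add) (auto intro!: continuous_intros)
  also have "amean (\<lambda>t. Re (?h (a + of_real r * cis t))) = Re (?h a)"
    by (rule amean_holomorphic_open[where S=UNIV]) (use assms in \<open>auto intro!: holomorphic_intros\<close>)
  finally show ?thesis by simp
qed

text \<open>With a small multiple of |z - x|^2 added to v - h, the maximum is still attained inside
  W, and there the sub-mean value inequality fails by \<kappa> r^2.\<close>

theorem maximum_principle:
  fixes v :: "complex \<Rightarrow> ereal" and h :: "complex \<Rightarrow> real"
  assumes W: "open W" "bounded W"
    and v: "usc_on (closure W) v" "\<And>a. a \<in> W \<Longrightarrow> sub_at v a"
    and h: "continuous_on (closure W) h" "\<And>a. a \<in> W \<Longrightarrow> super_mean_at h a"
    and le: "\<And>z. z \<in> frontier W \<Longrightarrow> v z \<le> ereal (h z)"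
    and x: "x \<in> W"
  shows "v x \<le> ereal (h x)"
proof (rule ccontr)
  assume "\<not> ?thesis"
  then have gt: "v x > ereal (h x)" by simp
  have xc: "x \<in> closure W" using x closure_subset by blast
  have "v x < \<infinity>" using usc_onD_less[OF v(1) xc] .
  then obtain vx where vx: "v x = ereal vx" using gt by (cases "v x") auto
  obtain D where D: "D > 0" "\<And>z. z \<in> closure W \<Longrightarrow> cmod (z - x) \<le> D"
  proof -
    obtain e where "\<forall>z\<in>closure W. dist x z \<le> e"
      using bounded_closure[OF W(2)] bounded_any_center by blast
    then show ?thesis by (intro that[of "max e 1"]) (auto simp: dist_norm norm_minus_commute le_max_iff_disj)
  qed
  \<comment> \<open>\<kappa> D^2 is half of the excess at x, so the perturbation cannot carry the
    maximum to the frontier.\<close>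
  define \<kappa> where "\<kappa> = (vx - h x) / (2 * D\<^sup>2)"
  have k: "\<kappa> > 0" using gt vx D(1) by (simp add: \<kappa>_def)
  have kD: "\<kappa> * D\<^sup>2 < vx - h x" using gt vx D(1) by (simp add: \<kappa>_def)
  define q where "q = (\<lambda>z. \<kappa> * (cmod (z - x))\<^sup>2 - h z)"
  have cq: "continuous_on (closure W) q" unfolding q_def by (intro continuous_intros h)
  have uq: "usc_on (closure W) (\<lambda>z. v z + ereal (q z))"
    by (rule usc_on_add_continuous[OF v(1) cq])
  have cW: "compact (closure W)" "closure W \<noteq> {}" using W(2) xc by auto
  obtain a where a: "a \<in> closure W" "\<And>z. z \<in> closure W \<Longrightarrow> v z + ereal (q z) \<le> v a + ereal (q a)"
    using usc_attains_sup[OF uq cW] by auto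
  have "ereal (vx - h x) \<le> v a + ereal (q a)" using a(2)[OF xc] vx by (simp add: q_def)
  moreover have "v a < \<infinity>" using usc_onD_less[OF v(1) a(1)] .
  ultimately obtain va where va: "v a = ereal va" "vx - h x \<le> va + q a" by (cases "v a") auto
  have "a \<in> W"
  proof (rule ccontr)
    assume "a \<notin> W"
    then have "a \<in> frontier W" using a(1) W(1) by (simp add: frontier_def interior_open)
    then have "va \<le> h a" using le[of a] va by simp
    then have "vx - h x \<le> \<kappa> * (cmod (a - x))\<^sup>2" using va(2) by (simp add: q_def)
    also have "\<dots> \<le> \<kappa> * D\<^sup>2" using D(2)[OF a(1)] k by (intro mult_left_mono power_mono) auto
    finally show False using kD by simp
  qed
  obtain R0 where R0: "R0 > 0" "cball a R0 \<subseteq> W" using W(1) \<open>a \<in> W\<close> open_contains_cball by blast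
  obtain R1 where R1: "R1 > 0" and sub: "\<And>r w. 0 < r \<Longrightarrow> r < R1 \<Longrightarrow> continuous_on (sphere a r) w \<Longrightarrow>
      (\<And>z. z\<in>sphere a r \<Longrightarrow> v z \<le> ereal (w z)) \<Longrightarrow> v a \<le> ereal (amean (\<lambda>t. w (a + of_real r * cis t)))"
    using v(2)[OF \<open>a \<in> W\<close>] unfolding sub_at_def by metis
  obtain R2 where R2: "R2 > 0" and hm: "\<And>r. 0 < r \<Longrightarrow> r < R2 \<Longrightarrow>
      continuous_on (sphere a r) h \<and> amean (\<lambda>t. h (a + of_real r * cis t)) \<le> h a"
    using h(2)[OF \<open>a \<in> W\<close>] unfolding super_mean_at_def by metis
  define r where "r = min R0 (min R1 R2) / 2"
  have r: "0 < r" "r < R0" "r < R1" "r < R2" using R0 R1 R2 by (auto simp: r_def)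
  have ch: "continuous_on (sphere a r) h" and am: "amean (\<lambda>t. h (a + of_real r * cis t)) \<le> h a" using hm[of r] r by auto
  \<comment> \<open>The majorant of v that the maximality of a provides.\<close>
  define w where "w = (\<lambda>z. (va + q a) + (h z - \<kappa> * (cmod (z - x))\<^sup>2))"
  have "v a \<le> ereal (amean (\<lambda>t. w (a + of_real r * cis t)))"
  proof (rule sub[OF r(1) r(3)])
    show "continuous_on (sphere a r) w" unfolding w_def by (intro continuous_intros ch)
    fix z assume "z \<in> sphere a r"
    then have "z \<in> closure W" using R0(2) r closure_subset[of W] by (auto simp: subset_iff)
    from a(2)[OF this] show "v z \<le> ereal (w z)" unfolding va(1) by (cases "v z") (auto simp: w_def q_def)
  qed
  also have "amean (\<lambda>t. w (a + of_real r * cis t)) =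
      (va + q a) + (amean (\<lambda>t. h (a + of_real r * cis t)) - \<kappa> * amean (\<lambda>t. (cmod (a + of_real r * cis t - x))\<^sup>2))"
    unfolding w_def amean_cmult[symmetric] using r(1)
    by (subst amean_add, (auto intro!: continuous_intros continuous_on_circle[OF ch])[2],
        subst amean_diff, auto intro!: continuous_intros continuous_on_circle[OF ch])
  also have "\<dots> \<le> va + q a + (h a - \<kappa> * ((cmod (a - x))\<^sup>2 + r\<^sup>2))"
    using am by (simp add: amean_norm_circle_sq[OF r(1)])
  also have "\<dots> = va - \<kappa> * r\<^sup>2" by (simp add: q_def algebra_simps)
  finally show False using va(1) mult_pos_pos[OF k, of "r\<^sup>2"] r(1) by simp
qed

text \<open>The real part of an entire function has its mean over the circle as value at the centre,
  and \<open>circle_approx\<close> brings such functions arbitrarily close above any continuous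
  majorant. So it is enough to compare v with real parts of entire functions.\<close>

lemma mean_from_harmonic_bounds:
  fixes v :: "complex \<Rightarrow> ereal"
  assumes r: "0 < r"
    and w: "continuous_on (sphere a r) w" "\<And>z. z \<in> sphere a r \<Longrightarrow> v z \<le> ereal (w z)"
    and poly: "\<And>p. p holomorphic_on UNIV \<Longrightarrow> (\<And>z. z \<in> sphere a r \<Longrightarrow> v z \<le> ereal (Re (p z))) \<Longrightarrow> v a \<le> ereal (Re (p a))"
  shows "v a \<le> ereal (amean (\<lambda>t. w (a + of_real r * cis t)))"
proof (rule ereal_le_epsilon2)
  fix e :: real assume e: "0 < e"
  obtain p where p: "p holomorphic_on UNIV" "\<And>z. z \<in> sphere a r \<Longrightarrow> \<bar>w z - Re (p z)\<bar> < e / 2"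
    using circle_approx[OF w(1) r, of "e/2"] e by auto
  let ?h = "\<lambda>z. p z + of_real (e / 2)"
  have cp: "continuous_on S p" for S using p(1) by (meson holomorphic_on_imp_continuous_on holomorphic_on_subset subset_UNIV)
  have "v a \<le> ereal (Re (?h a))"
  proof (rule poly)
    show "?h holomorphic_on UNIV" using p(1) by (intro holomorphic_intros)
    fix z assume z: "z \<in> sphere a r"
    have "w z \<le> Re (?h z)" using p(2)[OF z] unfolding plus_complex.sel Re_complex_of_real by linarith
    then show "v z \<le> ereal (Re (?h z))" using w(2)[OF z] by (meson ereal_less_eq(3) order_trans)
  qed
  also have "Re (?h a) = amean (\<lambda>t. Re (p (a + of_real r * cis t))) + e / 2"
    by (subst amean_holomorphic_open[OF p(1)]) (use r in auto)
  also have "amean (\<lambda>t. Re (p (a + of_real r * cis t))) \<le> amean (\<lambda>t. w (a + of_real r * cis t) + e / 2)"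
  proof (rule amean_mono)
    fix t :: real
    have "a + of_real r * cis t \<in> sphere a r" using r by (auto simp: dist_norm norm_mult)
    from p(2)[OF this] show "Re (p (a + of_real r * cis t)) \<le> w (a + of_real r * cis t) + e / 2" by linarith
  qed (use r in \<open>auto intro!: continuous_intros continuous_on_circle[OF w(1)] continuous_on_compose2[OF cp[of UNIV]]\<close>)
  also have "\<dots> = amean (\<lambda>t. w (a + of_real r * cis t)) + e / 2"
    using r by (subst amean_add) (auto intro!: continuous_on_circle[OF w(1)])
  finally show "v a \<le> ereal (amean (\<lambda>t. w (a + of_real r * cis t))) + ereal e"
    by (simp add: add.commute)
qed

text \<open>Passes from small circles to arbitrary ones: the maximum principle in the disc compares
  v with each harmonic majorant Re p.\<close>

lemma sub_at_imp_mean: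
  assumes r: "0 < r" and v: "usc_on (cball a r) v" "\<And>b. b \<in> ball a r \<Longrightarrow> sub_at v b"
    and w: "continuous_on (sphere a r) w" "\<And>z. z \<in> sphere a r \<Longrightarrow> v z \<le> ereal (w z)"
  shows "v a \<le> ereal (amean (\<lambda>t. w (a + of_real r * cis t)))"
proof (rule mean_from_harmonic_bounds[OF r w])
  fix p assume p: "p holomorphic_on UNIV" "\<And>z. z \<in> sphere a r \<Longrightarrow> v z \<le> ereal (Re (p z))"
  have cp: "continuous_on S p" for S using p(1) by (meson holomorphic_on_imp_continuous_on holomorphic_on_subset subset_UNIV)
  show "v a \<le> ereal (Re (p a))"
  proof (rule maximum_principle[where W="ball a r" and h="\<lambda>z. Re (p z)"])
    show "super_mean_at (\<lambda>z. Re (p z)) b" for b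
      by (intro super_mean_at_holomorphic[OF p(1)]) auto
  qed (use r v p in \<open>auto intro!: continuous_intros cp simp: frontier_ball\<close>)
qed

section \<open>Plurisubharmonic functions\<close>

lemma nn_integral_cont:
  assumes f: "continuous_on UNIV f" "\<And>t. 0 \<le> f t"
  shows "(\<integral>\<^sup>+t\<in>{0..2*pi}. ennreal (f t) \<partial>lborel) = ennreal (2 * pi * amean f)"
proof -
  have "(\<integral>\<^sup>+t\<in>{0..2*pi}. ennreal (f t) \<partial>lborel) = (\<integral>\<^sup>+t. ennreal (indicator {0..2*pi} t *\<^sub>R f t) \<partial>lborel)"
    by (intro nn_integral_cong) (auto simp: indicator_def)
  also have "\<dots> = ennreal (LINT t:{0..2*pi}|lborel. f t)"
    unfolding set_lebesgue_integral_def
    using set_integrable_cont[of f] f continuous_on_subset[OF f(1)]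
    by (intro nn_integral_eq_integral) (auto simp: set_integrable_def)
  finally show ?thesis by (simp add: amean_def)
qed

lemma ennreal_eq_e2ennreal: "0 \<le> x \<Longrightarrow> ennreal x = e2ennreal (ereal x)"
  by (metis e2ennreal_enn2ereal enn2ereal_ennreal)

lemma e2ennreal_max: "e2ennreal (max 0 (ereal x)) = ennreal (max 0 x)"
proof -
  have "max 0 (ereal x) = ereal (max 0 x)" by (simp add: max_def zero_ereal_def)
  then show ?thesis by (metis ennreal_eq_e2ennreal max.cobounded1)
qed

lemma amean_pos_neg:
  assumes "continuous_on UNIV f"
  shows "amean f = amean (\<lambda>t. max 0 (f t)) - amean (\<lambda>t. max 0 (- f t))"
proof -
  have "amean f = amean (\<lambda>t. max 0 (f t) - max 0 (- f t))" by (rule amean_cong) auto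
  also have "\<dots> = amean (\<lambda>t. max 0 (f t)) - amean (\<lambda>t. max 0 (- f t))"
    by (intro amean_diff continuous_intros continuous_on_subset[OF assms]) auto
  finally show ?thesis .
qed

lemma amean_nonneg: "(\<And>t. 0 \<le> f t) \<Longrightarrow> 0 \<le> amean f"
  unfolding amean_def set_lebesgue_integral_def by (intro divide_nonneg_pos integral_nonneg) auto

text \<open>Replacing u by a continuous majorant can only enlarge the positive part and shrink the
  negative part in \<open>circle_mean\<close>. Only monotonicity of the integral enters, so
  measurability of u is not at stake.\<close>

lemma psh_on_mean:
  assumes u: "psh_on S u"
    and disc: "\<And>\<zeta>. \<zeta> \<in> cball 0 1 \<Longrightarrow> (fst a + \<zeta> * fst b, snd a + \<zeta> * snd b) \<in> S"
    and w: "continuous_on (sphere 0 1) w"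
      "\<And>\<zeta>. \<zeta> \<in> sphere 0 1 \<Longrightarrow> u (fst a + \<zeta> * fst b, snd a + \<zeta> * snd b) \<le> ereal (w \<zeta>)"
  shows "u a \<le> ereal (amean (\<lambda>t. w (cis t)))"
proof -
  define v where "v = (\<lambda>\<theta>. u (fst a + cis \<theta> * fst b, snd a + cis \<theta> * snd b))"
  define W where "W = (\<lambda>t. w (cis t))"
  have cW: "continuous_on T W" for T unfolding W_def using continuous_on_circle[OF w(1), of T] by simp
  have vW: "v t \<le> ereal (W t)" for t unfolding v_def W_def by (rule w(2)) auto
  define P where "P = (\<integral>\<^sup>+\<theta>\<in>{0..2 * pi}. e2ennreal (max 0 (v \<theta>)) \<partial>lborel)"
  define N where "N = (\<integral>\<^sup>+\<theta>\<in>{0..2 * pi}. e2ennreal (max 0 (- v \<theta>)) \<partial>lborel)"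
  let ?p = "2 * pi * amean (\<lambda>t. max 0 (W t))" and ?n = "2 * pi * amean (\<lambda>t. max 0 (- W t))"
  have nonneg: "0 \<le> ?p" "0 \<le> ?n" by (auto intro!: amean_nonneg mult_nonneg_nonneg)
  have "P \<le> (\<integral>\<^sup>+\<theta>\<in>{0..2 * pi}. ennreal (max 0 (W \<theta>)) \<partial>lborel)"
    unfolding P_def
  proof (intro nn_integral_mono mult_right_mono)
    fix t
    have "max 0 (v t) \<le> ereal (max 0 (W t))" using vW[of t] by (cases "v t") (auto simp: max_def zero_ereal_def)
    then have "e2ennreal (max 0 (v t)) \<le> e2ennreal (ereal (max 0 (W t)))" by (rule e2ennreal_mono)
    then show "e2ennreal (max 0 (v t)) \<le> ennreal (max 0 (W t))" by (subst ennreal_eq_e2ennreal) auto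
  qed auto
  also have "\<dots> = ennreal ?p" by (intro nn_integral_cont continuous_intros cW) auto
  finally have "enn2ereal P \<le> enn2ereal (ennreal ?p)" by (simp add: less_eq_ennreal.rep_eq)
  then have P: "enn2ereal P \<le> ereal ?p" using nonneg by simp
  have "ennreal ?n = (\<integral>\<^sup>+\<theta>\<in>{0..2 * pi}. ennreal (max 0 (- W \<theta>)) \<partial>lborel)"
    by (intro nn_integral_cont[symmetric] continuous_intros cW) auto
  also have "\<dots> \<le> N"
    unfolding N_def
  proof (intro nn_integral_mono mult_right_mono)
    fix t
    have "ereal (max 0 (- W t)) \<le> max 0 (- v t)" using vW[of t] by (cases "v t") (auto simp: max_def zero_ereal_def)
    then have "e2ennreal (ereal (max 0 (- W t))) \<le> e2ennreal (max 0 (- v t))" by (rule e2ennreal_mono)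
    then show "ennreal (max 0 (- W t)) \<le> e2ennreal (max 0 (- v t))" by (subst ennreal_eq_e2ennreal) auto
  qed auto
  finally have "enn2ereal (ennreal ?n) \<le> enn2ereal N" by (simp add: less_eq_ennreal.rep_eq)
  then have N: "ereal ?n \<le> enn2ereal N" using nonneg by simp
  have "u a \<le> circle_mean u a b" using u disc unfolding psh_on_def by blast
  also have "\<dots> = ereal (1 / (2*pi)) * (enn2ereal P - enn2ereal N)"
    unfolding circle_mean_def P_def N_def v_def Let_def by simp
  also have "\<dots> \<le> ereal (1 / (2*pi)) * (ereal ?p - ereal ?n)"
    by (intro ereal_mult_left_mono ereal_minus_mono P N) auto
  also have "\<dots> = ereal (amean (\<lambda>t. max 0 (W t)) - amean (\<lambda>t. max 0 (- W t)))"
    by (simp flip: right_diff_distrib)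
  also have "\<dots> = ereal (amean W)" using amean_pos_neg[OF cW] by simp
  finally show ?thesis unfolding W_def .
qed

text \<open>Converse of \<open>psh_on_mean\<close>. The majorants from \<open>usc_approx\<close>
  decrease to u on the circle; the positive parts converge by dominated, the negative parts by
  monotone convergence.\<close>

lemma psh_onI:
  assumes usc: "usc_on S u"
    and mean: "\<And>a b w. (\<And>\<zeta>. \<zeta> \<in> cball 0 1 \<Longrightarrow> (fst a + \<zeta> * fst b, snd a + \<zeta> * snd b) \<in> S) \<Longrightarrow>
      continuous_on (sphere 0 1) w \<Longrightarrow>
      (\<And>\<zeta>. \<zeta> \<in> sphere 0 1 \<Longrightarrow> u (fst a + \<zeta> * fst b, snd a + \<zeta> * snd b) \<le> ereal (w \<zeta>)) \<Longrightarrow>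
      u a \<le> ereal (amean (\<lambda>t. w (cis t)))"
  shows "psh_on S u"
  unfolding psh_on_def
proof (intro conjI usc allI impI)
  fix a b :: "complex \<times> complex"
  assume disc: "\<forall>\<zeta>\<in>cball 0 1. (fst a + \<zeta> * fst b, snd a + \<zeta> * snd b) \<in> S"
  define v where "v = (\<lambda>\<theta>. u (fst a + cis \<theta> * fst b, snd a + cis \<theta> * snd b))"
  have us: "usc_on (sphere 0 1) (\<lambda>\<zeta>. u (fst a + \<zeta> * fst b, snd a + \<zeta> * snd b))"
    by (rule usc_on_compose[OF usc]) (use disc in \<open>auto intro!: continuous_intros\<close>)
  have ne: "sphere (0::complex) 1 \<noteq> {}" by simp
  obtain w :: "nat \<Rightarrow> complex \<Rightarrow> real" where
    w: "\<And>n. continuous_on (sphere 0 1) (w n)"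
      "\<And>n x. x \<in> sphere 0 1 \<Longrightarrow> u (fst a + x * fst b, snd a + x * snd b) \<le> ereal (w n x)"
      "\<And>x. x \<in> sphere 0 1 \<Longrightarrow> decseq (\<lambda>n. w n x)"
      "\<And>x. x \<in> sphere 0 1 \<Longrightarrow> (\<lambda>n. ereal (w n x)) \<longlonglongrightarrow> u (fst a + x * fst b, snd a + x * snd b)"
    using usc_approx[OF us compact_sphere ne] by blast
  define W where "W = (\<lambda>n t. w n (cis t))"
  have cW: "continuous_on T (W n)" for T n unfolding W_def using continuous_on_circle[OF w(1), of T] by simp
  have Wdec: "decseq (\<lambda>n. W n t)" for t unfolding W_def by (rule w(3)) simp
  have Wlim: "(\<lambda>n. ereal (W n t)) \<longlonglongrightarrow> v t" for t unfolding W_def v_def by (rule w(4)) simp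
  define P where "P = (\<integral>\<^sup>+\<theta>\<in>{0..2 * pi}. e2ennreal (max 0 (v \<theta>)) \<partial>lborel)"
  define N where "N = (\<integral>\<^sup>+\<theta>\<in>{0..2 * pi}. e2ennreal (max 0 (- v \<theta>)) \<partial>lborel)"
  define Pn where "Pn = (\<lambda>n. \<integral>\<^sup>+\<theta>\<in>{0..2 * pi}. ennreal (max 0 (W n \<theta>)) \<partial>lborel)"
  define Nn where "Nn = (\<lambda>n. \<integral>\<^sup>+\<theta>\<in>{0..2 * pi}. ennreal (max 0 (- W n \<theta>)) \<partial>lborel)"
  have Pn: "Pn n = ennreal (2 * pi * amean (\<lambda>t. max 0 (W n t)))" for n
    unfolding Pn_def by (intro nn_integral_cont continuous_intros cW) auto
  have Nn: "Nn n = ennreal (2 * pi * amean (\<lambda>t. max 0 (- W n t)))" for n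
    unfolding Nn_def by (intro nn_integral_cont continuous_intros cW) auto
  have meas [measurable]: "W n \<in> borel_measurable borel" for n
    by (rule borel_measurable_continuous_onI[OF cW])
  have limP: "(\<lambda>n. ennreal (max 0 (W n t))) \<longlonglongrightarrow> e2ennreal (max 0 (v t))" for t
  proof -
    have "(\<lambda>n. e2ennreal (max 0 (ereal (W n t)))) \<longlonglongrightarrow> e2ennreal (max 0 (v t))"
      by (intro tendsto_e2ennrealI tendsto_max Wlim tendsto_const)
    then show ?thesis unfolding e2ennreal_max .
  qed
  have limN: "(\<lambda>n. ennreal (max 0 (- W n t))) \<longlonglongrightarrow> e2ennreal (max 0 (- v t))" for t
  proof -
    have "(\<lambda>n. e2ennreal (max 0 (- ereal (W n t)))) \<longlonglongrightarrow> e2ennreal (max 0 (- v t))"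
      by (intro tendsto_e2ennrealI tendsto_max tendsto_uminus_ereal Wlim tendsto_const)
    then show ?thesis unfolding uminus_ereal.simps e2ennreal_max .
  qed
  have P: "(\<lambda>n. Pn n) \<longlonglongrightarrow> P"
    unfolding Pn_def P_def
  proof (rule nn_integral_dominated_convergence[where w="\<lambda>t. ennreal (max 0 (W 0 t)) * indicator {0..2*pi} t"])
    show "(\<integral>\<^sup>+ t. ennreal (max 0 (W 0 t)) * indicator {0..2*pi} t \<partial>lborel) < \<infinity>"
      using Pn[of 0] unfolding Pn_def by simp
    show "AE x in lborel. (\<lambda>i. ennreal (max 0 (W i x)) * indicator {0..2 * pi} x) \<longlonglongrightarrow> e2ennreal (max 0 (v x)) * indicator {0..2 * pi} x"
      by (rule AE_I2) (auto simp: indicator_def intro!: limP)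
    show "AE x in lborel. ennreal (max 0 (W j x)) * indicator {0..2 * pi} x \<le> ennreal (max 0 (W 0 x)) * indicator {0..2 * pi} x" for j
      using Wdec by (intro AE_I2 mult_right_mono ennreal_leI max.mono) (auto simp: decseq_def)
    have "(\<lambda>x. e2ennreal (max 0 (v x))) \<in> borel_measurable lborel"
      by (rule borel_measurable_LIMSEQ_order[OF limP]) auto
    then show "(\<lambda>x. e2ennreal (max 0 (v x)) * indicator {0..2 * pi} x) \<in> borel_measurable lborel" by measurable
  qed auto
  have N: "(\<lambda>n. Nn n) \<longlonglongrightarrow> N"
    unfolding Nn_def N_def
  proof (rule nn_integral_LIMSEQ)
    show "incseq (\<lambda>n x. ennreal (max 0 (- W n x)) * indicator {0..2 * pi} x)"
      using Wdec by (auto simp: incseq_def le_fun_def decseq_def intro!: mult_right_mono ennreal_leI max.mono)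
    show "(\<lambda>n. ennreal (max 0 (- W n x)) * indicator {0..2 * pi} x) \<longlonglongrightarrow> e2ennreal (max 0 (- v x)) * indicator {0..2 * pi} x" for x
      by (auto simp: indicator_def intro!: limN)
  qed auto
  have Pfin: "enn2ereal P < \<infinity>"
  proof -
    have "P \<le> Pn 0"
    proof (rule LIMSEQ_le_const2[OF P])
      show "\<exists>N. \<forall>n\<ge>N. Pn n \<le> Pn 0"
        unfolding Pn_def using Wdec
        by (auto simp: decseq_def intro!: nn_integral_mono mult_right_mono ennreal_leI max.mono)
    qed
    also have "\<dots> < \<infinity>" unfolding Pn by simp
    finally show ?thesis by (simp add: less_ennreal.rep_eq)
  qed
  have le: "u a \<le> ereal (amean (W n))" for n
    unfolding W_def by (rule mean[OF _ w(1)]) (use disc w(2) in auto)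
  have cm: "circle_mean u a b = ereal (1 / (2*pi)) * (enn2ereal P - enn2ereal N)"
    unfolding circle_mean_def P_def N_def v_def Let_def by simp
  show "u a \<le> circle_mean u a b"
  proof (cases "u a")
    case (real ua)
    \<comment> \<open>The negative part stays on the left, because its limit may still be infinite
      at this point; its finiteness follows from the limit inequality.\<close>
    have "ereal (2 * pi * ua) + enn2ereal (Nn n) \<le> enn2ereal (Pn n)" for n
    proof -
      have "ua \<le> amean (\<lambda>t. max 0 (W n t)) - amean (\<lambda>t. max 0 (- W n t))"
        using le[of n] real amean_pos_neg[OF cW] by simp
      then have "2 * pi * ua + 2 * pi * amean (\<lambda>t. max 0 (- W n t)) \<le> 2 * pi * amean (\<lambda>t. max 0 (W n t))"
        by (simp flip: distrib_left)
      then show ?thesis unfolding Pn Nn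
        by (simp add: amean_nonneg)
    qed
    note le' = this
    have L1: "(\<lambda>n. ereal (2 * pi * ua) + enn2ereal (Nn n)) \<longlonglongrightarrow> ereal (2 * pi * ua) + enn2ereal N"
      by (rule tendsto_add_ereal_general2) (use N in auto)
    have L2: "(\<lambda>n. enn2ereal (Pn n)) \<longlonglongrightarrow> enn2ereal P" using P by simp
    have "ereal (2 * pi * ua) + enn2ereal N \<le> enn2ereal P"
      by (rule LIMSEQ_le[OF L1 L2]) (use le' in auto)
    moreover obtain p where p: "enn2ereal P = ereal p" using Pfin by (cases "enn2ereal P") auto
    ultimately obtain n where n: "enn2ereal N = ereal n" by (cases "enn2ereal N") auto
    have "2 * pi * ua + n \<le> p" using \<open>ereal (2 * pi * ua) + enn2ereal N \<le> enn2ereal P\<close> p n by simp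
    then have "ua \<le> 1 / (2*pi) * (p - n)" by (simp add: field_simps)
    then show ?thesis unfolding cm p n real by simp
  next
    case PInf
    then show ?thesis using le[of 0] by simp
  qed simp
qed

lemma psh_onI_sub_at:
  assumes usc: "usc_on S u"
    and sub: "\<And>a b \<zeta>0. (\<And>\<zeta>. \<zeta> \<in> cball 0 1 \<Longrightarrow> (fst a + \<zeta> * fst b, snd a + \<zeta> * snd b) \<in> S) \<Longrightarrow> \<zeta>0 \<in> ball 0 1 \<Longrightarrow>
      sub_at (\<lambda>\<zeta>. u (fst a + \<zeta> * fst b, snd a + \<zeta> * snd b)) \<zeta>0"
  shows "psh_on S u"
proof (rule psh_onI[OF usc])
  fix a b :: "complex \<times> complex" and w
  assume disc: "\<And>\<zeta>. \<zeta> \<in> cball 0 1 \<Longrightarrow> (fst a + \<zeta> * fst b, snd a + \<zeta> * snd b) \<in> S"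
    and w: "continuous_on (sphere 0 1) w" "\<And>\<zeta>. \<zeta> \<in> sphere 0 1 \<Longrightarrow> u (fst a + \<zeta> * fst b, snd a + \<zeta> * snd b) \<le> ereal (w \<zeta>)"
  have "u (fst a + 0 * fst b, snd a + 0 * snd b) \<le> ereal (amean (\<lambda>t. w (0 + of_real 1 * cis t)))"
  proof (rule sub_at_imp_mean[where v="\<lambda>\<zeta>. u (fst a + \<zeta> * fst b, snd a + \<zeta> * snd b)"])
    show "usc_on (cball 0 1) (\<lambda>\<zeta>. u (fst a + \<zeta> * fst b, snd a + \<zeta> * snd b))"
      by (rule usc_on_compose[OF usc]) (use disc in \<open>auto intro!: continuous_intros\<close>)
  qed (use w disc sub in auto)
  then show "u a \<le> ereal (amean (\<lambda>t. w (cis t)))" by simp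
qed

text \<open>The part of the compact set where F \<ge> r is compact and contains no point with first
  coordinate 0, so the norm of the first coordinate has a positive minimum there.\<close>

lemma usc_tube:
  fixes F :: "'a::euclidean_space \<times> 'b::metric_space \<Rightarrow> ereal"
  assumes F: "usc_on (cball 0 \<delta> \<times> A) F" and A: "compact A" and d: "0 < \<delta>"
    and 0: "\<And>z. z \<in> A \<Longrightarrow> F (0, z) < r"
  obtains \<delta>' where "0 < \<delta>'" "\<delta>' \<le> \<delta>" "\<And>x z. norm x \<le> \<delta>' \<Longrightarrow> z \<in> A \<Longrightarrow> F (x, z) < r"
proof -
  define K where "K = cball (0::'a) \<delta> \<times> A"
  have cK: "compact K" unfolding K_def by (intro compact_Times A) auto
  define Z where "Z = K - {y\<in>K. F y < r}"
  have "closedin (top_of_set K) Z"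
    unfolding Z_def using F unfolding usc_on_def K_def[symmetric] by (intro closedin_diff) auto
  then have cZ: "compact Z" using closedin_compact[OF cK] by blast
  show thesis
  proof (cases "Z = {}")
    case True
    show ?thesis
    proof (rule that[of \<delta>])
      fix x :: 'a and z :: 'b assume "norm x \<le> \<delta>" "z \<in> A"
      then have "(x, z) \<in> K" by (auto simp: K_def)
      then show "F (x, z) < r" using True unfolding Z_def by blast
    qed (use d in auto)
  next
    case False
    have "continuous_on Z (\<lambda>y. norm (fst y))" by (intro continuous_intros)
    then obtain y where y: "y \<in> Z" "\<And>y'. y' \<in> Z \<Longrightarrow> norm (fst y) \<le> norm (fst y')"
      using continuous_attains_inf[OF cZ False] by blast
    have "fst y \<noteq> 0"
    proof
      assume "fst y = 0"
      then have "y = (0, snd y)" by (simp add: prod_eq_iff)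
      then show False using y(1) 0[of "snd y"] unfolding Z_def K_def by (auto simp: mem_Times_iff)
    qed
    show ?thesis
    proof (rule that[of "min \<delta> (norm (fst y) / 2)"])
      fix x :: 'a and z :: 'b assume x: "norm x \<le> min \<delta> (norm (fst y) / 2)" and z: "z \<in> A"
      then have xz: "(x, z) \<in> K" by (auto simp: K_def)
      have "norm x \<le> norm (fst y) / 2" using x by simp
      also have "\<dots> < norm (fst y)" using \<open>fst y \<noteq> 0\<close> by simp
      finally have "(x, z) \<notin> Z" using y(2)[of "(x,z)"] by auto
      then show "F (x, z) < r" using xz unfolding Z_def by blast
    qed (use d \<open>fst y \<noteq> 0\<close> in auto)
  qed
qed

text \<open>Local upper test functions: at a maximum of
  $u(\gamma(\tau) + d) - \mathrm{Re}\, p(\tau) + \kappa |\tau - a|^2 - N |d|^2$ one moves $\tau$ and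
  keeps $\gamma(\tau) + d$ on the tangent line of $\gamma$, on which $u$ has the sub-mean value property;
  $|d|^2$ then changes by a harmonic function up to an error that is small compared with $\kappa$.\<close>

theorem psh_on_holomorphic_disc:
  assumes u: "psh_on S u" and S: "open S"
    and O: "open W" "a \<in> W"
    and g: "g1 holomorphic_on W" "g2 holomorphic_on W" "\<And>z. z \<in> W \<Longrightarrow> (g1 z, g2 z) \<in> S"
  shows "sub_at (\<lambda>z. u (g1 z, g2 z)) a"
proof -
  define \<gamma> where "\<gamma> = (\<lambda>z. (g1 z, g2 z))"
  have cg: "continuous_on T \<gamma>" if "T \<subseteq> W" for T
    unfolding \<gamma>_def using g(1,2) that
    by (intro continuous_intros) (auto intro: holomorphic_on_imp_continuous_on continuous_on_subset)
  have uscu: "usc_on S u" using u by (simp add: psh_on_def)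
  obtain R where R: "R > 0" "cball a R \<subseteq> W" using O open_contains_cball by blast
  have key: "u (\<gamma> a) \<le> ereal (Re (p a))"
    if r: "0 < r" "r < R" and p: "p holomorphic_on UNIV" and le: "\<And>z. z \<in> sphere a r \<Longrightarrow> u (\<gamma> z) \<le> ereal (Re (p z))" for r p
  proof (rule ccontr)
    assume "\<not> ?thesis"
    then have gt: "u (\<gamma> a) > ereal (Re (p a))" by simp
    have cp: "continuous_on T p" for T using p by (meson holomorphic_on_imp_continuous_on holomorphic_on_subset subset_UNIV)
    have rW: "cball a r \<subseteq> W" using R(2) r subset_cball[of r R a] by auto
    have gS: "\<gamma> z \<in> S" if "z \<in> cball a r" for z using g(3) rW that unfolding \<gamma>_def by auto
    have "\<gamma> a \<in> S" using gS r by auto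
    then have "u (\<gamma> a) < \<infinity>" by (rule usc_onD_less[OF uscu])
    then obtain va where va: "u (\<gamma> a) = ereal va" using gt by (cases "u (\<gamma> a)") auto
    define \<theta> where "\<theta> = va - Re (p a)"
    have th: "\<theta> > 0" using gt va by (simp add: \<theta>_def)
    \<comment> \<open>Small enough that on the circle the perturbed difference stays below its value
      \<theta> at a.\<close>
    define \<kappa> where "\<kappa> = \<theta> / (2 * r\<^sup>2)"
    have k: "\<kappa> > 0" "\<kappa> * r\<^sup>2 < \<theta>" using th r by (auto simp: \<kappa>_def)
    have "compact (\<gamma> ` cball a r)" by (intro compact_continuous_image cg rW) auto
    moreover have "\<gamma> ` cball a r \<subseteq> S" using gS by auto
    ultimately obtain e where e: "e > 0" "(\<Union>x\<in>\<gamma> ` cball a r. ball x e) \<subseteq> S"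
      using compact_subset_open_imp_ball_epsilon_subset[OF _ S] by blast
    define \<delta> where "\<delta> = e / 2"
    have d: "\<delta> > 0" using e by (simp add: \<delta>_def)
    have dS: "\<gamma> z + x \<in> S" if "z \<in> cball a r" "norm x \<le> \<delta>" for z x
    proof -
      have "\<gamma> z + x \<in> ball (\<gamma> z) e" using that e by (auto simp: \<delta>_def dist_norm)
      then show ?thesis using e(2) that by blast
    qed
    define K where "K = (\<lambda>\<delta>. cball (0::complex\<times>complex) \<delta> \<times> cball a r)"
    define Q where "Q = (\<lambda>y. u (\<gamma> (snd y) + fst y) + ereal (\<kappa> * (cmod (snd y - a))\<^sup>2 - Re (p (snd y))))"
    have uQ: "usc_on (K \<delta>) Q"
      unfolding Q_def
    proof (intro usc_on_add_continuous usc_on_compose[OF uscu])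
      show "continuous_on (K \<delta>) (\<lambda>y. \<gamma> (snd y) + fst y)"
        by (intro continuous_intros continuous_on_compose2[OF cg[OF rW]]) (auto simp: K_def)
      show "(\<lambda>y. \<gamma> (snd y) + fst y) ` K \<delta> \<subseteq> S" using dS by (auto simp: K_def)
      show "continuous_on (K \<delta>) (\<lambda>y. \<kappa> * (cmod (snd y - a))\<^sup>2 - Re (p (snd y)))"
        by (intro continuous_intros continuous_on_compose2[OF cp[of UNIV]]) auto
    qed
    have compK: "compact (K x)" for x unfolding K_def by (intro compact_Times) auto
    have cen: "(0, a) \<in> K x" if "x > 0" for x using that r by (auto simp: K_def)
    have Qa: "Q (0, a) = ereal \<theta>" by (simp add: Q_def va \<theta>_def zero_prod_def[symmetric])
    have Q0: "Q (0, z) < ereal \<theta>" if z: "z \<in> sphere a r" for z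
    proof -
      have "Q (0, z) \<le> ereal (Re (p z)) + ereal (\<kappa> * (cmod (z - a))\<^sup>2 - Re (p z))"
        unfolding Q_def fst_conv snd_conv add_0_right by (intro add_right_mono le z)
      also have "\<dots> = ereal (\<kappa> * r\<^sup>2)" using z by (simp add: dist_norm norm_minus_commute)
      finally show ?thesis using k(2) by (simp add: le_less_trans)
    qed
    obtain \<delta>' where d': "0 < \<delta>'" "\<delta>' \<le> \<delta>" "\<And>x z. norm x \<le> \<delta>' \<Longrightarrow> z \<in> sphere a r \<Longrightarrow> Q (x, z) < ereal \<theta>"
    proof (rule usc_tube[where F=Q and A="sphere a r" and \<delta>=\<delta> and r="ereal \<theta>"])
      show "usc_on (cball 0 \<delta> \<times> sphere a r) Q"
        by (rule usc_on_subset[OF uQ]) (auto simp: K_def)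
    qed (use d Q0 in auto)
    have Ksub: "K \<delta>' \<subseteq> K \<delta>" using d' by (auto simp: K_def)
    obtain B where B: "\<And>y. y \<in> K \<delta> \<Longrightarrow> Q y \<le> ereal B"
    proof -
      obtain y where y: "y \<in> K \<delta>" "\<And>y'. y' \<in> K \<delta> \<Longrightarrow> Q y' \<le> Q y"
        using usc_attains_sup[OF uQ compK] cen[OF d] by blast
      have "Q y < \<infinity>" using usc_onD_less[OF uQ y(1)] .
      then obtain B where "Q y \<le> ereal B" by (cases "Q y") auto
      then show ?thesis using y(2) by (intro that[of B]) (auto intro: order_trans)
    qed
    \<comment> \<open>With this penalty the maximum of M cannot have |d| = \<delta>', since M is
      negative there while it is at least \<theta> at (0, a).\<close>
    define N where "N = (\<bar>B\<bar> + 1) / \<delta>'\<^sup>2"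
    have N: "N \<ge> 0" "N * \<delta>'\<^sup>2 = \<bar>B\<bar> + 1" using d' by (auto simp: N_def)
    define M where "M = (\<lambda>y. Q y + ereal (- N * (norm (fst y))\<^sup>2))"
    have uM: "usc_on (K \<delta>') M" unfolding M_def
      by (intro usc_on_add_continuous usc_on_subset[OF uQ Ksub] continuous_intros)
    obtain y where y: "y \<in> K \<delta>'" "\<And>y'. y' \<in> K \<delta>' \<Longrightarrow> M y' \<le> M y"
      using usc_attains_sup[OF uM compK] cen[OF d'(1)] by blast
    obtain d0 t0 where y_eq: "y = (d0, t0)" by (cases y)
    have My: "M y \<ge> ereal \<theta>" using y(2)[OF cen[OF d'(1)]] by (simp add: M_def Qa)
    have QM: "M x \<le> Q x" for x
      unfolding M_def using N(1) by (cases "Q x") auto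
    have t0: "cmod (t0 - a) < r"
    proof (rule ccontr)
      assume "\<not> ?thesis"
      then have "t0 \<in> sphere a r" "norm d0 \<le> \<delta>'" using y(1) y_eq by (auto simp: K_def dist_norm norm_minus_commute)
      then have "Q y < ereal \<theta>" using d'(3) y_eq by simp
      then show False using QM[of y] My by order
    qed
    have d0: "norm d0 < \<delta>'"
    proof (rule ccontr)
      assume "\<not> ?thesis"
      then have "norm d0 = \<delta>'" using y(1) y_eq by (auto simp: K_def)
      then have "M y = Q y + ereal (- (\<bar>B\<bar> + 1))" unfolding M_def y_eq using N(2) by simp
      also have "\<dots> \<le> ereal B + ereal (- (\<bar>B\<bar> + 1))" using B[of y] y(1) Ksub by (intro add_right_mono) auto
      also have "\<dots> < ereal \<theta>" using th by simp
      finally show False using My by simp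
    qed
    have t0W: "t0 \<in> W" using t0 rW by (auto simp: dist_norm norm_minus_commute)
    define x0 where "x0 = \<gamma> t0 + d0"
    have x0S: "x0 \<in> S" unfolding x0_def using t0 d0 d' by (intro dS) (auto simp: dist_norm norm_minus_commute)
    have "u x0 \<noteq> - \<infinity>" using My unfolding M_def Q_def y_eq x0_def by auto
    then obtain u0 where u0: "u x0 = ereal u0" using usc_onD_less[OF uscu x0S] by (cases "u x0") auto
    define D1 where "D1 = deriv g1 t0"
    define D2 where "D2 = deriv g2 t0"
    define R1 where "R1 = (\<lambda>z. g1 (t0 + z) - g1 t0 - D1 * z)"
    define R2 where "R2 = (\<lambda>z. g2 (t0 + z) - g2 t0 - D2 * z)"
    \<comment> \<open>The remainders R1 and R2 cost 2 N \<epsilon>^2 \<rho>^2, which the gain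
      \<kappa> \<rho>^2 of the quadratic term has to beat.\<close>
    define \<epsilon> where "\<epsilon> = sqrt (\<kappa> / (4 * (N + 1)))"
    have eps: "\<epsilon> > 0" "2 * N * \<epsilon>\<^sup>2 < \<kappa>" using k(1) N(1) by (auto simp: \<epsilon>_def field_simps intro!: add_pos_nonneg)
    have der: "\<exists>\<rho>>0. \<forall>z. cmod z < \<rho> \<longrightarrow> cmod (f (t0 + z) - f t0 - deriv f t0 * z) \<le> \<epsilon> * cmod z"
      if "f holomorphic_on W" for f
    proof -
      have "(f has_field_derivative deriv f t0) (at t0)" using that O t0W by (simp add: holomorphic_derivI)
      then have "(f has_derivative (*) (deriv f t0)) (at t0)" by (simp add: has_field_derivative_def)
      then obtain \<rho> where \<rho>: "\<rho> > 0" "\<And>y. norm (y - t0) < \<rho> \<Longrightarrow> norm (f y - f t0 - deriv f t0 * (y - t0)) \<le> \<epsilon> * norm (y - t0)"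
        using eps(1) unfolding has_derivative_at_alt by blast
      show ?thesis
      proof (intro exI[of _ \<rho>] conjI allI impI \<rho>(1))
        fix z assume "cmod z < \<rho>"
        then show "cmod (f (t0 + z) - f t0 - deriv f t0 * z) \<le> \<epsilon> * cmod z" using \<rho>(2)[of "t0 + z"] by simp
      qed
    qed
    obtain \<rho>1 where \<rho>1: "\<rho>1 > 0" "\<And>z. cmod z < \<rho>1 \<Longrightarrow> cmod (R1 z) \<le> \<epsilon> * cmod z"
      using der[OF g(1)] unfolding R1_def D1_def by blast
    obtain \<rho>2 where \<rho>2: "\<rho>2 > 0" "\<And>z. cmod z < \<rho>2 \<Longrightarrow> cmod (R2 z) \<le> \<epsilon> * cmod z"
      using der[OF g(2)] unfolding R2_def D2_def by blast
    have "0 < min (min \<rho>1 \<rho>2) (min (r - cmod (t0 - a)) ((\<delta>' - norm d0) / (2 * \<epsilon>)))"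
      using \<rho>1 \<rho>2 t0 d0 eps by auto
    then obtain \<rho> where \<rho>: "0 < \<rho>" "\<rho> < \<rho>1" "\<rho> < \<rho>2" "\<rho> < r - cmod (t0 - a)" "\<rho> < (\<delta>' - norm d0) / (2 * \<epsilon>)"
      using dense by (metis min_less_iff_conj)
    have \<rho>d: "2 * \<epsilon> * \<rho> < \<delta>' - norm d0" using \<rho>(5) eps(1) by (simp add: field_simps)
    \<comment> \<open>The displacement is corrected by the remainders, which keeps the point
      \<gamma>(t0 + z) + E z on the complex line through x0 in the tangent direction.\<close>
    define E where "E = (\<lambda>z. d0 - (R1 z, R2 z))"
    have inball: "t0 + z \<in> ball a r" if "cmod z \<le> \<rho>" for z
    proof -
      have "cmod (t0 + z - a) \<le> cmod (t0 - a) + cmod z" using norm_triangle_ineq[of "t0 - a" z] by (simp add: algebra_simps)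
      then show ?thesis using that \<rho>(4) by (auto simp: dist_norm norm_minus_commute)
    qed
    have Rb: "cmod (R1 z) \<le> \<epsilon> * \<rho>" "cmod (R2 z) \<le> \<epsilon> * \<rho>" if "cmod z \<le> \<rho>" for z
      using \<rho>1(2)[of z] \<rho>2(2)[of z] that \<rho> eps(1) mult_left_mono[OF that, of \<epsilon>] by (auto intro: order_trans)
    have Eb: "norm (E z) \<le> \<delta>'" if "cmod z \<le> \<rho>" for z
    proof -
      have "norm (E z) \<le> norm d0 + norm (R1 z, R2 z)" unfolding E_def by (rule norm_triangle_ineq4)
      also have "norm (R1 z, R2 z) \<le> norm (R1 z) + norm (R2 z)" by (rule norm_Pair_le)
      also have "\<dots> \<le> 2 * \<epsilon> * \<rho>" using Rb[OF that] by simp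
      finally show ?thesis using \<rho>d by simp
    qed
    have point: "\<gamma> (t0 + z) + E z = (fst x0 + D1 * z, snd x0 + D2 * z)" for z
      unfolding E_def x0_def \<gamma>_def R1_def R2_def by (simp add: prod_eq_iff)
    define b where "b = (of_real \<rho> * D1, of_real \<rho> * D2)"
    have pt: "(fst x0 + \<zeta> * fst b, snd x0 + \<zeta> * snd b) = \<gamma> (t0 + of_real \<rho> * \<zeta>) + E (of_real \<rho> * \<zeta>)" for \<zeta>
      unfolding point b_def by (simp add: algebra_simps)
    have nz: "cmod (of_real \<rho> * \<zeta>) \<le> \<rho>" if "\<zeta> \<in> cball 0 1" for \<zeta> :: complex
      using that \<rho>(1) by (simp add: norm_mult mult_left_le)
    \<comment> \<open>The holomorphic part of all changes: the increment of p and the mixed term of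
      |d0 - R|^2, which is linear in the holomorphic R1 and R2. It vanishes at 0.\<close>
    define h where "h = (\<lambda>z. p (t0 + z) - p t0 - 2 * of_real N * (cnj (fst d0) * R1 z + cnj (snd d0) * R2 z))"
    have hol: "h holomorphic_on ball 0 (r - cmod (t0 - a))"
    proof -
      have sub: "t0 + z \<in> W" if "z \<in> ball 0 (r - cmod (t0 - a))" for z
      proof -
        have "cmod (t0 + z - a) \<le> cmod (t0 - a) + cmod z" using norm_triangle_ineq[of "t0 - a" z] by (simp add: algebra_simps)
        then have "t0 + z \<in> cball a r" using that by (auto simp: dist_norm norm_minus_commute)
        then show ?thesis using rW by auto
      qed
      have "(\<lambda>z. f (t0 + z)) holomorphic_on ball 0 (r - cmod (t0 - a))" if "f holomorphic_on W" for f
      proof (rule holomorphic_on_compose_gen[OF _ that, unfolded o_def])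
        show "(\<lambda>z. t0 + z) ` ball 0 (r - cmod (t0 - a)) \<subseteq> W" using sub by blast
      qed (intro holomorphic_intros)
      note c = this
      have "p holomorphic_on W" using p holomorphic_on_subset by blast
      show ?thesis unfolding h_def R1_def R2_def
        by (intro holomorphic_intros c g \<open>p holomorphic_on W\<close>)
    qed
    define w where "w = (\<lambda>\<zeta>. u0 + \<kappa> * (cmod (t0 - a))\<^sup>2 + 2 * N * \<epsilon>\<^sup>2 * \<rho>\<^sup>2
        - \<kappa> * (cmod (t0 + of_real \<rho> * \<zeta> - a))\<^sup>2 + Re (h (0 + of_real \<rho> * \<zeta>)))"
    have ch: "continuous_on (sphere 0 1) (\<lambda>\<zeta>. h (0 + of_real \<rho> * \<zeta>))"
      by (rule continuous_on_compose2[OF holomorphic_on_imp_continuous_on[OF hol]])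
         (use \<rho> in \<open>auto intro!: continuous_intros simp: norm_mult\<close>)
    have "u x0 \<le> ereal (amean (\<lambda>t. w (cis t)))"
    proof (rule psh_on_mean[OF u])
      fix \<zeta> :: complex assume z: "\<zeta> \<in> cball 0 1"
      show "(fst x0 + \<zeta> * fst b, snd x0 + \<zeta> * snd b) \<in> S"
        unfolding pt using inball[OF nz[OF z]] Eb[OF nz[OF z]] d'(2) by (intro dS) auto
    next
      show "continuous_on (sphere 0 1) w" unfolding w_def by (intro continuous_intros ch)
    next
      fix \<zeta> :: complex assume z: "\<zeta> \<in> sphere 0 1"
      define Z where "Z = of_real \<rho> * \<zeta>"
      have Z: "cmod Z \<le> \<rho>" using nz[of \<zeta>] z unfolding Z_def by auto
      have "(E Z, t0 + Z) \<in> K \<delta>'" using inball[OF Z] Eb[OF Z] by (auto simp: K_def)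
      from y(2)[OF this]
      have "u (\<gamma> (t0 + Z) + E Z) + ereal (\<kappa> * (cmod (t0 + Z - a))\<^sup>2 - Re (p (t0 + Z)) - N * (norm (E Z))\<^sup>2)
         \<le> ereal (u0 + (\<kappa> * (cmod (t0 - a))\<^sup>2 - Re (p t0) - N * (norm d0)\<^sup>2))"
        unfolding M_def Q_def y_eq fst_conv snd_conv x0_def[symmetric] u0
        by (cases "u (\<gamma> (t0 + Z) + E Z)") auto
      moreover have "(norm (E Z))\<^sup>2 - (norm d0)\<^sup>2 \<le> 2 * \<epsilon>\<^sup>2 * \<rho>\<^sup>2 - 2 * Re (cnj (fst d0) * R1 Z + cnj (snd d0) * R2 Z)"
      proof -
        have n2: "(norm x)\<^sup>2 = (cmod (fst x))\<^sup>2 + (cmod (snd x))\<^sup>2" for x :: "complex \<times> complex"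
          by (simp add: norm_prod_def)
        have c2: "(cmod (s - t))\<^sup>2 - (cmod s)\<^sup>2 = (cmod t)\<^sup>2 - 2 * Re (cnj s * t)" for s t
          unfolding cmod_power2 by (simp add: power2_eq_square algebra_simps)
        have "(cmod (R1 Z))\<^sup>2 \<le> (\<epsilon> * \<rho>)\<^sup>2" "(cmod (R2 Z))\<^sup>2 \<le> (\<epsilon> * \<rho>)\<^sup>2"
          using Rb[OF Z] by (auto intro: power_mono)
        then show ?thesis
          unfolding n2 E_def fst_diff snd_diff fst_conv snd_conv
          using c2[of "fst d0" "R1 Z"] c2[of "snd d0" "R2 Z"] by (simp add: power_mult_distrib)
      qed
      then have "N * ((norm (E Z))\<^sup>2 - (norm d0)\<^sup>2) \<le> N * (2 * \<epsilon>\<^sup>2 * \<rho>\<^sup>2 - 2 * Re (cnj (fst d0) * R1 Z + cnj (snd d0) * R2 Z))"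
        using N(1) by (rule mult_left_mono)
      moreover have "Re (h Z) = Re (p (t0 + Z)) - Re (p t0) - N * (2 * Re (cnj (fst d0) * R1 Z + cnj (snd d0) * R2 Z))"
      proof -
        have "Re (2 * of_real N * x) = N * (2 * Re x)" for x by simp
        then show ?thesis unfolding h_def by (simp only: plus_complex.sel minus_complex.sel)
      qed
      moreover have "w \<zeta> = u0 + \<kappa> * (cmod (t0 - a))\<^sup>2 + 2 * N * \<epsilon>\<^sup>2 * \<rho>\<^sup>2 - \<kappa> * (cmod (t0 + Z - a))\<^sup>2 + Re (h Z)"
        unfolding w_def Z_def by simp
      ultimately show "u (fst x0 + \<zeta> * fst b, snd x0 + \<zeta> * snd b) \<le> ereal (w \<zeta>)"
        unfolding pt Z_def[symmetric] by (cases "u (\<gamma> (t0 + Z) + E Z)") (auto simp: algebra_simps)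
    qed
    also have "amean (\<lambda>t. w (cis t)) = u0 + \<kappa> * (cmod (t0 - a))\<^sup>2 + 2 * N * \<epsilon>\<^sup>2 * \<rho>\<^sup>2
       - \<kappa> * ((cmod (t0 - a))\<^sup>2 + \<rho>\<^sup>2) + Re (h 0)"
    proof -
      have c: "continuous_on {0..2*pi} (\<lambda>t. Re (h (0 + of_real \<rho> * cis t)))"
        by (intro continuous_intros continuous_on_compose2[OF ch, of _ cis]) auto
      have cX: "continuous_on {0..2*pi} (\<lambda>t. \<kappa> * (cmod (t0 + of_real \<rho> * cis t - a))\<^sup>2)"
        by (intro continuous_intros)
      have "amean (\<lambda>t. Re (h (0 + of_real \<rho> * cis t))) = Re (h 0)"
        by (rule amean_holomorphic_open[OF hol]) (use \<rho> in auto)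
      moreover have "amean (\<lambda>t. \<kappa> * (cmod (t0 + of_real \<rho> * cis t - a))\<^sup>2) = \<kappa> * ((cmod (t0 - a))\<^sup>2 + \<rho>\<^sup>2)"
        by (simp add: amean_cmult amean_norm_circle_sq \<rho>(1))
      ultimately show ?thesis
        unfolding w_def amean_add[OF continuous_on_diff[OF continuous_on_const cX] c]
          amean_diff[OF continuous_on_const cX] by simp
    qed
    also have "Re (h 0) = 0" by (simp add: h_def R1_def R2_def)
    finally have "\<kappa> * \<rho>\<^sup>2 \<le> 2 * N * \<epsilon>\<^sup>2 * \<rho>\<^sup>2" by (simp add: u0 algebra_simps)
    then show False using eps(2) \<rho>(1) by simp
  qed
  show ?thesis
    unfolding sub_at_def
  proof (intro exI[of _ R] conjI allI impI R(1))
    fix r w assume *: "0 < r \<and> r < R \<and> continuous_on (sphere a r) w \<and> (\<forall>z\<in>sphere a r. u (g1 z, g2 z) \<le> ereal (w z))"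
    show "u (g1 a, g2 a) \<le> ereal (amean (\<lambda>t. w (a + of_real r * cis t)))"
      by (rule mean_from_harmonic_bounds[where v="\<lambda>z. u (g1 z, g2 z)"])
         (use * key[of r] in \<open>auto simp: \<gamma>_def\<close>)
  qed
qed

subsection \<open>Logarithms of moduli\<close>

definition eln :: "real \<Rightarrow> ereal" where
  "eln x = (if x \<le> 0 then - \<infinity> else ereal (ln x))"

lemma eln_pos: "0 < x \<Longrightarrow> eln x = ereal (ln x)"
  by (simp add: eln_def)

lemma eln_mono: "x \<le> y \<Longrightarrow> eln x \<le> eln y"
  by (auto simp: eln_def)

lemma eln_add_ln: "0 < y \<Longrightarrow> eln x + ereal (ln y) = eln (x * y)"
  by (auto simp: eln_def ln_mult zero_less_mult_iff mult_le_0_iff)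

lemma eln_less_iff: "eln x < ereal r \<longleftrightarrow> x < exp r"
proof (cases "x \<le> 0")
  case True
  then show ?thesis using exp_gt_zero[of r] by (auto simp: eln_def intro: le_less_trans)
next
  case False
  then have "ln x < r \<longleftrightarrow> x < exp r" by (metis exp_less_cancel_iff exp_ln linorder_not_le)
  then show ?thesis using False by (simp add: eln_def)
qed

lemma usc_on_eln:
  assumes "continuous_on S T"
  shows "usc_on S (\<lambda>x. eln (T x))"
  unfolding usc_on_def
proof (intro conjI ballI allI)
  fix x show "eln (T x) < \<infinity>" by (simp add: eln_def)
next
  fix r
  show "openin (top_of_set S) {x \<in> S. eln (T x) < r}"
  proof (cases r)
    case (real q)
    have eq: "{x \<in> S. eln (T x) < r} = S \<inter> T -` {..<exp q}" using real by (auto simp: eln_less_iff)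
    show ?thesis unfolding eq by (rule continuous_openin_preimage_gen[OF assms]) simp
  next
    case PInf
    then have "{x \<in> S. eln (T x) < r} = S" by (auto simp: eln_def)
    then show ?thesis by simp
  next
    case MInf
    then have "{x \<in> S. eln (T x) < r} = {}" by auto
    then show ?thesis by (simp only: openin_empty)
  qed
qed

text \<open>Where $T$ is positive, $\ln T$ is supported from below by the harmonic function
  $\frac1m \ln |G|$.\<close>

lemma sub_at_eln:
  assumes m: "0 < m"
    and G: "T \<zeta>0 > 0 \<Longrightarrow> \<exists>G. G holomorphic_on UNIV \<and> (\<forall>\<zeta>. cmod (G \<zeta>) \<le> T \<zeta> ^ m) \<and> cmod (G \<zeta>0) = T \<zeta>0 ^ m"
    and T: "\<And>\<zeta>. 0 \<le> T \<zeta>"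
  shows "sub_at (\<lambda>\<zeta>. eln (T \<zeta>)) \<zeta>0"
proof (cases "T \<zeta>0 > 0")
  case False
  then have "eln (T \<zeta>0) = - \<infinity>" by (simp add: eln_def)
  then show ?thesis unfolding sub_at_def by (auto intro: exI[of _ 1])
next
  case True
  obtain G where G: "G holomorphic_on UNIV" "\<And>\<zeta>. cmod (G \<zeta>) \<le> T \<zeta> ^ m" "cmod (G \<zeta>0) = T \<zeta>0 ^ m"
    using G[OF True] by blast
  have "G \<zeta>0 \<noteq> 0" using G(3) True by auto
  have cG: "continuous_on UNIV G" using G(1) by (rule holomorphic_on_imp_continuous_on)
  then have "isCont G \<zeta>0" by (simp add: continuous_on_eq_continuous_at)
  from continuous_at_avoid[OF this \<open>G \<zeta>0 \<noteq> 0\<close>] obtain R where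
    R: "R > 0" "\<And>y. dist \<zeta>0 y < R \<Longrightarrow> G y \<noteq> 0" by blast
  have holb: "G holomorphic_on ball \<zeta>0 R" using G(1) holomorphic_on_subset by blast
  obtain L where L: "L holomorphic_on ball \<zeta>0 R" "\<And>z. z \<in> ball \<zeta>0 R \<Longrightarrow> G z = exp (L z)"
    using contractible_imp_holomorphic_log[OF holb convex_imp_contractible[OF convex_ball]] R(2) by auto
  have lnG: "Re (L z) = ln (cmod (G z))" if "z \<in> ball \<zeta>0 R" for z using L(2)[OF that] by simp
  show ?thesis unfolding sub_at_def
  proof (intro exI[of _ R] conjI allI impI R(1))
    fix r w assume a: "0 < r \<and> r < R \<and> continuous_on (sphere \<zeta>0 r) w \<and> (\<forall>z\<in>sphere \<zeta>0 r. eln (T z) \<le> ereal (w z))"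
    have sub: "cball \<zeta>0 r \<subseteq> ball \<zeta>0 R" using a by auto
    have "amean (\<lambda>t. Re (L (\<zeta>0 + of_real r * cis t))) = Re (L \<zeta>0)"
      by (rule amean_holomorphic_open[OF L(1) sub]) (use a in auto)
    also have "\<dots> = real m * ln (T \<zeta>0)"
      using lnG[of \<zeta>0] R(1) G(3) True by (simp add: ln_realpow)
    finally have eq: "amean (\<lambda>t. Re (L (\<zeta>0 + of_real r * cis t))) = real m * ln (T \<zeta>0)" .
    have cL: "continuous_on (sphere \<zeta>0 r) (\<lambda>z. Re (L z))"
    proof -
      have "sphere \<zeta>0 r \<subseteq> ball \<zeta>0 R" using a by auto
      then have "continuous_on (sphere \<zeta>0 r) L"
        by (rule continuous_on_subset[OF holomorphic_on_imp_continuous_on[OF L(1)]])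
      then show ?thesis by (intro continuous_intros)
    qed
    have "amean (\<lambda>t. Re (L (\<zeta>0 + of_real r * cis t))) \<le> amean (\<lambda>t. real m * w (\<zeta>0 + of_real r * cis t))"
    proof (rule amean_mono)
      show "continuous_on {0..2*pi} (\<lambda>t. Re (L (\<zeta>0 + of_real r * cis t)))"
        using continuous_on_circle[OF cL] a by auto
      show "continuous_on {0..2*pi} (\<lambda>t. real m * w (\<zeta>0 + of_real r * cis t))"
        using continuous_on_circle[of \<zeta>0 r w] a by (auto intro!: continuous_intros)
      fix t :: real
      define z where "z = \<zeta>0 + of_real r * cis t"
      have z: "z \<in> sphere \<zeta>0 r" "z \<in> ball \<zeta>0 R" using a unfolding z_def by (auto simp: dist_norm norm_mult)
      have "cmod (G z) > 0" using R(2)[of z] z by auto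
      then have "T z ^ m > 0" using G(2)[of z] by linarith
      then have "T z \<noteq> 0" using m by (auto simp: zero_power)
      then have Tz: "T z > 0" using T[of z] by linarith
      have "eln (T z) \<le> ereal (w z)" using a z(1) by blast
      then have "ln (T z) \<le> w z" using Tz by (simp add: eln_pos)
      have "Re (L z) \<le> ln (T z ^ m)" unfolding lnG[OF z(2)]
        using \<open>cmod (G z) > 0\<close> \<open>T z ^ m > 0\<close> G(2)[of z] by (subst ln_le_cancel_iff) auto
      also have "\<dots> = real m * ln (T z)" using Tz by (simp add: ln_realpow)
      also have "\<dots> \<le> real m * w z" using \<open>ln (T z) \<le> w z\<close> by (simp add: mult_left_mono)
      finally show "Re (L (\<zeta>0 + of_real r * cis t)) \<le> real m * w (\<zeta>0 + of_real r * cis t)" unfolding z_def .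
    qed
    then have "ln (T \<zeta>0) \<le> amean (\<lambda>t. w (\<zeta>0 + of_real r * cis t))"
      unfolding eq amean_cmult using m by simp
    then show "eln (T \<zeta>0) \<le> ereal (amean (\<lambda>t. w (\<zeta>0 + of_real r * cis t)))" using True by (simp add: eln_pos)
  qed
qed

section \<open>The solution of the Dirichlet problem as a competitor\<close>

definition competitor :: "(p1 \<times> complex \<Rightarrow> real) \<Rightarrow> (p1 \<times> complex \<Rightarrow> ereal) \<Rightarrow> bool" where
  "competitor \<phi> \<psi> \<longleftrightarrow> usc_on (UNIV \<times> cball 0 1) \<psi> \<and> fs_psh \<psi> \<and>
     (\<forall>z. \<forall>\<tau>\<in>sphere 0 1. \<psi> (z, \<tau>) \<le> ereal (\<phi> (z, \<tau>)))"

lemma hmae_solution_eq: "hmae_solution \<phi> p = (SUP \<psi>\<in>Collect (competitor \<phi>). \<psi> p)"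
  unfolding hmae_solution_def competitor_def by simp

lemma competitor_le: "competitor \<phi> \<psi> \<Longrightarrow> \<psi> p \<le> hmae_solution \<phi> p"
  unfolding hmae_solution_eq by (rule SUP_upper) simp

lemma hmae_solution_le: "(\<And>\<psi>. competitor \<phi> \<psi> \<Longrightarrow> \<psi> p \<le> r) \<Longrightarrow> hmae_solution \<phi> p \<le> r"
  unfolding hmae_solution_eq by (rule SUP_least) simp

lemma Fin_in_charts [simp]: "Fin \<in> charts" and chart_Infty_in_charts [simp]: "chart_Infty \<in> charts"
  by (auto simp: charts_def)

lemma chart_Infty_0 [simp]: "chart_Infty 0 = Infty"
  and chart_Infty_nz: "w \<noteq> 0 \<Longrightarrow> chart_Infty w = Fin (1 / w)"
  by (auto simp: chart_Infty_def)

lemma charts_cases [consumes 1, case_names Fin Infty]: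
  "c \<in> charts \<Longrightarrow> (c = Fin \<Longrightarrow> P) \<Longrightarrow> (c = chart_Infty \<Longrightarrow> P) \<Longrightarrow> P"
  by (auto simp: charts_def)

lemma p1_chart_surj: "\<exists>c\<in>charts. \<exists>z. p = c z"
proof (cases p)
  case (Fin z) then show ?thesis by (intro bexI[of _ Fin]) auto
next
  case Infty then show ?thesis by (intro bexI[of _ chart_Infty] exI[of _ 0]) auto
qed

lemma continuous_on_chart: "c \<in> charts \<Longrightarrow> continuous_on S c"
proof -
  assume c: "c \<in> charts"
  have "continuous_on UNIV c"
    using c by (auto simp: continuous_on_open_vimage open_p1_def)
  then show ?thesis by (rule continuous_on_subset) simp
qed

lemma inj_chart: "c \<in> charts \<Longrightarrow> inj c"
  by (erule charts_cases) (auto simp: inj_on_def chart_Infty_def split: if_splits)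

lemma open_chart_image:
  assumes c: "c \<in> charts" and U: "open U"
  shows "open (c ` U)"
proof -
  have inv: "open {z. z \<noteq> 0 \<and> 1 / z \<in> U}" if "open U" for U :: "complex set"
  proof -
    have "open ((\<lambda>z. 1 / z) -` U \<inter> (- {0}))"
    proof -
      have "continuous_on (- {0}) (\<lambda>z::complex. 1 / z)" by (intro continuous_intros) auto
      from continuous_open_preimage[OF this _ that] show ?thesis by (simp add: Int_commute open_Compl)
    qed
    moreover have "(\<lambda>z. 1 / z) -` U \<inter> (- {0}) = {z. z \<noteq> 0 \<and> 1 / z \<in> U}" by auto
    ultimately show ?thesis by simp
  qed
  have "open (c' -` c ` U)" if c': "c' \<in> charts" for c'
  proof (cases "c = c'")
    case True
    then show ?thesis using U inj_chart[OF c] by (simp add: inj_vimage_image_eq)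
  next
    case False
    have "c' z = c w \<longleftrightarrow> z \<noteq> 0 \<and> w = 1 / z" for z w
      using False c c' unfolding charts_def by (auto simp: chart_Infty_def split: if_splits)
    then have "c' -` c ` U = {z. z \<noteq> 0 \<and> 1 / z \<in> U}" by (auto simp: image_iff)
    then show ?thesis using inv[OF U] by simp
  qed
  then show ?thesis by (simp add: open_p1_def)
qed

lemma open_chart_prod_image:
  fixes V :: "(complex \<times> complex) set"
  assumes c: "c \<in> charts" and V: "open V"
  shows "open ((\<lambda>(z, \<tau>). (c z, \<tau>)) ` V)"
proof (rule open_prod_intro)
  fix x assume "x \<in> (\<lambda>(z, \<tau>). (c z, \<tau>)) ` V"
  then obtain z \<tau> where z: "(z, \<tau>) \<in> V" "x = (c z, \<tau>)" by auto
  obtain A B where AB: "open A" "open B" "(z, \<tau>) \<in> A \<times> B" "A \<times> B \<subseteq> V"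
    using open_prod_elim[OF V z(1)] by blast
  show "\<exists>A B. open A \<and> open B \<and> x \<in> A \<times> B \<and> A \<times> B \<subseteq> (\<lambda>(z, \<tau>). (c z, \<tau>)) ` V"
    using AB z open_chart_image[OF c AB(1)]
    by (intro exI[of _ "c ` A"] exI[of _ B]) force
qed

lemma usc_on_p1I:
  fixes C :: "complex set"
  assumes "\<And>c. c \<in> charts \<Longrightarrow> usc_on (UNIV \<times> C) (\<lambda>x. \<psi> (c (fst x), snd x))"
  shows "usc_on (UNIV \<times> C) \<psi>"
  unfolding usc_on_def
proof (intro conjI ballI allI)
  fix x :: "p1 \<times> complex" assume x: "x \<in> UNIV \<times> C"
  obtain c z where "c \<in> charts" "fst x = c z" using p1_chart_surj by blast
  then show "\<psi> x < \<infinity>" using assms[of c] x unfolding usc_on_def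
    by (cases x) (auto dest!: bspec[of _ _ "(z, snd x)"])
next
  fix r
  have "\<forall>c\<in>charts. \<exists>V. open V \<and> {x \<in> UNIV \<times> C. \<psi> (c (fst x), snd x) < r} = (UNIV \<times> C) \<inter> V"
    using assms unfolding usc_on_def openin_open by blast
  then obtain V where V: "\<And>c. c \<in> charts \<Longrightarrow> open (V c)"
    "\<And>c. c \<in> charts \<Longrightarrow> {x \<in> UNIV \<times> C. \<psi> (c (fst x), snd x) < r} = (UNIV \<times> C) \<inter> V c"
    unfolding bchoice_iff by blast
  define W where "W = (\<Union>c\<in>charts. (\<lambda>(z, \<tau>). (c z, \<tau>)) ` V c)"
  have "open W" unfolding W_def using V(1) by (intro open_UN ballI open_chart_prod_image) auto
  moreover have "{x \<in> UNIV \<times> C. \<psi> x < r} = (UNIV \<times> C) \<inter> W"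
  proof (intro set_eqI iffI)
    fix x assume x: "x \<in> {x \<in> UNIV \<times> C. \<psi> x < r}"
    obtain c z where c: "c \<in> charts" "fst x = c z" using p1_chart_surj by blast
    have "(z, snd x) \<in> {x \<in> UNIV \<times> C. \<psi> (c (fst x), snd x) < r}" using x c(2)[symmetric] by (cases x) auto
    then have "(z, snd x) \<in> V c" using V(2)[OF c(1)] by blast
    then have "x \<in> (\<lambda>(z, \<tau>). (c z, \<tau>)) ` V c" using c(2) by (cases x) force
    then show "x \<in> (UNIV \<times> C) \<inter> W" using x c(1) unfolding W_def by auto
  next
    fix x assume x: "x \<in> (UNIV \<times> C) \<inter> W"
    then obtain c z \<tau> where c: "c \<in> charts" "(z, \<tau>) \<in> V c" "x = (c z, \<tau>)" unfolding W_def by auto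
    then have "(z, \<tau>) \<in> (UNIV \<times> C) \<inter> V c" using x by auto
    then have "(z, \<tau>) \<in> {x \<in> UNIV \<times> C. \<psi> (c (fst x), snd x) < r}" using V(2)[OF c(1)] by blast
    then show "x \<in> {x \<in> UNIV \<times> C. \<psi> x < r}" using c(3) by auto
  qed
  ultimately show "openin (top_of_set (UNIV \<times> C)) {x \<in> UNIV \<times> C. \<psi> x < r}"
    unfolding openin_open by blast
qed

lemma usc_on_p1D:
  assumes "usc_on (UNIV \<times> C) \<psi>" "c \<in> charts" "continuous_on T h" "continuous_on T k" "k ` T \<subseteq> C"
  shows "usc_on T (\<lambda>x. \<psi> (c (h x), k x))"
  by (rule usc_on_compose[OF assms(1)])
     (use assms(5) in \<open>auto intro!: continuous_on_Pair assms(4) continuous_on_compose2[OF continuous_on_chart[OF assms(2), of UNIV] assms(3)]\<close>)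

lemma continuous_on_fs_potential: "continuous_on S h \<Longrightarrow> continuous_on S (\<lambda>x. fs_potential (h x))"
  unfolding fs_potential_def
  by (intro continuous_intros) (auto simp: add_pos_nonneg add_nonneg_eq_0_iff)

text \<open>The source of all upper bounds: along an analytic disc a competitor plus potential is
  subharmonic and at most the boundary data on the circle, so every superharmonic w above the data
  bounds it inside.\<close>

lemma competitor_disc:
  assumes \<psi>: "competitor \<phi> \<psi>" and c: "c \<in> charts"
    and h: "h holomorphic_on ball 0 1" "continuous_on (cball 0 1) h"
    and w: "continuous_on (cball 0 1) w" "\<And>\<tau>. \<tau> \<in> ball 0 1 \<Longrightarrow> super_mean_at w \<tau>"
    and le: "\<And>\<tau>. \<tau> \<in> sphere 0 1 \<Longrightarrow> \<phi> (c (h \<tau>), \<tau>) + fs_potential (h \<tau>) \<le> w \<tau>"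
    and t: "\<tau> \<in> cball 0 1"
  shows "\<psi> (c (h \<tau>), \<tau>) + ereal (fs_potential (h \<tau>)) \<le> ereal (w \<tau>)"
proof -
  have bd: "\<psi> (c (h \<tau>), \<tau>) + ereal (fs_potential (h \<tau>)) \<le> ereal (w \<tau>)" if "\<tau> \<in> sphere 0 1" for \<tau>
  proof -
    have "\<psi> (c (h \<tau>), \<tau>) + ereal (fs_potential (h \<tau>)) \<le> ereal (\<phi> (c (h \<tau>), \<tau>)) + ereal (fs_potential (h \<tau>))"
      using \<psi> that unfolding competitor_def by (intro add_right_mono) auto
    also have "\<dots> \<le> ereal (w \<tau>)" using le[OF that] by simp
    finally show ?thesis .
  qed
  show ?thesis
  proof (cases "\<tau> \<in> ball 0 1")
    case True
    show ?thesis
    proof (rule maximum_principle[where W="ball 0 1" and v="\<lambda>\<tau>. \<psi> (c (h \<tau>), \<tau>) + ereal (fs_potential (h \<tau>))"])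
      show "usc_on (closure (ball 0 1)) (\<lambda>\<tau>. \<psi> (c (h \<tau>), \<tau>) + ereal (fs_potential (h \<tau>)))"
        using \<psi> h(2) unfolding competitor_def
        by (intro usc_on_add_continuous continuous_on_fs_potential usc_on_p1D[where C="cball 0 1"] c) auto
      fix a :: complex assume a: "a \<in> ball 0 1"
      have "psh_on (UNIV \<times> ball 0 1) (\<lambda>(z, \<tau>). \<psi> (c z, \<tau>) + ereal (fs_potential z))"
        using \<psi> c unfolding competitor_def fs_psh_def by blast
      from psh_on_holomorphic_disc[OF this _ open_ball a h(1) holomorphic_on_ident]
      show "sub_at (\<lambda>\<tau>. \<psi> (c (h \<tau>), \<tau>) + ereal (fs_potential (h \<tau>))) a"
        by (auto intro!: open_Times)
    qed (use w bd True in auto)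
  next
    case False
    then show ?thesis using t by (intro bd) auto
  qed
qed

lemma hmae_solution_disc:
  assumes c: "c \<in> charts"
    and h: "h holomorphic_on ball 0 1" "continuous_on (cball 0 1) h"
    and w: "continuous_on (cball 0 1) w" "\<And>\<tau>. \<tau> \<in> ball 0 1 \<Longrightarrow> super_mean_at w \<tau>"
    and le: "\<And>\<tau>. \<tau> \<in> sphere 0 1 \<Longrightarrow> \<phi> (c (h \<tau>), \<tau>) + fs_potential (h \<tau>) \<le> w \<tau>"
    and t: "\<tau> \<in> cball 0 1"
  shows "hmae_solution \<phi> (c (h \<tau>), \<tau>) + ereal (fs_potential (h \<tau>)) \<le> ereal (w \<tau>)"
proof -
  have "hmae_solution \<phi> (c (h \<tau>), \<tau>) \<le> ereal (w \<tau> - fs_potential (h \<tau>))"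
  proof (rule hmae_solution_le)
    fix \<psi> assume "competitor \<phi> \<psi>"
    from competitor_disc[OF this assms] show "\<psi> (c (h \<tau>), \<tau>) \<le> ereal (w \<tau> - fs_potential (h \<tau>))"
      by (cases "\<psi> (c (h \<tau>), \<tau>)") auto
  qed
  then show ?thesis by (cases "hmae_solution \<phi> (c (h \<tau>), \<tau>)") auto
qed

text \<open>Perron's argument. The upper semicontinuous regularisation of the envelope inherits the
  sub-mean value inequality and, by \<open>bdry\<close>, lies below the data. So it is itself a
  competitor, hence at most the envelope, and the two are equal.\<close>

theorem hmae_solution_competitor:
  fixes \<phi> :: "p1 \<times> complex \<Rightarrow> real"
  defines "\<Phi> \<equiv> hmae_solution \<phi>"
  assumes bdd: "\<And>x. x \<in> UNIV \<times> cball 0 1 \<Longrightarrow> \<Phi> x \<le> ereal K"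
    and bdry: "\<And>p \<tau> e. \<tau> \<in> sphere 0 1 \<Longrightarrow> 0 < e \<Longrightarrow>
      \<exists>V. open V \<and> (p, \<tau>) \<in> V \<and> (\<forall>y\<in>V \<inter> (UNIV \<times> cball 0 1). \<Phi> y \<le> ereal (\<phi> (p, \<tau>) + e))"
  shows "competitor \<phi> \<Phi>"
proof -
  define X where "X = (UNIV :: p1 set) \<times> cball (0::complex) 1"
  \<comment> \<open>The upper semicontinuous regularisation relative to X.\<close>
  define \<Psi> where "\<Psi> = (\<lambda>x. INF V\<in>{V. open V \<and> x \<in> V}. SUP y\<in>V \<inter> X. \<Phi> y)"
  have PsiI: "\<Psi> x \<le> r" if "open V" "x \<in> V" "\<And>y. y \<in> V \<inter> X \<Longrightarrow> \<Phi> y \<le> r" for V x r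
    unfolding \<Psi>_def using that by (intro INF_lower2[of V] SUP_least) auto
  have PsiD: "\<exists>V. open V \<and> x \<in> V \<and> (SUP y\<in>V \<inter> X. \<Phi> y) < r" if "\<Psi> x < r" for x r
    using that unfolding \<Psi>_def INF_less_iff by auto
  have le: "\<Phi> x \<le> \<Psi> x" if "x \<in> X" for x
    unfolding \<Psi>_def using that by (intro INF_greatest SUP_upper) auto
  have usc: "usc_on X \<Psi>"
    unfolding usc_on_def
  proof (intro conjI ballI allI)
    fix x assume "x \<in> X"
    have "\<Psi> x \<le> ereal K" using bdd by (intro PsiI[of UNIV]) (auto simp: X_def)
    then show "\<Psi> x < \<infinity>" by (cases "\<Psi> x") auto
  next
    fix r
    have "open {x. \<Psi> x < r}"
    proof (subst open_subopen, rule ballI)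
      fix x assume "x \<in> {x. \<Psi> x < r}"
      then obtain V where V: "open V" "x \<in> V" "(SUP y\<in>V \<inter> X. \<Phi> y) < r" using PsiD by blast
      have "\<Psi> y < r" if "y \<in> V" for y
        unfolding \<Psi>_def INF_less_iff using V that by auto
      then show "\<exists>T. open T \<and> x \<in> T \<and> T \<subseteq> {x. \<Psi> x < r}" using V by blast
    qed
    moreover have "{x \<in> X. \<Psi> x < r} = X \<inter> {x. \<Psi> x < r}" by auto
    ultimately show "openin (top_of_set X) {x \<in> X. \<Psi> x < r}" by (simp add: openin_open_Int)
  qed
  have psh: "fs_psh \<Psi>"
    unfolding fs_psh_def
  proof
    fix c assume c: "c \<in> charts"
    define u where "u = (\<lambda>x. \<Psi> (c (fst x), snd x) + ereal (fs_potential (fst x)))"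
    have uscu: "usc_on (UNIV \<times> ball 0 1) u"
      unfolding u_def
    proof (intro usc_on_add_continuous continuous_on_fs_potential)
      show "usc_on (UNIV \<times> ball 0 1) (\<lambda>x. \<Psi> (c (fst x), snd x))"
        by (rule usc_on_p1D[OF usc[unfolded X_def] c]) (auto intro!: continuous_intros)
    qed (intro continuous_intros)
    have "psh_on (UNIV \<times> ball 0 1) u"
    proof (rule psh_onI[OF uscu])
      fix a b :: "complex \<times> complex" and w
      assume disc: "\<And>\<zeta>. \<zeta> \<in> cball 0 1 \<Longrightarrow> (fst a + \<zeta> * fst b, snd a + \<zeta> * snd b) \<in> UNIV \<times> ball 0 1"
        and w: "continuous_on (sphere 0 1) w"
          "\<And>\<zeta>. \<zeta> \<in> sphere 0 1 \<Longrightarrow> u (fst a + \<zeta> * fst b, snd a + \<zeta> * snd b) \<le> ereal (w \<zeta>)"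
      define L where "L = (\<lambda>\<zeta>. (fst a + \<zeta> * fst b, snd a + \<zeta> * snd b))"
      have "compact (L ` cball 0 1)" unfolding L_def by (intro compact_continuous_image continuous_intros) auto
      moreover have "L ` cball 0 1 \<subseteq> UNIV \<times> ball 0 1" using disc unfolding L_def by blast
      ultimately obtain e where e: "e > 0" "(\<Union>x\<in>L ` cball 0 1. ball x e) \<subseteq> UNIV \<times> ball 0 1"
        using compact_subset_open_imp_ball_epsilon_subset[OF _ open_Times[OF open_UNIV open_ball]] by blast
      have inS: "L \<zeta> + d \<in> UNIV \<times> ball 0 1" if "\<zeta> \<in> cball 0 1" "norm d \<le> e / 2" for \<zeta> d
      proof -
        have "L \<zeta> + d \<in> ball (L \<zeta>) e" using that e by (auto simp: dist_norm)
        then show ?thesis using e(2) that by blast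
      qed
      show "u a \<le> ereal (amean (\<lambda>t. w (cis t)))"
      proof (rule ereal_le_epsilon2)
        fix \<kappa> :: real assume k: "0 < \<kappa>"
        define F where "F = (\<lambda>x. u (L (snd x) + fst x) + ereal (- w (snd x)))"
        have uF: "usc_on (cball 0 (e/2) \<times> sphere 0 1) F"
          unfolding F_def
        proof (intro usc_on_add_continuous)
          show "usc_on (cball 0 (e/2) \<times> sphere 0 1) (\<lambda>x. u (L (snd x) + fst x))"
          proof (rule usc_on_compose[OF uscu])
            show "continuous_on (cball 0 (e/2) \<times> sphere 0 1) (\<lambda>x. L (snd x) + fst x)"
              unfolding L_def by (intro continuous_intros)
            show "(\<lambda>x. L (snd x) + fst x) ` (cball 0 (e/2) \<times> sphere 0 1) \<subseteq> UNIV \<times> ball 0 1"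
            proof (rule image_subsetI)
              fix x :: "(complex \<times> complex) \<times> complex" assume "x \<in> cball 0 (e/2) \<times> sphere 0 1"
              then show "L (snd x) + fst x \<in> UNIV \<times> ball 0 1" by (intro inS) (auto simp: mem_Times_iff)
            qed
          qed
          show "continuous_on (cball 0 (e/2) \<times> sphere 0 1) (\<lambda>x. - w (snd x))"
            by (intro continuous_intros continuous_on_compose2[OF w(1)]) auto
        qed
        have F0: "F (0, \<zeta>) < ereal (\<kappa>/2)" if "\<zeta> \<in> sphere 0 1" for \<zeta>
        proof -
          have "F (0, \<zeta>) \<le> ereal (w \<zeta>) + ereal (- w \<zeta>)"
            unfolding F_def fst_conv snd_conv add_0_right L_def by (intro add_right_mono w(2) that)
          also have "\<dots> < ereal (\<kappa>/2)" using k by simp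
          finally show ?thesis .
        qed
        obtain \<delta> where \<delta>: "0 < \<delta>" "\<delta> \<le> e/2" "\<And>x z. norm x \<le> \<delta> \<Longrightarrow> z \<in> sphere 0 1 \<Longrightarrow> F (x, z) < ereal (\<kappa>/2)"
          using usc_tube[where F=F and A="sphere 0 1" and \<delta>="e/2" and r="ereal (\<kappa>/2)",
              OF uF compact_sphere half_gt_zero[OF e(1)] F0] by blast
        have cfs: "isCont (\<lambda>x. fs_potential (fst x)) a"
        proof -
          have "continuous_on UNIV (\<lambda>x::complex \<times> complex. fs_potential (fst x))"
            by (intro continuous_on_fs_potential continuous_intros)
          from this[unfolded continuous_on_eq_continuous_at[OF open_UNIV]] show ?thesis by blast
        qed
        then obtain \<delta>2 where \<delta>2: "0 < \<delta>2" "\<And>x. dist x a < \<delta>2 \<Longrightarrow> dist (fs_potential (fst x)) (fs_potential (fst a)) < \<kappa>/2"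
          using half_gt_zero[OF k] unfolding continuous_at_eps_delta by blast
        \<comment> \<open>For centres in V the circle is a translate by at most \<delta>, on which u
          stays below w + \<kappa>/2. The mean value inequality of each competitor therefore bounds
          it on V, uniformly, and the bound passes to the supremum.\<close>
        define V where "V = (\<lambda>(z, \<tau>). (c z, \<tau>)) ` ball a (min \<delta> \<delta>2)"
        have "\<Psi> (c (fst a), snd a) \<le> ereal (amean (\<lambda>t. w (cis t)) + \<kappa> - fs_potential (fst a))"
        proof (rule PsiI)
          show "open V" unfolding V_def by (rule open_chart_prod_image[OF c open_ball])
          show "(c (fst a), snd a) \<in> V" unfolding V_def using \<delta> \<delta>2 by (intro image_eqI[of _ _ a]) (auto simp: case_prod_beta)
          fix y assume "y \<in> V \<inter> X"
          then obtain x where x: "x \<in> ball a (min \<delta> \<delta>2)" "y = (c (fst x), snd x)" unfolding V_def by auto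
          define d where "d = x - a"
          have d: "norm d \<le> \<delta>" "norm d \<le> e/2" using x(1) \<delta>(2) by (auto simp: d_def dist_norm norm_minus_commute)
          have xd: "x = a + d" by (simp add: d_def)
          show "\<Phi> y \<le> ereal (amean (\<lambda>t. w (cis t)) + \<kappa> - fs_potential (fst a))"
            unfolding \<Phi>_def
          proof (rule hmae_solution_le)
            fix \<psi> assume \<psi>: "competitor \<phi> \<psi>"
            define v where "v = (\<lambda>x. \<psi> (c (fst x), snd x) + ereal (fs_potential (fst x)))"
            have pv: "psh_on (UNIV \<times> ball 0 1) v"
              using \<psi> c unfolding competitor_def fs_psh_def v_def case_prod_beta' by blast
            have pt: "(fst x + \<zeta> * fst b, snd x + \<zeta> * snd b) = L \<zeta> + d" for \<zeta>
              unfolding xd L_def by (simp add: prod_eq_iff)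
            have "v x \<le> ereal (amean (\<lambda>t. w (cis t) + \<kappa>/2))"
            proof (rule psh_on_mean[OF pv, where w="\<lambda>\<zeta>. w \<zeta> + \<kappa>/2"])
              fix \<zeta> :: complex assume "\<zeta> \<in> cball 0 1"
              then show "(fst x + \<zeta> * fst b, snd x + \<zeta> * snd b) \<in> UNIV \<times> ball 0 1"
                unfolding pt using inS d by blast
            next
              show "continuous_on (sphere 0 1) (\<lambda>\<zeta>. w \<zeta> + \<kappa>/2)" by (intro continuous_intros w(1))
            next
              fix \<zeta> :: complex assume z: "\<zeta> \<in> sphere 0 1"
              have S: "L \<zeta> + d \<in> UNIV \<times> ball 0 1" using inS d z by auto
              have "\<psi> (c (fst (L \<zeta> + d)), snd (L \<zeta> + d)) \<le> \<Psi> (c (fst (L \<zeta> + d)), snd (L \<zeta> + d))"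
                using S by (intro order_trans[OF competitor_le[OF \<psi>, folded \<Phi>_def] le]) (auto simp: X_def mem_Times_iff)
              then have "v (L \<zeta> + d) \<le> u (L \<zeta> + d)" unfolding v_def u_def by (rule add_right_mono)
              moreover have "F (d, \<zeta>) < ereal (\<kappa>/2)" using \<delta>(3) d z by blast
              ultimately show "v (fst x + \<zeta> * fst b, snd x + \<zeta> * snd b) \<le> ereal (w \<zeta> + \<kappa>/2)"
                unfolding pt F_def fst_conv snd_conv
                by (cases "u (L \<zeta> + d)"; cases "v (L \<zeta> + d)") auto
            qed
            also have "amean (\<lambda>t. w (cis t) + \<kappa>/2) = amean (\<lambda>t. w (cis t)) + \<kappa>/2"
              using continuous_on_circle[OF w(1)] by (subst amean_add) auto
            finally have "v x \<le> ereal (amean (\<lambda>t. w (cis t)) + \<kappa>/2)" .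
            moreover have "\<bar>fs_potential (fst x) - fs_potential (fst a)\<bar> < \<kappa>/2"
              using \<delta>2(2)[of x] x(1) by (auto simp: dist_commute dist_real_def abs_minus_commute)
            ultimately show "\<psi> y \<le> ereal (amean (\<lambda>t. w (cis t)) + \<kappa> - fs_potential (fst a))"
              unfolding v_def x(2) by (cases "\<psi> (c (fst x), snd x)") (auto simp: abs_if split: if_splits)
          qed
        qed
        then show "u a \<le> ereal (amean (\<lambda>t. w (cis t))) + ereal \<kappa>"
          unfolding u_def by (cases "\<Psi> (c (fst a), snd a)") auto
      qed
    qed
    then show "psh_on (UNIV \<times> ball 0 1) (\<lambda>(z, \<tau>). \<Psi> (c z, \<tau>) + ereal (fs_potential z))"
      unfolding u_def case_prod_beta' .
  qed
  have bd: "\<Psi> (p, \<tau>) \<le> ereal (\<phi> (p, \<tau>))" if t: "\<tau> \<in> sphere 0 1" for p \<tau>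
  proof (rule ereal_le_epsilon2)
    fix e :: real assume "0 < e"
    then obtain V where "open V" "(p, \<tau>) \<in> V" "\<forall>y\<in>V \<inter> X. \<Phi> y \<le> ereal (\<phi> (p, \<tau>) + e)"
      using bdry[OF t] unfolding X_def by blast
    then show "\<Psi> (p, \<tau>) \<le> ereal (\<phi> (p, \<tau>)) + ereal e" by (auto intro: PsiI)
  qed
  have comp: "competitor \<phi> \<Psi>" using usc psh bd unfolding competitor_def X_def by auto
  have eq: "\<Psi> x = \<Phi> x" if "x \<in> X" for x
    using le[OF that] competitor_le[OF comp, of x] unfolding \<Phi>_def by simp
  have eq': "\<Psi> (c z, \<tau>) = \<Phi> (c z, \<tau>)" if "\<tau> \<in> cball 0 1" for c :: "complex \<Rightarrow> p1" and z \<tau> using that by (intro eq) (auto simp: X_def)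
  show ?thesis
    unfolding competitor_def
  proof (intro conjI allI ballI)
    have "{x \<in> X. \<Phi> x < r} = {x \<in> X. \<Psi> x < r}" for r using eq by auto
    then show "usc_on (UNIV \<times> cball 0 1) \<Phi>"
      using usc eq unfolding usc_on_def X_def[symmetric] by auto
    \<comment> \<open>\<Psi> and \<Phi> agree only on X, so plurisubharmonicity is carried over by
      way of majorants, which see only values over the open unit disc.\<close>
    show "fs_psh \<Phi>"
      unfolding fs_psh_def
    proof
      fix c assume c: "c \<in> charts"
      have p: "psh_on (UNIV \<times> ball 0 1) (\<lambda>(z, \<tau>). \<Psi> (c z, \<tau>) + ereal (fs_potential z))"
        using psh c unfolding fs_psh_def by blast
      show "psh_on (UNIV \<times> ball 0 1) (\<lambda>(z, \<tau>). \<Phi> (c z, \<tau>) + ereal (fs_potential z))"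
      proof (rule psh_onI)
        have "{x \<in> UNIV \<times> ball 0 1. (case x of (z, \<tau>) \<Rightarrow> \<Phi> (c z, \<tau>) + ereal (fs_potential z)) < r} =
          {x \<in> UNIV \<times> ball 0 1. (case x of (z, \<tau>) \<Rightarrow> \<Psi> (c z, \<tau>) + ereal (fs_potential z)) < r}" for r
          using eq' by auto
        then show "usc_on (UNIV \<times> ball 0 1) (\<lambda>(z, \<tau>). \<Phi> (c z, \<tau>) + ereal (fs_potential z))"
          using p eq' unfolding psh_on_def usc_on_def by auto
        fix a b :: "complex \<times> complex" and w
        assume disc: "\<And>\<zeta>. \<zeta> \<in> cball 0 1 \<Longrightarrow> (fst a + \<zeta> * fst b, snd a + \<zeta> * snd b) \<in> UNIV \<times> ball 0 1"
          and w: "continuous_on (sphere 0 1) w"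
            "\<And>\<zeta>. \<zeta> \<in> sphere 0 1 \<Longrightarrow> (case (fst a + \<zeta> * fst b, snd a + \<zeta> * snd b) of (z, \<tau>) \<Rightarrow> \<Phi> (c z, \<tau>) + ereal (fs_potential z)) \<le> ereal (w \<zeta>)"
        have "(case a of (z, \<tau>) \<Rightarrow> \<Psi> (c z, \<tau>) + ereal (fs_potential z)) \<le> ereal (amean (\<lambda>t. w (cis t)))"
        proof (rule psh_on_mean[OF p disc w(1)])
          fix \<zeta> :: complex assume z: "\<zeta> \<in> sphere 0 1"
          have "snd a + \<zeta> * snd b \<in> cball 0 1" using disc[of \<zeta>] z by auto
          then show "(case (fst a + \<zeta> * fst b, snd a + \<zeta> * snd b) of (z, \<tau>) \<Rightarrow> \<Psi> (c z, \<tau>) + ereal (fs_potential z)) \<le> ereal (w \<zeta>)"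
            using w(2)[OF z] eq' by auto
        qed auto
        moreover have "snd a \<in> cball 0 1" using disc[of 0] by auto
        ultimately show "(case a of (z, \<tau>) \<Rightarrow> \<Phi> (c z, \<tau>) + ereal (fs_potential z)) \<le> ereal (amean (\<lambda>t. w (cis t)))"
          using eq' by (cases a) auto
      qed
    qed
    fix z and \<tau> :: complex assume t: "\<tau> \<in> sphere 0 1"
    then show "\<Phi> (z, \<tau>) \<le> ereal (\<phi> (z, \<tau>))" using bd[OF t, of z] eq[of "(z, \<tau>)"] by (auto simp: X_def)
  qed
qed

section \<open>Competitors given by logarithms of homogeneous forms\<close>

text \<open>\<open>(hX p, hY p)\<close> are homogeneous coordinates of \<open>p\<close>, and \<open>(lX c z, lY c z)\<close> are holomorphic ones of \<open>c z\<close>.\<close>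

fun hX :: "p1 \<Rightarrow> complex" where "hX (Fin z) = z" | "hX Infty = 1"
fun hY :: "p1 \<Rightarrow> complex" where "hY (Fin z) = 1" | "hY Infty = 0"

definition hN :: "p1 \<Rightarrow> real" where "hN p = (cmod (hX p))\<^sup>2 + (cmod (hY p))\<^sup>2"

definition lX :: "(complex \<Rightarrow> p1) \<Rightarrow> complex \<Rightarrow> complex" where "lX c z = (if c = Fin then z else 1)"
definition lY :: "(complex \<Rightarrow> p1) \<Rightarrow> complex \<Rightarrow> complex" where "lY c z = (if c = Fin then 1 else z)"

definition hom2 :: "(complex \<Rightarrow> complex \<Rightarrow> complex \<Rightarrow> real) \<Rightarrow> bool" where
  "hom2 T \<longleftrightarrow> (\<forall>k X Y \<tau>. T (k * X) (k * Y) \<tau> = (cmod k)\<^sup>2 * T X Y \<tau>)"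

lemma hN_pos: "0 < hN p"
  by (cases p) (auto simp: hN_def add_nonneg_pos)

lemma chart_Infty_neq_Fin: "chart_Infty \<noteq> Fin"
  by (metis chart_Infty_0 p1.distinct(1))

lemma lX_simps [simp]: "lX Fin z = z" "lX chart_Infty z = 1" "lY Fin z = 1" "lY chart_Infty z = z"
  using chart_Infty_neq_Fin by (auto simp: lX_def lY_def)

text \<open>The two homogeneous representatives of a point differ by a factor k, and T and
  \<open>hN\<close> both scale by |k|^2.\<close>

lemma chart_hom2:
  assumes "c \<in> charts" "hom2 T"
  shows "T (hX (c z)) (hY (c z)) \<tau> / hN (c z) = T (lX c z) (lY c z) \<tau> / (1 + (cmod z)\<^sup>2)"
  using assms(1)
proof (cases rule: charts_cases)
  case Fin
  then show ?thesis by (simp add: hN_def add.commute)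
next
  case Infty
  show ?thesis
  proof (cases "z = 0")
    case True
    then show ?thesis using Infty by (simp add: hN_def)
  next
    case False
    have "T (1 / z * 1) (1 / z * z) \<tau> = (cmod (1 / z))\<^sup>2 * T 1 z \<tau>"
      using assms(2) unfolding hom2_def by blast
    then have "T (1 / z) 1 \<tau> = T 1 z \<tau> / (cmod z)\<^sup>2"
      using False by (simp add: norm_divide power_divide)
    moreover have "hN (Fin (1 / z)) = (1 + (cmod z)\<^sup>2) / (cmod z)\<^sup>2"
      using False by (simp add: hN_def norm_divide power_divide field_simps)
    ultimately show ?thesis using Infty False by (simp add: chart_Infty_nz)
  qed
qed

definition form_fun :: "(complex \<Rightarrow> complex \<Rightarrow> complex \<Rightarrow> real) \<Rightarrow> p1 \<times> complex \<Rightarrow> ereal" where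
  "form_fun T x = eln (T (hX (fst x)) (hY (fst x)) (snd x) / hN (fst x))"

lemma one_plus_sq_pos: "0 < 1 + (cmod z)\<^sup>2"
  by (simp add: add_pos_nonneg)

lemma form_fun_chart:
  assumes "c \<in> charts" "hom2 T"
  shows "form_fun T (c z, \<tau>) + ereal (fs_potential z) = eln (T (lX c z) (lY c z) \<tau>)"
  using one_plus_sq_pos[of z]
  by (simp add: form_fun_def chart_hom2[OF assms] fs_potential_def eln_add_ln)

text \<open>Forms whose logarithm is plurisubharmonic by the support criterion of
  \<open>sub_at_eln\<close>: at every point with T > 0 some G, holomorphic along complex lines,
  touches T^m from below in modulus. The power m absorbs the square roots in \<open>Th\<close> and
  \<open>Tb\<close>.\<close>

definition log_psh_form :: "(complex \<Rightarrow> complex \<Rightarrow> complex \<Rightarrow> real) \<Rightarrow> bool" where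
  "log_psh_form T \<longleftrightarrow> hom2 T \<and> continuous_on UNIV (\<lambda>x. T (fst x) (fst (snd x)) (snd (snd x))) \<and>
     (\<forall>X Y \<tau>. 0 \<le> T X Y \<tau>) \<and>
     (\<exists>m>0. \<forall>X0 Y0 \<tau>0. 0 < T X0 Y0 \<tau>0 \<longrightarrow>
       (\<exists>G. (\<forall>a a' b b' c c'. (\<lambda>\<zeta>. G (a + \<zeta> * a') (b + \<zeta> * b') (c + \<zeta> * c')) holomorphic_on UNIV) \<and>
            (\<forall>X Y \<tau>. cmod (G X Y \<tau>) \<le> T X Y \<tau> ^ m) \<and> cmod (G X0 Y0 \<tau>0) = T X0 Y0 \<tau>0 ^ m))"

lemma lift_affine:
  "\<exists>p q p' q'. \<forall>\<zeta>. lX c (a + \<zeta> * b) = p + \<zeta> * p' \<and> lY c (a + \<zeta> * b) = q + \<zeta> * q'"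
proof (cases "c = Fin")
  case True
  then show ?thesis by (intro exI[of _ a] exI[of _ 1] exI[of _ b] exI[of _ 0]) (simp add: lX_def lY_def)
next
  case False
  then show ?thesis by (intro exI[of _ 1] exI[of _ a] exI[of _ 0] exI[of _ b]) (simp add: lX_def lY_def)
qed

lemma continuous_on_lift: "continuous_on S h \<Longrightarrow> continuous_on S (\<lambda>x. lX c (h x))"
   "continuous_on S h \<Longrightarrow> continuous_on S (\<lambda>x. lY c (h x))"
  by (cases "c = Fin"; simp add: lX_def lY_def)+

lemma log_psh_form_usc:
  assumes T: "log_psh_form T" and c: "c \<in> charts" and h: "continuous_on S h" "continuous_on S k"
  shows "usc_on S (\<lambda>x. eln (T (lX c (h x)) (lY c (h x)) (k x)))"
proof (rule usc_on_eln)
  have ct: "continuous_on UNIV (\<lambda>x. T (fst x) (fst (snd x)) (snd (snd x)))"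
    using T unfolding log_psh_form_def by blast
  have "continuous_on S (\<lambda>x. (lX c (h x), lY c (h x), k x))"
    by (intro continuous_intros continuous_on_lift h)
  from continuous_on_compose2[OF ct this] show "continuous_on S (\<lambda>x. T (lX c (h x)) (lY c (h x)) (k x))" by simp
qed

lemma log_psh_form_fs_psh:
  assumes T: "log_psh_form T"
  shows "fs_psh (form_fun T)"
  unfolding fs_psh_def
proof
  fix c assume c: "c \<in> charts"
  have hom: "hom2 T" and nn: "\<And>X Y \<tau>. 0 \<le> T X Y \<tau>" using T unfolding log_psh_form_def by auto
  obtain m where m: "m > 0" "\<And>X0 Y0 \<tau>0. 0 < T X0 Y0 \<tau>0 \<Longrightarrow>
       (\<exists>G. (\<forall>a a' b b' c c'. (\<lambda>\<zeta>. G (a + \<zeta> * a') (b + \<zeta> * b') (c + \<zeta> * c')) holomorphic_on UNIV) \<and>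
            (\<forall>X Y \<tau>. cmod (G X Y \<tau>) \<le> T X Y \<tau> ^ m) \<and> cmod (G X0 Y0 \<tau>0) = T X0 Y0 \<tau>0 ^ m)"
    using T unfolding log_psh_form_def by blast
  have eq: "(\<lambda>(z, \<tau>). form_fun T (c z, \<tau>) + ereal (fs_potential z)) = (\<lambda>x. eln (T (lX c (fst x)) (lY c (fst x)) (snd x)))"
    by (simp add: case_prod_beta' form_fun_chart[OF c hom])
  show "psh_on (UNIV \<times> ball 0 1) (\<lambda>(z, \<tau>). form_fun T (c z, \<tau>) + ereal (fs_potential z))"
    unfolding eq
  proof (rule psh_onI_sub_at)
    show "usc_on (UNIV \<times> ball 0 1) (\<lambda>x. eln (T (lX c (fst x)) (lY c (fst x)) (snd x)))"
      by (intro log_psh_form_usc[OF T c] continuous_intros)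
    fix a b :: "complex \<times> complex" and \<zeta>0 :: complex
    obtain p q p' q' where lift: "\<And>\<zeta>. lX c (fst a + \<zeta> * fst b) = p + \<zeta> * p'" "\<And>\<zeta>. lY c (fst a + \<zeta> * fst b) = q + \<zeta> * q'"
      using lift_affine[of c "fst a" "fst b"] by blast
    show "sub_at (\<lambda>\<zeta>. eln (T (lX c (fst (fst a + \<zeta> * fst b, snd a + \<zeta> * snd b)))
        (lY c (fst (fst a + \<zeta> * fst b, snd a + \<zeta> * snd b))) (snd (fst a + \<zeta> * fst b, snd a + \<zeta> * snd b)))) \<zeta>0"
      unfolding fst_conv snd_conv lift
    proof (rule sub_at_eln[OF m(1) _ nn])
      assume "0 < T (p + \<zeta>0 * p') (q + \<zeta>0 * q') (snd a + \<zeta>0 * snd b)"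
      from m(2)[OF this] obtain G where G:
        "\<And>a a' b b' c c'. (\<lambda>\<zeta>. G (a + \<zeta> * a') (b + \<zeta> * b') (c + \<zeta> * c')) holomorphic_on UNIV"
        "\<And>X Y \<tau>. cmod (G X Y \<tau>) \<le> T X Y \<tau> ^ m"
        "cmod (G (p + \<zeta>0 * p') (q + \<zeta>0 * q') (snd a + \<zeta>0 * snd b)) = T (p + \<zeta>0 * p') (q + \<zeta>0 * q') (snd a + \<zeta>0 * snd b) ^ m"
        by blast
      show "\<exists>G. G holomorphic_on UNIV \<and> (\<forall>\<zeta>. cmod (G \<zeta>) \<le> T (p + \<zeta> * p') (q + \<zeta> * q') (snd a + \<zeta> * snd b) ^ m)
          \<and> cmod (G \<zeta>0) = T (p + \<zeta>0 * p') (q + \<zeta>0 * q') (snd a + \<zeta>0 * snd b) ^ m"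
        by (rule exI[of _ "\<lambda>\<zeta>. G (p + \<zeta> * p') (q + \<zeta> * q') (snd a + \<zeta> * snd b)"]) (use G in auto)
    qed
  qed
qed

lemma form_fun_competitor:
  assumes T: "log_psh_form T"
    and le: "\<And>p \<tau>. \<tau> \<in> sphere 0 1 \<Longrightarrow> form_fun T (p, \<tau>) \<le> ereal (\<phi> (p, \<tau>))"
  shows "competitor \<phi> (form_fun T)"
  unfolding competitor_def
proof (intro conjI allI ballI le log_psh_form_fs_psh[OF T])
  have hom: "hom2 T" using T unfolding log_psh_form_def by auto
  show "usc_on (UNIV \<times> cball 0 1) (form_fun T)"
  proof (rule usc_on_p1I)
    fix c assume c: "c \<in> charts"
    have "usc_on (UNIV \<times> cball 0 1) (\<lambda>x. eln (T (lX c (fst x)) (lY c (fst x)) (snd x)) + ereal (- fs_potential (fst x)))"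
      by (intro usc_on_add_continuous log_psh_form_usc[OF T c] continuous_intros continuous_on_fs_potential)
    moreover have "eln (T (lX c z) (lY c z) \<tau>) + ereal (- fs_potential z) = form_fun T (c z, \<tau>)" for z \<tau>
      unfolding form_fun_chart[OF c hom, symmetric] by (cases "form_fun T (c z, \<tau>)") auto
    ultimately show "usc_on (UNIV \<times> cball 0 1) (\<lambda>x. form_fun T (c (fst x), snd x))" by simp
  qed
qed auto

section \<open>The boundary data\<close>

text \<open>Y - \<tau> X is the homogeneous form of y = 1 - \<tau> z: with X = z and Y = 1 the two
  forms are E + |y|^2 and 1 + E |y|^2, the factors in u.\<close>

definition S1 :: "real \<Rightarrow> complex \<Rightarrow> complex \<Rightarrow> complex \<Rightarrow> real" where
  "S1 E X Y \<tau> = E * (cmod Y)\<^sup>2 + (cmod (Y - \<tau> * X))\<^sup>2"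
definition S2 :: "real \<Rightarrow> complex \<Rightarrow> complex \<Rightarrow> complex \<Rightarrow> real" where
  "S2 E X Y \<tau> = (cmod Y)\<^sup>2 + E * (cmod (Y - \<tau> * X))\<^sup>2"
definition Th :: "real \<Rightarrow> complex \<Rightarrow> complex \<Rightarrow> complex \<Rightarrow> real" where
  "Th E X Y \<tau> = sqrt (S1 E X Y \<tau> * S2 E X Y \<tau>)"

definition data :: "real \<Rightarrow> p1 \<times> complex \<Rightarrow> real" where
  "data E x = ln (Th E (hX (fst x)) (hY (fst x)) (snd x) / hN (fst x))"

text \<open>The function e^u in the coordinate y.\<close>

definition Tq :: "real \<Rightarrow> complex \<Rightarrow> real" where
  "Tq E y = sqrt ((E + (cmod y)\<^sup>2) * (1 + E * (cmod y)\<^sup>2))"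

lemma S_hom: "S1 E (k * X) (k * Y) \<tau> = (cmod k)\<^sup>2 * S1 E X Y \<tau>" "S2 E (k * X) (k * Y) \<tau> = (cmod k)\<^sup>2 * S2 E X Y \<tau>"
proof -
  have "k * Y - \<tau> * (k * X) = k * (Y - \<tau> * X)" by (simp add: algebra_simps)
  then have n: "(cmod (k * Y - \<tau> * (k * X)))\<^sup>2 = (cmod k)\<^sup>2 * (cmod (Y - \<tau> * X))\<^sup>2"
    by (simp only: norm_mult power_mult_distrib)
  show "S1 E (k * X) (k * Y) \<tau> = (cmod k)\<^sup>2 * S1 E X Y \<tau>" "S2 E (k * X) (k * Y) \<tau> = (cmod k)\<^sup>2 * S2 E X Y \<tau>"
    unfolding S1_def S2_def n norm_mult power_mult_distrib by (simp_all add: distrib_left)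
qed

lemma hom2_Th: "hom2 (Th E)"
  unfolding hom2_def Th_def S_hom by (auto simp: real_sqrt_mult power2_eq_square)

lemma cauchy_schwarz_form:
  assumes "0 \<le> a" "0 \<le> b"
  shows "(cmod (of_real a * x * cnj x0 + of_real b * y * cnj y0))\<^sup>2
    \<le> (a * (cmod x)\<^sup>2 + b * (cmod y)\<^sup>2) * (a * (cmod x0)\<^sup>2 + b * (cmod y0)\<^sup>2)"
proof -
  have "cmod (of_real a * x * cnj x0 + of_real b * y * cnj y0) \<le> a * (cmod x * cmod x0) + b * (cmod y * cmod y0)"
    using norm_triangle_ineq[of "of_real a * x * cnj x0" "of_real b * y * cnj y0"] assms by (simp add: norm_mult mult.assoc)
  then have "(cmod (of_real a * x * cnj x0 + of_real b * y * cnj y0))\<^sup>2 \<le> (a * (cmod x * cmod x0) + b * (cmod y * cmod y0))\<^sup>2"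
    by (rule power_mono) simp
  also have "\<dots> = (a * (cmod x)\<^sup>2 + b * (cmod y)\<^sup>2) * (a * (cmod x0)\<^sup>2 + b * (cmod y0)\<^sup>2) - a * b * (cmod x * cmod y0 - cmod y * cmod x0)\<^sup>2"
    by algebra
  also have "\<dots> \<le> (a * (cmod x)\<^sup>2 + b * (cmod y)\<^sup>2) * (a * (cmod x0)\<^sup>2 + b * (cmod y0)\<^sup>2)"
    using assms by simp
  finally show ?thesis .
qed

text \<open>Polarisations of \<open>S1\<close> and \<open>S2\<close>: holomorphic in (X, Y, \<tau>),
  antiholomorphic in the base point. By Cauchy-Schwarz they supply the supporting functions that
  \<open>log_psh_form\<close> demands.\<close>

definition B1 :: "real \<Rightarrow> complex \<Rightarrow> complex \<Rightarrow> complex \<Rightarrow> complex \<Rightarrow> complex \<Rightarrow> complex \<Rightarrow> complex" where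
  "B1 E X0 Y0 \<tau>0 X Y \<tau> = of_real E * Y * cnj Y0 + of_real 1 * (Y - \<tau> * X) * cnj (Y0 - \<tau>0 * X0)"
definition B2 :: "real \<Rightarrow> complex \<Rightarrow> complex \<Rightarrow> complex \<Rightarrow> complex \<Rightarrow> complex \<Rightarrow> complex \<Rightarrow> complex" where
  "B2 E X0 Y0 \<tau>0 X Y \<tau> = of_real 1 * Y * cnj Y0 + of_real E * (Y - \<tau> * X) * cnj (Y0 - \<tau>0 * X0)"

lemma B_le:
  assumes "0 \<le> E"
  shows "(cmod (B1 E X0 Y0 \<tau>0 X Y \<tau>))\<^sup>2 \<le> S1 E X Y \<tau> * S1 E X0 Y0 \<tau>0"
    "(cmod (B2 E X0 Y0 \<tau>0 X Y \<tau>))\<^sup>2 \<le> S2 E X Y \<tau> * S2 E X0 Y0 \<tau>0"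
  using cauchy_schwarz_form[of E 1 Y Y0 "Y - \<tau> * X" "Y0 - \<tau>0 * X0"]
    cauchy_schwarz_form[of 1 E Y Y0 "Y - \<tau> * X" "Y0 - \<tau>0 * X0"] assms
  unfolding B1_def B2_def S1_def S2_def by simp_all

lemma B_eq:
  "B1 E X0 Y0 \<tau>0 X0 Y0 \<tau>0 = of_real (S1 E X0 Y0 \<tau>0)"
  "B2 E X0 Y0 \<tau>0 X0 Y0 \<tau>0 = of_real (S2 E X0 Y0 \<tau>0)"
  unfolding B1_def B2_def S1_def S2_def of_real_add of_real_mult complex_norm_square by (simp_all only: mult.assoc of_real_1 mult_1)

lemma B_hol:
  "(\<lambda>\<zeta>. B1 E X0 Y0 \<tau>0 (a + \<zeta> * a') (b + \<zeta> * b') (c + \<zeta> * c')) holomorphic_on UNIV"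
  "(\<lambda>\<zeta>. B2 E X0 Y0 \<tau>0 (a + \<zeta> * a') (b + \<zeta> * b') (c + \<zeta> * c')) holomorphic_on UNIV"
  unfolding B1_def B2_def by (intro holomorphic_intros)+

lemma S_nonneg: "0 \<le> E \<Longrightarrow> 0 \<le> S1 E X Y \<tau>" "0 \<le> E \<Longrightarrow> 0 \<le> S2 E X Y \<tau>"
  by (simp_all add: S1_def S2_def)

lemma log_psh_form_Th:
  assumes E: "0 < E" shows "log_psh_form (Th E)"
  unfolding log_psh_form_def
proof (intro conjI hom2_Th allI)
  show "continuous_on UNIV (\<lambda>x. Th E (fst x) (fst (snd x)) (snd (snd x)))"
    unfolding Th_def S1_def S2_def by (intro continuous_intros)
  show "0 \<le> Th E X Y \<tau>" for X Y \<tau> using E by (simp add: Th_def S_nonneg)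
  show "\<exists>m>0. \<forall>X0 Y0 \<tau>0. 0 < Th E X0 Y0 \<tau>0 \<longrightarrow>
       (\<exists>G. (\<forall>a a' b b' c c'. (\<lambda>\<zeta>. G (a + \<zeta> * a') (b + \<zeta> * b') (c + \<zeta> * c')) holomorphic_on UNIV) \<and>
            (\<forall>X Y \<tau>. cmod (G X Y \<tau>) \<le> Th E X Y \<tau> ^ m) \<and> cmod (G X0 Y0 \<tau>0) = Th E X0 Y0 \<tau>0 ^ m)"
  proof (intro exI[of _ "2::nat"] conjI allI impI)
    fix X0 Y0 \<tau>0 assume pos: "0 < Th E X0 Y0 \<tau>0"
    define s1 where "s1 = S1 E X0 Y0 \<tau>0"
    define s2 where "s2 = S2 E X0 Y0 \<tau>0"
    have s: "0 < s1" "0 < s2"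
      using pos S_nonneg[of E X0 Y0 \<tau>0] E unfolding Th_def s1_def s2_def by (auto simp: zero_less_mult_iff)
    have sq: "Th E X Y \<tau> ^ 2 = S1 E X Y \<tau> * S2 E X Y \<tau>" for X Y \<tau>
      unfolding Th_def using E by (simp add: S_nonneg)
    \<comment> \<open>By \<open>B_le\<close> its modulus is at most S1 S2 = Th^2, and by
      \<open>B_eq\<close> equality holds at the base point.\<close>
    let ?G = "\<lambda>X Y \<tau>. (B1 E X0 Y0 \<tau>0 X Y \<tau>)^2 * (B2 E X0 Y0 \<tau>0 X Y \<tau>)^2 / of_real (s1 * s2)"
    show "\<exists>G. (\<forall>a a' b b' c c'. (\<lambda>\<zeta>. G (a + \<zeta> * a') (b + \<zeta> * b') (c + \<zeta> * c')) holomorphic_on UNIV) \<and>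
            (\<forall>X Y \<tau>. cmod (G X Y \<tau>) \<le> Th E X Y \<tau> ^ 2) \<and> cmod (G X0 Y0 \<tau>0) = Th E X0 Y0 \<tau>0 ^ 2"
    proof (intro exI[of _ ?G] conjI allI)
      show "(\<lambda>\<zeta>. ?G (a + \<zeta> * a') (b + \<zeta> * b') (c + \<zeta> * c')) holomorphic_on UNIV" for a a' b b' c c'
        using s by (intro holomorphic_intros B_hol) auto
      fix X Y \<tau>
      have "cmod (?G X Y \<tau>) = (cmod (B1 E X0 Y0 \<tau>0 X Y \<tau>))\<^sup>2 * (cmod (B2 E X0 Y0 \<tau>0 X Y \<tau>))\<^sup>2 / (s1 * s2)"
        using s by (simp add: norm_divide norm_mult norm_power)
      also have "\<dots> \<le> (S1 E X Y \<tau> * s1) * (S2 E X Y \<tau> * s2) / (s1 * s2)"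
        using s B_le[of E X0 Y0 \<tau>0 X Y \<tau>] E unfolding s1_def[symmetric] s2_def[symmetric]
        by (intro divide_right_mono mult_mono) (auto intro!: mult_nonneg_nonneg S_nonneg)
      also have "\<dots> = Th E X Y \<tau> ^ 2" unfolding sq using s by (simp add: field_simps)
      finally show "cmod (?G X Y \<tau>) \<le> Th E X Y \<tau> ^ 2" .
    next
      show "cmod (?G X0 Y0 \<tau>0) = Th E X0 Y0 \<tau>0 ^ 2"
        unfolding B_eq sq s1_def[symmetric] s2_def[symmetric] using s
        by (simp add: norm_divide norm_mult norm_power power2_eq_square)
    qed
  qed auto
qed

lemma log_psh_form_cX:
  assumes "0 < k" shows "log_psh_form (\<lambda>X Y \<tau>. k * (cmod X)\<^sup>2)"
  unfolding log_psh_form_def hom2_def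
proof (intro conjI allI)
  show "continuous_on UNIV (\<lambda>x::complex\<times>complex\<times>complex. k * (cmod (fst x))\<^sup>2)" by (intro continuous_intros)
  show "\<exists>m>0. \<forall>X0 Y0 \<tau>0. 0 < k * (cmod X0)\<^sup>2 \<longrightarrow>
       (\<exists>G. (\<forall>a a' b b' c c'. (\<lambda>\<zeta>. G (a + \<zeta> * a') (b + \<zeta> * b') (c + \<zeta> * c')) holomorphic_on UNIV) \<and>
            (\<forall>X Y \<tau>. cmod (G X Y \<tau>) \<le> (k * (cmod X)\<^sup>2) ^ m) \<and> cmod (G X0 Y0 \<tau>0) = (k * (cmod X0)\<^sup>2) ^ m)"
    using assms
    by (intro exI[of _ "1::nat"] conjI allI impI exI[of _ "\<lambda>X Y \<tau>. of_real k * X\<^sup>2"])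
       (auto simp: norm_mult norm_power intro!: holomorphic_intros)
qed (use assms in \<open>auto simp: norm_mult power_mult_distrib\<close>)

text \<open>By Buzano's inequality $|X \ell|$, for two linear forms, is dominated by a multiple of
  \<^term>\<open>S1 E\<close>, with equality at a point that is half way between the two zeros.\<close>

definition ell :: "real \<Rightarrow> complex \<Rightarrow> complex \<Rightarrow> complex \<Rightarrow> complex \<Rightarrow> complex" where
  "ell E y0 X Y \<tau> = ((1 - y0) * (of_real E * Y + (Y - \<tau> * X) * cnj y0) + (cnj y0 + of_real E) * ((Y - \<tau> * X) - y0 * Y))
     / of_real (E + (cmod y0)\<^sup>2)"

text \<open>\<open>Th\<close> with its factor \<open>S1\<close> replaced by the Buzano minorant on
  |\<tau>| = 1. The factor |X| = |1 - y| / |\<tau>| of the latter is what makes this form grow as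
  \<tau> tends to 0 with y fixed.\<close>

definition Tb :: "real \<Rightarrow> complex \<Rightarrow> complex \<Rightarrow> complex \<Rightarrow> complex \<Rightarrow> real" where
  "Tb E y0 X Y \<tau> = sqrt ((E + (cmod y0)\<^sup>2) / (cmod (1 - y0))\<^sup>2 * cmod (X * ell E y0 X Y \<tau>) * S2 E X Y \<tau>)"

lemma ell_hom: "ell E y0 (k * X) (k * Y) \<tau> = k * ell E y0 X Y \<tau>"
  unfolding ell_def by (simp add: algebra_simps)

lemma buzano:
  assumes E: "0 < E" and y0: "cmod (y0 + of_real E) \<le> sqrt E * cmod (1 - y0)"
  shows "(E + (cmod y0)\<^sup>2) * cmod ((\<tau> * X) * ell E y0 X Y \<tau>) \<le> (cmod (1 - y0))\<^sup>2 * S1 E X Y \<tau>"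
proof -
  define n where "n = E + (cmod y0)\<^sup>2"
  have n: "0 < n" using E by (simp add: n_def add_pos_nonneg)
  define D where "D = Y - \<tau> * X"
  \<comment> \<open>n \<tau> X and n \<open>ell\<close> are p - q and p + q, so their product is p^2
    - q^2. Here p and q come from splitting the vector (Y, D) along (1, y0) and orthogonally to it,
    in the inner product with weights E and 1; P is Pythagoras.\<close>
  define p where "p = (1 - y0) * (of_real E * Y + D * cnj y0)"
  define q where "q = (cnj y0 + of_real E) * (D - y0 * Y)"
  have cn: "of_real n = of_real E + y0 * cnj y0" unfolding n_def of_real_add complex_norm_square ..
  have e1: "of_real n * (\<tau> * X) = p - q"
    unfolding cn p_def q_def D_def by (simp add: algebra_simps)
  have e2: "of_real n * ell E y0 X Y \<tau> = p + q"
    using n unfolding ell_def p_def q_def D_def n_def[symmetric] by simp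
  have P: "(cmod (of_real E * Y + D * cnj y0))\<^sup>2 + E * (cmod (D - y0 * Y))\<^sup>2 = n * S1 E X Y \<tau>"
  proof -
    have "of_real ((cmod (of_real E * Y + D * cnj y0))\<^sup>2 + E * (cmod (D - y0 * Y))\<^sup>2)
       = (of_real E + y0 * cnj y0) * (of_real E * (Y * cnj Y) + D * cnj D)"
      unfolding of_real_add of_real_mult complex_norm_square by (simp add: algebra_simps)
    also have "\<dots> = of_real (n * S1 E X Y \<tau>)"
      unfolding cn[symmetric] S1_def D_def[symmetric] of_real_add of_real_mult complex_norm_square ..
    finally show ?thesis unfolding of_real_eq_iff .
  qed
  have cc: "cmod (cnj y0 + of_real E) = cmod (y0 + of_real E)"
    by (metis complex_cnj_add complex_cnj_complex_of_real complex_mod_cnj)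
  \<comment> \<open>The hypothesis on y0 makes the weight of the orthogonal part in |q|^2 at most
    the one that Pythagoras allows, E |1 - y0|^2.\<close>
  have "(cmod q)\<^sup>2 = (cmod (y0 + of_real E))\<^sup>2 * (cmod (D - y0 * Y))\<^sup>2"
    unfolding q_def by (simp add: norm_mult power_mult_distrib cc)
  also have "\<dots> \<le> (sqrt E * cmod (1 - y0))\<^sup>2 * (cmod (D - y0 * Y))\<^sup>2"
    by (intro mult_right_mono power_mono y0) auto
  finally have q: "(cmod q)\<^sup>2 \<le> (cmod (1 - y0))\<^sup>2 * (E * (cmod (D - y0 * Y))\<^sup>2)"
    using E by (simp add: power_mult_distrib algebra_simps)
  have p: "(cmod p)\<^sup>2 = (cmod (1 - y0))\<^sup>2 * (cmod (of_real E * Y + D * cnj y0))\<^sup>2"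
    unfolding p_def by (simp add: norm_mult power_mult_distrib)
  have "cmod ((p - q) * (p + q)) \<le> (cmod p)\<^sup>2 + (cmod q)\<^sup>2"
  proof -
    have "(p - q) * (p + q) = p^2 - q^2" by (simp add: power2_eq_square algebra_simps)
    then show ?thesis using norm_triangle_ineq4[of "p^2" "q^2"] by (simp add: norm_power)
  qed
  also have "\<dots> \<le> (cmod (1 - y0))\<^sup>2 * (n * S1 E X Y \<tau>)"
    unfolding P[symmetric] p distrib_left using q by simp
  finally have "cmod ((of_real n * (\<tau> * X)) * (of_real n * ell E y0 X Y \<tau>)) \<le> (cmod (1 - y0))\<^sup>2 * (n * S1 E X Y \<tau>)"
    unfolding e1 e2 .
  then have "n * (n * cmod ((\<tau> * X) * ell E y0 X Y \<tau>)) \<le> n * ((cmod (1 - y0))\<^sup>2 * S1 E X Y \<tau>)"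
    using n by (simp add: norm_mult algebra_simps)
  then show ?thesis using n unfolding n_def[symmetric] by simp
qed

lemma log_psh_form_Tb:
  assumes E: "0 < E" and y0: "y0 \<noteq> 1"
  shows "log_psh_form (Tb E y0)"
  unfolding log_psh_form_def
proof (intro conjI allI)
  define k where "k = (E + (cmod y0)\<^sup>2) / (cmod (1 - y0))\<^sup>2"
  have k: "0 < k" using E y0 by (simp add: k_def add_pos_nonneg)
  show "hom2 (Tb E y0)"
    unfolding hom2_def Tb_def ell_hom S_hom
  proof (intro allI)
    fix c X Y \<tau>
    have "a * cmod (c * X * (c * l)) * ((cmod c)\<^sup>2 * s) = ((cmod c)\<^sup>2)\<^sup>2 * (a * cmod (X * l) * s)" for a s :: real and l
      by (simp add: norm_mult power2_eq_square)
    then show "sqrt ((E + (cmod y0)\<^sup>2) / (cmod (1 - y0))\<^sup>2 * cmod (c * X * (c * ell E y0 X Y \<tau>)) * ((cmod c)\<^sup>2 * S2 E X Y \<tau>)) =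
       (cmod c)\<^sup>2 * sqrt ((E + (cmod y0)\<^sup>2) / (cmod (1 - y0))\<^sup>2 * cmod (X * ell E y0 X Y \<tau>) * S2 E X Y \<tau>)"
      by (simp only: real_sqrt_mult real_sqrt_abs abs_of_nonneg zero_le_power2)
  qed
  show "continuous_on UNIV (\<lambda>x. Tb E y0 (fst x) (fst (snd x)) (snd (snd x)))"
    unfolding Tb_def S2_def ell_def divide_inverse by (intro continuous_intros)
  show "0 \<le> Tb E y0 X Y \<tau>" for X Y \<tau> using E by (auto simp: Tb_def S_nonneg)
  show "\<exists>m>0. \<forall>X0 Y0 \<tau>0. 0 < Tb E y0 X0 Y0 \<tau>0 \<longrightarrow>
       (\<exists>G. (\<forall>a a' b b' c c'. (\<lambda>\<zeta>. G (a + \<zeta> * a') (b + \<zeta> * b') (c + \<zeta> * c')) holomorphic_on UNIV) \<and>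
            (\<forall>X Y \<tau>. cmod (G X Y \<tau>) \<le> Tb E y0 X Y \<tau> ^ m) \<and> cmod (G X0 Y0 \<tau>0) = Tb E y0 X0 Y0 \<tau>0 ^ m)"
  proof (intro exI[of _ "2::nat"] conjI allI impI)
    fix X0 Y0 \<tau>0 assume pos: "0 < Tb E y0 X0 Y0 \<tau>0"
    define s2 where "s2 = S2 E X0 Y0 \<tau>0"
    have s: "0 < s2"
      using pos S_nonneg(2)[of E X0 Y0 \<tau>0] E unfolding Tb_def s2_def by (cases "S2 E X0 Y0 \<tau>0 = 0") auto
    have sq: "Tb E y0 X Y \<tau> ^ 2 = k * cmod (X * ell E y0 X Y \<tau>) * S2 E X Y \<tau>" for X Y \<tau>
      unfolding Tb_def k_def using E by (simp add: S_nonneg)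
    let ?G = "\<lambda>X Y \<tau>. of_real k * (X * ell E y0 X Y \<tau>) * (B2 E X0 Y0 \<tau>0 X Y \<tau>)^2 / of_real s2"
    show "\<exists>G. (\<forall>a a' b b' c c'. (\<lambda>\<zeta>. G (a + \<zeta> * a') (b + \<zeta> * b') (c + \<zeta> * c')) holomorphic_on UNIV) \<and>
            (\<forall>X Y \<tau>. cmod (G X Y \<tau>) \<le> Tb E y0 X Y \<tau> ^ 2) \<and> cmod (G X0 Y0 \<tau>0) = Tb E y0 X0 Y0 \<tau>0 ^ 2"
    proof (intro exI[of _ ?G] conjI allI)
      show "(\<lambda>\<zeta>. ?G (a + \<zeta> * a') (b + \<zeta> * b') (c + \<zeta> * c')) holomorphic_on UNIV" for a a' b b' c c'
        unfolding ell_def divide_inverse by (intro holomorphic_intros B_hol)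
      fix X Y \<tau>
      have "cmod (?G X Y \<tau>) = k * cmod (X * ell E y0 X Y \<tau>) * (cmod (B2 E X0 Y0 \<tau>0 X Y \<tau>))\<^sup>2 / s2"
        using s k by (simp add: norm_divide norm_mult norm_power)
      also have "\<dots> \<le> k * cmod (X * ell E y0 X Y \<tau>) * (S2 E X Y \<tau> * s2) / s2"
        using s k B_le(2)[of E X0 Y0 \<tau>0 X Y \<tau>] E unfolding s2_def[symmetric]
        by (intro divide_right_mono mult_left_mono) auto
      also have "\<dots> = Tb E y0 X Y \<tau> ^ 2" unfolding sq using s by simp
      finally show "cmod (?G X Y \<tau>) \<le> Tb E y0 X Y \<tau> ^ 2" .
    next
      show "cmod (?G X0 Y0 \<tau>0) = Tb E y0 X0 Y0 \<tau>0 ^ 2"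
        unfolding B_eq sq s2_def[symmetric] using s k
        by (simp add: norm_divide norm_mult norm_power power2_eq_square)
    qed
  qed auto
qed

lemma Tb_le_Th:
  assumes E: "0 < E" and y0: "y0 \<noteq> 1" "cmod (y0 + of_real E) \<le> sqrt E * cmod (1 - y0)" and t: "cmod \<tau> = 1"
  shows "Tb E y0 X Y \<tau> \<le> Th E X Y \<tau>"
proof -
  have "(E + (cmod y0)\<^sup>2) / (cmod (1 - y0))\<^sup>2 * cmod (X * ell E y0 X Y \<tau>) \<le> S1 E X Y \<tau>"
    using buzano[OF E y0(2), of \<tau> X Y] t y0(1) by (simp add: norm_mult field_simps)
  then show ?thesis unfolding Tb_def Th_def
    by (intro real_sqrt_le_mono mult_right_mono) (use E in \<open>auto simp: S_nonneg\<close>)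
qed

lemma super_mean_at_cong:
  assumes f: "super_mean_at f a" and R: "0 < R" "\<And>z. z \<in> ball a R \<Longrightarrow> g z = f z"
  shows "super_mean_at g a"
proof -
  obtain R' where R': "R' > 0"
    and F: "\<And>r. 0 < r \<Longrightarrow> r < R' \<Longrightarrow> continuous_on (sphere a r) f \<and> amean (\<lambda>t. f (a + of_real r * cis t)) \<le> f a"
    using f unfolding super_mean_at_def by metis
  show ?thesis unfolding super_mean_at_def
  proof (intro exI[of _ "min R R'"] conjI allI impI)
    fix r assume r: "0 < r \<and> r < min R R'"
    have eq: "g z = f z" if "z \<in> sphere a r" for z using R(2)[of z] that r by auto
    have "amean (\<lambda>t. g (a + of_real r * cis t)) = amean (\<lambda>t. f (a + of_real r * cis t))"
      by (rule amean_cong, rule eq) (use r in \<open>auto simp: dist_norm norm_mult\<close>)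
    moreover have "g a = f a" using R by auto
    ultimately show "amean (\<lambda>t. g (a + of_real r * cis t)) \<le> g a" using F[of r] r by auto
    show "continuous_on (sphere a r) g" using F[of r] r eq by (subst continuous_on_cong[OF refl eq]) auto
  qed (use R R' in auto)
qed

lemma super_mean_at_ln_norm:
  assumes a: "a \<noteq> 0" shows "super_mean_at (\<lambda>z. A + B * ln (cmod z)) a"
proof (rule super_mean_at_cong)
  let ?f = "\<lambda>z. of_real (A + B * ln (cmod a)) + of_real B * Ln (z / a)"
  have nr: "z / a \<notin> \<real>\<^sub>\<le>\<^sub>0" if "z \<in> ball a (cmod a)" for z
  proof
    assume "z / a \<in> \<real>\<^sub>\<le>\<^sub>0"
    then have "Re (z / a) \<le> 0" by (auto simp: complex_nonpos_Reals_iff)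
    have "cmod (z / a - 1) = cmod (z - a) / cmod a" using a by (simp add: diff_divide_distrib flip: norm_divide)
    also have "\<dots> < 1" using that a by (simp add: dist_norm norm_minus_commute)
    finally have "\<bar>Re (z / a - 1)\<bar> < 1" using abs_Re_le_cmod[of "z / a - 1"] by linarith
    with \<open>Re (z / a) \<le> 0\<close> show False by simp
  qed
  show "super_mean_at (\<lambda>z. Re (?f z)) a"
    by (rule super_mean_at_holomorphic[where S="ball a (cmod a)"])
       (use a nr in \<open>auto intro!: holomorphic_intros\<close>)
  show "0 < cmod a" using a by simp
  fix z assume z: "z \<in> ball a (cmod a)"
  then have "z \<noteq> 0" by (auto simp: dist_norm)
  then have e: "ln (cmod z) = ln (cmod a) + Re (Ln (z / a))" using a by (simp add: norm_divide ln_div)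
  show "A + B * ln (cmod z) = Re (?f z)" unfolding e by (simp add: algebra_simps)
qed

text \<open>\<open>E1\<close> provides the contact points (\<open>contact_radius\<close>).
  \<open>E2\<close> separates slopes from the ring bound: a slope of at least 1/4 would make Q on
  |y| = 1 rise by at least ln 2 / 2 between |\<zeta>| = 1/2 and |\<zeta>| = 1/4, while
  \<open>Q_ring\<close> allows only E exp (8 \<pi>).\<close>

locale hele_shaw =
  fixes E :: real
  assumes E0: "0 < E" and E1: "E < 1 / 10" and E2: "E * exp (8 * pi) < ln 2 / 2"
begin

abbreviation \<Phi> :: "p1 \<times> complex \<Rightarrow> ereal" where "\<Phi> \<equiv> hmae_solution (data E)"

section \<open>Upper bounds for the solution from explicit discs\<close>

lemma Tq_pos: "0 < Tq E y"
  unfolding Tq_def using E0 by (auto intro!: mult_pos_pos add_pos_nonneg)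

lemma Th_Fin: "Th E z 1 \<tau> = Tq E (1 - \<tau> * z)"
  unfolding Th_def Tq_def S1_def S2_def by simp

lemma Th_Inf0: "Th E 1 0 \<tau> = (cmod \<tau>)\<^sup>2 * sqrt E"
  unfolding Th_def S1_def S2_def by (simp add: real_sqrt_mult norm_minus_commute power2_eq_square)

lemma Th_pos:
  assumes "\<tau> \<noteq> 0" "X \<noteq> 0 \<or> Y \<noteq> 0" shows "0 < Th E X Y \<tau>"
proof (cases "Y = 0")
  case True
  then show ?thesis using assms E0 by (simp add: Th_def S1_def S2_def)
next
  case False
  then show ?thesis using E0 by (auto simp: Th_def S1_def S2_def intro!: mult_pos_pos add_pos_nonneg)
qed

lemma lift_nz: "c \<in> charts \<Longrightarrow> lX c z \<noteq> 0 \<or> lY c z \<noteq> 0"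
  by (erule charts_cases) auto

lemma data_chart0: "c \<in> charts \<Longrightarrow> data E (c z, \<tau>) = ln (Th E (lX c z) (lY c z) \<tau> / (1 + (cmod z)\<^sup>2))"
  unfolding data_def by (simp add: chart_hom2 hom2_Th)

lemma data_chart:
  assumes "c \<in> charts" "\<tau> \<noteq> 0"
  shows "data E (c z, \<tau>) = ln (Th E (lX c z) (lY c z) \<tau>) - fs_potential z"
  unfolding data_chart0[OF assms(1)] fs_potential_def using Th_pos[OF assms(2) lift_nz[OF assms(1), of z]] one_plus_sq_pos[of z]
  by (simp add: ln_div)

text \<open>Along the disc z = w / \<tau> the coordinate y = 1 - w is constant, and so are the
  boundary values. This is the origin of Q \<le> u + s.\<close>

lemma upper_Infty_disc:
  assumes w: "w \<noteq> 0" and t: "\<tau> \<in> cball 0 1"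
  shows "\<Phi> (chart_Infty (\<tau> / w), \<tau>) + ereal (fs_potential (\<tau> / w)) \<le> ereal (ln (Tq E (1 - w)) - 2 * ln (cmod w))"
proof (rule hmae_solution_disc[where h="\<lambda>\<tau>. \<tau> / w" and w="\<lambda>_. ln (Tq E (1 - w)) - 2 * ln (cmod w)" and c=chart_Infty])
  fix \<tau> :: complex assume t: "\<tau> \<in> sphere 0 1"
  then have t0: "\<tau> \<noteq> 0" by auto
  have "Th E ((\<tau>/w) * (w/\<tau>)) ((\<tau>/w) * 1) \<tau> = (cmod (\<tau>/w))\<^sup>2 * Th E (w/\<tau>) 1 \<tau>"
    using hom2_Th[of E] unfolding hom2_def by blast
  then have "Th E 1 (\<tau>/w) \<tau> = Tq E (1 - w) / (cmod w)\<^sup>2" using t t0 w by (simp add: Th_Fin norm_divide power_divide)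
  then have "ln (Th E 1 (\<tau>/w) \<tau>) = ln (Tq E (1 - w)) - 2 * ln (cmod w)"
    using w Tq_pos[of "1 - w"] by (simp add: ln_div ln_realpow)
  then show "data E (chart_Infty (\<tau>/w), \<tau>) + fs_potential (\<tau>/w) \<le> ln (Tq E (1 - w)) - 2 * ln (cmod w)"
    using t0 by (simp add: data_chart)
qed (use w t in \<open>auto intro!: holomorphic_intros continuous_intros super_mean_at_const\<close>)

lemma upper_Infty:
  assumes t: "\<tau> \<in> cball 0 1"
  shows "\<Phi> (Infty, \<tau>) \<le> ereal (ln E / 2)"
proof -
  have "\<Phi> (chart_Infty 0, \<tau>) + ereal (fs_potential 0) \<le> ereal (ln E / 2)"
  proof (rule hmae_solution_disc[where h="\<lambda>_. 0" and w="\<lambda>_. ln E / 2" and c=chart_Infty])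
    fix \<tau> :: complex assume t: "\<tau> \<in> sphere 0 1"
    then have t0: "\<tau> \<noteq> 0" by auto
    show "data E (chart_Infty 0, \<tau>) + fs_potential 0 \<le> ln E / 2"
      unfolding data_chart[OF chart_Infty_in_charts t0] using t E0 by (simp add: Th_Inf0 ln_sqrt)
  qed (use t in \<open>auto intro!: super_mean_at_const\<close>)
  then show ?thesis by (simp add: fs_potential_def)
qed

lemma upper_zero:
  assumes t: "\<tau> \<in> cball 0 1"
  shows "\<Phi> (Fin 0, \<tau>) \<le> ereal (ln (1 + E))"
proof -
  have T: "Th E 0 1 \<tau> = 1 + E" for \<tau> using E0 by (simp add: Th_def S1_def S2_def add.commute)
  have "\<Phi> (Fin 0, \<tau>) + ereal (fs_potential 0) \<le> ereal (ln (1 + E))"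
  proof (rule hmae_solution_disc[where h="\<lambda>_. 0" and w="\<lambda>_. ln (1 + E)" and c=Fin])
    fix \<tau> :: complex assume t: "\<tau> \<in> sphere 0 1"
    then have t0: "\<tau> \<noteq> 0" by auto
    show "data E (Fin 0, \<tau>) + fs_potential 0 \<le> ln (1 + E)"
      unfolding data_chart[OF Fin_in_charts t0] by (simp add: T)
  qed (use t in \<open>auto intro!: super_mean_at_const\<close>)
  then show ?thesis by (simp add: fs_potential_def)
qed

lemma Th_le:
  assumes "cmod \<tau> = 1"
  shows "Th E X Y \<tau> \<le> 3 * ((cmod X)\<^sup>2 + (cmod Y)\<^sup>2)"
proof -
  let ?n = "(cmod X)\<^sup>2 + (cmod Y)\<^sup>2"
  have "(cmod (Y - \<tau> * X))\<^sup>2 \<le> (cmod Y + cmod X)\<^sup>2"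
    using norm_triangle_ineq4[of Y "\<tau> * X"] assms by (intro power_mono) (auto simp: norm_mult)
  also have "\<dots> \<le> 2 * ?n" using sum_squares_bound[of "cmod Y" "cmod X"] by (simp add: power2_sum)
  finally have D: "(cmod (Y - \<tau> * X))\<^sup>2 \<le> 2 * ?n" .
  have le1: "E * x \<le> x" if "0 \<le> x" for x using mult_right_mono[of E 1 x] E1 that by simp
  have "E * (cmod Y)\<^sup>2 \<le> (cmod Y)\<^sup>2" "E * (cmod (Y - \<tau> * X))\<^sup>2 \<le> (cmod (Y - \<tau> * X))\<^sup>2"
    by (rule le1, simp)+
  moreover have "0 \<le> (cmod X)\<^sup>2" "0 \<le> (cmod Y)\<^sup>2" by simp_all
  ultimately have "S1 E X Y \<tau> \<le> 3 * ?n" "S2 E X Y \<tau> \<le> 3 * ?n"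
    using D unfolding S1_def S2_def distrib_left by linarith+
  then have "S1 E X Y \<tau> * S2 E X Y \<tau> \<le> (3 * ?n) * (3 * ?n)"
    using E0 by (intro mult_mono S_nonneg) auto
  then have "Th E X Y \<tau> \<le> sqrt ((3 * ?n)\<^sup>2)" unfolding Th_def power2_eq_square by (rule real_sqrt_le_mono)
  then show ?thesis by (simp add: abs_of_nonneg)
qed

lemma upper_bound:
  assumes "x \<in> UNIV \<times> cball 0 1"
  shows "\<Phi> x \<le> ereal (ln 3)"
proof -
  obtain p \<tau> where x: "x = (p, \<tau>)" by (cases x)
  obtain c z where c: "c \<in> charts" "p = c z" using p1_chart_surj by blast
  have "\<Phi> (c z, \<tau>) + ereal (fs_potential z) \<le> ereal (ln 3 + fs_potential z)"
  proof (rule hmae_solution_disc[where h="\<lambda>_. z" and w="\<lambda>_. ln 3 + fs_potential z", OF c(1)])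
    fix \<tau> :: complex assume t: "\<tau> \<in> sphere 0 1"
    then have t0: "\<tau> \<noteq> 0" by auto
    have "Th E (lX c z) (lY c z) \<tau> \<le> 3 * (1 + (cmod z)\<^sup>2)"
      using Th_le[of \<tau> "lX c z" "lY c z"] t by (auto simp: lX_def lY_def add.commute split: if_splits)
    then have "ln (Th E (lX c z) (lY c z) \<tau>) \<le> ln (3 * (1 + (cmod z)\<^sup>2))"
      using Th_pos[OF t0 lift_nz[OF c(1)], of z] by simp
    also have "\<dots> = ln 3 + fs_potential z" unfolding fs_potential_def using one_plus_sq_pos[of z] by (subst ln_mult) auto
    finally show "data E (c z, \<tau>) + fs_potential z \<le> ln 3 + fs_potential z"
      unfolding data_chart[OF c(1) t0] by simp
  qed (use assms x in \<open>auto intro!: super_mean_at_const\<close>)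
  then show ?thesis unfolding x c(2) by (cases "\<Phi> (c z, \<tau>)") auto
qed

text \<open>Collects the disc bounds over the whole projective line. On |\<tau>| = 1 the right-hand
  side equals the data, so it is the continuous barrier needed for the boundary values of
  \<Phi>.\<close>

lemma upper_data:
  assumes t: "\<tau> \<in> cball 0 1" "\<tau> \<noteq> 0"
  shows "\<Phi> (p, \<tau>) \<le> ereal (data E (p, \<tau>) - 2 * ln (cmod \<tau>))"
proof (cases p)
  case Infty
  have "data E (Infty, \<tau>) = 2 * ln (cmod \<tau>) + ln E / 2"
    using data_chart0[OF chart_Infty_in_charts, of 0 \<tau>] t E0 by (simp add: Th_Inf0 ln_mult ln_sqrt ln_realpow)
  then show ?thesis using upper_Infty[OF t(1)] Infty by simp
next
  case (Fin z)
  show ?thesis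
  proof (cases "z = 0")
    case True
    have "data E (Fin 0, \<tau>) = ln (1 + E)"
      using data_chart0[OF Fin_in_charts, of 0 \<tau>] E0 by (simp add: Th_def S1_def S2_def add.commute)
    moreover have "ln (cmod \<tau>) \<le> 0" using t by simp
    ultimately show ?thesis using upper_zero[OF t(1)] Fin True by (auto intro: order_trans)
  next
    case False
    have ch: "chart_Infty (\<tau> / (\<tau> * z)) = Fin z" using t(2) False by (simp add: chart_Infty_nz)
    have "1 + (cmod (1 / z))\<^sup>2 = (1 + (cmod z)\<^sup>2) / (cmod z)\<^sup>2" using False by (simp add: norm_divide power_divide field_simps)
    then have "fs_potential (\<tau> / (\<tau> * z)) = fs_potential z - 2 * ln (cmod z)"
      unfolding fs_potential_def using False t(2) one_plus_sq_pos[of z] by (simp add: ln_div ln_realpow)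
    then have "\<Phi> (Fin z, \<tau>) + ereal (fs_potential z - 2 * ln (cmod z)) \<le> ereal (ln (Tq E (1 - \<tau> * z)) - 2 * ln (cmod (\<tau> * z)))"
      using upper_Infty_disc[of "\<tau> * z" \<tau>] t False ch by simp
    moreover have "ln (cmod (\<tau> * z)) = ln (cmod \<tau>) + ln (cmod z)" using t(2) False by (simp add: norm_mult ln_mult)
    moreover have "data E (Fin z, \<tau>) = ln (Tq E (1 - \<tau> * z)) - fs_potential z"
      unfolding data_chart[OF Fin_in_charts t(2)] by (simp add: Th_Fin)
    ultimately show ?thesis using Fin by (cases "\<Phi> (Fin z, \<tau>)") (auto simp: algebra_simps)
  qed
qed

lemma Phi_competitor: "competitor (data E) \<Phi>"
proof (rule hmae_solution_competitor[OF upper_bound])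
  fix p and \<tau> :: complex and e :: real assume t: "\<tau> \<in> sphere 0 1" and e: "0 < e"
  have t0: "\<tau> \<noteq> 0" using t by auto
  obtain c z where c: "c \<in> charts" "p = c z" using p1_chart_surj by blast
  define f where "f = (\<lambda>x::complex\<times>complex. ln (Th E (lX c (fst x)) (lY c (fst x)) (snd x) / (1 + (cmod (fst x))\<^sup>2)) - 2 * ln (cmod (snd x)))"
  have cont: "continuous_on (UNIV \<times> (- {0})) f"
    unfolding f_def
  proof (intro continuous_intros)
    show "continuous_on (UNIV \<times> (- {0})) (\<lambda>x. Th E (lX c (fst x)) (lY c (fst x)) (snd x))"
      unfolding Th_def S1_def S2_def by (intro continuous_intros continuous_on_lift)
  qed (use one_plus_sq_pos Th_pos lift_nz[OF c(1)] in \<open>force simp: less_imp_neq[symmetric]\<close>)+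
  have "open (UNIV \<times> (- {0}) :: (complex\<times>complex) set)" by (intro open_Times) auto
  moreover have "(z, \<tau>) \<in> UNIV \<times> (- {0})" using t0 by auto
  ultimately have "isCont f (z, \<tau>)" using cont by (simp add: continuous_on_eq_continuous_at)
  then obtain d where d: "d > 0" "\<And>x. dist x (z, \<tau>) < d \<Longrightarrow> dist (f x) (f (z, \<tau>)) < e"
    using e unfolding continuous_at_eps_delta by blast
  have "isCont (\<lambda>x::complex\<times>complex. snd x) (z, \<tau>)" by (intro continuous_intros)
  define B where "B = ball (z, \<tau>) d \<inter> (UNIV \<times> (- {0}))"
  have oB: "open B" unfolding B_def by (intro open_Int open_Times) auto
  show "\<exists>V. open V \<and> (p, \<tau>) \<in> V \<and> (\<forall>y\<in>V \<inter> (UNIV \<times> cball 0 1). \<Phi> y \<le> ereal (data E (p, \<tau>) + e))"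
  proof (intro exI[of _ "(\<lambda>(z, \<tau>). (c z, \<tau>)) ` B"] conjI ballI)
    show "open ((\<lambda>(z, \<tau>). (c z, \<tau>)) ` B)" by (rule open_chart_prod_image[OF c(1) oB])
    show "(p, \<tau>) \<in> (\<lambda>(z, \<tau>). (c z, \<tau>)) ` B" unfolding c(2) B_def using d(1) t0 by (intro image_eqI[of _ _ "(z, \<tau>)"]) auto
    fix y assume "y \<in> (\<lambda>(z, \<tau>). (c z, \<tau>)) ` B \<inter> (UNIV \<times> cball 0 1)"
    then obtain z' \<tau>' where y: "y = (c z', \<tau>')" "(z', \<tau>') \<in> B" "\<tau>' \<in> cball 0 1" by auto
    have "\<tau>' \<noteq> 0" using y(2) by (auto simp: B_def)
    have "\<Phi> y \<le> ereal (data E (c z', \<tau>') - 2 * ln (cmod \<tau>'))" unfolding y(1) by (rule upper_data[OF y(3) \<open>\<tau>' \<noteq> 0\<close>])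
    also have "data E (c z', \<tau>') - 2 * ln (cmod \<tau>') = f (z', \<tau>')" unfolding f_def data_chart0[OF c(1)] by simp
    also have "f (z', \<tau>') < f (z, \<tau>) + e"
      using d(2)[of "(z', \<tau>')"] y(2) unfolding B_def by (auto simp: dist_commute dist_real_def abs_if split: if_splits)
    also have "f (z, \<tau>) = data E (p, \<tau>)" unfolding f_def c(2) data_chart0[OF c(1)] using t by simp
    finally show "\<Phi> y \<le> ereal (data E (p, \<tau>) + e)" by simp
  qed
qed

subsection \<open>Lower bounds\<close>

text \<open>The source of all lower bounds: a form below \<open>Th\<close> over the unit circle
  yields a competitor.\<close>

lemma form_le_Phi:
  assumes T: "log_psh_form T" and le: "\<And>X Y \<tau>. cmod \<tau> = 1 \<Longrightarrow> T X Y \<tau> \<le> Th E X Y \<tau>" and c: "c \<in> charts"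
  shows "eln (T (lX c z) (lY c z) \<tau>) \<le> \<Phi> (c z, \<tau>) + ereal (fs_potential z)"
proof -
  have hom: "hom2 T" using T unfolding log_psh_form_def by auto
  have "competitor (data E) (form_fun T)"
  proof (rule form_fun_competitor[OF T])
    fix p and \<tau> :: complex assume t: "\<tau> \<in> sphere 0 1"
    then have t0: "\<tau> \<noteq> 0" by auto
    have nz: "hX p \<noteq> 0 \<or> hY p \<noteq> 0" by (cases p) auto
    have "form_fun T (p, \<tau>) \<le> eln (Th E (hX p) (hY p) \<tau> / hN p)"
      unfolding form_fun_def fst_conv snd_conv
      using le[of \<tau>] t hN_pos[of p] by (intro eln_mono divide_right_mono) auto
    also have "\<dots> = ereal (data E (p, \<tau>))"
      unfolding data_def using Th_pos[OF t0 nz] hN_pos[of p] by (simp add: eln_pos)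
    finally show "form_fun T (p, \<tau>) \<le> ereal (data E (p, \<tau>))" .
  qed
  from competitor_le[OF this, of "(c z, \<tau>)"]
  have "form_fun T (c z, \<tau>) + ereal (fs_potential z) \<le> \<Phi> (c z, \<tau>) + ereal (fs_potential z)" by (rule add_right_mono)
  then show ?thesis unfolding form_fun_chart[OF c hom] .
qed

text \<open>\<open>M\<close> is the best constant in $|1 - y|^2 \le M e^{u(y)}$.\<close>

definition M :: real where "M = sqrt (1 / E + 4 / (1 - E)\<^sup>2)"

lemma M_pos: "0 < M"
  unfolding M_def using E0 by (auto intro: add_pos_nonneg)

text \<open>On |y| = \<rho> the modulus |1 - y| is largest at y = -\<rho>, where it is 1 + \<rho>.
  The defect in the resulting inequality is a perfect square; its zeros solve a reciprocal quadratic
  equation, so they form a pair r, 1/r.\<close>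

lemma M_identity:
  fixes \<rho> :: real
  shows "(1 / E + 4 / (1 - E)\<^sup>2) * ((E + \<rho>\<^sup>2) * (1 + E * \<rho>\<^sup>2)) - (1 + \<rho>) ^ 4
     = ((1 - E)\<^sup>2 * \<rho> - 2 * E * (1 + \<rho>\<^sup>2))\<^sup>2 / (E * (1 - E)\<^sup>2)"
proof -
  define g where "g = (1 - E)\<^sup>2"
  have g: "g > 0" using E1 by (simp add: g_def)
  have e: "(E + \<rho>\<^sup>2) * (1 + E * \<rho>\<^sup>2) = E * (1 + \<rho>\<^sup>2)\<^sup>2 + g * \<rho>\<^sup>2"
    unfolding g_def by (simp add: power2_eq_square algebra_simps)
  have f: "(1 + \<rho>) ^ 4 = (1 + \<rho>\<^sup>2 + 2 * \<rho>)\<^sup>2" by (simp add: power2_eq_square power4_eq_xxxx algebra_simps)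
  show ?thesis
    unfolding e f g_def[symmetric] using E0 g
    by (simp add: field_simps) (simp add: power2_eq_square algebra_simps)
qed

lemma M_le: "(cmod (1 - y))\<^sup>2 \<le> M * Tq E y"
proof -
  let ?\<rho> = "cmod y"
  have "(cmod (1 - y))\<^sup>2 \<le> (1 + ?\<rho>)\<^sup>2" using norm_triangle_ineq4[of 1 y] by (intro power_mono) auto
  also have "\<dots> \<le> M * Tq E y"
  proof (rule power2_le_imp_le)
    have "0 \<le> ((1 - E)\<^sup>2 * ?\<rho> - 2 * E * (1 + ?\<rho>\<^sup>2))\<^sup>2 / (E * (1 - E)\<^sup>2)" using E0 by simp
    then have "(1 + ?\<rho>) ^ 4 \<le> (1 / E + 4 / (1 - E)\<^sup>2) * ((E + ?\<rho>\<^sup>2) * (1 + E * ?\<rho>\<^sup>2))"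
      using M_identity[of ?\<rho>] by linarith
    then show "((1 + ?\<rho>)\<^sup>2)\<^sup>2 \<le> (M * Tq E y)\<^sup>2"
      unfolding power_mult_distrib M_def Tq_def using E0 by simp
    show "0 \<le> M * Tq E y" using M_pos Tq_pos[of y] by simp
  qed
  finally show ?thesis .
qed

lemma M_eq:
  assumes "0 < \<rho>" "(1 - E)\<^sup>2 * \<rho> = 2 * E * (1 + \<rho>\<^sup>2)"
  shows "(cmod (1 - (- of_real \<rho>)))\<^sup>2 = M * Tq E (- of_real \<rho>)"
proof (rule power2_eq_imp_eq)
  have "1 - (- of_real \<rho>) = (of_real (1 + \<rho>) :: complex)" by simp
  then have n: "cmod (1 - (- of_real \<rho>)) = 1 + \<rho>" using assms(1) by (simp only: norm_of_real)
  have "(1 + \<rho>) ^ 4 = (1 / E + 4 / (1 - E)\<^sup>2) * ((E + \<rho>\<^sup>2) * (1 + E * \<rho>\<^sup>2))"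
    using M_identity[of \<rho>] assms(2) by simp
  then show "((cmod (1 - (- of_real \<rho>)))\<^sup>2)\<^sup>2 = (M * Tq E (- of_real \<rho>))\<^sup>2"
    unfolding n power_mult_distrib M_def Tq_def using E0 by simp
qed (use M_pos Tq_pos in \<open>auto simp: less_imp_le\<close>)

text \<open>At y = -r and y = -1/r equality in \<open>M_le\<close> makes the lower bound
  \<open>Q_lower_M\<close> and the upper bound \<open>Q_upper\<close> coincide, so Q is known there
  exactly.\<close>

lemma contact_radius:
  obtains r where "0 < r" "r < 1"
    "(cmod (1 - (- of_real r)))\<^sup>2 = M * Tq E (- of_real r)"
    "(cmod (1 - (- of_real (1 / r))))\<^sup>2 = M * Tq E (- of_real (1 / r))"
proof -
  define f where "f = (\<lambda>x::real. (1 - E)\<^sup>2 * x - 2 * E * (1 + x\<^sup>2))"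
  have f0: "f 0 < 0" using E0 by (simp add: f_def)
  have "(9/10)\<^sup>2 \<le> (1 - E)\<^sup>2" using E1 by (intro power_mono) auto
  then have f1: "f 1 > 0" using E1 by (simp add: f_def power2_eq_square)
  have "\<exists>x. 0 \<le> x \<and> x \<le> 1 \<and> f x = 0"
    using f0 f1 by (intro IVT') (auto simp: f_def intro!: continuous_intros)
  then obtain r where r: "0 \<le> r" "r \<le> 1" "f r = 0" by blast
  have "r \<noteq> 0" "r \<noteq> 1" using r(3) f0 f1 by auto
  then have r01: "0 < r" "r < 1" using r by auto
  have e1: "(1 - E)\<^sup>2 * r = 2 * E * (1 + r\<^sup>2)" using r(3) by (simp add: f_def)
  then have e2: "(1 - E)\<^sup>2 * (1 / r) = 2 * E * (1 + (1 / r)\<^sup>2)"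
    using r01 by (simp add: field_simps power2_eq_square)
  have r2: "0 < 1 / r" using r01 by simp
  show thesis by (rule that[OF r01 M_eq[OF r01(1) e1] M_eq[OF r2 e2]])
qed

end

lemma sub_at_cong:
  assumes f: "sub_at f a" and R: "0 < R" "\<And>z. z \<in> ball a R \<Longrightarrow> g z = f z"
  shows "sub_at g a"
proof -
  obtain R' where R': "R' > 0"
    and F: "\<And>r w. 0 < r \<Longrightarrow> r < R' \<Longrightarrow> continuous_on (sphere a r) w \<Longrightarrow> (\<And>z. z \<in> sphere a r \<Longrightarrow> f z \<le> ereal (w z)) \<Longrightarrow>
      f a \<le> ereal (amean (\<lambda>t. w (a + of_real r * cis t)))"
    using f unfolding sub_at_def by metis
  show ?thesis unfolding sub_at_def
  proof (intro exI[of _ "min R R'"] conjI allI impI)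
    fix r w assume r: "0 < r \<and> r < min R R' \<and> continuous_on (sphere a r) w \<and> (\<forall>z\<in>sphere a r. g z \<le> ereal (w z))"
    have "g a = f a" using R by auto
    also have "f a \<le> ereal (amean (\<lambda>t. w (a + of_real r * cis t)))"
    proof (rule F)
      fix z assume z: "z \<in> sphere a r"
      then have "z \<in> ball a R" using r by auto
      then show "f z \<le> ereal (w z)" using r z R(2) by metis
    qed (use r in auto)
    finally show "g a \<le> ereal (amean (\<lambda>t. w (a + of_real r * cis t)))" .
  qed (use R R' in auto)
qed

lemma usc_on_cong:
  assumes "usc_on S f" "\<And>x. x \<in> S \<Longrightarrow> g x = f x"
  shows "usc_on S g"
proof -
  have "{x \<in> S. g x < r} = {x \<in> S. f x < r}" for r using assms(2) by auto
  then show ?thesis using assms unfolding usc_on_def by auto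
qed

section \<open>Rotations of the projective line and of the disc\<close>

definition rot :: "complex \<Rightarrow> p1 \<Rightarrow> p1" where
  "rot \<omega> p = (case p of Fin z \<Rightarrow> Fin (\<omega> * z) | Infty \<Rightarrow> Infty)"

lemma rot_chart:
  assumes "cmod \<omega> = 1" "c \<in> charts"
  obtains \<alpha> where "cmod \<alpha> = 1" "\<And>z. rot \<omega> (c z) = c (\<alpha> * z)"
  using assms(2)
proof (cases rule: charts_cases)
  case Fin
  then show ?thesis using that[of \<omega>] assms(1) by (simp add: rot_def)
next
  case Infty
  have w: "\<omega> * cnj \<omega> = 1" using assms(1) by (metis complex_norm_square of_real_1 power_one)
  then have "cnj \<omega> \<noteq> 0" by auto
  then have "(\<omega> * cnj \<omega>) / (cnj \<omega> * z) = \<omega> * (1 / z)" for z by simp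
  then have "1 / (cnj \<omega> * z) = \<omega> * (1 / z)" for z unfolding w .
  then have "rot \<omega> (c z) = c (cnj \<omega> * z)" for z
    using Infty w by (auto simp: rot_def chart_Infty_def)
  then show ?thesis using that[of "cnj \<omega>"] assms(1) by simp
qed

lemma fs_potential_rot: "cmod \<alpha> = 1 \<Longrightarrow> fs_potential (\<alpha> * z) = fs_potential z"
  by (simp add: fs_potential_def norm_mult)

lemma psh_on_rot:
  assumes u: "psh_on (UNIV \<times> ball 0 1) u" and ab: "cmod \<alpha> = 1" "cmod \<beta> = 1"
  shows "psh_on (UNIV \<times> ball 0 1) (\<lambda>x. u (\<alpha> * fst x, \<beta> * snd x))"
proof (rule psh_onI)
  show "usc_on (UNIV \<times> ball 0 1) (\<lambda>x. u (\<alpha> * fst x, \<beta> * snd x))"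
    by (rule usc_on_compose[of "UNIV \<times> ball 0 1" u])
       (use u ab in \<open>auto simp: psh_on_def norm_mult intro!: continuous_intros\<close>)
  fix a b :: "complex \<times> complex" and w
  assume disc: "\<And>\<zeta>. \<zeta> \<in> cball 0 1 \<Longrightarrow> (fst a + \<zeta> * fst b, snd a + \<zeta> * snd b) \<in> UNIV \<times> ball 0 1"
    and w: "continuous_on (sphere 0 1) w"
      "\<And>\<zeta>. \<zeta> \<in> sphere 0 1 \<Longrightarrow> u (\<alpha> * fst (fst a + \<zeta> * fst b, snd a + \<zeta> * snd b), \<beta> * snd (fst a + \<zeta> * fst b, snd a + \<zeta> * snd b)) \<le> ereal (w \<zeta>)"
  show "u (\<alpha> * fst a, \<beta> * snd a) \<le> ereal (amean (\<lambda>t. w (cis t)))"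
  proof (rule psh_on_mean[OF u, where b="(\<alpha> * fst b, \<beta> * snd b)"])
    fix \<zeta> :: complex assume z: "\<zeta> \<in> cball 0 1"
    have e: "\<beta> * snd a + \<zeta> * (\<beta> * snd b) = \<beta> * (snd a + \<zeta> * snd b)" by (simp add: algebra_simps)
    show "(fst (\<alpha> * fst a, \<beta> * snd a) + \<zeta> * fst (\<alpha> * fst b, \<beta> * snd b), snd (\<alpha> * fst a, \<beta> * snd a) + \<zeta> * snd (\<alpha> * fst b, \<beta> * snd b)) \<in> UNIV \<times> ball 0 1"
      unfolding fst_conv snd_conv e using disc[OF z] ab by (simp add: norm_mult)
  next
    fix \<zeta> :: complex assume z: "\<zeta> \<in> sphere 0 1"
    have e: "\<beta> * snd a + \<zeta> * (\<beta> * snd b) = \<beta> * (snd a + \<zeta> * snd b)" "\<alpha> * fst a + \<zeta> * (\<alpha> * fst b) = \<alpha> * (fst a + \<zeta> * fst b)"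
      by (simp_all add: algebra_simps)
    show "u (fst (\<alpha> * fst a, \<beta> * snd a) + \<zeta> * fst (\<alpha> * fst b, \<beta> * snd b), snd (\<alpha> * fst a, \<beta> * snd a) + \<zeta> * snd (\<alpha> * fst b, \<beta> * snd b)) \<le> ereal (w \<zeta>)"
      using w(2)[OF z] unfolding fst_conv snd_conv e .
  qed (rule w(1))
qed

context hele_shaw
begin

text \<open>Replacing (z, \<tau>) by (\<omega> z, cnj \<omega> \<tau>) fixes \<tau> z and hence the
  data, so the rotated solution is again a competitor. The reverse inequality is the same statement
  for cnj \<omega>; see \<open>PF_rot\<close>.\<close>

lemma Phi_rot_le:
  assumes w: "cmod \<omega> = 1"
  shows "\<Phi> (rot \<omega> p, cnj \<omega> * \<tau>) \<le> \<Phi> (p, \<tau>)"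
proof -
  define \<psi> where "\<psi> = (\<lambda>x. \<Phi> (rot \<omega> (fst x), cnj \<omega> * snd x))"
  have "competitor (data E) \<psi>"
    unfolding competitor_def
  proof (intro conjI allI ballI)
    show "usc_on (UNIV \<times> cball 0 1) \<psi>"
    proof (rule usc_on_p1I)
      fix c assume c: "c \<in> charts"
      obtain \<alpha> where \<alpha>: "cmod \<alpha> = 1" "\<And>z. rot \<omega> (c z) = c (\<alpha> * z)" using rot_chart[OF w c] by blast
      show "usc_on (UNIV \<times> cball 0 1) (\<lambda>x. \<psi> (c (fst x), snd x))"
        unfolding \<psi>_def fst_conv snd_conv \<alpha>(2)
        using Phi_competitor w unfolding competitor_def
        by (intro usc_on_p1D[where C="cball 0 1"] c continuous_intros) (auto simp: norm_mult)
    qed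
    show "fs_psh \<psi>" unfolding fs_psh_def
    proof
      fix c assume c: "c \<in> charts"
      obtain \<alpha> where \<alpha>: "cmod \<alpha> = 1" "\<And>z. rot \<omega> (c z) = c (\<alpha> * z)" using rot_chart[OF w c] by blast
      have "psh_on (UNIV \<times> ball 0 1) (\<lambda>(z, \<tau>). \<Phi> (c z, \<tau>) + ereal (fs_potential z))"
        using Phi_competitor c unfolding competitor_def fs_psh_def by blast
      from psh_on_rot[OF this \<alpha>(1), of "cnj \<omega>"] w
      show "psh_on (UNIV \<times> ball 0 1) (\<lambda>(z, \<tau>). \<psi> (c z, \<tau>) + ereal (fs_potential z))"
        unfolding \<psi>_def by (simp add: case_prod_beta' \<alpha> fs_potential_rot)
    qed
    fix p and \<tau> :: complex assume t: "\<tau> \<in> sphere 0 1"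
    have wc: "cnj \<omega> * \<omega> = 1" using w by (metis complex_norm_square of_real_1 power_one mult.commute)
    have ww: "cnj \<omega> * \<tau> * (\<omega> * x) = \<tau> * x" for x
    proof -
      have "cnj \<omega> * \<tau> * (\<omega> * x) = (cnj \<omega> * \<omega>) * (\<tau> * x)" by (simp add: algebra_simps)
      then show ?thesis unfolding wc by simp
    qed
    have "data E (rot \<omega> p, cnj \<omega> * \<tau>) = data E (p, \<tau>)"
    proof (cases p)
      case (Fin z)
      show ?thesis
        unfolding Fin data_def rot_def p1.case fst_conv snd_conv hX.simps hY.simps Th_def S1_def S2_def hN_def ww
        using w by (simp add: norm_mult)
    next
      case Infty
      then show ?thesis using w by (simp add: data_def rot_def Th_def S1_def S2_def hN_def norm_mult)
    qed
    moreover have "\<Phi> (rot \<omega> p, cnj \<omega> * \<tau>) \<le> ereal (data E (rot \<omega> p, cnj \<omega> * \<tau>))"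
      using Phi_competitor t w unfolding competitor_def by (auto simp: norm_mult)
    ultimately show "\<psi> (p, \<tau>) \<le> ereal (data E (p, \<tau>))" unfolding \<psi>_def by simp
  qed
  from competitor_le[OF this, of "(p, \<tau>)"] show ?thesis unfolding \<psi>_def by simp
qed

section \<open>Potentials of the solution in the two charts and in the coordinate y\<close>

lemma lower_Th: "c \<in> charts \<Longrightarrow> eln (Th E (lX c z) (lY c z) \<tau>) \<le> \<Phi> (c z, \<tau>) + ereal (fs_potential z)"
  by (rule form_le_Phi[OF log_psh_form_Th[OF E0]]) auto

text \<open>\<open>M_le\<close> in homogeneous form, since X / Y = (1 - y) / \<tau>. The resulting
  lower bound for \<Phi> does not depend on \<tau>; in the coordinate y it has the full slope 1 in
  s.\<close>

lemma M_form_le: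
  assumes t: "cmod \<tau> = 1"
  shows "1 / M * (cmod X)\<^sup>2 \<le> Th E X Y \<tau>"
proof (cases "Y = 0")
  case True
  have "1 \<le> M\<^sup>2 * E" unfolding M_def using E0 by (simp add: field_simps add_pos_nonneg)
  then have "1 \<le> (M * sqrt E)\<^sup>2" using E0 by (simp add: power_mult_distrib)
  then have "1 \<le> M * sqrt E" using M_pos E0 by (intro power2_le_imp_le[of 1]) auto
  then have "1 * (cmod X)\<^sup>2 \<le> M * sqrt E * (cmod X)\<^sup>2" by (intro mult_right_mono) auto
  moreover have "Th E X 0 \<tau> = (cmod X)\<^sup>2 * sqrt E"
    unfolding Th_def S1_def S2_def using t by (simp add: real_sqrt_mult norm_mult norm_minus_commute power2_eq_square)
  ultimately show ?thesis using True M_pos by (simp add: field_simps)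
next
  case False
  have "Th E (Y * (X / Y)) (Y * 1) \<tau> = (cmod Y)\<^sup>2 * Th E (X / Y) 1 \<tau>"
    using hom2_Th[of E] unfolding hom2_def by blast
  then have T: "Th E X Y \<tau> = (cmod Y)\<^sup>2 * Tq E (1 - \<tau> * (X / Y))" using False by (simp add: Th_Fin)
  have "(cmod (1 - (1 - \<tau> * (X / Y))))\<^sup>2 \<le> M * Tq E (1 - \<tau> * (X / Y))" by (rule M_le)
  then have "(cmod X)\<^sup>2 / (cmod Y)\<^sup>2 \<le> M * Tq E (1 - \<tau> * (X / Y))" using t by (simp add: norm_mult norm_divide power_divide)
  then show ?thesis unfolding T using False M_pos by (simp add: field_simps)
qed

lemma lower_M: "c \<in> charts \<Longrightarrow> eln (1 / M * (cmod (lX c z))\<^sup>2) \<le> \<Phi> (c z, \<tau>) + ereal (fs_potential z)"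
  using form_le_Phi[OF log_psh_form_cX[of "1 / M"]] M_form_le M_pos by simp

text \<open>Real-valued because \<Phi> is finite over the closed disc (\<open>PF_eq\<close>,
  \<open>PI_eq\<close>). The chart at infinity is kept as well, since for fixed y \<noteq> 1 the
  limit \<tau> \<rightarrow> 0 means z \<rightarrow> \<infinity>.\<close>

definition PF :: "complex \<Rightarrow> complex \<Rightarrow> real" where
  "PF z \<tau> = real_of_ereal (\<Phi> (Fin z, \<tau>)) + fs_potential z"
definition PI :: "complex \<Rightarrow> complex \<Rightarrow> real" where
  "PI v \<tau> = real_of_ereal (\<Phi> (chart_Infty v, \<tau>)) + fs_potential v"

lemma PF_eq:
  assumes t: "\<tau> \<in> cball 0 1" shows "\<Phi> (Fin z, \<tau>) + ereal (fs_potential z) = ereal (PF z \<tau>)"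
proof -
  have "eln (Th E z 1 \<tau>) \<le> \<Phi> (Fin z, \<tau>) + ereal (fs_potential z)" using lower_Th[of Fin z \<tau>] by simp
  then have "ereal (ln (Tq E (1 - \<tau> * z))) \<le> \<Phi> (Fin z, \<tau>) + ereal (fs_potential z)" using Tq_pos by (simp add: Th_Fin eln_pos)
  moreover have "\<Phi> (Fin z, \<tau>) \<le> ereal (ln 3)" using t by (intro upper_bound) auto
  ultimately show ?thesis unfolding PF_def by (cases "\<Phi> (Fin z, \<tau>)") auto
qed

lemma PI_eq:
  assumes t: "\<tau> \<in> cball 0 1" shows "\<Phi> (chart_Infty v, \<tau>) + ereal (fs_potential v) = ereal (PI v \<tau>)"
proof -
  have "eln (1 / M) \<le> \<Phi> (chart_Infty v, \<tau>) + ereal (fs_potential v)" using lower_M[of chart_Infty v \<tau>] by simp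
  then have "ereal (ln (1 / M)) \<le> \<Phi> (chart_Infty v, \<tau>) + ereal (fs_potential v)" using M_pos by (simp add: eln_pos)
  moreover have "\<Phi> (chart_Infty v, \<tau>) \<le> ereal (ln 3)" using t by (intro upper_bound) auto
  ultimately show ?thesis unfolding PI_def by (cases "\<Phi> (chart_Infty v, \<tau>)") auto
qed

lemma PI_PF:
  assumes "v \<noteq> 0" shows "PI v \<tau> = PF (1 / v) \<tau> + 2 * ln (cmod v)"
proof -
  have "1 + (cmod (1 / v))\<^sup>2 = (1 + (cmod v)\<^sup>2) / (cmod v)\<^sup>2" using assms by (simp add: norm_divide power_divide field_simps)
  then have "fs_potential (1 / v) = fs_potential v - 2 * ln (cmod v)"
    unfolding fs_potential_def using assms one_plus_sq_pos[of v] by (simp add: ln_div ln_realpow)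
  then show ?thesis using assms unfolding PI_def PF_def by (simp add: chart_Infty_nz)
qed

lemma PF_usc:
  fixes h :: "'a::metric_space \<Rightarrow> complex"
  assumes "continuous_on T h" "continuous_on T k" "k ` T \<subseteq> cball 0 1"
  shows "usc_on T (\<lambda>x. ereal (PF (h x) (k x)))"
proof (rule usc_on_cong)
  show "usc_on T (\<lambda>x. \<Phi> (Fin (h x), k x) + ereal (fs_potential (h x)))"
    using Phi_competitor assms unfolding competitor_def
    by (intro usc_on_add_continuous continuous_on_fs_potential usc_on_p1D[where C="cball 0 1"]) auto
qed (use assms PF_eq in auto)

lemma PI_usc:
  fixes h :: "'a::metric_space \<Rightarrow> complex"
  assumes "continuous_on T h" "continuous_on T k" "k ` T \<subseteq> cball 0 1"
  shows "usc_on T (\<lambda>x. ereal (PI (h x) (k x)))"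
proof (rule usc_on_cong)
  show "usc_on T (\<lambda>x. \<Phi> (chart_Infty (h x), k x) + ereal (fs_potential (h x)))"
    using Phi_competitor assms unfolding competitor_def
    by (intro usc_on_add_continuous continuous_on_fs_potential usc_on_p1D[where C="cball 0 1"]) auto
qed (use assms PI_eq in auto)

lemma PF_sub_at:
  assumes W: "open W" "a \<in> W" and g: "g1 holomorphic_on W" "g2 holomorphic_on W" "\<And>z. z \<in> W \<Longrightarrow> cmod (g2 z) < 1"
  shows "sub_at (\<lambda>z. ereal (PF (g1 z) (g2 z))) a"
proof -
  have "psh_on (UNIV \<times> ball 0 1) (\<lambda>(z, \<tau>). \<Phi> (Fin z, \<tau>) + ereal (fs_potential z))"
    using Phi_competitor Fin_in_charts unfolding competitor_def fs_psh_def by blast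
  from psh_on_holomorphic_disc[OF this _ W g(1,2)] g(3)
  have "sub_at (\<lambda>z. \<Phi> (Fin (g1 z), g2 z) + ereal (fs_potential (g1 z))) a" by (auto intro!: open_Times)
  moreover obtain R where "R > 0" "ball a R \<subseteq> W" using W open_contains_ball by blast
  ultimately show ?thesis
    by (rule_tac sub_at_cong[of _ a R]) (use g(3) PF_eq in \<open>force simp: less_imp_le\<close>)+
qed

lemma PF_rot:
  assumes "cmod \<omega> = 1" shows "PF (\<omega> * z) (cnj \<omega> * \<tau>) = PF z \<tau>"
proof -
  have w: "cnj \<omega> * \<omega> = 1" "\<omega> * cnj \<omega> = 1" using assms by (metis complex_norm_square of_real_1 power_one mult.commute)+
  have "\<Phi> (Fin (\<omega> * z), cnj \<omega> * \<tau>) \<le> \<Phi> (Fin z, \<tau>)" using Phi_rot_le[OF assms, of "Fin z" \<tau>] by (simp add: rot_def)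
  moreover have "\<Phi> (Fin (cnj \<omega> * (\<omega> * z)), cnj (cnj \<omega>) * (cnj \<omega> * \<tau>)) \<le> \<Phi> (Fin (\<omega> * z), cnj \<omega> * \<tau>)"
    using Phi_rot_le[of "cnj \<omega>" "Fin (\<omega> * z)" "cnj \<omega> * \<tau>"] assms by (simp add: rot_def)
  moreover have "cnj \<omega> * (\<omega> * z) = z" "cnj (cnj \<omega>) * (cnj \<omega> * \<tau>) = \<tau>" using w by (simp_all flip: mult.assoc)
  ultimately have "\<Phi> (Fin (\<omega> * z), cnj \<omega> * \<tau>) = \<Phi> (Fin z, \<tau>)" by (simp only: order_antisym)
  then show ?thesis unfolding PF_def using fs_potential_rot[OF assms] by simp
qed

text \<open>In the coordinate $y = 1 - \tau z$ the boundary data do not depend on \<open>\<tau>\<close>.\<close>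

definition Q :: "complex \<Rightarrow> complex \<Rightarrow> real" where
  "Q y \<tau> = PF ((1 - y) / \<tau>) \<tau>"

lemma PF_Q: "\<tau> \<noteq> 0 \<Longrightarrow> PF z \<tau> = Q (1 - \<tau> * z) \<tau>"
  by (simp add: Q_def)

lemma Q_lower:
  assumes "\<tau> \<in> cball 0 1" "\<tau> \<noteq> 0" shows "ln (Tq E y) \<le> Q y \<tau>"
  using lower_Th[of Fin "(1 - y) / \<tau>" \<tau>] assms Tq_pos[of y] unfolding PF_eq[OF assms(1)] Q_def
  by (simp add: Th_Fin eln_pos)

lemma Q_upper:
  assumes "\<tau> \<in> cball 0 1" "\<tau> \<noteq> 0" shows "Q y \<tau> \<le> ln (Tq E y) - 2 * ln (cmod \<tau>)"
  using upper_data[OF assms, of "Fin ((1 - y) / \<tau>)"] PF_eq[OF assms(1), of "(1 - y) / \<tau>"]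
    data_chart[OF Fin_in_charts assms(2), of "(1 - y) / \<tau>"] assms(2) unfolding Q_def
  by (cases "\<Phi> (Fin ((1 - y) / \<tau>), \<tau>)") (auto simp: Th_Fin)

lemma Q_lower_M:
  assumes "\<tau> \<in> cball 0 1" "\<tau> \<noteq> 0" "y \<noteq> 1" shows "2 * ln (cmod (1 - y)) - ln M \<le> Q y \<tau> + 2 * ln (cmod \<tau>)"
  using lower_M[of Fin "(1 - y) / \<tau>" \<tau>] assms M_pos unfolding PF_eq[OF assms(1)] Q_def
  by (simp add: eln_pos norm_divide power_divide ln_div ln_realpow ln_mult)

lemma Q_rot: "\<tau> \<noteq> 0 \<Longrightarrow> Q y \<tau> = Q y (of_real (cmod \<tau>))"
proof -
  assume t: "\<tau> \<noteq> 0"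
  define \<omega> where "\<omega> = \<tau> / of_real (cmod \<tau>)"
  have w: "cmod \<omega> = 1" using t by (simp add: \<omega>_def norm_divide)
  have "cnj \<omega> * \<tau> = of_real (cmod \<tau>)"
    unfolding \<omega>_def using t complex_norm_square[of \<tau>] by (simp add: field_simps power2_eq_square)
  moreover have "\<omega> * ((1 - y) / \<tau>) = (1 - y) / of_real (cmod \<tau>)" unfolding \<omega>_def using t by simp
  ultimately show ?thesis using PF_rot[OF w, of "(1 - y) / \<tau>" \<tau>] unfolding Q_def by simp
qed

lemma Q_rot': "\<tau> \<noteq> 0 \<Longrightarrow> cmod \<tau> = cmod \<tau>' \<Longrightarrow> Q y \<tau> = Q y \<tau>'"
  using Q_rot[of \<tau> y] Q_rot[of \<tau>' y] by (metis norm_eq_zero)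

text \<open>The Buzano form with base point y0 = y attains equality at y, and its factor |X| = |1 -
  y| / |\<tau>| contributes |\<tau>|^(-1/2) after the square root, that is the summand s/4.\<close>

lemma Q_quarter:
  assumes y: "y \<noteq> 1" "cmod (y + of_real E) \<le> sqrt E * cmod (1 - y)" and t: "\<tau> \<in> cball 0 1" "\<tau> \<noteq> 0"
  shows "ln (Tq E y) - ln (cmod \<tau>) / 2 \<le> Q y \<tau>"
proof -
  define X where "X = (1 - y) / \<tau>"
  have D: "1 - \<tau> * X = y" using t by (simp add: X_def)
  define n where "n = E + (cmod y)\<^sup>2"
  have n: "0 < n" using E0 by (simp add: n_def add_pos_nonneg)
  have cn: "of_real n = of_real E + y * cnj y" unfolding n_def of_real_add complex_norm_square ..
  have "ell E y X 1 \<tau> = (1 - y) * of_real n / of_real n"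
    unfolding ell_def D n_def[symmetric] cn by (simp add: algebra_simps)
  then have ell: "ell E y X 1 \<tau> = 1 - y" using n by simp
  have "n / (cmod (1 - y))\<^sup>2 * cmod (X * (1 - y)) = n / cmod \<tau>"
    using y(1) by (simp add: X_def norm_mult norm_divide power2_eq_square)
  then have "Tb E y X 1 \<tau> = sqrt (n / cmod \<tau> * S2 E X 1 \<tau>)" unfolding Tb_def ell n_def[symmetric] by simp
  also have "S2 E X 1 \<tau> = 1 + E * (cmod y)\<^sup>2" unfolding S2_def D by simp
  also have "n / cmod \<tau> * (1 + E * (cmod y)\<^sup>2) = (n * (1 + E * (cmod y)\<^sup>2)) / cmod \<tau>" by simp
  also have "sqrt \<dots> = Tq E y / sqrt (cmod \<tau>)" unfolding real_sqrt_divide Tq_def n_def ..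
  finally have Tb: "Tb E y X 1 \<tau> = Tq E y / sqrt (cmod \<tau>)" .
  have "eln (Tb E y (lX Fin X) (lY Fin X) \<tau>) \<le> \<Phi> (Fin X, \<tau>) + ereal (fs_potential X)"
    by (rule form_le_Phi[OF log_psh_form_Tb[OF E0 y(1)] Tb_le_Th[OF E0 y]]) auto
  then have "ln (Tq E y / sqrt (cmod \<tau>)) \<le> Q y \<tau>"
    unfolding PF_eq[OF t(1)] Q_def X_def[symmetric] using Tq_pos[of y] t by (simp add: Tb eln_pos)
  then show ?thesis using Tq_pos[of y] t by (simp add: ln_div ln_sqrt)
qed

text \<open>Hadamard's three circles theorem: for fixed y, Q is subharmonic in \<zeta> and depends
  on |\<zeta>| only, so on an annulus it lies below the function A + B ln|\<zeta>| with the same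
  values on both boundary circles; and ln|\<zeta>| is -s/2.\<close>

lemma Q_convex: "convex_on {0<..} (\<lambda>s. Q y (of_real (exp (- s / 2))))"
proof (rule convex_on_linorderI)
  fix t x x' :: real
  assume t: "0 < t" "t < 1" and x: "x \<in> {0<..}" "x' \<in> {0<..}" "x < x'"
  define s where "s = (1 - t) * x + t * x'"
  have s: "x < s" "s < x'"
  proof -
    have "s - x = t * (x' - x)" "x' - s = (1 - t) * (x' - x)" by (simp_all add: s_def algebra_simps)
    then show "x < s" "s < x'" using t x(3) by (metis diff_gt_0_iff_gt mult_pos_pos)+
  qed
  define q where "q = (\<lambda>s. Q y (of_real (exp (- s / 2))))"
  define B where "B = 2 * (q x - q x') / (x' - x)"
  define A where "A = q x + B * x / 2"
  define W where "W = {\<zeta>::complex. exp (- x' / 2) < cmod \<zeta> \<and> cmod \<zeta> < exp (- x / 2)}"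
  define C where "C = {\<zeta>::complex. exp (- x' / 2) \<le> cmod \<zeta> \<and> cmod \<zeta> \<le> exp (- x / 2)}"
  have oW: "open W" unfolding W_def by (intro open_Collect_conj open_Collect_less continuous_intros)
  have "closed C" unfolding C_def by (intro closed_Collect_conj closed_Collect_le continuous_intros)
  moreover have "W \<subseteq> C" unfolding W_def C_def by auto
  ultimately have clW: "closure W \<subseteq> C" by (intro closure_minimal)
  have ex1: "exp (- x / 2) < 1" using x by simp
  have C1: "cmod \<zeta> < 1" "\<zeta> \<noteq> 0" if "\<zeta> \<in> C" for \<zeta>
  proof -
    have "exp (- x' / 2) \<le> cmod \<zeta>" "cmod \<zeta> \<le> exp (- x / 2)" using that by (auto simp: C_def)
    then have "cmod \<zeta> < 1" "0 < cmod \<zeta>" using ex1 exp_gt_zero[of "- x' / 2"] by linarith+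
    then show "cmod \<zeta> < 1" "\<zeta> \<noteq> 0" by auto
  qed
  have "ereal (Q y (of_real (exp (- s / 2)))) \<le> ereal (A + B * ln (cmod (of_real (exp (- s / 2)))))"
  proof (rule maximum_principle[where W=W and v="\<lambda>\<zeta>. ereal (Q y \<zeta>)" and h="\<lambda>\<zeta>. A + B * ln (cmod \<zeta>)"])
    show "bounded W" unfolding W_def bounded_iff by (auto intro!: exI[of _ "exp (- x / 2)"])
    show "usc_on (closure W) (\<lambda>\<zeta>. ereal (Q y \<zeta>))"
      unfolding Q_def by (intro PF_usc continuous_intros) (use clW C1 in \<open>force simp: less_imp_le\<close>)+
    show "sub_at (\<lambda>\<zeta>. ereal (Q y \<zeta>)) a" if "a \<in> W" for a
      unfolding Q_def by (rule PF_sub_at[OF oW that]) (use \<open>W \<subseteq> C\<close> C1 in \<open>auto intro!: holomorphic_intros\<close>)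
    show "continuous_on (closure W) (\<lambda>\<zeta>. A + B * ln (cmod \<zeta>))"
      using clW C1 by (intro continuous_intros) auto
    show "super_mean_at (\<lambda>\<zeta>. A + B * ln (cmod \<zeta>)) a" if "a \<in> W" for a
      using that \<open>W \<subseteq> C\<close> C1 by (intro super_mean_at_ln_norm) auto
    fix \<zeta> assume z: "\<zeta> \<in> frontier W"
    then have zC: "\<zeta> \<in> C" "\<zeta> \<notin> W" using clW oW by (auto simp: frontier_def interior_open)
    then have "cmod \<zeta> = exp (- x / 2) \<or> cmod \<zeta> = exp (- x' / 2)" unfolding C_def W_def by auto
    moreover have "Q y \<zeta> = Q y (of_real (cmod \<zeta>))" by (intro Q_rot C1(2) zC(1))
    moreover have "A + B * (- x / 2) = q x" by (simp add: A_def)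
    moreover have "A + B * (- x' / 2) = q x'"
    proof -
      have "A + B * (- x' / 2) = q x - B * (x' - x) / 2" by (simp add: A_def field_simps)
      also have "B * (x' - x) = 2 * (q x - q x')" unfolding B_def using x(3) by simp
      finally show ?thesis by (simp add: field_simps)
    qed
    ultimately show "ereal (Q y \<zeta>) \<le> ereal (A + B * ln (cmod \<zeta>))" unfolding q_def by auto
  next
    show "of_real (exp (- s / 2)) \<in> W" using s unfolding W_def by auto
  qed (rule oW)
  then have "q s \<le> A - B * s / 2" unfolding q_def by simp
  also have "A - B * s / 2 = q x - t * (B * (x' - x)) / 2" by (simp add: A_def s_def field_simps)
  also have "B * (x' - x) = 2 * (q x - q x')" unfolding B_def using x(3) by simp
  also have "q x - t * (2 * (q x - q x')) / 2 = (1 - t) * q x + t * q x'" by (simp add: field_simps)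
  finally show "Q y (of_real (exp (- ((1 - t) *\<^sub>R x + t *\<^sub>R x') / 2))) \<le> (1 - t) * Q y (of_real (exp (- x / 2))) + t * Q y (of_real (exp (- x' / 2)))"
    unfolding q_def s_def by simp
qed (simp add: convex_real_interval)

text \<open>Uses the disc on which y = exp (k \<tau>) with k = 4 \<i> \<theta>; it passes through y
  = exp (\<i> \<theta>) at \<tau> = 1/4. On its boundary |y| lies between exp (-4 \<pi>) and exp (4
  \<pi>), where u exceeds ln|y| = Re (k \<tau>) by at most E exp (8 \<pi>). This harmonic function
  is 0 at 1/4.\<close>

lemma Q_ring:
  assumes y: "cmod y = 1" shows "Q y (1 / 4) \<le> E * exp (8 * pi)"
proof -
  define \<theta> where "\<theta> = Arg y"
  have th: "y = cis \<theta>" "\<bar>\<theta>\<bar> \<le> pi" using y Arg_bounded[of y] unfolding \<theta>_def using rcis_cmod_Arg[of y] by (auto simp: rcis_def)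
  define k where "k = 4 * \<i> * of_real \<theta>"
  have ck: "cmod k \<le> 4 * pi" using th(2) by (simp add: k_def norm_mult)
  \<comment> \<open>This is z = (1 - y) / \<tau>, whose singularity at 0 is removable because y = 1
    there.\<close>
  define h where "h = (\<lambda>\<tau>. if \<tau> = 0 then deriv (\<lambda>\<tau>. - exp (k * \<tau>)) 0 else (- exp (k * \<tau>) - (- exp (k * 0))) / (\<tau> - 0))"
  have hol: "h holomorphic_on UNIV"
    unfolding h_def by (rule pole_lemma) (auto intro!: holomorphic_intros)
  have h: "\<tau> * h \<tau> = 1 - exp (k * \<tau>)" if "\<tau> \<noteq> 0" for \<tau> using that by (simp add: h_def)
  have "\<Phi> (Fin (h (1/4)), 1/4) + ereal (fs_potential (h (1/4))) \<le> ereal (Re (k * (1/4)) + E * exp (8 * pi))"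
  proof (rule hmae_solution_disc[where h=h and w="\<lambda>\<tau>. Re (k * \<tau>) + E * exp (8 * pi)", OF Fin_in_charts])
    show "h holomorphic_on ball 0 1" using hol holomorphic_on_subset by blast
    show "continuous_on (cball 0 1) h" using hol by (meson holomorphic_on_imp_continuous_on continuous_on_subset subset_UNIV)
    show "super_mean_at (\<lambda>\<tau>. Re (k * \<tau>) + E * exp (8 * pi)) a" for a
      by (intro super_mean_at_add super_mean_at_const super_mean_at_holomorphic[where S=UNIV]) (auto intro!: holomorphic_intros)
    fix \<tau> :: complex assume t: "\<tau> \<in> sphere 0 1"
    then have t0: "\<tau> \<noteq> 0" by auto
    define x where "x = Re (k * \<tau>)"
    have "\<bar>x\<bar> \<le> cmod (k * \<tau>)" unfolding x_def by (rule abs_Re_le_cmod)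
    also have "\<dots> \<le> 4 * pi" using ck t by (simp add: norm_mult)
    finally have x: "exp (2 * x) \<le> exp (8 * pi)" "exp (- 2 * x) \<le> exp (8 * pi)" by auto
    have ny: "cmod (1 - \<tau> * h \<tau>) = exp x" unfolding h[OF t0] x_def by simp
    have e: "(exp x)\<^sup>2 = exp (2 * x)" by (simp add: exp_double)
    have "(E + exp (2 * x)) * (1 + E * exp (2 * x)) = exp (2 * x) * ((1 + E * exp (- 2 * x)) * (1 + E * exp (2 * x)))"
      by (simp add: algebra_simps flip: exp_add mult.assoc)
    also have "\<dots> \<le> exp (2 * x) * (exp (E * exp (8 * pi)) * exp (E * exp (8 * pi)))"
    proof (intro mult_left_mono mult_mono)
      have "E * exp (- 2 * x) \<le> E * exp (8 * pi)" "E * exp (2 * x) \<le> E * exp (8 * pi)" using x E0 by auto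
      then show "1 + E * exp (- 2 * x) \<le> exp (E * exp (8 * pi))" "1 + E * exp (2 * x) \<le> exp (E * exp (8 * pi))"
        using exp_ge_add_one_self[of "E * exp (8 * pi)"] by linarith+
    qed (use E0 in auto)
    also have "\<dots> = (exp (x + E * exp (8 * pi)))\<^sup>2" by (simp add: power2_eq_square algebra_simps flip: exp_add)
    finally have "Tq E (1 - \<tau> * h \<tau>) \<le> sqrt ((exp (x + E * exp (8 * pi)))\<^sup>2)"
      unfolding Tq_def ny e by (rule real_sqrt_le_mono)
    then have "ln (Tq E (1 - \<tau> * h \<tau>)) \<le> ln (exp (x + E * exp (8 * pi)))"
      using Tq_pos[of "1 - \<tau> * h \<tau>"] by (simp del: ln_exp)
    then show "data E (Fin (h \<tau>), \<tau>) + fs_potential (h \<tau>) \<le> Re (k * \<tau>) + E * exp (8 * pi)"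
      unfolding data_chart[OF Fin_in_charts t0] by (simp add: Th_Fin x_def)
  qed (auto intro!: continuous_intros simp: norm_divide)
  moreover have "h (1/4) = (1 - y) / (1/4)"
    unfolding h_def k_def th(1) by (simp add: cis_conv_exp)
  moreover have "Re (k * (1/4)) = 0" by (simp add: k_def)
  moreover have "(1/4::complex) \<in> cball 0 1" by (simp add: norm_divide)
  ultimately show ?thesis using PF_eq[of "1/4" "h (1/4)"] unfolding Q_def by simp
qed

end

section \<open>Poles of holomorphic maps into the projective line\<close>

lemma range_Fin: "range Fin = - {Infty}"
  by (auto intro: p1.exhaust)

lemma range_chart_Infty: "range chart_Infty = - {Fin 0}"
proof -
  have "Fin z \<in> range chart_Infty" if "z \<noteq> 0" for z using that by (intro image_eqI[of _ _ "1 / z"]) (auto simp: chart_Infty_def)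
  moreover have "Infty \<in> range chart_Infty" by (intro image_eqI[of _ _ 0]) auto
  ultimately have "p \<in> range chart_Infty" if "p \<noteq> Fin 0" for p using that by (cases p) auto
  then show ?thesis by (auto simp: chart_Infty_def split: if_splits)
qed

lemma inv_Fin [simp]: "inv Fin (Fin z) = z"
  using inj_chart[OF Fin_in_charts] by (rule inv_f_f)

lemma inv_chart_Infty [simp]: "inv chart_Infty (Fin z) = 1 / z" if "z \<noteq> 0"
  using inv_f_f[OF inj_chart[OF chart_Infty_in_charts], of "1 / z"] that by (simp add: chart_Infty_def)

lemma inv_chart_Infty_Infty [simp]: "inv chart_Infty Infty = 0"
  using inv_f_f[OF inj_chart[OF chart_Infty_in_charts], of 0] by simp

lemma holomorphic_to_p1_finite:
  assumes g: "holomorphic_to_p1 g (ball 0 1)"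
  defines "G \<equiv> \<lambda>\<tau>. inv Fin (g \<tau>)" and "N \<equiv> \<lambda>\<tau>. inv chart_Infty (g \<tau>)"
  shows "open {\<tau>\<in>ball 0 1. g \<tau> \<noteq> Infty}" "G holomorphic_on {\<tau>\<in>ball 0 1. g \<tau> \<noteq> Infty}"
    and "open {\<tau>\<in>ball 0 1. g \<tau> \<noteq> Fin 0}" "N holomorphic_on {\<tau>\<in>ball 0 1. g \<tau> \<noteq> Fin 0}"
proof -
  have cg: "continuous_on (ball 0 1) g" using g by (simp add: holomorphic_to_p1_def)
  have o: "open (- {Infty})" "open (- {Fin 0})"
    unfolding range_Fin[symmetric] range_chart_Infty[symmetric] by (intro open_chart_image; simp)+
  have "open (ball 0 1 \<inter> g -` (- {Infty}))" "open (ball 0 1 \<inter> g -` (- {Fin 0}))"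
    by (intro continuous_open_preimage[OF cg] o open_ball)+
  moreover have "ball 0 1 \<inter> g -` (- {Infty}) = {\<tau>\<in>ball 0 1. g \<tau> \<noteq> Infty}" "ball 0 1 \<inter> g -` (- {Fin 0}) = {\<tau>\<in>ball 0 1. g \<tau> \<noteq> Fin 0}"
    by auto
  ultimately show "open {\<tau>\<in>ball 0 1. g \<tau> \<noteq> Infty}" "open {\<tau>\<in>ball 0 1. g \<tau> \<noteq> Fin 0}" by simp_all
  have "\<forall>c\<in>charts. (\<lambda>\<tau>. inv c (g \<tau>)) holomorphic_on {\<tau>\<in>ball 0 1. g \<tau> \<in> range c}"
    using g unfolding holomorphic_to_p1_def by blast
  from bspec[OF this Fin_in_charts] bspec[OF this chart_Infty_in_charts]
  show "G holomorphic_on {\<tau>\<in>ball 0 1. g \<tau> \<noteq> Infty}" "N holomorphic_on {\<tau>\<in>ball 0 1. g \<tau> \<noteq> Fin 0}"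
    unfolding G_def N_def range_Fin range_chart_Infty by simp_all
qed

text \<open>By the identity theorem for the coordinate at infinity, each pole is either isolated or
  interior to the set of poles. So within the disc the limit points of that set are its interior
  points, and connectedness leaves none once one value is finite.\<close>

lemma poles_sparse:
  assumes g: "holomorphic_to_p1 g (ball 0 1)" and t0: "\<tau>0 \<in> ball 0 1" "g \<tau>0 \<noteq> Infty"
  shows "{\<tau>\<in>ball 0 1. g \<tau> = Infty} sparse_in ball 0 1"
proof -
  define P where "P = {\<tau>\<in>ball 0 1. g \<tau> = Infty}"
  have PB: "P \<subseteq> ball 0 1" by (auto simp: P_def)
  define N where "N = (\<lambda>\<tau>. inv chart_Infty (g \<tau>))"
  note op = holomorphic_to_p1_finite[OF g]
  have fin: "\<not> y islimpt P" if "y \<in> ball 0 1" "g y \<noteq> Infty" for y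
  proof
    assume "y islimpt P"
    moreover have "y \<in> {\<tau>\<in>ball 0 1. g \<tau> \<noteq> Infty}" using that by simp
    ultimately obtain x where "x \<in> P" "x \<in> {\<tau>\<in>ball 0 1. g \<tau> \<noteq> Infty}" by (rule islimptE[OF _ _ op(1)]) blast
    then show False by (auto simp: P_def)
  qed
  have cover: "\<not> y islimpt P \<or> y \<in> interior P" if y: "y \<in> ball 0 1" for y
  proof (cases "g y = Infty")
    case True
    then have "y \<in> {\<tau>\<in>ball 0 1. g \<tau> \<noteq> Fin 0}" using y by simp
    then obtain R where R: "R > 0" "ball y R \<subseteq> {\<tau>\<in>ball 0 1. g \<tau> \<noteq> Fin 0}" using op(3) open_contains_ball by blast
    have hol: "N holomorphic_on ball y R" using op(4) R(2) unfolding N_def by (rule holomorphic_on_subset)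
    have N0: "N z = 0 \<longleftrightarrow> g z = Infty" if "z \<in> ball y R" for z
      using that R(2) unfolding N_def by (cases "g z") auto
    show ?thesis
    proof (cases "\<exists>\<beta>\<in>ball y R. N \<beta> \<noteq> 0")
      case True
      then obtain \<beta> where "\<beta> \<in> ball y R" "N \<beta> \<noteq> 0" by blast
      moreover have "N y = 0" using N0[of y] R(1) \<open>g y = Infty\<close> by simp
      ultimately obtain r where r: "0 < r" "ball y r \<subseteq> ball y R" "\<And>z. z \<in> ball y r - {y} \<Longrightarrow> N z \<noteq> 0"
        using isolated_zeros[OF hol open_ball connected_ball, of y \<beta>] R(1) by auto
      have "\<not> y islimpt P"
      proof
        assume "y islimpt P"
        then obtain x where "x \<in> P" "x \<in> ball y r" "x \<noteq> y" using r(1) by (auto elim: islimptE[of y P "ball y r"])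
        then show False using r N0[of x] by (auto simp: P_def)
      qed
      then show ?thesis ..
    next
      case False
      then have "ball y R \<subseteq> P" using N0 R(2) by (auto simp: P_def)
      then show ?thesis using R(1) interiorI[OF open_ball, of y y R P] by simp
    qed
  qed (use fin y in blast)
  have "interior P = {}"
  proof (rule ccontr)
    assume ne: "interior P \<noteq> {}"
    have "open (- {y. y islimpt P})" by (rule open_Compl[OF closed_limpts])
    moreover have "ball 0 1 \<subseteq> - {y. y islimpt P} \<union> interior P" using cover by auto
    moreover have "- {y. y islimpt P} \<inter> interior P \<inter> ball 0 1 = {}" using interior_limit_point by auto
    moreover have "interior P \<inter> ball 0 1 \<noteq> {}" using ne interior_subset[of P] PB by blast
    moreover have "- {y. y islimpt P} \<inter> ball 0 1 \<noteq> {}" using fin[OF t0] t0(1) by blast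
    ultimately show False using connectedD[OF connected_ball[of "0::complex" 1], of "- {y. y islimpt P}" "interior P"] by auto
  qed
  then show ?thesis unfolding sparse_in_open[OF open_ball] P_def[symmetric] using cover by auto
qed

text \<open>The real part is the Poisson kernel of the unit disc with pole at \<open>1\<close>.\<close>

definition pk :: "real \<Rightarrow> complex \<Rightarrow> complex" where
  "pk \<rho> q = (1 + of_real \<rho> * q) / (1 - of_real \<rho> * q)"

lemma pk_den:
  assumes "0 < \<rho>" "\<rho> < 1" "cmod q \<le> 1" shows "1 - \<rho> \<le> cmod (1 - of_real \<rho> * q)"
proof -
  have "cmod (of_real \<rho> * q) \<le> \<rho>" using assms by (simp add: norm_mult)
  then show ?thesis using norm_triangle_ineq2[of 1 "of_real \<rho> * q"] unfolding norm_one by linarith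
qed

lemma Re_pk:
  assumes "0 < \<rho>" "\<rho> < 1" "cmod q \<le> 1"
  shows "Re (pk \<rho> q) = (1 - \<rho>\<^sup>2 * (cmod q)\<^sup>2) / (cmod (1 - of_real \<rho> * q))\<^sup>2"
proof -
  let ?w = "of_real \<rho> * q"
  have "pk \<rho> q = (1 + ?w) * cnj (1 - ?w) / of_real ((cmod (1 - ?w))\<^sup>2)"
  proof -
    have "1 - ?w \<noteq> 0" using pk_den[OF assms] assms by auto
    then have "cnj (1 - ?w) \<noteq> 0" using complex_cnj_zero_iff[of "1 - ?w"] by blast
    then show ?thesis unfolding pk_def complex_norm_square by (rule nonzero_mult_divide_mult_cancel_right[symmetric])
  qed
  moreover have "Re ((1 + ?w) * cnj (1 - ?w)) = 1 - (cmod ?w)\<^sup>2"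
    unfolding cmod_power2 by (simp add: power2_eq_square algebra_simps)
  ultimately show ?thesis by (simp add: norm_mult power_mult_distrib)
qed

lemma Re_pk_bounds:
  assumes r: "0 < \<rho>" "\<rho> < 1" "cmod q \<le> 1"
  shows "0 \<le> Re (pk \<rho> q)" "Re (pk \<rho> q) \<le> 2 / (1 - \<rho>)"
proof -
  have "\<rho>\<^sup>2 * (cmod q)\<^sup>2 \<le> 1 * 1" using r by (intro mult_mono power_le_one) auto
  then show "0 \<le> Re (pk \<rho> q)" unfolding Re_pk[OF r] by simp
  have "Re (pk \<rho> q) \<le> cmod (pk \<rho> q)" by (rule complex_Re_le_cmod)
  also have "\<dots> = cmod (1 + of_real \<rho> * q) / cmod (1 - of_real \<rho> * q)" by (simp add: pk_def norm_divide)
  also have "\<dots> \<le> 2 / (1 - \<rho>)"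
  proof (rule frac_le)
    have "cmod (1 + of_real \<rho> * q) \<le> 1 + \<rho> * cmod q" using norm_triangle_ineq[of 1 "of_real \<rho> * q"] r by (simp add: norm_mult)
    also have "\<dots> \<le> 1 + 1 * 1" using r by (intro add_left_mono mult_mono) auto
    finally show "cmod (1 + of_real \<rho> * q) \<le> 2" by simp
  qed (use r pk_den[OF r] in auto)
  finally show "Re (pk \<rho> q) \<le> 2 / (1 - \<rho>)" .
qed

text \<open>Away from the pole the numerator 1 - \<rho>^2 makes the kernel O(1 - \<rho>), because at
  least half of the distance d survives in the denominator.\<close>

lemma Re_pk_small:
  assumes r: "0 < \<rho>" "\<rho> < 1" "cmod q = 1" and d: "0 < d" "d \<le> cmod (q - 1)" "1 - \<rho> \<le> d / 2"
  shows "Re (pk \<rho> q) \<le> 8 * (1 - \<rho>) / d\<^sup>2"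
proof -
  have "cmod (q - 1) \<le> cmod (1 - of_real \<rho> * q) + (1 - \<rho>)"
  proof -
    have "q - 1 = - (1 - of_real \<rho> * q) + of_real (1 - \<rho>) * q" by (simp add: algebra_simps)
    then have "cmod (q - 1) \<le> cmod (- (1 - of_real \<rho> * q)) + cmod (of_real (1 - \<rho>) * q)" by (metis norm_triangle_ineq)
    also have "cmod (of_real (1 - \<rho>) * q) = 1 - \<rho>" unfolding norm_mult norm_of_real using r by simp
    finally show ?thesis by (simp add: norm_minus_commute)
  qed
  then have "d / 2 \<le> cmod (1 - of_real \<rho> * q)" using d by linarith
  then have "(d / 2)\<^sup>2 \<le> (cmod (1 - of_real \<rho> * q))\<^sup>2" using d by (intro power_mono) auto
  moreover have "1 - \<rho>\<^sup>2 \<le> 2 * (1 - \<rho>)" using zero_le_power2[of "1 - \<rho>"] by (simp add: power2_eq_square algebra_simps)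
  ultimately have "(1 - \<rho>\<^sup>2) / (cmod (1 - of_real \<rho> * q))\<^sup>2 \<le> 2 * (1 - \<rho>) / (d / 2)\<^sup>2"
    using r d by (intro frac_le) auto
  also have "\<dots> = 8 * (1 - \<rho>) / d\<^sup>2" by (simp add: power_divide)
  finally show ?thesis using Re_pk[of \<rho> q] r by simp
qed

section \<open>Kiselman's minimum principle\<close>

context hele_shaw
begin

text \<open>Convexity in s in multiplicative form: multiplying \<tau> by exp \<sigma> lowers s by 2
  \<sigma>.\<close>

lemma Q_convex_shift:
  assumes \<tau>: "\<tau> \<noteq> 0" "cmod \<tau> < 1" "exp \<sigma> * cmod \<tau> < 1" and t: "0 \<le> t" "t \<le> 1"
  shows "Q y (exp (of_real (t * \<sigma>)) * \<tau>) - Q y \<tau> \<le> t * (Q y (exp (of_real \<sigma>) * \<tau>) - Q y \<tau>)"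
proof -
  define k where "k = (\<lambda>s. Q y (of_real (exp (- s / 2))))"
  define s where "s = - 2 * ln (cmod \<tau>)"
  have cn: "cmod \<tau> = exp (- s / 2)" using \<tau>(1) by (simp add: s_def)
  have eq: "Q y (exp (of_real x) * \<tau>) = k (s - 2 * x)" for x
  proof -
    have "cmod (exp (of_real x) * \<tau>) = exp (- (s - 2 * x) / 2)"
      by (simp add: norm_mult cn field_simps flip: exp_add)
    then show ?thesis unfolding k_def using Q_rot[of "exp (of_real x) * \<tau>" y] \<tau>(1) by simp
  qed
  have s0: "0 < s" using \<tau> by (simp add: s_def)
  have "ln (exp \<sigma> * cmod \<tau>) < 0" using \<tau> by simp
  then have s1: "0 < s - 2 * \<sigma>" using \<tau>(1) by (simp add: s_def ln_mult)
  have "k ((1 - t) *\<^sub>R s + t *\<^sub>R (s - 2 * \<sigma>)) \<le> (1 - t) * k s + t * k (s - 2 * \<sigma>)"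
    using convex_onD[OF Q_convex[of y], of t s "s - 2 * \<sigma>"] s0 s1 t unfolding k_def by simp
  moreover have "(1 - t) *\<^sub>R s + t *\<^sub>R (s - 2 * \<sigma>) = s - 2 * (t * \<sigma>)" by (simp add: algebra_simps)
  moreover have "Q y \<tau> = k s" using eq[of 0] by simp
  ultimately show ?thesis unfolding eq by (simp add: algebra_simps)
qed

text \<open>Kiselman's minimum principle, for the function of two variables $Q(f(\tau), \zeta)$ with
  $f(\tau) = 1 - \tau G(\tau)$, which depends on \<open>\<zeta>\<close> only through $|\zeta|$: were the inequality strict
  at a point of a circle, composing with $\zeta = \tau e^{F(\tau)}$, where \<open>Re F\<close> is a small multiple of
  the Poisson kernel of that point, would contradict the maximum principle.\<close>

lemma kiselman_step:
  assumes W: "open W" "\<And>\<tau>. \<tau> \<in> W \<Longrightarrow> \<tau> \<noteq> 0 \<and> cmod \<tau> < 1" and G: "G holomorphic_on W"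
    and H: "continuous_on W (\<lambda>\<tau>. PF (G \<tau>) \<tau>)" "\<And>a. a \<in> W \<Longrightarrow> super_mean_at (\<lambda>\<tau>. PF (G \<tau>) \<tau>) a"
    and a: "\<And>\<sigma>. exp \<sigma> * cmod a < 1 \<Longrightarrow> Q (1 - a * G a) a \<le> Q (1 - a * G a) (exp (of_real \<sigma>) * a) + 2 * c * \<sigma>"
    and r: "cball a r \<subseteq> W" "0 < r" and b: "cmod (b - a) = r" "exp \<sigma>0 * cmod b < 1"
  shows "Q (1 - b * G b) b \<le> Q (1 - b * G b) (exp (of_real \<sigma>0) * b) + 2 * c * \<sigma>0"
proof (rule ccontr)
  assume neg: "\<not> ?thesis"
  define f where "f = (\<lambda>\<tau>. 1 - \<tau> * G \<tau>)"
  define H where "H = (\<lambda>\<tau>. PF (G \<tau>) \<tau>)"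
  have QH: "Q (f \<tau>) \<tau> = H \<tau>" if "\<tau> \<in> W" for \<tau> using PF_Q[of \<tau> "G \<tau>"] W(2)[OF that] unfolding f_def H_def by simp
  \<comment> \<open>Negative values of K are violations of the minimum at \<zeta> = \<tau>. K is
    convex in \<sigma> and 0 at \<sigma> = 0, so a violation at \<sigma> entails one at t \<sigma>
    that is at least t times as large.\<close>
  define K where "K = (\<lambda>\<tau> \<sigma>. Q (f \<tau>) (exp (of_real \<sigma>) * \<tau>) + 2 * c * \<sigma> - H \<tau>)"
  have bW: "b \<in> W" using r(1) b(1) by (auto simp: dist_norm norm_minus_commute)
  have aW: "a \<in> W" using r by auto
  have Kb: "K b \<sigma>0 < 0" using neg QH[OF bW] unfolding K_def f_def by simp
  have Kconv: "K \<tau> (t * \<sigma>) \<le> t * K \<tau> \<sigma>" if "\<tau> \<in> W" "exp \<sigma> * cmod \<tau> < 1" "0 \<le> t" "t \<le> 1" for \<tau> t \<sigma>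
    using Q_convex_shift[of \<tau> \<sigma> t "f \<tau>"] W(2)[OF that(1)] that QH[OF that(1)] unfolding K_def by (simp add: algebra_simps)
  have Ka: "0 \<le> K a \<sigma>" if "exp \<sigma> * cmod a < 1" for \<sigma>
    using assms(6)[OF that] QH[OF aW] unfolding K_def f_def by simp
  obtain m where m: "0 < m" "m < 1" "\<And>\<tau>. \<tau> \<in> cball a r \<Longrightarrow> cmod \<tau> \<le> m"
  proof -
    obtain x where "x \<in> cball a r" "\<And>\<tau>. \<tau> \<in> cball a r \<Longrightarrow> cmod \<tau> \<le> cmod x"
      using continuous_attains_sup[OF compact_cball[of a r] _ continuous_on_norm_id] r(2) by auto
    moreover from this have "x \<in> W" using r(1) by auto
    ultimately show ?thesis using that[of "cmod x"] W(2)[of x] by auto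
  qed
  \<comment> \<open>Shrinks \<sigma>0 so that the whole closed disc stays inside the unit disc when
    multiplied by exp \<sigma>; the violation at b persists.\<close>
  define t0 where "t0 = min 1 (- ln m / (2 * (\<bar>\<sigma>0\<bar> + 1)))"
  have lm: "ln m < 0" using m by simp
  have "0 < - ln m / (2 * (\<bar>\<sigma>0\<bar> + 1))" using lm by (intro divide_pos_pos) auto
  then have t0: "0 < t0" "t0 \<le> 1" by (auto simp: t0_def)
  have t0s: "t0 * \<sigma>0 < - ln m"
  proof -
    have "t0 * \<sigma>0 \<le> t0 * (\<bar>\<sigma>0\<bar> + 1)" using t0 by (intro mult_left_mono) auto
    also have "\<dots> \<le> (- ln m / (2 * (\<bar>\<sigma>0\<bar> + 1))) * (\<bar>\<sigma>0\<bar> + 1)" by (intro mult_right_mono) (auto simp: t0_def)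
    also have "\<dots> = - ln m / 2" by (simp add: field_simps)
    also have "\<dots> < - ln m" using lm by simp
    finally show ?thesis .
  qed
  define \<sigma> where "\<sigma> = t0 * \<sigma>0"
  have esm: "exp \<sigma> * m < 1"
  proof -
    have "exp \<sigma> * m = exp (\<sigma> + ln m)" using m by (simp add: exp_add)
    then show ?thesis using t0s unfolding \<sigma>_def by simp
  qed
  have es: "exp \<sigma> * cmod \<tau> < 1" if "\<tau> \<in> cball a r" for \<tau>
    using le_less_trans[OF mult_left_mono[OF m(3)[OF that], of "exp \<sigma>"] esm] by simp
  have bC: "b \<in> cball a r" using b(1) by (simp add: dist_norm norm_minus_commute)
  have "K b \<sigma> \<le> t0 * K b \<sigma>0" unfolding \<sigma>_def using bW b(2) t0 by (intro Kconv) auto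
  also have "\<dots> < 0" using Kb t0 by (simp add: mult_pos_neg)
  finally have Kbs: "K b \<sigma> < 0" .
  define \<kappa> where "\<kappa> = - K b \<sigma> / 2"
  have k: "0 < \<kappa>" "K b \<sigma> < - \<kappa>" using Kbs by (auto simp: \<kappa>_def)
  have cG: "continuous_on (cball a r) G" using G r(1) by (meson continuous_on_subset holomorphic_on_imp_continuous_on)
  have cH: "continuous_on (cball a r) H" using H(1) r(1) unfolding H_def by (rule continuous_on_subset)
  have PFexp: "PF (G \<tau> * exp (- z)) (exp z * \<tau>) = Q (f \<tau>) (exp (of_real (Re z)) * \<tau>)" if "\<tau> \<in> W" for \<tau> z
  proof -
    have nz: "exp z * \<tau> \<noteq> 0" using W(2)[OF that] by simp
    have e: "exp z * \<tau> * (G \<tau> * exp (- z)) = \<tau> * G \<tau>" by (simp add: exp_minus)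
    have "PF (G \<tau> * exp (- z)) (exp z * \<tau>) = Q (f \<tau>) (exp z * \<tau>)" unfolding PF_Q[OF nz] e f_def ..
    also have "\<dots> = Q (f \<tau>) (exp (of_real (Re z)) * \<tau>)" by (rule Q_rot'[OF nz]) (simp add: norm_mult)
    finally show ?thesis .
  qed
  have uK: "usc_on (cball a r) (\<lambda>\<tau>. ereal (K \<tau> \<sigma>))"
  proof (rule usc_on_cong)
    show "usc_on (cball a r) (\<lambda>\<tau>. ereal (PF (G \<tau> * exp (- of_real \<sigma>)) (exp (of_real \<sigma>) * \<tau>)) + ereal (2 * c * \<sigma> - H \<tau>))"
    proof (intro usc_on_add_continuous PF_usc continuous_intros cG cH)
      show "(\<lambda>\<tau>. exp (of_real \<sigma>) * \<tau>) ` cball a r \<subseteq> cball 0 1"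
        using es by (auto simp: norm_mult less_imp_le)
    qed
    fix \<tau> assume "\<tau> \<in> cball a r"
    then show "ereal (K \<tau> \<sigma>) = ereal (PF (G \<tau> * exp (- of_real \<sigma>)) (exp (of_real \<sigma>) * \<tau>)) + ereal (2 * c * \<sigma> - H \<tau>)"
      using PFexp[of \<tau> "of_real \<sigma>"] r(1) by (auto simp: K_def)
  qed
  obtain \<delta> where \<delta>: "0 < \<delta>" "\<And>\<tau>. \<tau> \<in> cball a r \<Longrightarrow> dist \<tau> b < \<delta> \<Longrightarrow> K \<tau> \<sigma> < - \<kappa>"
    using usc_onD[OF uK bC, of "ereal (- \<kappa>)"] k(2) by auto
  obtain L where L: "0 \<le> L" "\<And>\<tau>. \<tau> \<in> cball a r \<Longrightarrow> K \<tau> \<sigma> \<le> L"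
  proof -
    obtain x where "x \<in> cball a r" "\<forall>y\<in>cball a r. ereal (K y \<sigma>) \<le> ereal (K x \<sigma>)"
      using usc_attains_sup[OF uK compact_cball] bC by blast
    then show ?thesis by (intro that[of "max 0 (K x \<sigma>)"]) (auto simp: le_max_iff_disj)
  qed
  define d where "d = \<delta> / r"
  have d: "0 < d" using \<delta> r by (simp add: d_def)
  \<comment> \<open>So close to 1 that away from b the Poisson kernel is at most B with (L +
    \<kappa>) B < \<kappa>: the gain \<kappa> near b outweighs the possible loss L elsewhere. The
    bound d / 2 is for \<open>Re_pk_small\<close>.\<close>
  define \<rho> where "\<rho> = 1 - min (1/2) (min (d / 2) (\<kappa> * d\<^sup>2 / (16 * (L + \<kappa>))))"
  have Lk: "0 < L + \<kappa>" using L k by simp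
  have mp: "0 < min (1/2) (min (d / 2) (\<kappa> * d\<^sup>2 / (16 * (L + \<kappa>))))" using d k Lk by auto
  have \<rho>: "0 < \<rho>" "\<rho> < 1" "1 - \<rho> \<le> d / 2" "1 - \<rho> \<le> \<kappa> * d\<^sup>2 / (16 * (L + \<kappa>))"
    using mp unfolding \<rho>_def by (auto simp: min_def split: if_splits)
  define B where "B = 8 * (1 - \<rho>) / d\<^sup>2"
  have B: "(L + \<kappa>) * B < \<kappa>"
  proof -
    have "(L + \<kappa>) * B \<le> (L + \<kappa>) * (8 * (\<kappa> * d\<^sup>2 / (16 * (L + \<kappa>))) / d\<^sup>2)"
      unfolding B_def using \<rho>(4) Lk d by (intro mult_left_mono divide_right_mono) auto
    also have "\<dots> = \<kappa> / 2"
    proof -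
      have gen: "x * (8 * (\<kappa> * y / (16 * x)) / y) = \<kappa> / 2" if "x \<noteq> 0" "y \<noteq> 0" for x y :: real
        using that by (simp add: field_simps)
      show ?thesis by (rule gen) (use Lk d in auto)
    qed
    finally show ?thesis using k by simp
  qed
  have B0: "0 \<le> B" using \<rho> by (simp add: B_def)
  \<comment> \<open>Maps the disc to the unit disc and b to 1, where the pole of the kernel is
    approached.\<close>
  define q where "q = (\<lambda>\<tau>. (\<tau> - a) * cnj (b - a) / of_real (r\<^sup>2))"
  have nq: "cmod (q \<tau>) = cmod (\<tau> - a) / r" for \<tau>
    using r(2) b(1) unfolding q_def by (simp add: norm_divide norm_mult power2_eq_square flip: complex_cnj_diff)
  have q1: "cmod (q \<tau>) \<le> 1" if "\<tau> \<in> cball a r" for \<tau>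
    using that r(2) unfolding nq by (simp add: dist_norm norm_minus_commute)
  have qb: "cmod (q \<tau> - 1) = cmod (\<tau> - b) / r" for \<tau>
  proof -
    have "(b - a) * cnj (b - a) = of_real (r\<^sup>2)" using b(1) complex_norm_square[of "b - a"] by simp
    then have "q b = 1" unfolding q_def using r(2) by simp
    then have "q \<tau> - 1 = q \<tau> - q b" by simp
    also have "\<dots> = (\<tau> - b) * cnj (b - a) / of_real (r\<^sup>2)"
      unfolding q_def by (simp only: diff_divide_distrib[symmetric] left_diff_distrib[symmetric]) simp
    finally show ?thesis using r(2) b(1) by (simp add: norm_divide norm_mult power2_eq_square flip: complex_cnj_diff)
  qed
  \<comment> \<open>The reciprocal of the bound 2 / (1 - \<rho>) for the kernel, so that T = \<eta>
    Re F0 takes values in [0, 1], where \<open>Kconv\<close> applies.\<close>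
  define \<eta> where "\<eta> = (1 - \<rho>) / 2"
  have \<eta>: "0 < \<eta>" using \<rho> by (simp add: \<eta>_def)
  define F0 where "F0 = (\<lambda>\<tau>. pk \<rho> (q \<tau>))"
  have holF0: "F0 holomorphic_on ball a r"
    unfolding F0_def pk_def q_def
  proof (intro holomorphic_intros)
    fix \<tau> assume "\<tau> \<in> ball a r"
    then show "1 - of_real \<rho> * ((\<tau> - a) * cnj (b - a) / of_real (r\<^sup>2)) \<noteq> 0"
      using pk_den[OF \<rho>(1,2) q1[of \<tau>]] \<rho>(2) by (auto simp: q_def)
  qed (use r in auto)
  have cF0: "continuous_on (cball a r) F0"
    unfolding F0_def pk_def q_def
  proof (intro continuous_intros ballI)
    fix \<tau> assume "\<tau> \<in> cball a r"
    then show "1 - of_real \<rho> * ((\<tau> - a) * cnj (b - a) / of_real (r\<^sup>2)) \<noteq> 0"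
      using pk_den[OF \<rho>(1,2) q1[of \<tau>]] \<rho>(2) by (auto simp: q_def)
  qed (use r in auto)
  define T where "T = (\<lambda>\<tau>. \<eta> * Re (F0 \<tau>))"
  have T: "0 \<le> T \<tau>" "T \<tau> \<le> 1" if "\<tau> \<in> cball a r" for \<tau>
  proof -
    show "0 \<le> T \<tau>" unfolding T_def F0_def using Re_pk_bounds(1)[OF \<rho>(1,2) q1[OF that]] \<eta> by simp
    have "T \<tau> \<le> \<eta> * (2 / (1 - \<rho>))" unfolding T_def F0_def using Re_pk_bounds(2)[OF \<rho>(1,2) q1[OF that]] \<eta> by (intro mult_left_mono) auto
    also have "\<dots> = 1" using \<rho> by (simp add: \<eta>_def)
    finally show "T \<tau> \<le> 1" .
  qed
  define F where "F = (\<lambda>\<tau>. of_real (\<eta> * \<sigma>) * F0 \<tau>)"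
  have ReF: "Re (F \<tau>) = T \<tau> * \<sigma>" for \<tau> unfolding F_def T_def by simp
  have esT: "exp (T \<tau> * \<sigma>) * cmod \<tau> < 1" if "\<tau> \<in> cball a r" for \<tau>
  proof -
    have "T \<tau> * \<sigma> \<le> max 0 \<sigma>"
    proof (cases "0 \<le> \<sigma>")
      case True
      then show ?thesis using mult_right_mono[OF T(2)[OF that] True] by simp
    next
      case False
      then show ?thesis using mult_nonneg_nonpos[OF T(1)[OF that], of \<sigma>] by simp
    qed
    then have "exp (T \<tau> * \<sigma>) * cmod \<tau> \<le> exp (max 0 \<sigma>) * cmod \<tau>" by (intro mult_right_mono) auto
    also have "\<dots> < 1" using es[OF that] W(2)[of \<tau>] r(1) that by (cases "0 \<le> \<sigma>") (auto simp: max_def)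
    finally show ?thesis .
  qed
  \<comment> \<open>On the circle K at the shift T \<sigma> is bounded by -\<kappa> T + (L +
    \<kappa>) \<eta> B. As T and Re F are harmonic inside, the bound carries over to the
    centre.\<close>
  define h where "h = (\<lambda>\<tau>. H \<tau> + (Re (of_real (- \<kappa> * \<eta>) * F0 \<tau>) + ((L + \<kappa>) * \<eta> * B - 2 * c * Re (F \<tau>))))"
  have "ereal (PF (G a * exp (- F a)) (exp (F a) * a)) \<le> ereal (h a)"
  proof (rule maximum_principle[where W="ball a r" and h=h and v="\<lambda>\<tau>. ereal (PF (G \<tau> * exp (- F \<tau>)) (exp (F \<tau>) * \<tau>))"])
    have cl: "closure (ball a r) = cball a r" using r(2) by simp
    show "usc_on (closure (ball a r)) (\<lambda>\<tau>. ereal (PF (G \<tau> * exp (- F \<tau>)) (exp (F \<tau>) * \<tau>)))"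
      unfolding cl
    proof (intro PF_usc)
      show "continuous_on (cball a r) (\<lambda>\<tau>. G \<tau> * exp (- F \<tau>))" "continuous_on (cball a r) (\<lambda>\<tau>. exp (F \<tau>) * \<tau>)"
        unfolding F_def by (intro continuous_intros cG cF0)+
      show "(\<lambda>\<tau>. exp (F \<tau>) * \<tau>) ` cball a r \<subseteq> cball 0 1"
        using esT by (auto simp: norm_mult ReF less_imp_le)
    qed
    fix x assume x: "x \<in> ball a r"
    have holG: "G holomorphic_on ball a r" using G r(1) ball_subset_cball by (meson holomorphic_on_subset)
    show "sub_at (\<lambda>\<tau>. ereal (PF (G \<tau> * exp (- F \<tau>)) (exp (F \<tau>) * \<tau>))) x"
    proof (rule PF_sub_at[OF open_ball x])
      show "(\<lambda>\<tau>. G \<tau> * exp (- F \<tau>)) holomorphic_on ball a r" "(\<lambda>\<tau>. exp (F \<tau>) * \<tau>) holomorphic_on ball a r"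
        unfolding F_def by (intro holomorphic_intros holG holF0)+
      show "cmod (exp (F z) * z) < 1" if "z \<in> ball a r" for z using esT[of z] that by (auto simp: norm_mult ReF)
    qed
    have "(\<lambda>\<tau>. of_real (- \<kappa> * \<eta>) * F0 \<tau>) holomorphic_on ball a r" "(\<lambda>\<tau>. of_real (- 2 * c) * F \<tau>) holomorphic_on ball a r"
      unfolding F_def by (intro holomorphic_intros holF0)+
    note hh = this
    have s: "super_mean_at (\<lambda>\<tau>. Re (of_real (- \<kappa> * \<eta>) * F0 \<tau>)) x"
      by (rule super_mean_at_holomorphic[OF hh(1) open_ball x])
    have s': "super_mean_at (\<lambda>\<tau>. Re (of_real (- 2 * c) * F \<tau>)) x"
      by (rule super_mean_at_holomorphic[OF hh(2) open_ball x])
    have "super_mean_at (\<lambda>\<tau>. H \<tau> + (Re (of_real (- \<kappa> * \<eta>) * F0 \<tau>) + ((L + \<kappa>) * \<eta> * B + Re (of_real (- 2 * c) * F \<tau>)))) x"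
    proof (intro super_mean_at_add s s' super_mean_at_const)
      have "x \<in> cball a r" using x by auto
      then show "super_mean_at H x" using r(1) H(2)[of x] unfolding H_def by blast
    qed
    then show "super_mean_at h x" unfolding h_def by simp
  next
    fix \<tau> assume "\<tau> \<in> frontier (ball a r)"
    then have t: "\<tau> \<in> sphere a r" using r(2) by (simp add: frontier_ball)
    then have tC: "\<tau> \<in> cball a r" by auto
    then have tW: "\<tau> \<in> W" using r(1) by auto
    have "K \<tau> (T \<tau> * \<sigma>) \<le> T \<tau> * K \<tau> \<sigma>" by (rule Kconv[OF tW es[OF tC] T[OF tC]])
    also have "\<dots> \<le> - \<kappa> * T \<tau> + (L + \<kappa>) * (\<eta> * B)"
    proof (cases "dist \<tau> b < \<delta>")
      case True
      then have "T \<tau> * K \<tau> \<sigma> \<le> T \<tau> * (- \<kappa>)" using \<delta>(2)[OF tC] T(1)[OF tC] by (intro mult_left_mono) auto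
      moreover have "0 \<le> (L + \<kappa>) * (\<eta> * B)" using Lk \<eta> B0 by simp
      ultimately show ?thesis by (simp add: mult.commute)
    next
      case False
      have q1': "cmod (q \<tau>) = 1" unfolding nq using t r(2) by (simp add: dist_norm norm_minus_commute)
      have dq: "d \<le> cmod (q \<tau> - 1)" unfolding qb d_def using False r(2) by (simp add: dist_norm divide_right_mono)
      have "Re (F0 \<tau>) \<le> B" unfolding F0_def B_def by (rule Re_pk_small[OF \<rho>(1,2) q1' d dq \<rho>(3)])
      then have TB: "T \<tau> \<le> \<eta> * B" unfolding T_def using \<eta> by simp
      have "T \<tau> * K \<tau> \<sigma> \<le> T \<tau> * L" using L(2)[OF tC] T(1)[OF tC] by (intro mult_left_mono) auto
      also have "\<dots> = - \<kappa> * T \<tau> + (L + \<kappa>) * T \<tau>" by (simp add: algebra_simps)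
      also have "\<dots> \<le> - \<kappa> * T \<tau> + (L + \<kappa>) * (\<eta> * B)" using TB Lk by (intro add_left_mono mult_left_mono) auto
      finally show ?thesis .
    qed
    finally have "Q (f \<tau>) (exp (of_real (T \<tau> * \<sigma>)) * \<tau>) \<le> h \<tau>"
      unfolding K_def h_def ReF unfolding T_def by (simp add: algebra_simps)
    then show "ereal (PF (G \<tau> * exp (- F \<tau>)) (exp (F \<tau>) * \<tau>)) \<le> ereal (h \<tau>)"
      unfolding PFexp[OF tW] ReF by simp
  next
    show "continuous_on (closure (ball a r)) h"
      unfolding h_def F_def using r(2) by (auto intro!: continuous_intros cH cF0)
  qed (use r in auto)
  then have "K a (T a * \<sigma>) \<le> - \<kappa> * T a + (L + \<kappa>) * (\<eta> * B)"
    unfolding PFexp[OF aW] ReF K_def h_def unfolding T_def by (simp add: algebra_simps)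
  \<comment> \<open>The kernel is 1 at the centre, so the bound there is \<eta> ((L + \<kappa>) B -
    \<kappa>), which is negative.\<close>
  also have "T a = \<eta>" unfolding T_def F0_def q_def pk_def by simp
  also have "- \<kappa> * \<eta> + (L + \<kappa>) * (\<eta> * B) = \<eta> * ((L + \<kappa>) * B - \<kappa>)" by (simp add: algebra_simps)
  also have "\<dots> < 0" using B \<eta> by (simp add: mult_pos_neg)
  finally have "K a (T a * \<sigma>) < 0" using \<open>T a = \<eta>\<close> by simp
  moreover have "0 \<le> K a (T a * \<sigma>)" using esT[of a] r(2) by (intro Ka) auto
  ultimately show False by simp
qed

end

lemma islimpt_ball_sparse_punctured:
  "P sparse_in ball (0::complex) 1 \<Longrightarrow> (P \<union> {0}) sparse_in ball 0 1"
  by (intro sparse_in_union') auto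

section \<open>Slopes, and the exclusion of discs through the open set\<close>

context hele_shaw
begin

text \<open>In terms of $y = 1 - \tau z$, the second inequality is the range of Buzano's inequality, which makes
  the slope at least $\frac14$; the last one makes it smaller than $1$.\<close>

definition bad_set :: "(p1 \<times> complex) set" where
  "bad_set = {(Fin z, \<tau>) | z \<tau>. \<tau> \<noteq> 0 \<and> 1 - \<tau> * z \<noteq> 1 \<and>
      cmod (1 - \<tau> * z + of_real E) < sqrt E * cmod (\<tau> * z) \<and>
      (cmod (\<tau> * z))\<^sup>2 < Tq E (1 - \<tau> * z) * (cmod \<tau>)\<^sup>2 * M}"

lemma Tq_sq: "(Tq E y)\<^sup>2 = (E + (cmod y)\<^sup>2) * (1 + E * (cmod y)\<^sup>2)"
  unfolding Tq_def using E0 by simp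

text \<open>c is a one-sided derivative of the convex function k at s0, taken as an infimum of
  difference quotients. Since u + s0/4 \<le> k s0 and k s \<le> u + s, letting s tend to 0 in the
  tangent inequality forces c \<ge> 1/4.\<close>

lemma slope_exists:
  assumes t0: "\<tau>0 \<noteq> 0" "cmod \<tau>0 < 1"
    and y: "y \<noteq> 1" "cmod (y + of_real E) \<le> sqrt E * cmod (1 - y)"
  obtains c where "1 / 4 \<le> c" "\<And>\<zeta>. \<zeta> \<noteq> 0 \<Longrightarrow> cmod \<zeta> < 1 \<Longrightarrow> Q y \<tau>0 + 2 * c * ln (cmod \<tau>0) \<le> Q y \<zeta> + 2 * c * ln (cmod \<zeta>)"
proof -
  define k where "k = (\<lambda>s. Q y (of_real (exp (- s / 2))))"
  define s0 where "s0 = - 2 * ln (cmod \<tau>0)"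
  have s0: "0 < s0" using t0 by (simp add: s0_def)
  have kQ: "Q y \<zeta> = k (- 2 * ln (cmod \<zeta>))" if "\<zeta> \<noteq> 0" for \<zeta>
    using Q_rot[OF that, of y] that unfolding k_def by simp
  obtain c where c: "\<And>s. 0 < s \<Longrightarrow> k s0 + c * (s - s0) \<le> k s"
  proof -
    have "convex_on {0<..} k" unfolding k_def by (rule Q_convex)
    then have "k s0 + Inf ((\<lambda>t. (k s0 - k t) / (s0 - t)) ` ({s0<..} \<inter> {0<..})) * (s - s0) \<le> k s" if "0 < s" for s
      using s0 that by (intro convex_le_Inf_differential) (auto simp: interior_open)
    then show ?thesis using that by blast
  qed
  define u where "u = ln (Tq E y)"
  have ex: "of_real (exp (- s / 2)) \<in> cball (0::complex) 1" "of_real (exp (- s / 2)) \<noteq> (0::complex)" if "0 < s" for s :: real using that by auto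
  have up: "k s \<le> u + s" if "0 < s" for s
    using Q_upper[OF ex[OF that], of y] unfolding k_def u_def by simp
  have lo: "u + s / 4 \<le> k s" if "0 < s" for s
    using Q_quarter[OF y ex[OF that]] unfolding k_def u_def by simp
  have "1 / 4 \<le> c"
  proof (rule ccontr)
    assume "\<not> ?thesis"
    then have c4: "0 < 1 / 4 - c" "0 < 1 - c" by auto
    \<comment> \<open>A value so small that (1 - c) s is half of (1/4 - c) s0.\<close>
    define s where "s = (1 / 4 - c) * s0 / (2 * (1 - c))"
    have s: "0 < s" unfolding s_def using c4 s0 by simp
    have "(u + s0 / 4) + c * (s - s0) \<le> u + s" using c[OF s] up[OF s] lo[OF s0] by linarith
    then have "(1 / 4 - c) * s0 \<le> (1 - c) * s" by (simp add: algebra_simps)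
    also have "\<dots> = (1 / 4 - c) * s0 / 2" unfolding s_def using c4 by (simp add: field_simps)
    finally have le: "(1 / 4 - c) * s0 \<le> (1 / 4 - c) * s0 / 2" .
    have False if "x \<le> x / 2" "0 < x" for x :: real using that by simp
    from this[OF le mult_pos_pos[OF c4(1) s0]] show False .
  qed
  moreover have "Q y \<tau>0 + 2 * c * ln (cmod \<tau>0) \<le> Q y \<zeta> + 2 * c * ln (cmod \<zeta>)" if "\<zeta> \<noteq> 0" "cmod \<zeta> < 1" for \<zeta>
    using c[of "- 2 * ln (cmod \<zeta>)"] that unfolding kQ[OF that(1)] kQ[OF t0(1)] s0_def by (simp add: algebra_simps)
  ultimately show thesis using that by blast
qed

theorem no_disc:
  assumes g: "holomorphic_to_p1 g (ball 0 1)"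
  defines "D \<equiv> {\<tau>\<in>ball 0 1. \<tau> \<noteq> 0 \<and> g \<tau> \<noteq> Infty}" and "G \<equiv> \<lambda>\<tau>. inv Fin (g \<tau>)"
  assumes H: "continuous_on D (\<lambda>\<tau>. PF (G \<tau>) \<tau>)" "\<And>a. a \<in> D \<Longrightarrow> super_mean_at (\<lambda>\<tau>. PF (G \<tau>) \<tau>) a"
  shows "disc_graph g \<inter> bad_set = {}"
proof (rule ccontr)
  assume "disc_graph g \<inter> bad_set \<noteq> {}"
  then obtain \<tau>0 z0 where t0: "\<tau>0 \<in> ball 0 1" "g \<tau>0 = Fin z0" "\<tau>0 \<noteq> 0" and y0: "1 - \<tau>0 * z0 \<noteq> 1"
      "cmod (1 - \<tau>0 * z0 + of_real E) < sqrt E * cmod (\<tau>0 * z0)"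
      "(cmod (\<tau>0 * z0))\<^sup>2 < Tq E (1 - \<tau>0 * z0) * (cmod \<tau>0)\<^sup>2 * M"
    unfolding disc_graph_def bad_set_def by auto
  define N where "N = (\<lambda>\<tau>. inv chart_Infty (g \<tau>))"
  note op = holomorphic_to_p1_finite[OF g, folded G_def N_def]
  define f where "f = (\<lambda>\<tau>. 1 - \<tau> * G \<tau>)"
  have GF: "g \<tau> = Fin (G \<tau>)" if "g \<tau> \<noteq> Infty" for \<tau> using that unfolding G_def by (cases "g \<tau>") auto
  \<comment> \<open>At 0 and at the poles neither the coordinate y nor ln|\<tau>| is under control,
    so they are removed; being sparse, they leave D open and connected.\<close>
  have D_eq: "D = ball 0 1 - ({\<tau>\<in>ball 0 1. g \<tau> = Infty} \<union> {0})" unfolding D_def by auto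
  have sparse: "({\<tau>\<in>ball 0 1. g \<tau> = Infty} \<union> {0}) sparse_in ball 0 1"
    by (intro islimpt_ball_sparse_punctured poles_sparse[OF g t0(1)]) (use t0 in auto)
  have conD: "connected D" unfolding D_eq by (intro sparse_imp_connected sparse) auto
  have oD: "open D" unfolding D_eq by (intro open_diff_sparse_pts sparse) auto
  have DW: "\<tau> \<noteq> 0 \<and> cmod \<tau> < 1" if "\<tau> \<in> D" for \<tau> using that unfolding D_def by auto
  have holG: "G holomorphic_on D" by (rule holomorphic_on_subset[OF op(2)]) (auto simp: D_def)
  have t0D: "\<tau>0 \<in> D" using t0 by (simp add: D_def)
  have f0: "f \<tau>0 = 1 - \<tau>0 * z0" "1 - f \<tau>0 = \<tau>0 * z0" using t0 by (simp_all add: f_def G_def)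
  have QH: "Q (f \<tau>) \<tau> = PF (G \<tau>) \<tau>" if "\<tau> \<in> D" for \<tau> using PF_Q[of \<tau> "G \<tau>"] DW[OF that] unfolding f_def by simp
  obtain c where c: "1 / 4 \<le> c" and c0: "\<And>\<zeta>. \<zeta> \<noteq> 0 \<Longrightarrow> cmod \<zeta> < 1 \<Longrightarrow> Q (f \<tau>0) \<tau>0 + 2 * c * ln (cmod \<tau>0) \<le> Q (f \<tau>0) \<zeta> + 2 * c * ln (cmod \<zeta>)"
  proof (rule slope_exists[of \<tau>0 "f \<tau>0"])
    show "cmod (f \<tau>0 + of_real E) \<le> sqrt E * cmod (1 - f \<tau>0)" unfolding f0 using y0(2) by simp
  qed (use t0 y0 f0 in auto)
  \<comment> \<open>The set of \<tau> at which c is still a slope of \<open>Q (f \<tau>)\<close>. It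
    contains \<tau>0; being open and closed in D, it is all of D.\<close>
  define Z where "Z = {\<tau>\<in>D. \<forall>\<zeta>. \<zeta> \<noteq> 0 \<and> cmod \<zeta> < 1 \<longrightarrow> Q (f \<tau>) \<tau> + 2 * c * ln (cmod \<tau>) \<le> Q (f \<tau>) \<zeta> + 2 * c * ln (cmod \<zeta>)}"
  have "open Z"
    unfolding open_contains_ball
  proof
    fix a assume a: "a \<in> Z"
    then have aD: "a \<in> D" by (simp add: Z_def)
    obtain R where R: "R > 0" "cball a R \<subseteq> D" using oD aD open_contains_cball by blast
    have az: "Q (f a) a + 2 * c * ln (cmod a) \<le> Q (f a) \<zeta> + 2 * c * ln (cmod \<zeta>)" if "\<zeta> \<noteq> 0" "cmod \<zeta> < 1" for \<zeta>
      using a that unfolding Z_def by blast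
    have "b \<in> Z" if b: "b \<in> ball a R" for b
    proof (cases "b = a")
      case False
      define r where "r = cmod (b - a)"
      have r: "0 < r" "cball a r \<subseteq> D" using False b R(2) unfolding r_def by (auto simp: dist_norm norm_minus_commute subset_iff)
      have bD: "b \<in> D" using r(2) unfolding r_def by (auto simp: dist_norm norm_minus_commute)
      have "Q (f b) b + 2 * c * ln (cmod b) \<le> Q (f b) \<zeta> + 2 * c * ln (cmod \<zeta>)" if z: "\<zeta> \<noteq> 0" "cmod \<zeta> < 1" for \<zeta>
      proof -
        define \<sigma> where "\<sigma> = ln (cmod \<zeta>) - ln (cmod b)"
        have es: "exp \<sigma> * cmod b = cmod \<zeta>" unfolding \<sigma>_def using z DW[OF bD] by (simp add: exp_diff)
        have "Q (1 - b * G b) b \<le> Q (1 - b * G b) (exp (of_real \<sigma>) * b) + 2 * c * \<sigma>"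
        proof (rule kiselman_step[OF oD DW holG H _ r(2,1)])
          show "Q (1 - a * G a) a \<le> Q (1 - a * G a) (exp (of_real \<sigma>) * a) + 2 * c * \<sigma>" if "exp \<sigma> * cmod a < 1" for \<sigma>
          proof -
            have nz: "exp (of_real \<sigma>) * a \<noteq> 0" "cmod (exp (of_real \<sigma>) * a) = exp \<sigma> * cmod a" using DW[OF aD] by (auto simp: norm_mult)
            then have "Q (f a) a + 2 * c * ln (cmod a) \<le> Q (f a) (exp (of_real \<sigma>) * a) + 2 * c * ln (exp \<sigma> * cmod a)"
              using az[OF nz(1)] that unfolding nz(2) by blast
            then show ?thesis using DW[OF aD] unfolding f_def by (simp add: ln_mult algebra_simps)
          qed
        qed (use r_def es z in auto)
        moreover have "Q (f b) (exp (of_real \<sigma>) * b) = Q (f b) \<zeta>"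
          by (rule Q_rot') (use DW[OF bD] es in \<open>auto simp: norm_mult\<close>)
        ultimately show ?thesis unfolding f_def \<sigma>_def by (simp add: algebra_simps)
      qed
      then show ?thesis using bD unfolding Z_def by blast
    qed (use a in simp)
    then show "\<exists>e>0. ball a e \<subseteq> Z" using R(1) by blast
  qed
  \<comment> \<open>A strict violation at some \<zeta> persists nearby:
    \<open>Q (f \<tau>) \<zeta>\<close> is upper semicontinuous in \<tau>, and
    \<open>Q (f \<tau>) \<tau>\<close> is continuous by the hypothesis on the disc.\<close>
  moreover have "open (D - Z)"
    unfolding open_contains_ball
  proof
    fix a assume a: "a \<in> D - Z"
    then have aD: "a \<in> D" by simp
    obtain \<zeta> where z: "\<zeta> \<noteq> 0" "cmod \<zeta> < 1" "Q (f a) \<zeta> + 2 * c * ln (cmod \<zeta>) < Q (f a) a + 2 * c * ln (cmod a)"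
      using a unfolding Z_def by force
    define h where "h = (\<lambda>\<tau>. 2 * c * ln (cmod \<zeta>) - PF (G \<tau>) \<tau> - 2 * c * ln (cmod \<tau>))"
    have ch: "continuous_on D h" unfolding h_def using H(1) DW by (intro continuous_intros) auto
    have "usc_on D (\<lambda>\<tau>. ereal (PF (\<tau> * G \<tau> / \<zeta>) \<zeta>) + ereal (h \<tau>))"
      using z holomorphic_on_imp_continuous_on[OF holG]
      by (intro usc_on_add_continuous PF_usc continuous_intros ch) auto
    note us = this
    have l0: "ereal (PF (a * G a / \<zeta>) \<zeta>) + ereal (h a) < 0"
      using z(3) QH[OF aD] unfolding Q_def f_def h_def by (simp add: zero_ereal_def)
    obtain d where d: "d > 0" "\<And>\<tau>. \<tau> \<in> D \<Longrightarrow> dist \<tau> a < d \<Longrightarrow> ereal (PF (\<tau> * G \<tau> / \<zeta>) \<zeta>) + ereal (h \<tau>) < 0"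
      using usc_onD[OF us aD l0] by blast
    obtain R where R: "R > 0" "ball a R \<subseteq> D" using oD aD open_contains_ball by blast
    have "\<tau> \<in> D - Z" if t: "\<tau> \<in> ball a (min d R)" for \<tau>
    proof -
      have tD: "\<tau> \<in> D" using t R(2) by auto
      have "Q (f \<tau>) \<zeta> + 2 * c * ln (cmod \<zeta>) < Q (f \<tau>) \<tau> + 2 * c * ln (cmod \<tau>)"
        using d(2)[OF tD] t QH[OF tD] unfolding Q_def f_def h_def by (auto simp: zero_ereal_def dist_commute)
      then show ?thesis using tD z unfolding Z_def by force
    qed
    then show "\<exists>e>0. ball a e \<subseteq> D - Z" using d(1) R(1) by (intro exI[of _ "min d R"]) auto
  qed
  moreover have "\<tau>0 \<in> Z" unfolding Z_def using t0D c0 by blast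
  moreover have ZD: "Z \<subseteq> D" by (auto simp: Z_def)
  ultimately have "D - Z = {}" using connectedD[OF conD, of Z "D - Z"] by blast
  then have Z: "Q (f \<tau>) \<tau> + 2 * c * ln (cmod \<tau>) \<le> Q (f \<tau>) \<zeta> + 2 * c * ln (cmod \<zeta>)" if "\<tau> \<in> D" "\<zeta> \<noteq> 0" "cmod \<zeta> < 1" for \<tau> \<zeta>
    using that unfolding Z_def by blast
  obtain r where r: "0 < r" "r < 1"
    "(cmod (1 - (- of_real r)))\<^sup>2 = M * Tq E (- of_real r)"
    "(cmod (1 - (- of_real (1 / r))))\<^sup>2 = M * Tq E (- of_real (1 / r))" by (rule contact_radius)
  have lncon: "2 * ln (cmod (1 - y)) = ln M + ln (Tq E y)" if "(cmod (1 - y))\<^sup>2 = M * Tq E y" for y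
  proof -
    have "y \<noteq> 1" using that M_pos Tq_pos[of y] by auto
    then have "ln ((cmod (1 - y))\<^sup>2) = 2 * ln (cmod (1 - y))" by (simp add: ln_realpow)
    then show ?thesis unfolding that using M_pos Tq_pos[of y] by (simp add: ln_mult)
  qed
  \<comment> \<open>For c \<ge> 1 the slope inequality survives the limit \<zeta> \<rightarrow> 0
    along the disc z = w0 / \<zeta> and bounds \<open>PI 0 0\<close> below by b. The disc through
    the contact point -r bounds it above by -ln M, against the last inequality of
    \<open>bad_set\<close>.\<close>
  have c1: "c < 1"
  proof (rule ccontr)
    assume "\<not> c < 1"
    then have cge: "1 \<le> c" by simp
    define w0 where "w0 = \<tau>0 * z0"
    have w0: "w0 \<noteq> 0" "1 - f \<tau>0 = w0" using y0(1) f0 by (auto simp: w0_def)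
    define b where "b = Q (f \<tau>0) \<tau>0 + 2 * ln (cmod \<tau>0) - 2 * ln (cmod w0)"
    have ge: "b \<le> PI (\<zeta> / w0) \<zeta>" if z: "\<zeta> \<noteq> 0" "cmod \<zeta> \<le> cmod \<tau>0" for \<zeta>
    proof -
      have z1: "cmod \<zeta> < 1" using z t0(1) by simp
      have "Q (f \<tau>0) \<zeta> = PI (\<zeta> / w0) \<zeta> - 2 * ln (cmod (\<zeta> / w0))"
        using PI_PF[of "\<zeta> / w0" \<zeta>] z w0 unfolding Q_def w0(2) by simp
      moreover have "ln (cmod (\<zeta> / w0)) = ln (cmod \<zeta>) - ln (cmod w0)" using z w0 by (simp add: norm_divide ln_div)
      moreover have "(c - 1) * ln (cmod \<zeta>) \<le> (c - 1) * ln (cmod \<tau>0)" using z cge t0 by (intro mult_left_mono) auto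
      ultimately show ?thesis using c0[OF z(1) z1] unfolding b_def by (simp add: algebra_simps)
    qed
    have "b \<le> PI 0 0"
    proof (rule ccontr)
      assume "\<not> b \<le> PI 0 0"
      have "usc_on (cball 0 1) (\<lambda>\<zeta>. ereal (PI (\<zeta> / w0) \<zeta>))" using w0 by (intro PI_usc continuous_intros) auto
      then obtain d where d: "d > 0" "\<And>\<zeta>. \<zeta> \<in> cball 0 1 \<Longrightarrow> dist \<zeta> 0 < d \<Longrightarrow> ereal (PI (\<zeta> / w0) \<zeta>) < ereal b"
        using usc_onD[of "cball 0 1" "\<lambda>\<zeta>. ereal (PI (\<zeta> / w0) \<zeta>)" 0 "ereal b"] \<open>\<not> b \<le> PI 0 0\<close> by auto
      define \<zeta> where "\<zeta> = complex_of_real (min (d / 2) (cmod \<tau>0))"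
      have "\<zeta> \<noteq> 0" "cmod \<zeta> \<le> cmod \<tau>0" "cmod \<zeta> < d" using d(1) t0(3) by (auto simp: \<zeta>_def min_def abs_if)
      moreover have "cmod \<zeta> \<le> 1" using \<open>cmod \<zeta> \<le> cmod \<tau>0\<close> t0(1) by simp
      ultimately show False using ge[of \<zeta>] d(2)[of \<zeta>] by simp
    qed
    also have "PI 0 0 \<le> - ln M"
    proof -
      define w where "w = 1 - (- complex_of_real r)"
      have w: "w \<noteq> 0"
      proof -
        have "w = of_real (1 + r)" by (simp add: w_def)
        then show ?thesis using r(1) by (simp only: of_real_eq_0_iff)
      qed
      have "2 * ln (cmod w) = ln M + ln (Tq E (1 - w))" using lncon[OF r(3)] unfolding w_def by simp
      moreover have "ereal (PI 0 0) \<le> ereal (ln (Tq E (1 - w)) - 2 * ln (cmod w))"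
        using upper_Infty_disc[OF w, of 0] PI_eq[of 0 0] by simp
      ultimately show ?thesis by simp
    qed
    finally have "Q (f \<tau>0) \<tau>0 + 2 * ln (cmod \<tau>0) + ln M \<le> 2 * ln (cmod w0)" unfolding b_def by simp
    moreover have "ln (Tq E (f \<tau>0)) \<le> Q (f \<tau>0) \<tau>0" using t0 by (intro Q_lower) auto
    ultimately have "ln (Tq E (f \<tau>0)) + 2 * ln (cmod \<tau>0) + ln M \<le> 2 * ln (cmod w0)" by simp
    moreover have "ln (Tq E (f \<tau>0) * (cmod \<tau>0)\<^sup>2 * M) = ln (Tq E (f \<tau>0)) + 2 * ln (cmod \<tau>0) + ln M"
      using Tq_pos[of "f \<tau>0"] M_pos t0(3) by (simp add: ln_mult ln_realpow)
    moreover have "ln ((cmod w0)\<^sup>2) = 2 * ln (cmod w0)" using w0 by (simp add: ln_realpow)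
    moreover have "ln ((cmod w0)\<^sup>2) < ln (Tq E (f \<tau>0) * (cmod \<tau>0)\<^sup>2 * M)"
      using y0(3) w0(1) unfolding f0 w0_def[symmetric] by (subst ln_less_cancel_iff) (auto intro: less_trans[rotated])
    ultimately show False by simp
  qed
  \<comment> \<open>At a contact point Q = u + s has slope 1, larger than c. So
    \<open>Q y \<zeta>\<close> + 2 c ln|\<zeta>| strictly decreases as |\<zeta>| grows and has no
    minimum in the punctured disc.\<close>
  have omit: "f \<tau> \<noteq> y" if tD: "\<tau> \<in> D" and con: "(cmod (1 - y))\<^sup>2 = M * Tq E y" for \<tau> y
  proof
    assume fy: "f \<tau> = y"
    have y1: "y \<noteq> 1" using con M_pos Tq_pos[of y] by auto
    have eq: "Q y \<zeta> = ln (Tq E y) - 2 * ln (cmod \<zeta>)" if "\<zeta> \<noteq> 0" "cmod \<zeta> < 1" for \<zeta>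
      using Q_upper[of \<zeta> y] Q_lower_M[of \<zeta> y] that y1 lncon[OF con] by simp
    define \<zeta> where "\<zeta> = complex_of_real ((1 + cmod \<tau>) / 2)"
    have n: "cmod \<zeta> = (1 + cmod \<tau>) / 2" unfolding \<zeta>_def norm_of_real by simp
    have z: "\<zeta> \<noteq> 0" "cmod \<zeta> < 1" "cmod \<tau> < cmod \<zeta>"
    proof -
      have "0 < cmod \<zeta>" unfolding n by (intro divide_pos_pos add_pos_nonneg) auto
      then show "\<zeta> \<noteq> 0" by auto
      show "cmod \<zeta> < 1" "cmod \<tau> < cmod \<zeta>" unfolding n using DW[OF tD] by auto
    qed
    have "(1 - c) * ln (cmod \<zeta>) \<le> (1 - c) * ln (cmod \<tau>)"
      using Z[OF tD z(1,2)] eq[OF z(1,2)] eq[of \<tau>] DW[OF tD] unfolding fy by (simp add: algebra_simps)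
    then have "ln (cmod \<zeta>) \<le> ln (cmod \<tau>)" using c1 by simp
    then show False using z DW[OF tD] by simp
  qed
  have y_r: "f \<tau> \<noteq> - of_real r" "f \<tau> \<noteq> - of_real (1 / r)" if "\<tau> \<in> D" for \<tau> using omit[OF that] r(3,4) by blast+
  \<comment> \<open>Near a pole at 0, \<open>Q (f \<tau>) \<tau>\<close> is at least 2 ln|G| up to a
    constant, while \<open>Q (f \<tau>) (1/2)\<close> is at most 2 ln|\<tau> G| up to a constant,
    |\<tau> G| being bounded below. The slope inequality between \<tau> and 1/2 then bounds (1 - c)
    ln|\<tau>| from below, which fails as \<tau> \<rightarrow> 0.\<close>
  have g0: "g 0 \<noteq> Infty"
  proof
    assume g0: "g 0 = Infty"
    then have N0: "N 0 = 0" by (simp add: N_def)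
    have "0 \<in> {\<tau>\<in>ball 0 1. g \<tau> \<noteq> Fin 0}" using g0 by simp
    then obtain R where R: "R > 0" "ball 0 R \<subseteq> {\<tau>\<in>ball 0 1. g \<tau> \<noteq> Fin 0}" using op(3) open_contains_ball by blast
    have "(N has_field_derivative deriv N 0) (at 0)"
      using op(3,4) \<open>0 \<in> {\<tau>\<in>ball 0 1. g \<tau> \<noteq> Fin 0}\<close> by (simp add: holomorphic_derivI)
    then have "(N has_derivative (*) (deriv N 0)) (at 0)" by (simp add: has_field_derivative_def)
    then obtain R1 where R1: "R1 > 0" "\<And>y. norm (y - 0) < R1 \<Longrightarrow> norm (N y - N 0 - deriv N 0 * (y - 0)) \<le> 1 * norm (y - 0)"
      unfolding has_derivative_at_alt using zero_less_one by blast
    define C where "C = cmod (deriv N 0) + 1"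
    have C: "0 < C" by (simp add: C_def add_nonneg_pos)
    have NC: "cmod (N \<tau>) \<le> C * cmod \<tau>" if "cmod \<tau> < R1" for \<tau>
    proof -
      have "cmod (N \<tau>) \<le> cmod (N \<tau> - deriv N 0 * \<tau>) + cmod (deriv N 0 * \<tau>)" using norm_triangle_sub[of "N \<tau>" "deriv N 0 * \<tau>"] by (simp add: add.commute)
      also have "\<dots> \<le> C * cmod \<tau>" using R1(2)[of \<tau>] that N0 by (simp add: C_def norm_mult algebra_simps)
      finally show ?thesis .
    qed
    define B where "B = ln (3 * (C\<^sup>2 + 1)) + ln M + 2 * ln 2"
    have key: "2 * (1 - c) * ln (cmod \<tau>) \<ge> - B" if t: "\<tau> \<in> D" "cmod \<tau> < R" "cmod \<tau> < R1" for \<tau>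
    proof -
      have gt: "g \<tau> = Fin (G \<tau>)" "G \<tau> \<noteq> 0" using t GF[of \<tau>] R(2) unfolding D_def by force+
      have NG: "N \<tau> = 1 / G \<tau>" using gt unfolding N_def by simp
      have tn: "\<tau> \<noteq> 0" "cmod \<tau> < 1" using DW[OF t(1)] by auto
      define w where "w = \<tau> * G \<tau>"
      have w: "w \<noteq> 0" using gt tn by (simp add: w_def)
      have fw: "f \<tau> = 1 - w" by (simp add: f_def w_def)
      have "1 \<le> C * cmod w" using NC[OF t(3)] gt(2) unfolding NG w_def by (simp add: norm_divide norm_mult field_simps)
      then have "1\<^sup>2 \<le> (C * cmod w)\<^sup>2" by (intro power_mono) auto
      then have Cw: "1 \<le> C\<^sup>2 * (cmod w)\<^sup>2" by (simp add: power_mult_distrib)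
      have Tq: "Tq E (1 - w) \<le> 3 * (C\<^sup>2 + 1) * (cmod w)\<^sup>2"
      proof -
        have "Th E (w / \<tau>') 1 \<tau>' \<le> 3 * ((cmod (w / \<tau>'))\<^sup>2 + (cmod 1)\<^sup>2)" if "\<tau>' = 1" for \<tau>'
          using that by (intro Th_le) auto
        from this[of 1] have "Tq E (1 - w) \<le> 3 * ((cmod w)\<^sup>2 + 1)" by (simp add: Th_Fin)
        also have "\<dots> \<le> 3 * (C\<^sup>2 + 1) * (cmod w)\<^sup>2" using Cw by (simp add: algebra_simps)
        finally show ?thesis .
      qed
      have "ln (Tq E (1 - w)) \<le> ln (3 * (C\<^sup>2 + 1) * (cmod w)\<^sup>2)" using Tq Tq_pos[of "1 - w"] by (intro ln_mono) auto
      also have "\<dots> = ln (3 * (C\<^sup>2 + 1)) + ln ((cmod w)\<^sup>2)"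
        using w by (intro ln_mult_pos) (auto intro!: mult_pos_pos add_nonneg_pos)
      also have "ln ((cmod w)\<^sup>2) = 2 * ln (cmod w)" using w by (simp add: ln_realpow)
      finally have lT: "ln (Tq E (1 - w)) \<le> ln (3 * (C\<^sup>2 + 1)) + 2 * ln (cmod w)" .
      have lw: "ln (cmod w) = ln (cmod \<tau>) + ln (cmod (G \<tau>))" unfolding w_def using gt tn by (simp add: norm_mult ln_mult)
      have half: "cmod (1/2 :: complex) = 1/2" by (simp add: norm_divide)
      have "Q (1 - w) (1/2) \<le> ln (Tq E (1 - w)) + 2 * ln 2"
        using Q_upper[of "1/2" "1 - w"] half by (simp add: ln_div)
      moreover have "Q (1 - w) \<tau> + 2 * c * ln (cmod \<tau>) \<le> Q (1 - w) (1/2) + 2 * c * ln (1/2)"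
        using Z[OF t(1), of "1/2"] half unfolding fw by simp
      moreover have "2 * c * ln (1/2) \<le> 0" using c by (simp add: ln_div)
      moreover have "- ln M + 2 * ln (cmod (G \<tau>)) \<le> Q (1 - w) \<tau>"
      proof -
        have "eln (1 / M * (cmod (G \<tau>))\<^sup>2) \<le> \<Phi> (Fin (G \<tau>), \<tau>) + ereal (fs_potential (G \<tau>))"
          using lower_M[of Fin "G \<tau>" \<tau>] by simp
        then have "ln (1 / M * (cmod (G \<tau>))\<^sup>2) \<le> PF (G \<tau>) \<tau>"
          using PF_eq[of \<tau> "G \<tau>"] tn M_pos gt(2) by (simp add: eln_pos)
        then show ?thesis using QH[OF t(1)] fw M_pos gt(2) by (simp add: ln_mult ln_div ln_realpow)
      qed
      ultimately show ?thesis using lT lw unfolding B_def by (simp add: algebra_simps)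
    qed
    have "0 islimpt D"
    proof -
      have "\<not> 0 islimpt ({\<tau>\<in>ball 0 1. g \<tau> = Infty} \<union> {0})" using sparse unfolding sparse_in_open[OF open_ball] by auto
      moreover have "(0::complex) islimpt ball 0 1" by (simp add: islimpt_ball)
      moreover have "ball 0 1 \<subseteq> D \<union> ({\<tau>\<in>ball 0 1. g \<tau> = Infty} \<union> {0})" unfolding D_eq by auto
      ultimately show ?thesis using islimpt_subset[of 0 "ball 0 1" "D \<union> ({\<tau>\<in>ball 0 1. g \<tau> = Infty} \<union> {0})"]
        unfolding islimpt_Un[of 0 D] by blast
    qed
    define e where "e = min (min R R1) (exp (- (B + 1) / (2 * (1 - c))))"
    have e: "0 < e" using R(1) R1(1) by (simp add: e_def)
    have "\<exists>x\<in>D. x \<noteq> 0 \<and> dist x 0 < e"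
      using \<open>0 islimpt D\<close> e unfolding islimpt_approachable by blast
    then obtain \<tau> where t: "\<tau> \<in> D" "cmod \<tau> < e" by auto
    have "ln (cmod \<tau>) < ln (exp (- (B + 1) / (2 * (1 - c))))"
      using t DW[OF t(1)] unfolding e_def by (subst ln_less_cancel_iff) auto
    then have "2 * (1 - c) * ln (cmod \<tau>) < 2 * (1 - c) * (- (B + 1) / (2 * (1 - c)))"
      unfolding ln_exp using c1 by (intro mult_strict_left_mono) auto
    also have "\<dots> = - (B + 1)" using c1 by simp
    finally show False using key[OF t(1)] t(2) unfolding e_def by simp
  qed
  \<comment> \<open>Homogeneous versions of f + r and 1 + r f, so that F is defined at the poles of
    g as well, with value 1/r there.\<close>
  define num where "num = (\<lambda>\<tau>. (1 + of_real r) * hY (g \<tau>) - \<tau> * hX (g \<tau>))"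
  define den where "den = (\<lambda>\<tau>. (1 + of_real r) * hY (g \<tau>) - of_real r * \<tau> * hX (g \<tau>))"
  define F where "F = (\<lambda>\<tau>. num \<tau> / den \<tau>)"
  have rr: "1 + complex_of_real r \<noteq> 0"
  proof -
    have "1 + complex_of_real r = of_real (1 + r)" by simp
    then show ?thesis using r(1) by (simp only: of_real_eq_0_iff)
  qed
  have nd: "num \<tau> \<noteq> 0 \<and> den \<tau> \<noteq> 0" if t: "\<tau> \<in> ball 0 1" for \<tau>
  proof (cases "g \<tau> = Infty")
    case True
    then have "\<tau> \<noteq> 0" using g0 by auto
    then show ?thesis using True r(1) by (simp add: num_def den_def)
  next
    case False
    show ?thesis
    proof (cases "\<tau> = 0")
      case True
      then show ?thesis using GF[OF False] rr by (simp add: num_def den_def)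
    next
      case nz: False
      then have tD: "\<tau> \<in> D" using False t by (simp add: D_def)
      have n: "num \<tau> = f \<tau> + of_real r" "den \<tau> = 1 + of_real r * f \<tau>"
        unfolding num_def den_def f_def GF[OF False] by (simp_all add: algebra_simps)
      have "f \<tau> + of_real r \<noteq> 0" using y_r(1)[OF tD] by (simp add: add_eq_0_iff2)
      moreover have "1 + of_real r * f \<tau> \<noteq> 0"
      proof
        assume "1 + of_real r * f \<tau> = 0"
        then have "of_real r * f \<tau> = - 1" by (simp add: add_eq_0_iff)
        then have "f \<tau> = - 1 / of_real r" using r(1) by (simp add: field_simps)
        then show False using y_r(2)[OF tD] by simp
      qed
      ultimately show ?thesis unfolding n by simp
    qed
  qed
  have holF: "F holomorphic_on ball 0 1"
  proof -
    have "F holomorphic_on {\<tau>\<in>ball 0 1. g \<tau> \<noteq> Infty}"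
    proof (rule holomorphic_transform)
      show "(\<lambda>\<tau>. ((1 + of_real r) - \<tau> * G \<tau>) / ((1 + of_real r) - of_real r * \<tau> * G \<tau>)) holomorphic_on {\<tau>\<in>ball 0 1. g \<tau> \<noteq> Infty}"
      proof (intro holomorphic_intros op(2))
        fix \<tau> assume "\<tau> \<in> {\<tau>\<in>ball 0 1. g \<tau> \<noteq> Infty}"
        then show "(1 + of_real r) - of_real r * \<tau> * G \<tau> \<noteq> 0" using nd[of \<tau>] GF[of \<tau>] by (auto simp: den_def)
      qed
      fix \<tau> assume "\<tau> \<in> {\<tau>\<in>ball 0 1. g \<tau> \<noteq> Infty}"
      then show "((1 + of_real r) - \<tau> * G \<tau>) / ((1 + of_real r) - of_real r * \<tau> * G \<tau>) = F \<tau>"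
        using GF[of \<tau>] by (simp add: F_def num_def den_def)
    qed
    moreover have "F holomorphic_on {\<tau>\<in>ball 0 1. g \<tau> \<noteq> Fin 0}"
    proof -
      \<comment> \<open>In the chart at infinity numerator and denominator share the nonzero factor
        k, which cancels in F.\<close>
      have e: "hX (g \<tau>) = k \<and> hY (g \<tau>) = k * N \<tau>" if "k = (if g \<tau> = Infty then 1 else G \<tau>)" "g \<tau> \<noteq> Fin 0" for \<tau> k
        using that unfolding N_def G_def by (cases "g \<tau>") auto
      have nd': "num \<tau> = k * ((1 + of_real r) * N \<tau> - \<tau>) \<and> den \<tau> = k * ((1 + of_real r) * N \<tau> - of_real r * \<tau>) \<and> k \<noteq> 0"
        if "k = (if g \<tau> = Infty then 1 else G \<tau>)" "g \<tau> \<noteq> Fin 0" for \<tau> k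
        using e[OF that] that unfolding num_def den_def G_def by (cases "g \<tau>") (auto simp: algebra_simps)
      show ?thesis
      proof (rule holomorphic_transform)
        show "(\<lambda>\<tau>. ((1 + of_real r) * N \<tau> - \<tau>) / ((1 + of_real r) * N \<tau> - of_real r * \<tau>)) holomorphic_on {\<tau>\<in>ball 0 1. g \<tau> \<noteq> Fin 0}"
        proof (intro holomorphic_intros op(4))
          fix \<tau> assume "\<tau> \<in> {\<tau>\<in>ball 0 1. g \<tau> \<noteq> Fin 0}"
          then show "(1 + of_real r) * N \<tau> - of_real r * \<tau> \<noteq> 0" using nd[of \<tau>] nd'[OF refl, of \<tau>] by auto
        qed
        fix \<tau> assume "\<tau> \<in> {\<tau>\<in>ball 0 1. g \<tau> \<noteq> Fin 0}"
        then show "((1 + of_real r) * N \<tau> - \<tau>) / ((1 + of_real r) * N \<tau> - of_real r * \<tau>) = F \<tau>"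
          using nd'[OF refl, of \<tau>] unfolding F_def by auto
      qed
    qed
    ultimately have "F holomorphic_on {\<tau>\<in>ball 0 1. g \<tau> \<noteq> Infty} \<union> {\<tau>\<in>ball 0 1. g \<tau> \<noteq> Fin 0}"
      by (intro holomorphic_on_Un op)
    moreover have "{\<tau>\<in>ball 0 1. g \<tau> \<noteq> Infty} \<union> {\<tau>\<in>ball 0 1. g \<tau> \<noteq> Fin 0} = ball 0 1" by auto
    ultimately show ?thesis by simp
  qed
  have F0: "F 0 = 1" using GF[OF g0] rr by (simp add: F_def num_def den_def)
  have sub: "cball (0::complex) (1/2) \<subseteq> ball 0 1" by auto
  have cF: "continuous_on (cball 0 (1/2)) F" using holF sub by (meson continuous_on_subset holomorphic_on_imp_continuous_on)
  \<comment> \<open>As r < 1, |F| = 1 means |f| = 1. The slope inequality between |\<tau>| = 1/2 and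
    1/4 would then give 2 c ln 2 \<le> \<open>Q (f \<tau>) (1/4)\<close>, since Q \<ge> u \<ge> 0 on
    |y| = 1, and this contradicts \<open>Q_ring\<close> and \<open>E2\<close>.\<close>
  have ne1: "cmod (F \<tau>) \<noteq> 1" if t: "\<tau> \<in> sphere 0 (1/2)" for \<tau>
  proof (cases "g \<tau> = Infty")
    case True
    have "\<tau> \<noteq> 0" using t by auto
    then have "F \<tau> = 1 / of_real r" using True r(1) by (simp add: F_def num_def den_def)
    then show ?thesis using r by (simp add: norm_divide)
  next
    case False
    have tb: "\<tau> \<in> ball 0 1" "\<tau> \<noteq> 0" using t by auto
    then have tD: "\<tau> \<in> D" using False by (simp add: D_def)
    have n: "num \<tau> = f \<tau> + of_real r" "den \<tau> = 1 + of_real r * f \<tau>"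
      unfolding num_def den_def f_def GF[OF False] by (simp_all add: algebra_simps)
    show ?thesis
    proof
      assume "cmod (F \<tau>) = 1"
      then have "cmod (f \<tau> + of_real r) = cmod (1 + of_real r * f \<tau>)"
        using nd[OF tb(1)] unfolding F_def n norm_divide by (simp add: divide_eq_1_iff)
      then have "(cmod (f \<tau> + of_real r))\<^sup>2 = (cmod (1 + of_real r * f \<tau>))\<^sup>2" by simp
      then have "(1 - r\<^sup>2) * ((cmod (f \<tau>))\<^sup>2 - 1) = 0"
        unfolding cmod_power2 by (simp add: power2_eq_square algebra_simps)
      moreover have "r\<^sup>2 < 1" using r by (simp add: power_less_one_iff)
      ultimately have "(cmod (f \<tau>))\<^sup>2 = 1" by simp
      then have f1: "cmod (f \<tau>) = 1" using power2_eq_imp_eq[of "cmod (f \<tau>)" 1] by simp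
      have q: "cmod (1/4 :: complex) = 1/4" by (simp add: norm_divide)
      have "Q (f \<tau>) \<tau> + 2 * c * ln (1/2) \<le> Q (f \<tau>) (1/4) + 2 * c * ln (1/4)"
      proof -
        have n: "cmod \<tau> = 1/2" using t by simp
        show ?thesis using Z[OF tD, of "1/4"] unfolding n q by simp
      qed
      moreover have "ln (1/4 :: real) = 2 * ln (1/2)"
      proof -
        have "(1/4 :: real) = (1/2)^2" by (simp add: power2_eq_square)
        then show ?thesis by (simp only: ln_realpow)
      qed
      moreover have "ln (1/2 :: real) = - ln 2" by (simp add: ln_div)
      moreover have "Q (f \<tau>) (1/4) \<le> E * exp (8 * pi)" by (rule Q_ring[OF f1])
      moreover have "0 \<le> Q (f \<tau>) \<tau>"
      proof -
        have "1 \<le> (Tq E (f \<tau>))\<^sup>2" unfolding Tq_sq f1 using E0 by (simp add: algebra_simps)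
        then have "1 \<le> Tq E (f \<tau>)" using Tq_pos[of "f \<tau>"] by (intro power2_le_imp_le[of 1]) auto
        then have "0 \<le> ln (Tq E (f \<tau>))" by simp
        also have "\<dots> \<le> Q (f \<tau>) \<tau>" using tb by (intro Q_lower) auto
        finally show ?thesis .
      qed
      moreover have "1/4 * ln 2 \<le> c * ln 2" using c by (intro mult_right_mono) auto
      ultimately show False using E2 by (simp add: algebra_simps)
    qed
  qed
  have small: "cmod (h 0) < 1" if h: "h holomorphic_on ball 0 1" "\<And>\<tau>. \<tau> \<in> sphere 0 (1/2) \<Longrightarrow> cmod (h \<tau>) < 1" for h
  proof -
    have ch: "continuous_on (cball 0 (1/2)) h" using h(1) sub by (meson continuous_on_subset holomorphic_on_imp_continuous_on)
    have "continuous_on (sphere 0 (1/2)) (\<lambda>\<tau>. cmod (h \<tau>))"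
      by (intro continuous_intros continuous_on_subset[OF ch]) auto
    then obtain x where x: "x \<in> sphere 0 (1/2)" "\<forall>y\<in>sphere 0 (1/2). cmod (h y) \<le> cmod (h x)"
      using continuous_attains_sup[OF compact_sphere[of "0::complex" "1/2"]] by fastforce
    have "cmod (h 0) \<le> cmod (h x)"
    proof (rule maximum_modulus_frontier[of h "ball 0 (1/2)"])
      show "h holomorphic_on interior (ball 0 (1/2))" using h(1) by (simp add: interior_open) (rule holomorphic_on_subset, auto)
    qed (use ch x in \<open>auto simp: frontier_ball\<close>)
    then show ?thesis using h(2)[OF x(1)] by simp
  qed
  \<comment> \<open>By connectedness |F| stays on one side of 1 over the whole circle, so
    \<open>small\<close> applies to F or to 1 / F, both of which equal 1 at 0.\<close>
  have "connected ((\<lambda>\<tau>. cmod (F \<tau>)) ` sphere 0 (1/2))"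
    by (intro connected_continuous_image continuous_intros continuous_on_subset[OF cF] connected_sphere) auto
  moreover have "1 \<notin> (\<lambda>\<tau>. cmod (F \<tau>)) ` sphere 0 (1/2)" using ne1 by force
  ultimately
  consider "\<And>\<tau>. \<tau> \<in> sphere 0 (1/2) \<Longrightarrow> cmod (F \<tau>) < 1" | "\<And>\<tau>. \<tau> \<in> sphere 0 (1/2) \<Longrightarrow> 1 < cmod (F \<tau>)"
  proof -
    let ?S = "(\<lambda>\<tau>. cmod (F \<tau>)) ` sphere 0 (1/2)"
    have iv: "1 \<in> ?S" if "x \<in> ?S" "y \<in> ?S" "x \<le> 1" "1 \<le> y" for x y
      using \<open>connected ?S\<close> that unfolding connected_iff_interval by blast
    show thesis
    proof (cases "\<exists>x\<in>?S. x \<le> 1")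
      case True
      then have "y < 1" if "y \<in> ?S" for y using iv that \<open>1 \<notin> ?S\<close> linorder_not_le by blast
      then show ?thesis using that(1) by blast
    next
      case False
      then have "1 < y" if "y \<in> ?S" for y using that linorder_not_le by blast
      then show ?thesis using that(2) by blast
    qed
  qed
  then show False
  proof cases
    case 1
    then show False using small[OF holF] F0 by simp
  next
    case 2
    have "(\<lambda>\<tau>. 1 / F \<tau>) holomorphic_on ball 0 1"
      using nd by (intro holomorphic_intros holF) (auto simp: F_def)
    moreover have "cmod (1 / F \<tau>) < 1" if "\<tau> \<in> sphere 0 (1/2)" for \<tau>
    proof -
      have "0 < cmod (F \<tau>)" using 2[OF that] by linarith
      then show ?thesis using 2[OF that] by (simp add: norm_divide divide_less_eq_1_pos)
    qed
    ultimately show False using small[of "\<lambda>\<tau>. 1 / F \<tau>"] F0 by simp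
  qed
qed

end

section \<open>Smooth functions\<close>

lemma C_k_SucI:
  assumes "\<And>x. (f has_derivative f' x) (at x)" "\<And>v. C_k k (\<lambda>x. f' x v)"
  shows "C_k (Suc k) f"
proof -
  have "frechet_derivative f (at x) = f' x" for x
    using frechet_derivative_at[OF assms(1)[of x]] by simp
  then show ?thesis using assms unfolding C_k.simps differentiable_def by auto
qed

lemma C_k_SucD:
  assumes "C_k (Suc k) f"
  shows "(f has_derivative frechet_derivative f (at x)) (at x)" "C_k k (\<lambda>x. frechet_derivative f (at x) v)"
  using assms frechet_derivative_works by auto

lemma C_k_lower: "C_k (Suc k) f \<Longrightarrow> C_k k f"
proof (induction k arbitrary: f)
  case 0
  then have "f differentiable (at x)" for x by simp
  then show ?case by (simp add: continuous_at_imp_continuous_on differentiable_imp_continuous_within)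
next
  case (Suc k)
  show ?case
  proof (rule C_k_SucI)
    show "(f has_derivative frechet_derivative f (at x)) (at x)" for x by (rule C_k_SucD(1)[OF Suc.prems])
    show "C_k k (\<lambda>x. frechet_derivative f (at x) v)" for v
      by (rule Suc.IH[OF C_k_SucD(2)[OF Suc.prems]])
  qed
qed

lemma C_k_const [simp]: "C_k k (\<lambda>x. c)"
proof (induction k arbitrary: c)
  case (Suc k)
  show ?case by (rule C_k_SucI[where f'="\<lambda>x v. 0"]) (use Suc in auto)
qed auto

lemma C_k_add: "C_k k f \<Longrightarrow> C_k k g \<Longrightarrow> C_k k (\<lambda>x. f x + g x)"
proof (induction k arbitrary: f g)
  case (Suc k)
  show ?case
    by (rule C_k_SucI[OF has_derivative_add[OF C_k_SucD(1)[OF Suc.prems(1)] C_k_SucD(1)[OF Suc.prems(2)]]])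
       (intro Suc.IH C_k_SucD(2)[OF Suc.prems(1)] C_k_SucD(2)[OF Suc.prems(2)])
qed (auto intro: continuous_intros)

lemma C_k_mult: "C_k k f \<Longrightarrow> C_k k g \<Longrightarrow> C_k k (\<lambda>x. f x * g x)"
proof (induction k arbitrary: f g)
  case (Suc k)
  show ?case
    by (rule C_k_SucI[OF has_derivative_mult[OF C_k_SucD(1)[OF Suc.prems(1)] C_k_SucD(1)[OF Suc.prems(2)]]])
       (rule C_k_add[OF Suc.IH[OF C_k_lower[OF Suc.prems(1)] C_k_SucD(2)[OF Suc.prems(2)]]
          Suc.IH[OF C_k_SucD(2)[OF Suc.prems(1)] C_k_lower[OF Suc.prems(2)]]])
qed (auto intro: continuous_intros)

lemma C_k_linear:
  assumes "bounded_linear f" shows "C_k k f"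
proof (cases k)
  case 0
  then show ?thesis using assms by (simp add: linear_continuous_on)
next
  case (Suc m)
  show ?thesis unfolding Suc
    by (rule C_k_SucI[where f'="\<lambda>x. f"]) (use assms in \<open>auto intro: bounded_linear_imp_has_derivative\<close>)
qed

lemma C_k_minus: "C_k k f \<Longrightarrow> C_k k (\<lambda>x. - f x)"
  using C_k_mult[OF C_k_const[of k "-1"], of f] by simp

lemma C_k_diff: "C_k k f \<Longrightarrow> C_k k g \<Longrightarrow> C_k k (\<lambda>x. f x - g x)"
  using C_k_add[of k f "\<lambda>x. - g x"] C_k_minus[of k g] by simp

lemma C_k_power2: "C_k k f \<Longrightarrow> C_k k (\<lambda>x. (f x)\<^sup>2)"
  unfolding power2_eq_square by (rule C_k_mult)

text \<open>The induction step shared by the outer functions below: their derivatives are built from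
  functions already covered, so an induction hypothesis takes care of h' composed with f.\<close>

lemma C_k_compose_step:
  assumes f: "C_k (Suc k) f" and h: "\<And>x. (h has_real_derivative h' (f x)) (at (f x))" and h': "C_k k (\<lambda>x. h' (f x))"
  shows "C_k (Suc k) (\<lambda>x. h (f x))"
proof (rule C_k_SucI)
  show "((\<lambda>x. h (f x)) has_derivative (\<lambda>v. h' (f x) * frechet_derivative f (at x) v)) (at x)" for x
    using has_derivative_compose[OF C_k_SucD(1)[OF f, of x] h[unfolded has_field_derivative_def]] by simp
  show "C_k k (\<lambda>x. h' (f x) * frechet_derivative f (at x) v)" for v
    by (intro C_k_mult h' C_k_SucD(2)[OF f])
qed

lemma C_k_inverse:
  assumes nz: "\<And>x. f x \<noteq> 0" shows "C_k k f \<Longrightarrow> C_k k (\<lambda>x. inverse (f x))"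
proof (induction k)
  case 0
  then show ?case using nz by (auto intro!: continuous_intros)
next
  case (Suc k)
  show ?case
  proof (rule C_k_compose_step[OF Suc.prems, where h'="\<lambda>x. - (inverse x * inverse x)"])
    show "(inverse has_real_derivative - (inverse (f x) * inverse (f x))) (at (f x))" for x
      using DERIV_inverse'[OF DERIV_ident nz[of x]] nz[of x] by (auto intro!: derivative_eq_intros simp: power2_eq_square)
    have "C_k k (\<lambda>x. inverse (f x))" using Suc.IH[OF C_k_lower[OF Suc.prems]] .
    then show "C_k k (\<lambda>x. - (inverse (f x) * inverse (f x)))" by (intro C_k_minus C_k_mult)
  qed
qed

lemma C_k_ln:
  assumes pos: "\<And>x. 0 < f x" and f: "C_k k f" shows "C_k k (\<lambda>x. ln (f x))"
proof (cases k)
  case 0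
  then show ?thesis using pos f by (auto intro!: continuous_intros simp: less_imp_neq[symmetric])
next
  case (Suc m)
  have nz: "f x \<noteq> 0" for x using pos[of x] by simp
  show ?thesis unfolding Suc
  proof (rule C_k_compose_step[where f=f and h=ln and h'=inverse])
    show "(ln has_real_derivative inverse (f x)) (at (f x))" for x by (rule DERIV_ln[OF pos])
    show "C_k m (\<lambda>x. inverse (f x))" by (rule C_k_inverse[OF nz C_k_lower[OF f[unfolded Suc]]])
  qed (use f Suc in simp)
qed

lemma C_k_sin_cos: "C_k k f \<Longrightarrow> C_k k (\<lambda>x. sin (f x)) \<and> C_k k (\<lambda>x. cos (f x))"
proof (induction k)
  case 0
  then show ?case by (auto intro!: continuous_intros)
next
  case (Suc k)
  note IH = Suc.IH[OF C_k_lower[OF Suc.prems]]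
  show ?case
  proof
    show "C_k (Suc k) (\<lambda>x. sin (f x))"
      by (rule C_k_compose_step[OF Suc.prems, where h=sin and h'=cos]) (use IH in auto)
    show "C_k (Suc k) (\<lambda>x. cos (f x))"
      by (rule C_k_compose_step[OF Suc.prems, where h=cos and h'="\<lambda>x. - sin x"]) (use IH in \<open>auto intro: C_k_minus\<close>)
  qed
qed

section \<open>A bump function\<close>

text \<open>The usual flat function, divided by x^n so that the linear span of the family is closed
  under differentiation, with \<open>bump'\<close> as derivative.\<close>

definition bump :: "nat \<Rightarrow> real \<Rightarrow> real" where
  "bump n x = (if 0 < x then exp (- 1 / x) / x ^ n else 0)"

lemma bump_nonneg: "0 \<le> bump n x"
  by (simp add: bump_def)

lemma bump_pos: "0 < x \<Longrightarrow> 0 < bump n x"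
  by (simp add: bump_def)

text \<open>A single term of the series of exp (1 / x) gives a quadratic bound, which makes the
  difference quotients at 0 tend to 0.\<close>

lemma bump_le: "bump n x \<le> fact (n + 2) * x\<^sup>2"
proof (cases "0 < x")
  case True
  have exp: "(1 / x) ^ (n + 2) / fact (n + 2) \<le> exp (1 / x)"
  proof -
    have "(\<Sum>k\<in>{n + 2}. inverse (fact k) *\<^sub>R (1 / x) ^ k) \<le> (\<Sum>k. inverse (fact k) *\<^sub>R (1 / x) ^ k)"
      by (rule sum_le_suminf) (use True summable_exp[of "1/x"] in auto)
    then show ?thesis by (simp add: exp_def divide_inverse mult.commute)
  qed
  have "exp (- (1 / x)) \<le> fact (n + 2) * x ^ (n + 2)"
  proof -
    define c y where "c = (fact (n + 2) :: real)" and "y = x ^ (n + 2)"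
    have "0 < c" "0 < y" using True by (simp_all only: c_def y_def fact_gt_zero zero_less_power)
    moreover have "1 / y / c \<le> exp (1 / x)" using exp unfolding c_def y_def by (simp only: power_one_over)
    ultimately have "inverse (exp (1 / x)) \<le> c * y" by (simp add: field_simps)
    then show ?thesis unfolding exp_minus c_def y_def .
  qed
  then have "exp (- 1 / x) / x ^ n \<le> fact (n + 2) * x ^ (n + 2) / x ^ n" using True by (intro divide_right_mono) auto
  also have "\<dots> = fact (n + 2) * x\<^sup>2" using True by (simp add: power_add power2_eq_square)
  finally show ?thesis using True by (simp add: bump_def)
qed (simp add: bump_def)

definition bump' :: "nat \<Rightarrow> real \<Rightarrow> real" where "bump' n x = bump (n + 2) x - real n * bump (n + 1) x"

lemma bump_deriv: "(bump n has_real_derivative bump' n x) (at x)"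
proof (cases x "0 :: real" rule: linorder_cases)
  case greater
  have "((\<lambda>x. exp (- 1 / x) / x ^ n) has_real_derivative bump' n x) (at x)"
  proof (cases n)
    case 0
    then show ?thesis using greater
      by (auto intro!: derivative_eq_intros simp: bump'_def bump_def field_simps power2_eq_square)
  next
    case (Suc m)
    show ?thesis using greater unfolding Suc
      by (auto intro!: derivative_eq_intros simp: bump'_def bump_def field_simps power2_eq_square) (cases m; simp)
  qed
  then show ?thesis
    by (rule has_field_derivative_transform_within_open[where S="{0<..}"]) (use greater in \<open>auto simp: bump_def\<close>)
next
  case less
  have "((\<lambda>x. 0) has_real_derivative 0) (at x)" by simp
  then have "(bump n has_real_derivative 0) (at x)"
    by (rule has_field_derivative_transform_within_open[where S="{..<0}"]) (use less in \<open>auto simp: bump_def\<close>)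
  then show ?thesis using less by (simp add: bump'_def bump_def)
next
  case equal
  have "((\<lambda>h. bump n h / h) \<longlongrightarrow> 0) (at 0)"
  proof (rule Lim_null_comparison)
    show "\<forall>\<^sub>F h in at 0. norm (bump n h / h) \<le> fact (n + 2) * \<bar>h\<bar>"
    proof (rule always_eventually, rule allI)
      fix h :: real
      show "norm (bump n h / h) \<le> fact (n + 2) * \<bar>h\<bar>"
      proof (cases "h = 0")
        case False
        have "\<bar>bump n h\<bar> / \<bar>h\<bar> \<le> fact (n + 2) * h\<^sup>2 / \<bar>h\<bar>"
          using bump_le[of n h] bump_nonneg[of n h] by (intro divide_right_mono) auto
        also have "\<dots> = fact (n + 2) * \<bar>h\<bar>" using False by (simp add: power2_eq_square abs_if)
        finally show ?thesis by simp
      qed simp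
    qed
    show "((\<lambda>h::real. fact (n + 2) * \<bar>h\<bar>) \<longlongrightarrow> 0) (at 0)" by (auto intro!: tendsto_eq_intros)
  qed
  then show ?thesis using equal by (simp add: has_field_derivative_iff bump'_def bump_def)
qed

lemma continuous_on_bump: "continuous_on S h \<Longrightarrow> continuous_on S (\<lambda>x. bump n (h x))"
  using continuous_on_compose2[of UNIV "bump n" S h] bump_deriv DERIV_continuous_on[of UNIV "bump n" "bump' n"] by auto

lemma C_k_bump: "C_k k f \<Longrightarrow> C_k k (\<lambda>x. bump n (f x))"
proof (induction k arbitrary: n)
  case 0
  then show ?case by (auto intro: continuous_on_bump)
next
  case (Suc k)
  note IH = Suc.IH[OF C_k_lower[OF Suc.prems]]
  show ?case
  proof (rule C_k_compose_step[OF Suc.prems bump_deriv])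
    show "C_k k (\<lambda>x. bump' n (f x))"
      unfolding bump'_def by (rule C_k_diff[OF IH C_k_mult[OF C_k_const IH]])
  qed
qed

text \<open>The kernel \<open>kern\<close> is chosen so that its derivative in \<open>r\<close> is a multiple of the Laplacian of the test
  function \<open>rad\<close>; hence the means of a weakly harmonic function with respect to it do not depend on \<open>r\<close>.\<close>

definition rad :: "complex \<Rightarrow> real \<Rightarrow> complex \<Rightarrow> real" where
  "rad a r z = bump 0 (1 - (cmod (z - a))\<^sup>2 / r\<^sup>2)"
definition kern :: "complex \<Rightarrow> real \<Rightarrow> complex \<Rightarrow> real" where
  "kern a r z = bump 2 (1 - (cmod (z - a))\<^sup>2 / r\<^sup>2) / r\<^sup>2"
definition rad_lap :: "complex \<Rightarrow> real \<Rightarrow> complex \<Rightarrow> real" where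
  "rad_lap a r z = (4 * ((cmod (z - a))\<^sup>2 / r\<^sup>2) * bump' 2 (1 - (cmod (z - a))\<^sup>2 / r\<^sup>2) - 4 * bump 2 (1 - (cmod (z - a))\<^sup>2 / r\<^sup>2)) / r\<^sup>2"

lemma sq_deriv:
  "((\<lambda>z. 1 - (cmod (z - a))\<^sup>2 / r\<^sup>2) has_derivative (\<lambda>v. - (2 / r\<^sup>2) * ((Re z - Re a) * Re v + (Im z - Im a) * Im v))) (at z)"
  unfolding cmod_power2 divide_inverse
  by (auto intro!: derivative_eq_intros simp: fun_eq_iff algebra_simps power2_eq_square)

lemma smooth_rad: "smooth (rad a r)"
proof -
  have "C_k k (\<lambda>z. 1 - ((Re z - Re a)\<^sup>2 + (Im z - Im a)\<^sup>2) * inverse (r\<^sup>2))" for k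
    by (intro C_k_diff C_k_const C_k_mult C_k_add C_k_power2 C_k_linear bounded_linear_Re bounded_linear_Im)
  then have "C_k k (\<lambda>z. 1 - (cmod (z - a))\<^sup>2 / r\<^sup>2)" for k by (simp add: cmod_power2 divide_inverse)
  then show ?thesis unfolding smooth_def rad_def by (intro allI C_k_bump)
qed

definition radx :: "complex \<Rightarrow> real \<Rightarrow> complex \<Rightarrow> real" where
  "radx a r z = - (2 / r\<^sup>2) * (Re z - Re a) * bump 2 (1 - (cmod (z - a))\<^sup>2 / r\<^sup>2)"
definition rady :: "complex \<Rightarrow> real \<Rightarrow> complex \<Rightarrow> real" where
  "rady a r z = - (2 / r\<^sup>2) * (Im z - Im a) * bump 2 (1 - (cmod (z - a))\<^sup>2 / r\<^sup>2)"

lemma bump_comp_deriv: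
  "((\<lambda>z. bump n (1 - (cmod (z - a))\<^sup>2 / r\<^sup>2)) has_derivative
     (\<lambda>v. bump' n (1 - (cmod (z - a))\<^sup>2 / r\<^sup>2) * (- (2 / r\<^sup>2) * ((Re z - Re a) * Re v + (Im z - Im a) * Im v)))) (at z)"
  using has_derivative_compose[OF sq_deriv bump_deriv[unfolded has_field_derivative_def]] by simp

lemma rad_deriv: "(rad a r has_derivative (\<lambda>v. radx a r z * Re v + rady a r z * Im v)) (at z)"
proof -
  have e: "bump' 0 x = bump 2 x" for x by (simp add: bump'_def numeral_2_eq_2)
  show ?thesis unfolding rad_def[abs_def]
    by (rule has_derivative_eq_rhs[OF bump_comp_deriv]) (auto simp: fun_eq_iff e radx_def rady_def algebra_simps add_divide_distrib diff_divide_distrib)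
qed

definition radxx :: "complex \<Rightarrow> real \<Rightarrow> complex \<Rightarrow> real" where
  "radxx a r z = (4 / r^4) * (Re z - Re a)\<^sup>2 * bump' 2 (1 - (cmod (z - a))\<^sup>2 / r\<^sup>2) - (2 / r\<^sup>2) * bump 2 (1 - (cmod (z - a))\<^sup>2 / r\<^sup>2)"
definition radyy :: "complex \<Rightarrow> real \<Rightarrow> complex \<Rightarrow> real" where
  "radyy a r z = (4 / r^4) * (Im z - Im a)\<^sup>2 * bump' 2 (1 - (cmod (z - a))\<^sup>2 / r\<^sup>2) - (2 / r\<^sup>2) * bump 2 (1 - (cmod (z - a))\<^sup>2 / r\<^sup>2)"

lemma radx_deriv: "\<exists>D. (radx a r has_derivative D) (at z) \<and> D 1 = radxx a r z"
proof -
  have p4: "r ^ 4 = r\<^sup>2 * r\<^sup>2" by (simp flip: power_add)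
  show ?thesis unfolding radx_def[abs_def]
    by (rule exI, rule conjI, (rule derivative_eq_intros bump_comp_deriv refl)+) (simp add: radxx_def p4 power2_eq_square field_simps)
qed

lemma rady_deriv: "\<exists>D. (rady a r has_derivative D) (at z) \<and> D \<i> = radyy a r z"
proof -
  have p4: "r ^ 4 = r\<^sup>2 * r\<^sup>2" by (simp flip: power_add)
  show ?thesis unfolding rady_def[abs_def]
    by (rule exI, rule conjI, (rule derivative_eq_intros bump_comp_deriv refl)+) (simp add: radyy_def p4 power2_eq_square field_simps)
qed

lemma rad_lap_eq: assumes "r \<noteq> 0" shows "radxx a r z + radyy a r z = rad_lap a r z"
proof -
  define s where "s = (cmod (z - a))\<^sup>2"
  define B where "B = bump' 2 (1 - s / r\<^sup>2)"
  define b where "b = bump 2 (1 - s / r\<^sup>2)"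
  have s: "s = (Re z - Re a)\<^sup>2 + (Im z - Im a)\<^sup>2" unfolding s_def by (simp add: cmod_power2)
  have "radxx a r z + radyy a r z = (4 / r^4) * s * B - (4 / r\<^sup>2) * b"
    unfolding radxx_def radyy_def s_def[symmetric] B_def[symmetric] b_def[symmetric] unfolding s by (simp add: algebra_simps)
  also have "\<dots> = rad_lap a r z"
    unfolding rad_lap_def s_def[symmetric] B_def[symmetric] b_def[symmetric] using assms
    by (simp add: field_simps power2_eq_square power4_eq_xxxx)
  finally show ?thesis .
qed

lemma laplacian_eqI:
  assumes S: "open S" "z \<in> S"
    and f: "\<And>x. x \<in> S \<Longrightarrow> (f has_derivative (\<lambda>v. fx x * Re v + fy x * Im v)) (at x)"
    and x: "(fx has_derivative Dx) (at z)" and y: "(fy has_derivative Dy) (at z)"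
  shows "laplacian f z = Dx 1 + Dy \<i>"
proof -
  have fr: "frechet_derivative f (at x) = (\<lambda>v. fx x * Re v + fy x * Im v)" if "x \<in> S" for x
    using frechet_derivative_at[OF f[OF that]] by simp
  have "((\<lambda>x. frechet_derivative f (at x) 1) has_derivative Dx) (at z)"
    by (rule has_derivative_transform_within_open[OF x S]) (simp add: fr)
  moreover have "((\<lambda>x. frechet_derivative f (at x) \<i>) has_derivative Dy) (at z)"
    by (rule has_derivative_transform_within_open[OF y S]) (simp add: fr)
  ultimately have "frechet_derivative (\<lambda>x. frechet_derivative f (at x) 1) (at z) = Dx"
    "frechet_derivative (\<lambda>x. frechet_derivative f (at x) \<i>) (at z) = Dy"
    by (simp_all add: frechet_derivative_at[symmetric])
  then show ?thesis unfolding laplacian_def by (simp add: Basis_complex_def)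
qed

lemma ddc_rad: assumes "r \<noteq> 0" shows "ddc (rad a r) z = rad_lap a r z / (4 * pi)"
proof -
  obtain Dx Dy where "(radx a r has_derivative Dx) (at z)" "Dx 1 = radxx a r z"
    "(rady a r has_derivative Dy) (at z)" "Dy \<i> = radyy a r z" using radx_deriv rady_deriv by metis
  then show ?thesis unfolding ddc_def
    using laplacian_eqI[OF open_UNIV UNIV_I rad_deriv] rad_lap_eq[OF assms, of a z] by metis
qed

lemma rad_zero:
  assumes "0 < r" "r \<le> cmod (z - a)"
  shows "rad a r z = 0" "kern a r z = 0" "rad_lap a r z = 0" "radx a r z = 0" "rady a r z = 0" "radxx a r z = 0" "radyy a r z = 0"
proof -
  have "r\<^sup>2 \<le> (cmod (z - a))\<^sup>2" using assms by (intro power_mono) auto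
  then have "1 - (cmod (z - a))\<^sup>2 / r\<^sup>2 \<le> 0" using assms by simp
  then have b: "bump n (1 - (cmod (z - a))\<^sup>2 / r\<^sup>2) = 0" for n by (simp add: bump_def)
  then have b': "bump' n (1 - (cmod (z - a))\<^sup>2 / r\<^sup>2) = 0" for n by (simp add: bump'_def)
  show "rad a r z = 0" "kern a r z = 0" "rad_lap a r z = 0" "radx a r z = 0" "rady a r z = 0" "radxx a r z = 0" "radyy a r z = 0"
    unfolding rad_def kern_def rad_lap_def radx_def rady_def radxx_def radyy_def b b' by simp_all
qed

lemma test_function_rad:
  assumes "0 < r" "cball a r \<subseteq> S"
  shows "test_function S (rad a r)"
proof -
  have "{z. rad a r z \<noteq> 0} \<subseteq> cball a r"
    using rad_zero(1)[OF assms(1), of _ a] by (force simp: dist_norm norm_minus_commute)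
  then have sub: "closure {z. rad a r z \<noteq> 0} \<subseteq> cball a r" by (rule closure_minimal) auto
  then have "compact (closure {z. rad a r z \<noteq> 0})" by (meson bounded_cball bounded_subset closed_closure compact_eq_bounded_closed)
  then show ?thesis unfolding test_function_def using smooth_rad sub assms(2) by auto
qed

lemma kern_deriv:
  assumes "0 < r" shows "((\<lambda>r. kern a r z) has_real_derivative rad_lap a r z / (2 * r)) (at r)"
proof -
  define s where "s = (cmod (z - a))\<^sup>2"
  have in1: "((\<lambda>r. 1 - s / r\<^sup>2) has_real_derivative 2 * s / r ^ 3) (at r)"
    using assms by (auto intro!: derivative_eq_intros simp: field_simps power2_eq_square power3_eq_cube)
  have "((\<lambda>r. bump 2 (1 - s / r\<^sup>2)) has_real_derivative bump' 2 (1 - s / r\<^sup>2) * (2 * s / r ^ 3)) (at r)"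
    by (rule DERIV_chain2[OF bump_deriv in1])
  then have "((\<lambda>r. bump 2 (1 - s / r\<^sup>2) / r\<^sup>2) has_real_derivative
      (bump' 2 (1 - s / r\<^sup>2) * (2 * s / r ^ 3) * r\<^sup>2 - bump 2 (1 - s / r\<^sup>2) * (2 * r)) / (r\<^sup>2 * r\<^sup>2)) (at r)"
    using assms by (auto intro!: derivative_eq_intros)
  moreover have "(B * (2 * s / r ^ 3) * r\<^sup>2 - b * (2 * r)) / (r\<^sup>2 * r\<^sup>2) = ((4 * (s / r\<^sup>2) * B - 4 * b) / r\<^sup>2) / (2 * r)" for B b
    using assms by (simp add: field_simps power2_eq_square power3_eq_cube)
  ultimately show ?thesis unfolding kern_def rad_lap_def s_def[symmetric] by simp
qed

section \<open>Averaging over rotations\<close>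

lemma nn_integral_complex:
  fixes f :: "complex \<Rightarrow> ennreal"
  assumes [measurable]: "f \<in> borel_measurable borel"
  shows "(\<integral>\<^sup>+z. f z \<partial>lborel) = (\<integral>\<^sup>+x. \<integral>\<^sup>+y. f (Complex x y) \<partial>lborel \<partial>lborel)"
proof -
  define C where "C = (\<lambda>p::real\<times>real. Complex (fst p) (snd p))"
  have cC: "continuous_on UNIV C" unfolding C_def Complex_eq by (intro continuous_intros)
  have mC [measurable]: "C \<in> borel_measurable borel" by (rule borel_measurable_continuous_onI[OF cC])
  have "lborel = distr lborel borel C"
  proof (rule lborel_eqI)
    fix l u :: complex assume le: "\<And>b. b \<in> Basis \<Longrightarrow> l \<bullet> b \<le> u \<bullet> b"
    then have le': "Re l \<le> Re u" "Im l \<le> Im u" using le[of 1] le[of \<i>] by (simp_all add: Basis_complex_def inner_complex_def)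
    have pre: "C -` box l u \<inter> space lborel = box (Re l, Im l) (Re u, Im u)"
      by (auto simp: C_def box_def Basis_complex_def Basis_prod_def inner_complex_def)
    have "emeasure (distr lborel borel C) (box l u) = emeasure lborel (box (Re l, Im l) (Re u, Im u))"
      by (subst emeasure_distr) (auto simp: pre simp del: space_lborel)
    also have "\<dots> = (Re u - Re l) * (Im u - Im l)"
      using le' by (subst emeasure_lborel_box) (auto simp: Basis_prod_def inner_prod_def prod.union_disjoint)
    also have "(Re u - Re l) * (Im u - Im l) = (\<Prod>b\<in>Basis. (u - l) \<bullet> b)"
      by (simp add: Basis_complex_def inner_complex_def)
    finally show "emeasure (distr lborel borel C) (box l u) = (\<Prod>b\<in>Basis. (u - l) \<bullet> b)" .
  qed simp
  then have "(\<integral>\<^sup>+z. f z \<partial>lborel) = (\<integral>\<^sup>+z. f z \<partial>distr lborel borel C)" by simp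
  also have "\<dots> = (\<integral>\<^sup>+p. f (C p) \<partial>lborel)" by (rule nn_integral_distr) auto
  also have "\<dots> = (\<integral>\<^sup>+p. f (C p) \<partial>(lborel \<Otimes>\<^sub>M lborel))" by (simp add: lborel_prod)
  also have "\<dots> = (\<integral>\<^sup>+x. \<integral>\<^sup>+y. f (C (x, y)) \<partial>lborel \<partial>lborel)"
    by (rule lborel.nn_integral_fst[symmetric]) (simp add: lborel_prod)
  finally show ?thesis by (simp add: C_def)
qed

text \<open>On each vertical or horizontal line a shear is a translation, and Fubini does the
  rest.\<close>

lemma nn_integral_complex_shear:
  fixes f :: "complex \<Rightarrow> ennreal"
  assumes [measurable]: "f \<in> borel_measurable borel"
  shows "(\<integral>\<^sup>+z. f (z + \<i> * of_real (t * Re z)) \<partial>lborel) = (\<integral>\<^sup>+z. f z \<partial>lborel)"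
    "(\<integral>\<^sup>+z. f (z + of_real (t * Im z)) \<partial>lborel) = (\<integral>\<^sup>+z. f z \<partial>lborel)"
proof -
  have mC [measurable]: "(\<lambda>p::real\<times>real. Complex (fst p) (snd p)) \<in> borel_measurable borel"
    unfolding Complex_eq by (intro borel_measurable_continuous_onI continuous_intros)
  have m1 [measurable]: "(\<lambda>z. z + \<i> * of_real (t * Re z)) \<in> borel_measurable borel"
    "(\<lambda>z. z + of_real (t * Im z)) \<in> borel_measurable borel"
    by (intro borel_measurable_continuous_onI continuous_intros)+
  have mx: "(\<lambda>y. f (Complex x y)) \<in> borel_measurable borel" "(\<lambda>y. f (Complex y x)) \<in> borel_measurable borel" for x
    unfolding Complex_eq by measurable
  have tr: "(\<integral>\<^sup>+y. h (s + y) \<partial>lborel) = (\<integral>\<^sup>+y. h y \<partial>lborel)" if "h \<in> borel_measurable borel" for h :: "real \<Rightarrow> ennreal" and s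
    using nn_integral_real_affine[OF that, of 1 s] by simp
  have "(\<integral>\<^sup>+z. f (z + \<i> * of_real (t * Re z)) \<partial>lborel) = (\<integral>\<^sup>+x. \<integral>\<^sup>+y. f (Complex x (t * x + y)) \<partial>lborel \<partial>lborel)"
    by (subst nn_integral_complex) (auto intro!: nn_integral_cong arg_cong[where f=f] simp: complex_eq_iff)
  also have "\<dots> = (\<integral>\<^sup>+x. \<integral>\<^sup>+y. f (Complex x y) \<partial>lborel \<partial>lborel)"
    by (intro nn_integral_cong tr mx)
  finally show "(\<integral>\<^sup>+z. f (z + \<i> * of_real (t * Re z)) \<partial>lborel) = (\<integral>\<^sup>+z. f z \<partial>lborel)"
    by (simp add: nn_integral_complex)
  have sw: "(\<integral>\<^sup>+x. \<integral>\<^sup>+y. g (Complex x y) \<partial>lborel \<partial>lborel) = (\<integral>\<^sup>+y. \<integral>\<^sup>+x. g (Complex x y) \<partial>lborel \<partial>lborel)"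
    if [measurable]: "g \<in> borel_measurable borel" for g :: "complex \<Rightarrow> ennreal"
  proof (rule lborel_pair.Fubini'[symmetric])
    have "(\<lambda>p::real\<times>real. g (Complex (fst p) (snd p))) \<in> borel_measurable borel" by measurable
    then show "(\<lambda>(x, y). g (Complex x y)) \<in> borel_measurable (lborel \<Otimes>\<^sub>M lborel)" by (simp add: lborel_prod case_prod_beta')
  qed
  have "(\<integral>\<^sup>+z. f (z + of_real (t * Im z)) \<partial>lborel) = (\<integral>\<^sup>+y. \<integral>\<^sup>+x. f (Complex (t * y + x) y) \<partial>lborel \<partial>lborel)"
    by (subst nn_integral_complex, measurable, subst sw, measurable)
       (auto intro!: nn_integral_cong arg_cong[where f=f] simp: complex_eq_iff)
  also have "\<dots> = (\<integral>\<^sup>+y. \<integral>\<^sup>+x. f (Complex x y) \<partial>lborel \<partial>lborel)"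
    by (intro nn_integral_cong tr mx)
  also have "\<dots> = (\<integral>\<^sup>+z. f z \<partial>lborel)" by (subst nn_integral_complex) (auto simp: sw)
  finally show "(\<integral>\<^sup>+z. f (z + of_real (t * Im z)) \<partial>lborel) = (\<integral>\<^sup>+z. f z \<partial>lborel)" .
qed

text \<open>A rotation is a product of three shears, unless it is the rotation by \<open>\<pi>\<close>.\<close>

lemma nn_integral_complex_rotate:
  fixes f :: "complex \<Rightarrow> ennreal"
  assumes f: "f \<in> borel_measurable borel" and c: "cmod c = 1"
  shows "(\<integral>\<^sup>+z. f (c * z) \<partial>lborel) = (\<integral>\<^sup>+z. f z \<partial>lborel)"
proof -
  have main: "(\<integral>\<^sup>+z. f (c * z) \<partial>lborel) = (\<integral>\<^sup>+z. f z \<partial>lborel)"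
    if f: "f \<in> borel_measurable borel" and c: "cmod c = 1" "Re c \<noteq> -1" for f :: "complex \<Rightarrow> ennreal" and c
  proof -
    define \<alpha> where "\<alpha> = - Im c / (1 + Re c)"
    have nz: "1 + Re c \<noteq> 0" using c(2) by linarith
    have cc: "(Re c)\<^sup>2 + (Im c)\<^sup>2 = 1" using c(1) by (simp add: cmod_def)
    have a1: "1 + \<alpha> * Im c = Re c"
      using nz cc unfolding \<alpha>_def by (simp add: field_simps power2_eq_square)
    have a2: "\<alpha> * (1 + Re c) = - Im c" using nz unfolding \<alpha>_def by simp
    define A where "A = (\<lambda>z. z + of_real (\<alpha> * Im z))"
    define B where "B = (\<lambda>z. z + \<i> * of_real (Im c * Re z))"
    have eq: "c * z = A (B (A z))" for z
    proof (rule complex_eqI)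
      have "Re (A (B (A z))) = (1 + \<alpha> * Im c) * Re z + \<alpha> * (1 + (1 + \<alpha> * Im c)) * Im z"
        unfolding A_def B_def by (simp add: algebra_simps)
      also have "\<dots> = Re c * Re z - Im c * Im z" unfolding a1 a2 by simp
      finally show "Re (c * z) = Re (A (B (A z)))" by simp
      have "Im (A (B (A z))) = Im c * Re z + (1 + \<alpha> * Im c) * Im z"
        unfolding A_def B_def by (simp add: algebra_simps)
      then show "Im (c * z) = Im (A (B (A z)))" unfolding a1 by simp
    qed
    have mA [measurable]: "A \<in> borel_measurable borel" "B \<in> borel_measurable borel"
      unfolding A_def B_def by (intro borel_measurable_continuous_onI continuous_intros)+
    note f [measurable]
    have "(\<integral>\<^sup>+z. f (A (B (A z))) \<partial>lborel) = (\<integral>\<^sup>+z. f (A (B z)) \<partial>lborel)"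
      using nn_integral_complex_shear(2)[of "\<lambda>z. f (A (B z))" \<alpha>] by (simp add: A_def)
    moreover have "(\<integral>\<^sup>+z. f (A (B z)) \<partial>lborel) = (\<integral>\<^sup>+z. f (A z) \<partial>lborel)"
      using nn_integral_complex_shear(1)[of "\<lambda>z. f (A z)" "Im c"] by (simp add: B_def)
    moreover have "(\<integral>\<^sup>+z. f (A z) \<partial>lborel) = (\<integral>\<^sup>+z. f z \<partial>lborel)"
      unfolding A_def by (rule nn_integral_complex_shear(2)[OF f])
    ultimately show ?thesis unfolding eq by simp
  qed
  show ?thesis
  proof (cases "Re c = -1")
    case True
    have "(Re c)\<^sup>2 + (Im c)\<^sup>2 = 1" using c by (simp add: cmod_def)
    then have "Im c = 0" using True by simp
    then have "c = \<i> * \<i>" using True by (simp add: complex_eq_iff)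
    then have "(\<integral>\<^sup>+z. f (c * z) \<partial>lborel) = (\<integral>\<^sup>+z. (\<lambda>z. f (\<i> * z)) (\<i> * z) \<partial>lborel)" by (simp add: mult.assoc)
    also have "\<dots> = (\<integral>\<^sup>+z. f (\<i> * z) \<partial>lborel)" by (rule main) (use f in auto)
    also have "\<dots> = (\<integral>\<^sup>+z. f z \<partial>lborel)" by (rule main) (use f in auto)
    finally show ?thesis .
  qed (use main[OF f c] in simp)
qed

lemma lborel_rotate:
  assumes "cmod c = 1" shows "distr lborel borel ((*) c) = (lborel :: complex measure)"
proof (rule measure_eqI)
  fix A :: "complex set" assume "A \<in> sets (distr lborel borel ((*) c))"
  then have A [measurable]: "A \<in> sets borel" by simp
  have "emeasure (distr lborel borel ((*) c)) A = (\<integral>\<^sup>+z. indicator A z \<partial>distr lborel borel ((*) c))" by simp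
  also have "\<dots> = (\<integral>\<^sup>+z. indicator A (c * z) \<partial>lborel)" by (rule nn_integral_distr) auto
  also have "\<dots> = (\<integral>\<^sup>+z. indicator A z \<partial>lborel)" by (rule nn_integral_complex_rotate[OF _ assms]) measurable
  finally show "emeasure (distr lborel borel ((*) c)) A = emeasure lborel A" by simp
qed simp

lemma integral_rotate:
  fixes f :: "complex \<Rightarrow> real"
  assumes "f \<in> borel_measurable borel" "cmod c = 1"
  shows "(LINT z|lborel. f (c * z)) = (LINT z|lborel. f z)"
proof -
  have "(LINT z|lborel. f z) = (LINT z|distr lborel borel ((*) c). f z)" by (simp add: lborel_rotate[OF assms(2)])
  also have "\<dots> = (LINT z|lborel. f (c * z))" by (rule integral_distr) (use assms in auto)
  finally show ?thesis ..
qed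

lemma integral_translate:
  fixes f :: "complex \<Rightarrow> real"
  assumes "f \<in> borel_measurable borel"
  shows "(LINT z|lborel. f (a + z)) = (LINT z|lborel. f z)"
proof -
  have "(LINT z|lborel. f z) = (LINT z|distr lborel borel ((+) a). f z)" by (simp add: lborel_distr_plus)
  also have "\<dots> = (LINT z|lborel. f (a + z))" by (rule integral_distr) (use assms in auto)
  finally show ?thesis ..
qed

lemma integrable_cont_compact:
  fixes f :: "'a::euclidean_space \<Rightarrow> real"
  assumes f: "continuous_on UNIV f" and K: "compact K" "\<And>z. z \<notin> K \<Longrightarrow> f z = 0"
  shows "integrable lborel f"
proof -
  have "integrable lborel (\<lambda>z. indicator K z *\<^sub>R f z)"
    by (rule borel_integrable_compact[OF K(1) continuous_on_subset[OF f]]) simp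
  moreover have "(\<lambda>z. indicator K z *\<^sub>R f z) = f" using K(2) by (force simp: fun_eq_iff indicator_def)
  ultimately show ?thesis by simp
qed

lemma continuous_on_amean:
  fixes w :: "complex \<Rightarrow> real"
  assumes "continuous_on UNIV w"
  shows "continuous_on UNIV (\<lambda>\<zeta>. amean (\<lambda>t. w (a + cis t * \<zeta>)))"
proof -
  have "continuous_on UNIV (\<lambda>\<zeta>. integral (cbox 0 (2*pi)) (\<lambda>t. w (a + cis t * \<zeta>)))"
  proof (rule integral_continuous_on_param)
    show "continuous_on (UNIV \<times> cbox 0 (2*pi)) (\<lambda>(\<zeta>, t). w (a + cis t * \<zeta>))"
      unfolding case_prod_beta' by (rule continuous_on_compose2[OF assms]) (auto intro!: continuous_intros)
  qed
  then have "continuous_on UNIV (\<lambda>\<zeta>. integral {0..2*pi} (\<lambda>t. w (a + cis t * \<zeta>)) / (2*pi))"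
    by (intro continuous_intros) auto
  moreover have "amean (\<lambda>t. w (a + cis t * \<zeta>)) = integral {0..2*pi} (\<lambda>t. w (a + cis t * \<zeta>)) / (2*pi)" for \<zeta>
    by (rule amean_integral) (auto intro!: continuous_on_compose2[OF assms] continuous_intros)
  ultimately show ?thesis by simp
qed

text \<open>Replaces polar coordinates: each rotated copy of w has the same integral, and Fubini
  moves the average over the angles inside.\<close>

lemma integral_rotation_average:
  fixes w :: "complex \<Rightarrow> real"
  assumes w: "continuous_on UNIV w" and R: "\<And>z. R \<le> cmod z \<Longrightarrow> w z = 0"
  shows "(LINT z|lborel. w z) = (LINT \<zeta>|lborel. amean (\<lambda>t. w (cis t * \<zeta>)))"
proof -
  define F where "F = (\<lambda>(t::real, z). indicator ({0..2*pi} \<times> cball 0 R) (t, z) *\<^sub>R w (cis t * z))"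
  have cw: "continuous_on S (\<lambda>x. w (cis (fst x) * snd x))" for S :: "(real \<times> complex) set"
    by (rule continuous_on_compose2[OF w]) (auto intro!: continuous_intros)
  have "integrable lborel (\<lambda>x. indicator ({0..2*pi} \<times> cball 0 R) x *\<^sub>R w (cis (fst x) * snd x))"
    by (rule borel_integrable_compact) (auto intro!: compact_Times cw)
  then have int: "integrable (lborel \<Otimes>\<^sub>M lborel) F"
    unfolding F_def by (simp add: lborel_prod case_prod_beta')
  have F: "F (t, z) = indicator {0..2*pi} t *\<^sub>R w (cis t * z)" for t z
    using R[of "cis t * z"] unfolding F_def by (auto simp: indicator_def norm_mult)
  have mw: "w \<in> borel_measurable borel" by (rule borel_measurable_continuous_onI[OF w])
  have "(LINT z|lborel. LINT t|lborel. F (t, z)) = (LINT t|lborel. LINT z|lborel. F (t, z))"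
    using lborel_pair.Fubini_integral[of "\<lambda>t z. F (t, z)"] int by (simp add: case_prod_beta')
  also have "\<dots> = (LINT t|lborel. indicator {0..2*pi} t *\<^sub>R (LINT z|lborel. w z))"
    unfolding F by (simp add: integral_rotate[OF mw])
  also have "\<dots> = 2 * pi * (LINT z|lborel. w z)" by simp
  finally have "2 * pi * (LINT z|lborel. w z) = (LINT z|lborel. 2 * pi * amean (\<lambda>t. w (cis t * z)))"
    unfolding F amean_def set_lebesgue_integral_def by simp
  then show ?thesis by simp
qed

text \<open>The mean does not depend on the starting angle: for the real part of an entire function
  both means are its value at a, and \<open>circle_approx\<close> transfers this to w.\<close>

lemma amean_phase:
  assumes w: "continuous_on (sphere a (cmod \<zeta>)) w" and z: "\<zeta> \<noteq> 0"
  shows "amean (\<lambda>t. w (a + cis t * \<zeta>)) = amean (\<lambda>t. w (a + of_real (cmod \<zeta>) * cis t))"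
proof -
  define \<rho> where "\<rho> = cmod \<zeta>"
  have \<rho>: "0 < \<rho>" using z by (simp add: \<rho>_def)
  have c1: "continuous_on {0..2*pi} (\<lambda>t. w (a + cis t * \<zeta>))"
    by (rule continuous_on_compose2[OF w]) (auto intro!: continuous_intros simp: dist_norm norm_mult)
  have c2: "continuous_on {0..2*pi} (\<lambda>t. w (a + of_real \<rho> * cis t))"
    using continuous_on_circle[OF w] unfolding \<rho>_def by simp
  define x where "x = \<bar>amean (\<lambda>t. w (a + cis t * \<zeta>)) - amean (\<lambda>t. w (a + of_real \<rho> * cis t))\<bar>"
  have key: "\<bar>amean (\<lambda>t. w (a + cis t * \<zeta>)) - amean (\<lambda>t. w (a + of_real \<rho> * cis t))\<bar> \<le> e" if e: "0 < e" for e
  proof -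
    obtain p where p: "p holomorphic_on UNIV" "\<And>z. z \<in> sphere a \<rho> \<Longrightarrow> \<bar>w z - Re (p z)\<bar> < e / 2"
      using circle_approx[of a \<rho> w "e/2"] w \<rho> e unfolding \<rho>_def by auto
    have cp: "continuous_on UNIV p" using p(1) by (rule holomorphic_on_imp_continuous_on)
    have 1: "amean (\<lambda>t. Re (p (a + cis t * \<zeta>))) = Re (p a)"
    proof -
      define \<omega> where "\<omega> = \<zeta> / of_real \<rho>"
      have "(\<lambda>z. p (a + \<omega> * z)) holomorphic_on UNIV"
        by (rule holomorphic_on_compose_gen[OF _ p(1), unfolded o_def]) (auto intro!: holomorphic_intros)
      then have "amean (\<lambda>t. Re (p (a + \<omega> * (0 + of_real \<rho> * cis t)))) = Re (p (a + \<omega> * 0))"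
        by (rule amean_holomorphic_open) (use \<rho> in auto)
      moreover have "\<omega> * (0 + of_real \<rho> * cis t) = cis t * \<zeta>" for t unfolding \<omega>_def using \<rho> by simp
      ultimately show ?thesis by (simp only: mult_zero_right add_0_right)
    qed
    have 2: "amean (\<lambda>t. Re (p (a + of_real \<rho> * cis t))) = Re (p a)"
      by (rule amean_holomorphic_open[OF p(1)]) (use \<rho> in auto)
    have close: "\<bar>amean f - amean g\<bar> \<le> e / 2" if "continuous_on {0..2*pi} f" "continuous_on {0..2*pi} g" "\<And>t. \<bar>f t - g t\<bar> < e / 2" for f g
    proof -
      have "f t \<le> g t + e / 2" "g t \<le> f t + e / 2" for t using that(3)[of t] by linarith+
      then have "amean f \<le> amean (\<lambda>t. g t + e / 2)" "amean g \<le> amean (\<lambda>t. f t + e / 2)"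
        by (intro amean_mono continuous_intros that(1,2); simp)+
      then have "amean f \<le> amean g + e / 2" "amean g \<le> amean f + e / 2" using that by (simp_all add: amean_add)
      then show ?thesis by linarith
    qed
    have "\<bar>amean (\<lambda>t. w (a + cis t * \<zeta>)) - Re (p a)\<bar> \<le> e / 2" unfolding 1[symmetric]
    proof (rule close[OF c1])
      show "\<bar>w (a + cis t * \<zeta>) - Re (p (a + cis t * \<zeta>))\<bar> < e / 2" for t
        by (rule p(2)) (simp add: dist_norm norm_mult \<rho>_def)
    qed (auto intro!: continuous_intros continuous_on_compose2[OF cp])
    moreover have "\<bar>amean (\<lambda>t. w (a + of_real \<rho> * cis t)) - Re (p a)\<bar> \<le> e / 2" unfolding 2[symmetric]
    proof (rule close[OF c2])
      show "\<bar>w (a + of_real \<rho> * cis t) - Re (p (a + of_real \<rho> * cis t))\<bar> < e / 2" for t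
        by (rule p(2)) (simp add: dist_norm norm_mult \<rho>_def)
    qed (auto intro!: continuous_intros continuous_on_compose2[OF cp])
    ultimately show ?thesis by linarith
  qed
  then have "x \<le> e" if "0 < e" for e unfolding x_def using that .
  then have "x \<le> 0" by (meson dense not_le)
  then show ?thesis unfolding x_def \<rho>_def by simp
qed

section \<open>Green's formula\<close>

text \<open>Difference quotients integrate to 0 by translation invariance; the mean value theorem
  bounds them by the derivative, and dominated convergence passes to the limit.\<close>

lemma integral_directional_derivative_zero:
  fixes F :: "complex \<Rightarrow> real"
  assumes F: "\<And>x. \<exists>D. (F has_derivative D) (at x) \<and> D b = Fb x" and c: "continuous_on UNIV Fb"
    and z: "\<And>x. r \<le> cmod (x - a) \<Longrightarrow> F x = 0" "\<And>x. r \<le> cmod (x - a) \<Longrightarrow> Fb x = 0"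
  shows "(LINT x|lborel. Fb x) = 0"
proof -
  have cF: "continuous_on UNIV F"
    using F has_derivative_continuous by (metis continuous_at_imp_continuous_on)
  have mF: "F \<in> borel_measurable borel" by (rule borel_measurable_continuous_onI[OF cF])
  have intF: "integrable lborel F"
    by (rule integrable_cont_compact[OF cF compact_cball[of a r]]) (use z in \<open>auto simp: dist_norm norm_minus_commute\<close>)
  have "bounded (Fb ` cball a r)"
    by (intro compact_imp_bounded compact_continuous_image continuous_on_subset[OF c]) auto
  then obtain C where C: "0 < C" "\<And>x. x \<in> cball a r \<Longrightarrow> \<bar>Fb x\<bar> \<le> C" unfolding bounded_pos by auto
  have bd: "\<bar>Fb x\<bar> \<le> C" for x
    using C z(2)[of x] by (cases "x \<in> cball a r") (auto simp: dist_norm norm_minus_commute)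
  define d where "d = (\<lambda>n. 1 / real (Suc n))"
  define g where "g = (\<lambda>n x. real (Suc n) * (F (d n *\<^sub>R b + x) - F x))"
  have d0: "0 < d n" "d n \<le> 1" for n by (simp_all add: d_def)
  have mvt: "\<exists>\<xi>. 0 < \<xi> \<and> \<xi> < d n \<and> g n x = Fb (x + \<xi> *\<^sub>R b)" for n x
  proof -
    have "((\<lambda>t. F (x + t *\<^sub>R b)) has_real_derivative Fb (x + t *\<^sub>R b)) (at t)" for t
    proof -
      obtain D where D: "(F has_derivative D) (at (x + t *\<^sub>R b))" "D b = Fb (x + t *\<^sub>R b)" using F by blast
      have "((\<lambda>t. x + t *\<^sub>R b) has_derivative (\<lambda>h. h *\<^sub>R b)) (at t)" by (auto intro!: derivative_eq_intros)
      from has_derivative_compose[OF this D(1)] have "((\<lambda>t. F (x + t *\<^sub>R b)) has_derivative (\<lambda>h. D (h *\<^sub>R b))) (at t)" .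
      moreover have "D (h *\<^sub>R b) = Fb (x + t *\<^sub>R b) * h" for h
        using linear_cmul[OF has_derivative_linear[OF D(1)], of h b] D(2) by simp
      ultimately show ?thesis by (simp add: has_field_derivative_def)
    qed
    from MVT2[OF d0(1)[of n] this] obtain \<xi> where "0 < \<xi>" "\<xi> < d n" "F (x + d n *\<^sub>R b) - F (x + 0 *\<^sub>R b) = (d n - 0) * Fb (x + \<xi> *\<^sub>R b)"
      by blast
    moreover have "real (Suc n) * d n = 1" by (simp add: d_def)
    ultimately show ?thesis unfolding g_def by (intro exI[of _ \<xi>]) (simp add: add.commute mult.assoc[symmetric])
  qed
  have i0: "(LINT x|lborel. g n x) = 0" for n
  proof -
    have sh: "integrable lborel (\<lambda>x. F (d n *\<^sub>R b + x))"
    proof (rule integrable_cont_compact[OF _ compact_cball[of "a - d n *\<^sub>R b" r]])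
      show "continuous_on UNIV (\<lambda>x. F (d n *\<^sub>R b + x))" by (rule continuous_on_compose2[OF cF]) (auto intro!: continuous_intros)
    qed (rule z(1), auto simp: dist_norm norm_minus_commute algebra_simps)
    show ?thesis unfolding g_def using integral_translate[OF mF, of "d n *\<^sub>R b"] sh intF by simp
  qed
  have "(\<lambda>n. LINT x|lborel. g n x) \<longlonglongrightarrow> (LINT x|lborel. Fb x)"
  proof (rule integral_dominated_convergence[where w="\<lambda>x. indicator (cball a (r + cmod b)) x *\<^sub>R C"])
    show "integrable lborel (\<lambda>x. indicator (cball a (r + cmod b)) x *\<^sub>R C)"
      by (rule borel_integrable_compact) auto
    show "Fb \<in> borel_measurable lborel" using borel_measurable_continuous_onI[OF c] by simp
    show "g n \<in> borel_measurable lborel" for n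
      unfolding g_def using mF by measurable
    show "AE x in lborel. (\<lambda>n. g n x) \<longlonglongrightarrow> Fb x"
    proof (rule AE_I2)
      fix x
      obtain \<xi> where \<xi>: "\<And>n. 0 < \<xi> n \<and> \<xi> n < d n \<and> g n x = Fb (x + \<xi> n *\<^sub>R b)" using mvt[of _ x] by metis
      have "\<xi> \<longlonglongrightarrow> 0"
      proof (rule tendsto_sandwich[of "\<lambda>n. 0" _ _ d])
        show "d \<longlonglongrightarrow> 0" unfolding d_def using LIMSEQ_inverse_real_of_nat by (simp add: inverse_eq_divide)
      qed (use \<xi> in \<open>auto intro: always_eventually less_imp_le\<close>)
      then have "(\<lambda>n. x + \<xi> n *\<^sub>R b) \<longlonglongrightarrow> x + 0 *\<^sub>R b" by (intro tendsto_intros)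
      moreover have "isCont Fb (x + 0 *\<^sub>R b)" using c by (simp add: continuous_on_eq_continuous_at)
      ultimately have "(\<lambda>n. Fb (x + \<xi> n *\<^sub>R b)) \<longlonglongrightarrow> Fb (x + 0 *\<^sub>R b)" by (metis isCont_tendsto_compose)
      then show "(\<lambda>n. g n x) \<longlonglongrightarrow> Fb x" using \<xi> by simp
    qed
    show "AE x in lborel. norm (g n x) \<le> indicator (cball a (r + cmod b)) x *\<^sub>R C" for n
    proof (rule AE_I2)
      fix x
      obtain \<xi> where \<xi>: "0 < \<xi>" "\<xi> < d n" "g n x = Fb (x + \<xi> *\<^sub>R b)" using mvt by blast
      show "norm (g n x) \<le> indicator (cball a (r + cmod b)) x *\<^sub>R C"
      proof (cases "x \<in> cball a (r + cmod b)")
        case False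
        then have "r + cmod b \<le> cmod (x - a)" by (simp add: dist_norm norm_minus_commute)
        moreover have "cmod (\<xi> *\<^sub>R b) \<le> cmod b" using \<xi> d0(2)[of n] by (simp add: mult_left_le_one_le)
        moreover have "cmod (x - a) \<le> cmod (x + \<xi> *\<^sub>R b - a) + cmod (\<xi> *\<^sub>R b)"
          using norm_triangle_ineq4[of "x + \<xi> *\<^sub>R b - a" "\<xi> *\<^sub>R b"] by simp
        ultimately have "Fb (x + \<xi> *\<^sub>R b) = 0" by (intro z(2)) linarith
        then show ?thesis using \<xi>(3) C by simp
      qed (use bd \<xi>(3) in simp)
    qed
  qed
  then have "(\<lambda>n. 0 :: real) \<longlonglongrightarrow> (LINT x|lborel. Fb x)" unfolding i0 .
  then show ?thesis using LIMSEQ_unique tendsto_const by metis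
qed

text \<open>Carries along the first derivative and the two pure second derivatives, the latter
  continuous, which is what integration against \<open>rad_lap\<close> in \<open>green_rad\<close>
  uses.\<close>

definition has_lap :: "complex set \<Rightarrow> (complex \<Rightarrow> real) \<Rightarrow> (complex \<Rightarrow> real) \<Rightarrow> bool" where
  "has_lap S f L \<longleftrightarrow> (\<exists>fx fy fxx fyy.
     (\<forall>z\<in>S. (f has_derivative (\<lambda>v. fx z * Re v + fy z * Im v)) (at z)) \<and>
     (\<forall>z\<in>S. \<exists>D. (fx has_derivative D) (at z) \<and> D 1 = fxx z) \<and>
     (\<forall>z\<in>S. \<exists>D. (fy has_derivative D) (at z) \<and> D \<i> = fyy z) \<and>
     (\<forall>z\<in>S. L z = fxx z + fyy z) \<and> continuous_on S fxx \<and> continuous_on S fyy)"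

lemma has_lap_laplacian:
  assumes "has_lap S f L" "open S" "z \<in> S" shows "laplacian f z = L z"
proof -
  obtain fx fy fxx fyy where f0:
    "\<forall>z\<in>S. (f has_derivative (\<lambda>v. fx z * Re v + fy z * Im v)) (at z)"
    "\<forall>z\<in>S. \<exists>D. (fx has_derivative D) (at z) \<and> D 1 = fxx z"
    "\<forall>z\<in>S. \<exists>D. (fy has_derivative D) (at z) \<and> D \<i> = fyy z"
    "\<forall>z\<in>S. L z = fxx z + fyy z" "continuous_on S fxx" "continuous_on S fyy"
    using assms(1) unfolding has_lap_def by (elim exE conjE) (rule that)
  note f = f0[rule_format]
  obtain Dx Dy where "(fx has_derivative Dx) (at z)" "Dx 1 = fxx z" "(fy has_derivative Dy) (at z)" "Dy \<i> = fyy z"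
    using f(2,3)[OF assms(3)] by blast
  then show ?thesis using laplacian_eqI[OF assms(2,3) f(1)] f(4)[OF assms(3)] by simp
qed

lemma has_lap_const: "has_lap S (\<lambda>z. c) (\<lambda>z. 0)"
  unfolding has_lap_def
proof (intro exI conjI ballI)
  show "((\<lambda>z. c) has_derivative (\<lambda>v. 0 * Re v + 0 * Im v)) (at z)" for z :: complex by simp
  show "((\<lambda>z. 0) has_derivative (\<lambda>v. 0)) (at z)" "((\<lambda>z. 0) has_derivative (\<lambda>v. 0)) (at z)" for z :: complex by auto
qed auto

lemma has_lap_add:
  assumes "has_lap S f L" "has_lap S g K" shows "has_lap S (\<lambda>z. f z + g z) (\<lambda>z. L z + K z)"
proof -
  obtain fx fy fxx fyy where f0: "\<forall>z\<in>S. (f has_derivative (\<lambda>v. fx z * Re v + fy z * Im v)) (at z)"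
     "\<forall>z\<in>S. \<exists>D. (fx has_derivative D) (at z) \<and> D 1 = fxx z"
     "\<forall>z\<in>S. \<exists>D. (fy has_derivative D) (at z) \<and> D \<i> = fyy z"
     "\<forall>z\<in>S. L z = fxx z + fyy z" "continuous_on S fxx" "continuous_on S fyy"
    using assms(1) unfolding has_lap_def by (elim exE conjE) (rule that)
  note f = f0[rule_format]
  obtain gx gy gxx gyy where g0: "\<forall>z\<in>S. (g has_derivative (\<lambda>v. gx z * Re v + gy z * Im v)) (at z)"
     "\<forall>z\<in>S. \<exists>D. (gx has_derivative D) (at z) \<and> D 1 = gxx z"
     "\<forall>z\<in>S. \<exists>D. (gy has_derivative D) (at z) \<and> D \<i> = gyy z"
     "\<forall>z\<in>S. K z = gxx z + gyy z" "continuous_on S gxx" "continuous_on S gyy"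
    using assms(2) unfolding has_lap_def by (elim exE conjE) (rule that)
  note g = g0[rule_format]
  show ?thesis unfolding has_lap_def
  proof (intro exI, intro conjI ballI)
    fix z assume z: "z \<in> S"
    show "((\<lambda>z. f z + g z) has_derivative (\<lambda>v. (fx z + gx z) * Re v + (fy z + gy z) * Im v)) (at z)"
      by (rule has_derivative_eq_rhs[OF has_derivative_add[OF f(1)[OF z] g(1)[OF z]]]) (simp add: algebra_simps)
    show "\<exists>D. ((\<lambda>z. fx z + gx z) has_derivative D) (at z) \<and> D 1 = fxx z + gxx z"

    proof -
      obtain D1 D2 where D: "(fx has_derivative D1) (at z)" "D1 1 = fxx z" "(gx has_derivative D2) (at z)" "D2 1 = gxx z"
        using f(2)[OF z] g(2)[OF z] by blast
      show ?thesis by (rule exI, rule conjI[OF has_derivative_add[OF D(1,3)]]) (simp add: D)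
    qed
    show "\<exists>D. ((\<lambda>z. fy z + gy z) has_derivative D) (at z) \<and> D \<i> = fyy z + gyy z"

    proof -
      obtain D1 D2 where D: "(fy has_derivative D1) (at z)" "D1 \<i> = fyy z" "(gy has_derivative D2) (at z)" "D2 \<i> = gyy z"
        using f(3)[OF z] g(3)[OF z] by blast
      show ?thesis by (rule exI, rule conjI[OF has_derivative_add[OF D(1,3)]]) (simp add: D)
    qed
    show "L z + K z = (fxx z + gxx z) + (fyy z + gyy z)" using f(4) g(4) z by simp
  qed (intro continuous_intros f g)+
qed

lemma has_lap_cmult:
  assumes "has_lap S f L" shows "has_lap S (\<lambda>z. c * f z) (\<lambda>z. c * L z)"
proof -
  obtain fx fy fxx fyy where f0: "\<forall>z\<in>S. (f has_derivative (\<lambda>v. fx z * Re v + fy z * Im v)) (at z)"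
     "\<forall>z\<in>S. \<exists>D. (fx has_derivative D) (at z) \<and> D 1 = fxx z"
     "\<forall>z\<in>S. \<exists>D. (fy has_derivative D) (at z) \<and> D \<i> = fyy z"
     "\<forall>z\<in>S. L z = fxx z + fyy z" "continuous_on S fxx" "continuous_on S fyy"
    using assms(1) unfolding has_lap_def by (elim exE conjE) (rule that)
  note f = f0[rule_format]
  show ?thesis unfolding has_lap_def
  proof (intro exI, intro conjI ballI)
    fix z assume z: "z \<in> S"
    show "((\<lambda>z. c * f z) has_derivative (\<lambda>v. (c * fx z) * Re v + (c * fy z) * Im v)) (at z)"
      by (rule has_derivative_eq_rhs[OF has_derivative_mult_right[OF f(1)[OF z]]]) (simp add: algebra_simps)
    show "\<exists>D. ((\<lambda>z. c * fx z) has_derivative D) (at z) \<and> D 1 = c * fxx z"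

    proof -
      obtain D1 where D: "(fx has_derivative D1) (at z)" "D1 1 = fxx z"
        using f(2)[OF z] by blast
      show ?thesis by (rule exI, rule conjI[OF has_derivative_mult_right[OF D(1)]]) (simp add: D)
    qed
    show "\<exists>D. ((\<lambda>z. c * fy z) has_derivative D) (at z) \<and> D \<i> = c * fyy z"

    proof -
      obtain D1 where D: "(fy has_derivative D1) (at z)" "D1 \<i> = fyy z"
        using f(3)[OF z] by blast
      show ?thesis by (rule exI, rule conjI[OF has_derivative_mult_right[OF D(1)]]) (simp add: D)
    qed
    show "c * L z = c * fxx z + c * fyy z" using f(4) z by (simp add: distrib_left)
  qed (intro continuous_intros f)+
qed

text \<open>With N = |G1|^2 + |G2|^2 and A its complex derivative, the Laplacian of ln N is 4 (T N -
  |A|^2) / N^2, and by Lagrange's identity T N - |A|^2 is the squared modulus of the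
  Wronskian.\<close>

lemma has_lap_ln:
  assumes S: "open S" and G: "G1 holomorphic_on S" "G2 holomorphic_on S"
    and nz: "\<And>z. z \<in> S \<Longrightarrow> G1 z \<noteq> 0 \<or> G2 z \<noteq> 0"
  shows "has_lap S (\<lambda>z. ln ((cmod (G1 z))\<^sup>2 + (cmod (G2 z))\<^sup>2))
    (\<lambda>z. 4 * (cmod (G1 z * deriv G2 z - G2 z * deriv G1 z))\<^sup>2 / ((cmod (G1 z))\<^sup>2 + (cmod (G2 z))\<^sup>2)\<^sup>2)"
proof -
  define N where "N = (\<lambda>z. (cmod (G1 z))\<^sup>2 + (cmod (G2 z))\<^sup>2)"
  define A where "A = (\<lambda>z. cnj (G1 z) * deriv G1 z + cnj (G2 z) * deriv G2 z)"
  define T where "T = (\<lambda>z. (cmod (deriv G1 z))\<^sup>2 + (cmod (deriv G2 z))\<^sup>2)"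
  define B where "B = (\<lambda>z. cnj (G1 z) * deriv (deriv G1) z + cnj (G2 z) * deriv (deriv G2) z)"
  have N0: "0 < N z" if "z \<in> S" for z
    using nz[OF that] unfolding N_def by (auto simp: add_pos_nonneg add_nonneg_pos)
  have hd: "deriv G1 holomorphic_on S" "deriv G2 holomorphic_on S" using G S by (auto intro: holomorphic_deriv)
  have der: "(f has_derivative (\<lambda>v. deriv f z * v)) (at z)" if "f holomorphic_on S" "z \<in> S" for f z
    using holomorphic_derivI[OF that(1) S that(2)] by (simp add: has_field_derivative_def)
  have dN: "(N has_derivative (\<lambda>v. 2 * Re (A z * v))) (at z)" if z: "z \<in> S" for z
    unfolding N_def power2_norm_eq_inner
    by (rule has_derivative_eq_rhs[OF has_derivative_add[OF has_derivative_inner[OF der[OF G(1) z] der[OF G(1) z]]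
          has_derivative_inner[OF der[OF G(2) z] der[OF G(2) z]]]])
       (simp add: fun_eq_iff A_def inner_complex_def algebra_simps)
  have dA: "(A has_derivative (\<lambda>v. of_real (T z) * cnj v + B z * v)) (at z)" if z: "z \<in> S" for z
    unfolding A_def
    by (rule has_derivative_eq_rhs[OF has_derivative_add[OF
          has_derivative_mult[OF bounded_linear.has_derivative[OF bounded_linear_cnj der[OF G(1) z]] der[OF hd(1) z]]
          has_derivative_mult[OF bounded_linear.has_derivative[OF bounded_linear_cnj der[OF G(2) z]] der[OF hd(2) z]]]])
       (simp add: fun_eq_iff T_def B_def complex_norm_square algebra_simps del: of_real_power)
  note c0 = G[THEN holomorphic_on_imp_continuous_on] hd[THEN holomorphic_on_imp_continuous_on]
    holomorphic_deriv[OF hd(1) S, THEN holomorphic_on_imp_continuous_on] holomorphic_deriv[OF hd(2) S, THEN holomorphic_on_imp_continuous_on]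
  have cT: "continuous_on S T" "continuous_on S A" "continuous_on S B" "continuous_on S N"
    unfolding T_def A_def B_def N_def by (intro continuous_intros c0)+
  have N0': "\<forall>z\<in>S. N z * N z \<noteq> 0" "\<forall>z\<in>S. N z \<noteq> 0" using N0 by force+
  have "has_lap S (\<lambda>z. ln (N z)) (\<lambda>z. 4 * (cmod (G1 z * deriv G2 z - G2 z * deriv G1 z))\<^sup>2 / (N z)\<^sup>2)"
    unfolding has_lap_def
  proof (intro exI, intro conjI ballI)
    fix z assume z: "z \<in> S"
    have "(ln has_derivative (\<lambda>h. inverse (N z) * h)) (at (N z))"
      using DERIV_ln[OF N0[OF z]] by (simp add: has_field_derivative_def)
    from has_derivative_compose[OF dN[OF z] this]
    show "((\<lambda>z. ln (N z)) has_derivative (\<lambda>v. (2 * Re (A z) / N z) * Re v + (- 2 * Im (A z) / N z) * Im v)) (at z)"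
      by (rule has_derivative_eq_rhs) (simp add: fun_eq_iff divide_inverse algebra_simps)
    have dv: "((\<lambda>z. c * f (A z) / N z) has_derivative (\<lambda>h. (c * f (of_real (T z) * cnj h + B z * h) * N z - c * f (A z) * (2 * Re (A z * h))) / (N z * N z))) (at z)"
      if "bounded_linear f" for f :: "complex \<Rightarrow> real" and c
      by (rule has_derivative_divide'[OF has_derivative_mult_right[OF bounded_linear.has_derivative[OF that dA[OF z]]] dN[OF z]])
         (use N0[OF z] in simp)
    show "\<exists>D. ((\<lambda>z. 2 * Re (A z) / N z) has_derivative D) (at z) \<and>
        D 1 = (2 * (T z + Re (B z)) * N z - 4 * (Re (A z))\<^sup>2) / (N z * N z)"
      by (rule exI, rule conjI[OF dv[OF bounded_linear_Re]]) (simp add: power2_eq_square)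
    show "\<exists>D. ((\<lambda>z. - 2 * Im (A z) / N z) has_derivative D) (at z) \<and>
        D \<i> = (2 * (T z - Re (B z)) * N z - 4 * (Im (A z))\<^sup>2) / (N z * N z)"
      by (rule exI, rule conjI[OF dv[OF bounded_linear_Im]]) (simp add: power2_eq_square algebra_simps)
    have "T z * N z - ((Re (A z))\<^sup>2 + (Im (A z))\<^sup>2) = (cmod (G1 z * deriv G2 z - G2 z * deriv G1 z))\<^sup>2"
      unfolding T_def N_def A_def cmod_power2 by (simp add: power2_eq_square algebra_simps)
    then have "4 * (cmod (G1 z * deriv G2 z - G2 z * deriv G1 z))\<^sup>2
       = (2 * (T z + Re (B z)) * N z - 4 * (Re (A z))\<^sup>2) + (2 * (T z - Re (B z)) * N z - 4 * (Im (A z))\<^sup>2)"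
      by (simp add: algebra_simps)
    then show "4 * (cmod (G1 z * deriv G2 z - G2 z * deriv G1 z))\<^sup>2 / (N z)\<^sup>2
       = (2 * (T z + Re (B z)) * N z - 4 * (Re (A z))\<^sup>2) / (N z * N z) + (2 * (T z - Re (B z)) * N z - 4 * (Im (A z))\<^sup>2) / (N z * N z)"
      by (simp add: add_divide_distrib power2_eq_square)
  qed (intro continuous_intros cT N0')+
  then show ?thesis unfolding N_def .
qed

lemma continuous_on_bump': "continuous_on S h \<Longrightarrow> continuous_on S (\<lambda>x. bump' n (h x))"
  unfolding bump'_def by (intro continuous_intros continuous_on_bump)

lemma continuous_on_rad:
  "continuous_on S (rad a r)" "continuous_on S (kern a r)" "continuous_on S (rad_lap a r)" "continuous_on S (radxx a r)" "continuous_on S (radyy a r)"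
  unfolding rad_def[abs_def] kern_def[abs_def] rad_lap_def[abs_def] radxx_def[abs_def] radyy_def[abs_def] divide_inverse
  by (intro continuous_intros continuous_on_bump continuous_on_bump')+

lemma continuous_on_zero_extension:
  fixes h k :: "complex \<Rightarrow> real"
  assumes S: "open S" "cball a r \<subseteq> S" and h: "continuous_on S h" and k: "continuous_on UNIV k" "\<And>z. r \<le> cmod (z - a) \<Longrightarrow> k z = 0"
  shows "continuous_on UNIV (\<lambda>z. h z * k z)" "integrable lborel (\<lambda>z. h z * k z)"
proof -
  have "continuous_on (S \<union> - cball a r) (\<lambda>z. h z * k z)"
  proof (rule continuous_on_open_Un[OF S(1)])
    show "continuous_on S (\<lambda>z. h z * k z)" by (intro continuous_intros h continuous_on_subset[OF k(1)]) auto
    have "h z * k z = 0" if "z \<in> - cball a r" for z using k(2)[of z] that by (auto simp: dist_norm norm_minus_commute)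
    then show "continuous_on (- cball a r) (\<lambda>z. h z * k z)" by (metis (mono_tags, lifting) continuous_on_cong continuous_on_const)
  qed (simp add: open_Compl)
  moreover have "S \<union> - cball a r = UNIV" using S(2) by auto
  ultimately show c: "continuous_on UNIV (\<lambda>z. h z * k z)" by simp
  show "integrable lborel (\<lambda>z. h z * k z)"
    by (rule integrable_cont_compact[OF c compact_cball[of a r]]) (use k(2) in \<open>auto simp: dist_norm norm_minus_commute\<close>)
qed

text \<open>In direction b the derivative of P u - p \<open>rad\<close> is P uu - pp
  \<open>rad\<close>, as the terms p u cancel; a compactly supported derivative integrates to
  0.\<close>

lemma green_direction:
  assumes S: "open S" "cball a r \<subseteq> S" and r: "0 < r"
    and u: "\<And>z. \<exists>D. (rad a r has_derivative D) (at z) \<and> D b = u z" "\<And>z. \<exists>D. (u has_derivative D) (at z) \<and> D b = uu z"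
      "\<And>z. r \<le> cmod (z - a) \<Longrightarrow> u z = 0" "\<And>z. r \<le> cmod (z - a) \<Longrightarrow> uu z = 0" "continuous_on UNIV uu"
    and P: "\<And>z. z \<in> S \<Longrightarrow> \<exists>D. (P has_derivative D) (at z) \<and> D b = p z" "\<And>z. z \<in> S \<Longrightarrow> \<exists>D. (p has_derivative D) (at z) \<and> D b = pp z"
      "continuous_on S P" "continuous_on S pp"
  shows "(LINT z|lborel. P z * uu z) = (LINT z|lborel. pp z * rad a r z)"
    "integrable lborel (\<lambda>z. P z * uu z)" "integrable lborel (\<lambda>z. pp z * rad a r z)"
proof -
  note e1 = continuous_on_zero_extension[OF S P(3) u(5,4)]
  note e2 = continuous_on_zero_extension[OF S P(4) continuous_on_rad(1) rad_zero(1)[OF r]]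
  show "integrable lborel (\<lambda>z. P z * uu z)" "integrable lborel (\<lambda>z. pp z * rad a r z)" using e1 e2 by auto
  have "(LINT z|lborel. P z * uu z - pp z * rad a r z) = 0"
  proof (rule integral_directional_derivative_zero[where b=b and a=a and r=r and F="\<lambda>z. P z * u z - p z * rad a r z"])
    show "continuous_on UNIV (\<lambda>z. P z * uu z - pp z * rad a r z)" by (intro continuous_intros e1 e2)
    show "\<exists>D. ((\<lambda>z. P z * u z - p z * rad a r z) has_derivative D) (at z) \<and> D b = P z * uu z - pp z * rad a r z" for z
    proof (cases "z \<in> S")
      case True
      obtain D1 D2 D3 D4 where D: "(rad a r has_derivative D1) (at z)" "D1 b = u z" "(u has_derivative D2) (at z)" "D2 b = uu z"
        "(P has_derivative D3) (at z)" "D3 b = p z" "(p has_derivative D4) (at z)" "D4 b = pp z"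
        using u(1,2)[of z] P(1,2)[OF True] by blast
      show ?thesis
        by (rule exI, rule conjI[OF has_derivative_diff[OF has_derivative_mult[OF D(5,3)] has_derivative_mult[OF D(7,1)]]])
           (simp add: D)
    next
      case False
      then have z: "z \<in> - cball a r" using S by auto
      have z0: "u w = 0" "rad a r w = 0" "uu w = 0" if "w \<in> - cball a r" for w
        using that u(3,4)[of w] rad_zero(1)[OF r, of w a] by (auto simp: dist_norm norm_minus_commute)
      have "((\<lambda>w. 0) has_derivative (\<lambda>h. 0 :: real)) (at z)" by simp
      then have "((\<lambda>z. P z * u z - p z * rad a r z) has_derivative (\<lambda>h. 0)) (at z)"
        by (rule has_derivative_transform_within_open[of _ _ _ _ "- cball a r"]) (use z z0 in \<open>auto simp: open_Compl\<close>)
      then show ?thesis using z0[OF z] by auto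
    qed
  qed (use u rad_zero[OF r] in auto)
  then show "(LINT z|lborel. P z * uu z) = (LINT z|lborel. pp z * rad a r z)"
    using e1(2) e2(2) by simp
qed

lemma green_rad:
  assumes S: "open S" "cball a r \<subseteq> S" and r: "0 < r" and P: "has_lap S P L"
  shows "(LINT z|lborel. P z * rad_lap a r z) = (LINT z|lborel. L z * rad a r z)"
    "integrable lborel (\<lambda>z. L z * rad a r z)"
proof -
  obtain fx fy fxx fyy where f0: "\<forall>z\<in>S. (P has_derivative (\<lambda>v. fx z * Re v + fy z * Im v)) (at z)"
     "\<forall>z\<in>S. \<exists>D. (fx has_derivative D) (at z) \<and> D 1 = fxx z"
     "\<forall>z\<in>S. \<exists>D. (fy has_derivative D) (at z) \<and> D \<i> = fyy z"
     "\<forall>z\<in>S. L z = fxx z + fyy z" "continuous_on S fxx" "continuous_on S fyy"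
    using P unfolding has_lap_def by (elim exE conjE) (rule that)
  note f = f0[rule_format]
  have cP: "continuous_on S P"
    by (intro continuous_at_imp_continuous_on ballI has_derivative_continuous[OF f(1)])
  have D: "\<exists>D. (rad a r has_derivative D) (at z) \<and> D 1 = radx a r z" "\<exists>D. (rad a r has_derivative D) (at z) \<and> D \<i> = rady a r z" for z
    by (rule exI, rule conjI[OF rad_deriv], simp)+
  have E: "\<exists>D. (P has_derivative D) (at z) \<and> D 1 = fx z" "\<exists>D. (P has_derivative D) (at z) \<and> D \<i> = fy z" if "z \<in> S" for z
    by (rule exI, rule conjI[OF f(1)[OF that]], simp)+
  note x = green_direction[OF S r D(1) radx_deriv rad_zero(4)[OF r] rad_zero(6)[OF r] continuous_on_rad(4) E(1) f(2) cP f(5)]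
  note y = green_direction[OF S r D(2) rady_deriv rad_zero(5)[OF r] rad_zero(7)[OF r] continuous_on_rad(5) E(2) f(3) cP f(6)]
  have L: "L z * rad a r z = fxx z * rad a r z + fyy z * rad a r z" for z
  proof (cases "z \<in> S")
    case False
    then have "rad a r z = 0" using S rad_zero(1)[OF r, of z a] by (force simp: dist_norm norm_minus_commute subset_iff)
    then show ?thesis by simp
  qed (simp add: f(4) distrib_right)
  have "P z * rad_lap a r z = P z * radxx a r z + P z * radyy a r z" for z
    using rad_lap_eq[of r a z] r by (simp add: distrib_left[symmetric])
  then show "(LINT z|lborel. P z * rad_lap a r z) = (LINT z|lborel. L z * rad a r z)"
    unfolding L using x y by simp
  show "integrable lborel (\<lambda>z. L z * rad a r z)" unfolding L using x y by simp
qed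

section \<open>Weakly harmonic upper semicontinuous functions\<close>

lemma nonneg_integral_zero:
  fixes f :: "complex \<Rightarrow> real"
  assumes c: "continuous_on UNIV f" and nn: "\<And>z. 0 \<le> f z" and r: "0 < r" "\<And>z. r \<le> cmod z \<Longrightarrow> f z = 0"
    and i: "(LINT z|lborel. f z) = 0"
  shows "f z = 0"
proof (cases "r \<le> cmod z")
  case False
  define u where "u = Complex r r"
  have out: "w \<in> cbox (- u) u" if "cmod w < r" for w
    using that abs_Re_le_cmod[of w] abs_Im_le_cmod[of w] by (auto simp: in_cbox_complex_iff u_def)
  have "integrable lborel f"
    by (rule integrable_cont_compact[OF c compact_cball[of 0 r]]) (use r(2) in auto)
  then have "(f has_integral 0) UNIV" using has_integral_integral_lborel i by metis
  moreover have "f = (\<lambda>w. if w \<in> cbox (- u) u then f w else 0)"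
    using out r(2) by (auto simp: fun_eq_iff not_le[symmetric])
  ultimately have "(f has_integral 0) (cbox (- u) u)" using has_integral_restrict_UNIV by metis
  then show ?thesis
  proof (rule has_integral_0_cbox_imp_0[rotated 2])
    show "continuous_on (cbox (- u) u) f" using c continuous_on_subset by blast
    have "0 \<in> box (- u) u" using r(1) by (simp add: in_box_complex_iff u_def)
    then show "box (- u) u \<noteq> {}" by blast
    show "z \<in> cbox (- u) u" using out False by simp
  qed (rule nn)
qed (rule r(2))

lemma compact_kernel_close:
  fixes f :: "'a::metric_space \<Rightarrow> 'b::metric_space \<Rightarrow> real"
  assumes "compact A" "compact K" "continuous_on (A \<times> K) (\<lambda>x. f (fst x) (snd x))" "0 < e"
  obtains d where "0 < d" "\<And>s t z. s \<in> A \<Longrightarrow> t \<in> A \<Longrightarrow> z \<in> K \<Longrightarrow> dist s t < d \<Longrightarrow> \<bar>f s z - f t z\<bar> < e"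
proof -
  have "uniformly_continuous_on (A \<times> K) (\<lambda>x. f (fst x) (snd x))"
    using assms by (intro compact_uniformly_continuous compact_Times)
  then obtain d where d: "0 < d" "\<And>x x'. x \<in> A \<times> K \<Longrightarrow> x' \<in> A \<times> K \<Longrightarrow> dist x' x < d \<Longrightarrow> dist (f (fst x') (snd x')) (f (fst x) (snd x)) < e"
    using assms(4) unfolding uniformly_continuous_on_def by blast
  show thesis
  proof (rule that[OF d(1)])
    fix s t z assume "s \<in> A" "t \<in> A" "z \<in> K" "dist s t < d"
    then show "\<bar>f s z - f t z\<bar> < e" using d(2)[of "(t, z)" "(s, z)"] by (simp add: dist_Pair_Pair dist_real_def)
  qed
qed

lemma integrable_kernel:
  fixes H k :: "complex \<Rightarrow> real"
  assumes H: "set_integrable lborel K H" and K: "compact K" and k: "continuous_on UNIV k" "\<And>z. z \<notin> K \<Longrightarrow> k z = 0"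
  shows "integrable lborel (\<lambda>z. H z * k z)"
    "(\<And>z. \<bar>k z\<bar> \<le> C) \<Longrightarrow> \<bar>LINT z|lborel. H z * k z\<bar> \<le> C * (LINT z|lborel. norm (indicator K z *\<^sub>R H z))"
proof -
  define h where "h = (\<lambda>z. indicator K z *\<^sub>R H z)"
  have ih: "integrable lborel h" using H unfolding set_integrable_def h_def .
  have eq: "H z * k z = h z * k z" for z using k(2)[of z] by (cases "z \<in> K") (auto simp: h_def)
  have mk: "k \<in> borel_measurable lborel" using borel_measurable_continuous_onI[OF k(1)] by simp
  have int: "integrable lborel (\<lambda>z. h z * k z)" if C: "\<And>z. \<bar>k z\<bar> \<le> C" for C
  proof (rule Bochner_Integration.integrable_bound)
    show "integrable lborel (\<lambda>z. C * norm (h z))" using ih by simp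
    show "(\<lambda>z. h z * k z) \<in> borel_measurable lborel" using borel_measurable_integrable[OF ih] mk by measurable
    show "AE z in lborel. norm (h z * k z) \<le> norm (C * norm (h z))"
    proof (rule AE_I2)
      fix z
      have "\<bar>h z\<bar> * \<bar>k z\<bar> \<le> \<bar>h z\<bar> * C" using C[of z] by (intro mult_left_mono) auto
      moreover have "0 \<le> C" using C[of z] by linarith
      ultimately show "norm (h z * k z) \<le> norm (C * norm (h z))" by (simp add: abs_mult mult.commute)
    qed
  qed
  have "bounded (k ` K)" by (intro compact_imp_bounded compact_continuous_image continuous_on_subset[OF k(1)] K) auto
  then obtain C0 where C0: "0 < C0" "\<And>x. x \<in> K \<Longrightarrow> \<bar>k x\<bar> \<le> C0" unfolding bounded_pos by auto
  have "\<bar>k z\<bar> \<le> C0" for z using C0 k(2)[of z] by (cases "z \<in> K") auto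
  from int[OF this] show "integrable lborel (\<lambda>z. H z * k z)" unfolding eq .
  show "\<bar>LINT z|lborel. H z * k z\<bar> \<le> C * (LINT z|lborel. norm (indicator K z *\<^sub>R H z))" if C: "\<And>z. \<bar>k z\<bar> \<le> C"
  proof -
    have "\<bar>LINT z|lborel. H z * k z\<bar> \<le> (LINT z|lborel. norm (h z * k z))"
      unfolding eq using integral_norm_bound[of lborel "\<lambda>z. h z * k z"] by simp
    also have "\<dots> \<le> (LINT z|lborel. C * norm (h z))"
    proof (rule integral_mono)
      show "integrable lborel (\<lambda>z. norm (h z * k z))" by (rule integrable_norm[OF int[OF C]])
      show "integrable lborel (\<lambda>z. C * norm (h z))" using ih by simp
      show "norm (h z * k z) \<le> C * norm (h z)" for z
        using mult_left_mono[OF C[of z], of "\<bar>h z\<bar>"] by (simp add: abs_mult mult.commute)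
    qed
    finally show ?thesis unfolding h_def by simp
  qed
qed

lemma kern_nonneg: "0 \<le> kern a r z"
  by (simp add: kern_def bump_nonneg)

lemma kern_pos: assumes "0 < r" "cmod (z - a) < r" shows "0 < kern a r z"
proof -
  have "(cmod (z - a))\<^sup>2 < r\<^sup>2" using assms by (intro power_strict_mono) auto
  then show ?thesis using assms unfolding kern_def by (intro divide_pos_pos bump_pos) auto
qed

lemma continuous_on_kern_params:
  assumes "continuous_on T h" "continuous_on T k" "continuous_on T l" "\<And>x. x \<in> T \<Longrightarrow> k x \<noteq> 0"
  shows "continuous_on T (\<lambda>x. kern (h x) (k x) (l x))" "continuous_on T (\<lambda>x. rad_lap (h x) (k x) (l x))"
  unfolding kern_def rad_lap_def
  by (intro continuous_intros continuous_on_bump continuous_on_bump' assms ballI; use assms(4) in simp)+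

locale weakly_harmonic =
  fixes W :: "complex set" and H :: "complex \<Rightarrow> real"
  assumes W: "open W"
    and integrable: "\<And>K. compact K \<Longrightarrow> K \<subseteq> W \<Longrightarrow> set_integrable lborel K H"
    and weak: "\<And>a r. 0 < r \<Longrightarrow> cball a r \<subseteq> W \<Longrightarrow> (LINT z|lborel. H z * rad_lap a r z) = 0"
begin

definition kmean :: "complex \<Rightarrow> real \<Rightarrow> real" where
  "kmean a r = (LINT z|lborel. H z * kern a r z)"

text \<open>The r-derivative of the kernel is \<open>rad_lap\<close> / (2 r), whose integral against
  H vanishes; differentiation under the integral is justified by uniform continuity of that
  derivative.\<close>

lemma kmean_const:
  assumes r: "0 < r1" "r1 \<le> r2" and sub: "cball a r2 \<subseteq> W"
  shows "kmean a r1 = kmean a r2"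
proof -
  define K where "K = cball a r2"
  have K: "compact K" "K \<subseteq> W" using sub by (auto simp: K_def)
  note H = integrable[OF K]
  define L where "L = (LINT z|lborel. norm (indicator K z *\<^sub>R H z))"
  have L: "0 \<le> L" unfolding L_def by simp
  have z0: "kern a s z = 0" "rad_lap a s z = 0" if "s \<in> {r1..r2}" "z \<notin> K" for s z
    using that r by (auto intro!: rad_zero simp: K_def dist_norm norm_minus_commute)
  have int: "integrable lborel (\<lambda>z. H z * kern a s z)" "integrable lborel (\<lambda>z. H z * rad_lap a s z)" if "s \<in> {r1..r2}" for s
    by (rule integrable_kernel(1)[OF H K(1) continuous_on_rad(2)], rule z0[OF that], assumption)
       (rule integrable_kernel(1)[OF H K(1) continuous_on_rad(3)], rule z0[OF that], assumption)
  have "\<exists>c. \<forall>s\<in>{r1..r2}. kmean a s = c"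
  proof (rule has_derivative_zero_constant)
    fix t assume t: "t \<in> {r1..r2}"
    show "(kmean a has_derivative (\<lambda>h. 0)) (at t within {r1..r2})"
      unfolding has_derivative_within_alt
    proof (intro conjI allI impI bounded_linear_zero)
      fix e :: real assume e: "0 < e"
      define e' where "e' = e / (L + 1)"
      have e': "0 < e'" "e' * L \<le> e" using e L by (auto simp: e'_def field_simps)
      have "continuous_on ({r1..r2} \<times> K) (\<lambda>x. rad_lap a (fst x) (snd x) / (2 * fst x))"
        using r(1) by (intro continuous_intros continuous_on_kern_params) auto
      then obtain d where d: "0 < d"
          "\<And>s t z. s \<in> {r1..r2} \<Longrightarrow> t \<in> {r1..r2} \<Longrightarrow> z \<in> K \<Longrightarrow> dist s t < d \<Longrightarrow>
             \<bar>rad_lap a s z / (2 * s) - rad_lap a t z / (2 * t)\<bar> < e'"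
        using compact_kernel_close[of "{r1..r2}" K "\<lambda>s z. rad_lap a s z / (2 * s)" e'] K(1) e' by blast
      \<comment> \<open>Stated for s < t with the derivative taken at s; it serves for increments to
        either side.\<close>
      have inc: "\<bar>kmean a t - kmean a s\<bar> \<le> e * (t - s)" if st: "s \<in> {r1..r2}" "t \<in> {r1..r2}" "s < t" "t - s < d" for s t
      proof -
        define k where "k = (\<lambda>z. kern a t z - kern a s z - ((t - s) / (2 * s)) * rad_lap a s z)"
        have s0: "0 < s" using st r by auto
        have ck: "continuous_on UNIV k" unfolding k_def by (intro continuous_intros continuous_on_rad)
        have k0: "k z = 0" if "z \<notin> K" for z unfolding k_def using z0[OF st(1) that] z0[OF st(2) that] by simp
        have kb: "\<bar>k z\<bar> \<le> e' * (t - s)" for z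
        proof (cases "z \<in> K")
          case True
          have "\<And>x. s \<le> x \<Longrightarrow> x \<le> t \<Longrightarrow> ((\<lambda>r. kern a r z) has_real_derivative rad_lap a x z / (2 * x)) (at x)"
            using s0 by (intro kern_deriv) auto
          from MVT2[OF st(3) this] obtain x where x: "s < x" "x < t" "kern a t z - kern a s z = (t - s) * (rad_lap a x z / (2 * x))"
            by blast
          have "\<bar>rad_lap a x z / (2 * x) - rad_lap a s z / (2 * s)\<bar> < e'"
            by (rule d(2)) (use st x True in \<open>auto simp: dist_real_def\<close>)
          then have "(t - s) * \<bar>rad_lap a x z / (2 * x) - rad_lap a s z / (2 * s)\<bar> \<le> (t - s) * e'"
            using st by (intro mult_left_mono) auto
          moreover have "k z = (t - s) * (rad_lap a x z / (2 * x) - rad_lap a s z / (2 * s))"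
            unfolding k_def x(3) by (simp add: right_diff_distrib)
          ultimately show ?thesis using st by (simp add: abs_mult mult.commute)
        qed (use k0 e' st in simp)
        have "(LINT z|lborel. H z * k z) = (LINT z|lborel. H z * kern a t z - H z * kern a s z - ((t - s) / (2 * s)) * (H z * rad_lap a s z))"
          unfolding k_def by (simp add: algebra_simps)
        also have "\<dots> = kmean a t - kmean a s - ((t - s) / (2 * s)) * (LINT z|lborel. H z * rad_lap a s z)"
          unfolding kmean_def using int st by simp
        also have "(LINT z|lborel. H z * rad_lap a s z) = 0"
          by (rule weak[OF s0]) (use st sub in auto)
        finally have "\<bar>kmean a t - kmean a s\<bar> = \<bar>LINT z|lborel. H z * k z\<bar>" by simp
        also have "\<dots> \<le> e' * (t - s) * L"
          unfolding L_def by (rule integrable_kernel(2)[OF H K(1) ck k0 kb])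
        also have "\<dots> = (e' * L) * (t - s)" by simp
        also have "\<dots> \<le> e * (t - s)" using e' st by (intro mult_right_mono) auto
        finally show ?thesis .
      qed
      show "\<exists>d>0. \<forall>y\<in>{r1..r2}. norm (y - t) < d \<longrightarrow> norm (kmean a y - kmean a t - 0) \<le> e * norm (y - t)"
      proof (intro exI conjI ballI impI)
        fix y assume y: "y \<in> {r1..r2}" "norm (y - t) < d"
        show "norm (kmean a y - kmean a t - 0) \<le> e * norm (y - t)"
          using inc[OF y(1) t] inc[OF t y(1)] y(2) by (cases y t rule: linorder_cases) (auto simp: abs_minus_commute)
      qed (rule d(1))
    qed
  qed simp
  then show ?thesis using r by auto
qed

end

definition kmass :: "real \<Rightarrow> real" where "kmass r = (LINT z|lborel. kern 0 r z)"

lemma kern_translate: "kern a r (a + z) = kern 0 r z"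
  by (simp add: kern_def)

lemma kmass_eq: "(LINT z|lborel. kern a r z) = kmass r"
  unfolding kmass_def using integral_translate[of "kern a r" a] borel_measurable_continuous_onI[OF continuous_on_rad(2)]
  by (simp add: kern_translate)

lemma integrable_kern: "0 < r \<Longrightarrow> integrable lborel (kern a r)"
  by (rule integrable_cont_compact[OF continuous_on_rad(2) compact_cball[of a r]])
     (auto intro!: rad_zero simp: dist_norm norm_minus_commute)

lemma kmass_pos: assumes "0 < r" shows "0 < kmass r"
proof -
  have "0 \<le> kmass r" unfolding kmass_def by (intro Bochner_Integration.integral_nonneg kern_nonneg)
  moreover have "kmass r \<noteq> 0"
  proof
    assume "kmass r = 0"
    have "kern 0 r 0 = 0"
    proof (rule nonneg_integral_zero[where f="kern 0 r" and r=r])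
      show "kern 0 r z = 0" if "r \<le> cmod z" for z using rad_zero(2)[OF assms, of z 0] that by simp
      show "(LINT z|lborel. kern 0 r z) = 0" using \<open>kmass r = 0\<close> by (simp add: kmass_def)
    qed (rule continuous_on_rad kern_nonneg assms)+
    then show False using kern_pos[OF assms, of 0 0] assms by simp
  qed
  ultimately show ?thesis by simp
qed

text \<open>The constant 1 is weakly harmonic, and \<open>kmass\<close> is its
  \<open>kmean\<close>.\<close>

lemma kmass_const: assumes "0 < r1" "r1 \<le> r2" shows "kmass r1 = kmass r2"
proof -
  interpret weakly_harmonic UNIV "\<lambda>z. 1"
  proof
    show "set_integrable lborel K (\<lambda>z. 1 :: real)" if "compact K" for K :: "complex set"
      unfolding set_integrable_def by (rule borel_integrable_compact[OF that]) simp
    show "(LINT z|lborel. 1 * rad_lap a r z) = 0" if "0 < r" for a r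
      using green_rad(1)[OF open_UNIV subset_UNIV that has_lap_const[of UNIV 1], of a] by simp
  qed simp
  show ?thesis using kmean_const[OF assms subset_UNIV, of 0] unfolding kmean_def kmass_def by simp
qed

text \<open>Averaging over rotations turns the integral of w times the kernel into a weighted
  average of circle means, each at least c. If the total equals c times the mass, the continuous
  nonnegative excess F integrates to 0, so each circle mean equals c.\<close>

lemma kern_submean:
  assumes r: "0 < r" and w: "continuous_on (cball a r) w"
    and lower: "\<And>\<rho>. 0 < \<rho> \<Longrightarrow> \<rho> \<le> r \<Longrightarrow> c \<le> amean (\<lambda>t. w (a + of_real \<rho> * cis t))" "c \<le> w a"
  shows "integrable lborel (\<lambda>z. w z * kern a r z)" "c * kmass r \<le> (LINT z|lborel. w z * kern a r z)"
    "(LINT z|lborel. w z * kern a r z) = c * kmass r \<Longrightarrow> 0 < \<rho> \<Longrightarrow> \<rho> < r \<Longrightarrow> amean (\<lambda>t. w (a + of_real \<rho> * cis t)) = c"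
proof -
  define k where "k = (\<lambda>z. w z * kern a r z)"
  have k0: "k z = 0" if "r \<le> cmod (z - a)" for z using rad_zero(2)[OF r that] by (simp add: k_def)
  have "continuous_on (cball a r \<union> - ball a r) k"
  proof (rule continuous_on_closed_Un)
    show "continuous_on (cball a r) k" unfolding k_def by (intro continuous_intros w continuous_on_rad)
    have "k z = 0" if "z \<in> - ball a r" for z using that by (intro k0) (auto simp: dist_norm norm_minus_commute)
    then show "continuous_on (- ball a r) k" by (metis (mono_tags, lifting) continuous_on_cong continuous_on_const)
  qed auto
  moreover have "cball a r \<union> - ball a r = UNIV" by auto
  ultimately have ck: "continuous_on UNIV k" by simp
  have ik: "integrable lborel k"
    by (rule integrable_cont_compact[OF ck compact_cball[of a r]]) (rule k0, auto simp: dist_norm norm_minus_commute)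
  then show "integrable lborel (\<lambda>z. w z * kern a r z)" unfolding k_def .
  define A where "A = (\<lambda>\<zeta>. amean (\<lambda>t. k (a + cis t * \<zeta>)))"
  define F where "F = (\<lambda>\<zeta>. A \<zeta> - c * kern 0 r \<zeta>)"
  have cA: "continuous_on UNIV A" unfolding A_def by (rule continuous_on_amean[OF ck])
  have A0: "A \<zeta> = 0" if "r \<le> cmod \<zeta>" for \<zeta>
  proof -
    have "k (a + cis t * \<zeta>) = 0" for t by (rule k0) (use that in \<open>simp add: norm_mult\<close>)
    then show ?thesis unfolding A_def by simp
  qed
  have F0: "F \<zeta> = 0" if "r \<le> cmod \<zeta>" for \<zeta>
    unfolding F_def using A0[OF that] rad_zero(2)[OF r, of \<zeta> 0] that by simp
  have cF: "continuous_on UNIV F" unfolding F_def by (intro continuous_intros cA continuous_on_rad)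
  have iA: "integrable lborel A"
    by (rule integrable_cont_compact[OF cA compact_cball[of 0 r]]) (rule A0, auto)
  have Fm: "F \<zeta> = kern 0 r \<zeta> * (amean (\<lambda>t. w (a + of_real (cmod \<zeta>) * cis t)) - c)" if z: "\<zeta> \<noteq> 0" "cmod \<zeta> \<le> r" for \<zeta>
  proof -
    have "k (a + cis t * \<zeta>) = kern 0 r \<zeta> * w (a + cis t * \<zeta>)" for t
      unfolding k_def kern_def by (simp add: norm_mult)
    then have "A \<zeta> = kern 0 r \<zeta> * amean (\<lambda>t. w (a + cis t * \<zeta>))" unfolding A_def by (simp add: amean_cmult)
    also have "amean (\<lambda>t. w (a + cis t * \<zeta>)) = amean (\<lambda>t. w (a + of_real (cmod \<zeta>) * cis t))"
      by (rule amean_phase[OF continuous_on_subset[OF w] z(1)]) (use z in auto)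
    finally show ?thesis unfolding F_def by (simp add: algebra_simps)
  qed
  have nn: "0 \<le> F \<zeta>" for \<zeta>
  proof -
    consider "\<zeta> = 0" | "r \<le> cmod \<zeta>" | "\<zeta> \<noteq> 0" "cmod \<zeta> \<le> r" by linarith
    then show ?thesis
    proof cases
      case 1
      have "F \<zeta> = kern 0 r 0 * (w a - c)" unfolding F_def A_def k_def 1 using r by (simp add: kern_def field_simps)
      then show ?thesis using lower(2) kern_nonneg[of 0 r 0] by simp
    next
      case 3
      then show ?thesis unfolding Fm[OF 3] using lower(1)[of "cmod \<zeta>"] kern_nonneg[of 0 r \<zeta>] by simp
    qed (simp add: F0)
  qed
  have "(LINT z|lborel. k z) = (LINT z|lborel. k (a + z))"
    by (rule integral_translate[OF borel_measurable_continuous_onI[OF ck], symmetric])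
  also have "\<dots> = (LINT \<zeta>|lborel. A \<zeta>)" unfolding A_def
  proof (rule integral_rotation_average[where R=r])
    show "continuous_on UNIV (\<lambda>z. k (a + z))" by (rule continuous_on_compose2[OF ck]) (auto intro!: continuous_intros)
  qed (rule k0, simp)
  finally have "(LINT z|lborel. F z) = (LINT z|lborel. w z * kern a r z) - c * kmass r"
    unfolding F_def k_def kmass_def using iA integrable_kern[OF r, of 0] by simp
  note iF = this
  have "0 \<le> (LINT z|lborel. F z)" by (intro Bochner_Integration.integral_nonneg nn)
  then show "c * kmass r \<le> (LINT z|lborel. w z * kern a r z)" unfolding iF by simp
  assume eq: "(LINT z|lborel. w z * kern a r z) = c * kmass r" and \<rho>: "0 < \<rho>" "\<rho> < r"
  have "F (of_real \<rho>) = 0"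
    by (rule nonneg_integral_zero[where f=F and r=r]) (use iF eq in \<open>auto intro: cF nn r F0\<close>)
  moreover have "0 < kern 0 r (of_real \<rho>)" using \<rho> r by (intro kern_pos) auto
  ultimately show "amean (\<lambda>t. w (a + of_real \<rho> * cis t)) = c" using Fm[of "of_real \<rho>"] \<rho> by simp
qed

text \<open>The weak equation alone determines H only almost everywhere. Upper semicontinuity and
  the sub-mean value property pin H down at every point, so that Weyl's lemma holds for H itself
  rather than for a modification.\<close>

locale weakly_harmonic_usc = weakly_harmonic +
  assumes usc: "usc_on W (\<lambda>z. ereal (H z))" and sub: "\<And>b. b \<in> W \<Longrightarrow> sub_at (\<lambda>z. ereal (H z)) b"
begin

lemma usc_subset: "S \<subseteq> W \<Longrightarrow> usc_on S (\<lambda>z. ereal (H z))"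
  unfolding usc_on_def
proof (intro conjI allI ballI)
  fix x assume S: "S \<subseteq> W"
  obtain T where "open T" "{z\<in>W. ereal (H z) < x} = W \<inter> T" using usc unfolding usc_on_def openin_open by blast
  then have "{z\<in>S. ereal (H z) < x} = S \<inter> T" using S by blast
  then show "openin (top_of_set S) {z\<in>S. ereal (H z) < x}" using \<open>open T\<close> by (simp add: openin_open_Int)
qed simp

lemma mean_lower:
  assumes "cball a \<rho> \<subseteq> W" "0 < \<rho>" "continuous_on (sphere a \<rho>) w" "\<And>z. z \<in> sphere a \<rho> \<Longrightarrow> H z \<le> w z"
  shows "H a \<le> amean (\<lambda>t. w (a + of_real \<rho> * cis t))"
proof -
  have "ereal (H a) \<le> ereal (amean (\<lambda>t. w (a + of_real \<rho> * cis t)))"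
  proof (rule sub_at_imp_mean[OF assms(2) usc_subset[OF assms(1)] _ assms(3)])
    show "sub_at (\<lambda>z. ereal (H z)) b" if "b \<in> ball a \<rho>" for b
      by (rule sub) (use that assms(1) ball_subset_cball in blast)
  qed (use assms(4) in simp)
  then show ?thesis by simp
qed

lemma integrable_kmean:
  assumes "0 < r" "cball a r \<subseteq> W" shows "Bochner_Integration.integrable lborel (\<lambda>z. H z * kern a r z)"
  by (rule integrable_kernel(1)[OF integrable[OF compact_cball assms(2)] compact_cball continuous_on_rad(2)])
     (rule rad_zero(2)[OF assms(1)], simp add: dist_norm norm_minus_commute)

text \<open>Approximates H from above by continuous functions, to which \<open>kern_submean\<close>
  applies, and passes to the limit by dominated convergence.\<close>

lemma kmean_lower:
  assumes r: "0 < r" and sub: "cball a r \<subseteq> W" shows "H a * kmass r \<le> kmean a r"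
proof -
  obtain w :: "nat \<Rightarrow> complex \<Rightarrow> real" where w: "\<And>n. continuous_on (cball a r) (w n)"
    "\<And>n x. x \<in> cball a r \<Longrightarrow> ereal (H x) \<le> ereal (w n x)" "\<And>x. x \<in> cball a r \<Longrightarrow> decseq (\<lambda>n. w n x)"
    "\<And>x. x \<in> cball a r \<Longrightarrow> (\<lambda>n. ereal (w n x)) \<longlonglongrightarrow> ereal (H x)"
    using usc_approx[OF usc_subset[OF sub] compact_cball] r by auto
  have low: "H a \<le> amean (\<lambda>t. w n (a + of_real \<rho> * cis t))" if "0 < \<rho>" "\<rho> \<le> r" for n \<rho>
  proof (rule mean_lower[OF _ that(1)])
    show "cball a \<rho> \<subseteq> W" using that(2) sub by (meson order_trans subset_cball)
    show "continuous_on (sphere a \<rho>) (w n)" by (rule continuous_on_subset[OF w(1)]) (use that in auto)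
    show "H z \<le> w n z" if "z \<in> sphere a \<rho>" for z using w(2)[of z n] that \<open>\<rho> \<le> r\<close> by simp
  qed
  have lowa: "H a \<le> w n a" for n using w(2)[of a n] r by simp
  note K = kern_submean(1,2)[OF r w(1) low lowa]
  have lim: "(\<lambda>n. LINT z|lborel. w n z * kern a r z) \<longlonglongrightarrow> (LINT z|lborel. H z * kern a r z)"
  proof (rule integral_dominated_convergence[where w="\<lambda>z. norm (w 0 z * kern a r z) + norm (H z * kern a r z)"])
    show "(\<lambda>z. H z * kern a r z) \<in> borel_measurable lborel" "(\<lambda>z. w n z * kern a r z) \<in> borel_measurable lborel" for n
      using integrable_kmean[OF r sub] K(1) by (auto dest: borel_measurable_integrable)
    show "Bochner_Integration.integrable lborel (\<lambda>z. norm (w 0 z * kern a r z) + norm (H z * kern a r z))"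
      by (intro Bochner_Integration.integrable_add integrable_norm K(1) integrable_kmean[OF r sub])
    have z0: "kern a r z = 0" if "z \<notin> cball a r" for z
      using that by (intro rad_zero(2)[OF r]) (simp add: dist_norm norm_minus_commute)
    show "AE z in lborel. (\<lambda>n. w n z * kern a r z) \<longlonglongrightarrow> H z * kern a r z"
    proof (rule AE_I2)
      fix z
      show "(\<lambda>n. w n z * kern a r z) \<longlonglongrightarrow> H z * kern a r z"
        using w(4)[of z] z0[of z] by (cases "z \<in> cball a r") (auto intro: tendsto_mult)
    qed
    show "AE z in lborel. norm (w n z * kern a r z) \<le> norm (w 0 z * kern a r z) + norm (H z * kern a r z)" for n
    proof (rule AE_I2)
      fix z
      show "norm (w n z * kern a r z) \<le> norm (w 0 z * kern a r z) + norm (H z * kern a r z)"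
      proof (cases "z \<in> cball a r")
        case True
        have "H z \<le> w n z" "w n z \<le> w 0 z" using w(2)[OF True, of n] decseqD[OF w(3)[OF True], of 0 n] by auto
        then have "\<bar>w n z\<bar> \<le> \<bar>w 0 z\<bar> + \<bar>H z\<bar>" by linarith
        then have "\<bar>w n z\<bar> * kern a r z \<le> (\<bar>w 0 z\<bar> + \<bar>H z\<bar>) * kern a r z" by (intro mult_right_mono kern_nonneg)
        then show ?thesis using kern_nonneg[of a r z] by (simp add: abs_mult distrib_right)
      qed (simp add: z0)
    qed
  qed
  show ?thesis unfolding kmean_def
    by (rule LIMSEQ_le_const[OF lim]) (use K(2) in auto)
qed

text \<open>For the upper bound the radius is shrunk, which does not change \<open>kmean\<close>,
  until upper semicontinuity gives H \<le> H a + e on the disc.\<close>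

lemma kmean_eq:
  assumes r: "0 < r" and sub: "cball a r \<subseteq> W" shows "kmean a r = H a * kmass r"
proof (rule antisym)
  have aW: "a \<in> W" using r sub by auto
  have "kmean a r \<le> (H a + e) * kmass r" if e: "0 < e" for e
  proof -
    have "openin (top_of_set W) {z\<in>W. ereal (H z) < ereal (H a + e)}" using usc unfolding usc_on_def by blast
    then have "open {z\<in>W. ereal (H z) < ereal (H a + e)}" using W by (simp add: openin_open_eq)
    then obtain \<rho>0 where \<rho>0: "0 < \<rho>0" "cball a \<rho>0 \<subseteq> {z\<in>W. ereal (H z) < ereal (H a + e)}"
      using open_contains_cball aW e by (metis (mono_tags, lifting) less_add_same_cancel1 less_ereal.simps(1) mem_Collect_eq)
    define \<rho> where "\<rho> = min \<rho>0 r"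
    have \<rho>: "0 < \<rho>" "\<rho> \<le> r" "cball a \<rho> \<subseteq> W" using \<rho>0 r sub by (auto simp: \<rho>_def)
    have Hle: "H z \<le> H a + e" if "z \<in> cball a \<rho>" for z using \<rho>0(2) that by (force simp: \<rho>_def)
    have "kmean a r = kmean a \<rho>" by (rule kmean_const[OF \<rho>(1,2) sub, symmetric])
    also have "\<dots> \<le> (LINT z|lborel. (H a + e) * kern a \<rho> z)"
      unfolding kmean_def
    proof (rule integral_mono)
      show "Bochner_Integration.integrable lborel (\<lambda>z. H z * kern a \<rho> z)" by (rule integrable_kmean[OF \<rho>(1,3)])
      show "Bochner_Integration.integrable lborel (\<lambda>z. (H a + e) * kern a \<rho> z)" using integrable_kern[OF \<rho>(1), of a] by simp
      show "H z * kern a \<rho> z \<le> (H a + e) * kern a \<rho> z" for z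
      proof (cases "z \<in> cball a \<rho>")
        case False
        then have "kern a \<rho> z = 0" by (intro rad_zero(2)[OF \<rho>(1)]) (simp add: dist_norm norm_minus_commute)
        then show ?thesis by simp
      qed (intro mult_right_mono Hle kern_nonneg)
    qed
    also have "\<dots> = (H a + e) * kmass r" by (simp add: kmass_eq kmass_const[OF \<rho>(1,2)])
    finally show ?thesis .
  qed
  note le = this
  show "kmean a r \<le> H a * kmass r"
  proof (rule ccontr)
    assume "\<not> kmean a r \<le> H a * kmass r"
    then have "0 < (kmean a r - H a * kmass r) / (2 * kmass r)" using kmass_pos[OF r] by simp
    from le[OF this] have "kmean a r \<le> H a * kmass r + (kmean a r - H a * kmass r) / 2"
      using kmass_pos[OF r] by (simp add: distrib_right)
    then show False using \<open>\<not> kmean a r \<le> H a * kmass r\<close> by (simp add: field_simps)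
  qed
qed (rule kmean_lower[OF assms])

text \<open>With a fixed radius \<open>kmean\<close> is continuous in the centre, because the kernel
  is, and by \<open>kmean_eq\<close> it is a constant multiple of H.\<close>

lemma continuous: "continuous_on W H"
  unfolding continuous_on_eq_continuous_at[OF W]
proof
  fix a0 assume "a0 \<in> W"
  then obtain R0 where R0: "0 < R0" "cball a0 R0 \<subseteq> W" using W open_contains_cball by blast
  define R where "R = R0 / 2"
  define K where "K = cball a0 R0"
  have R: "0 < R" "2 * R = R0" using R0 by (auto simp: R_def)
  have K: "compact K" "K \<subseteq> W" using R0 by (auto simp: K_def)
  note H = integrable[OF K]
  define L where "L = (LINT z|lborel. norm (indicator K z *\<^sub>R H z))"
  have L: "0 \<le> L" unfolding L_def by simp
  have sub: "cball a R \<subseteq> K" if "a \<in> cball a0 R" for a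
    unfolding K_def R(2)[symmetric] using that by (intro cball_subset_cball_iff[THEN iffD2]) (auto simp: dist_commute)
  have subW: "cball a R \<subseteq> W" if "a \<in> cball a0 R" for a using sub[OF that] K(2) by blast
  have z0: "kern a R z = 0" if "a \<in> cball a0 R" "z \<notin> K" for a z
    using sub[OF that(1)] that(2) by (intro rad_zero(2)[OF R(1)]) (force simp: dist_norm norm_minus_commute subset_iff)
  have "continuous_on (cball a0 R) (\<lambda>a. kmean a R)"
    unfolding continuous_on_iff
  proof (intro ballI allI impI)
    fix a and e :: real assume a: "a \<in> cball a0 R" and e: "0 < e"
    have e': "0 < e / (L + 1)" using e L by simp
    have "continuous_on (cball a0 R \<times> K) (\<lambda>x. kern (fst x) R (snd x))"
      using R(1) by (intro continuous_intros continuous_on_kern_params) auto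
    then obtain d where d: "0 < d" "\<And>s t z. s \<in> cball a0 R \<Longrightarrow> t \<in> cball a0 R \<Longrightarrow> z \<in> K \<Longrightarrow> dist s t < d \<Longrightarrow> \<bar>kern s R z - kern t R z\<bar> < e / (L + 1)"
      using compact_kernel_close[of "cball a0 R" K "\<lambda>s z. kern s R z" "e / (L + 1)"] K(1) e' by auto
    show "\<exists>d>0. \<forall>x'\<in>cball a0 R. dist x' a < d \<longrightarrow> dist (kmean x' R) (kmean a R) < e"
    proof (intro exI conjI ballI impI)
      fix b assume b: "b \<in> cball a0 R" "dist b a < d"
      define k where "k = (\<lambda>z. kern b R z - kern a R z)"
      have ck: "continuous_on UNIV k" unfolding k_def by (intro continuous_intros continuous_on_rad)
      have k0: "k z = 0" if "z \<notin> K" for z unfolding k_def using z0[OF a that] z0[OF b(1) that] by simp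
      have kb: "\<bar>k z\<bar> \<le> e / (L + 1)" for z
        using d(2)[OF b(1) a _ b(2), of z] k0[of z] e' unfolding k_def[symmetric] by (cases "z \<in> K") (auto simp: k_def)
      have "kmean b R - kmean a R = (LINT z|lborel. H z * k z)"
        unfolding kmean_def k_def using integrable_kmean[OF R(1) subW[OF a]] integrable_kmean[OF R(1) subW[OF b(1)]]
        by (simp add: right_diff_distrib)
      also have "\<bar>LINT z|lborel. H z * k z\<bar> \<le> e / (L + 1) * L"
        unfolding L_def[symmetric] by (rule integrable_kernel(2)[OF H K(1) ck k0 kb, folded L_def])
      also have "\<dots> < e" using e L by (simp add: field_simps)
      finally show "dist (kmean b R) (kmean a R) < e"
        using \<open>kmean b R - kmean a R = _\<close> by (simp add: dist_real_def)
    qed (rule d(1))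
  qed
  then have "continuous_on (cball a0 R) (\<lambda>a. kmean a R / kmass R)"
    using kmass_pos[OF R(1)] by (intro continuous_intros) auto
  moreover have "kmean a R / kmass R = H a" if "a \<in> cball a0 R" for a
    using kmean_eq[OF R(1) subW[OF that]] kmass_pos[OF R(1)] by simp
  ultimately have "continuous_on (cball a0 R) H" by (metis (mono_tags, lifting) continuous_on_cong)
  then show "isCont H a0" using R(1) by (intro continuous_on_interior[of "cball a0 R"]) auto
qed

text \<open>Equality in \<open>kern_submean\<close>, granted by \<open>kmean_eq\<close>, makes all
  small circle means equal to the value at the centre.\<close>

lemma super_mean: assumes "a \<in> W" shows "super_mean_at H a"
proof -
  obtain R where R: "0 < R" "cball a R \<subseteq> W" using assms W open_contains_cball by blast
  have c: "continuous_on (cball a R) H" using continuous R(2) continuous_on_subset by blast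
  have low: "H a \<le> amean (\<lambda>t. H (a + of_real \<rho> * cis t))" if "0 < \<rho>" "\<rho> \<le> R" for \<rho>
    by (rule mean_lower) (use that R(2) in \<open>auto intro!: continuous_on_subset[OF continuous] simp: subset_iff\<close>)
  have "amean (\<lambda>t. H (a + of_real \<rho> * cis t)) = H a" if "0 < \<rho>" "\<rho> < R" for \<rho>
    by (rule kern_submean(3)[OF R(1) c low _ _ that]) (use kmean_eq[OF R] in \<open>auto simp: kmean_def\<close>)
  then show ?thesis unfolding super_mean_at_def
    using R by (intro exI[of _ R]) (auto intro!: continuous_on_subset[OF continuous] simp: subset_iff)
qed

end

section \<open>Harmonic discs\<close>

lemma has_lap_fs_potential:
  assumes "open S" "G holomorphic_on S"
  shows "has_lap S (\<lambda>z. fs_potential (G z)) (\<lambda>z. 4 * (cmod (deriv G z))\<^sup>2 / (1 + (cmod (G z))\<^sup>2)\<^sup>2)"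
  using has_lap_ln[of S "\<lambda>z. 1" G] assms by (simp add: fs_potential_def[abs_def])

lemma fs_density_eq: "fs_density z = 4 / (1 + (cmod z)\<^sup>2)\<^sup>2 / (4 * pi)"
proof -
  have "has_lap UNIV (\<lambda>z. fs_potential z) (\<lambda>z. 4 * (cmod (deriv (\<lambda>z. z) z))\<^sup>2 / (1 + (cmod z)\<^sup>2)\<^sup>2)"
    by (rule has_lap_fs_potential) (auto intro: holomorphic_intros)
  from has_lap_laplacian[OF this open_UNIV UNIV_I] show ?thesis
    unfolding fs_density_def ddc_def by simp
qed

context hele_shaw
begin

text \<open>Along the disc, \<open>PF\<close> is \<Phi> plus the potential composed with G, and dd^c
  of the latter is the pullback of the Fubini-Study form. The disc equation thus says that the sum
  is weakly harmonic away from 0 and the poles.\<close>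

lemma harmonic_disc_bad_set:
  assumes "harmonic_disc \<Phi> g" shows "disc_graph g \<inter> bad_set = {}"
proof -
  have g: "holomorphic_to_p1 g (ball 0 1)" and wd: "weak_ddc_eq (ball 0 1) (\<lambda>\<tau>. real_of_ereal (\<Phi> (g \<tau>, \<tau>))) (\<lambda>\<tau>. - fs_pullback g \<tau>)"
    using assms unfolding harmonic_disc_def by auto
  define G where "G = (\<lambda>\<tau>. inv Fin (g \<tau>))"
  define D where "D = {\<tau>\<in>ball 0 1. \<tau> \<noteq> 0 \<and> g \<tau> \<noteq> Infty}"
  define u where "u = (\<lambda>\<tau>. real_of_ereal (\<Phi> (g \<tau>, \<tau>)))"
  define f where "f = (\<lambda>\<tau>. fs_potential (G \<tau>))"
  define L where "L = (\<lambda>z. 4 * (cmod (deriv G z))\<^sup>2 / (1 + (cmod (G z))\<^sup>2)\<^sup>2)"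
  define H where "H = (\<lambda>\<tau>. PF (G \<tau>) \<tau>)"
  note op = holomorphic_to_p1_finite[OF g, folded G_def]
  have D_eq: "D = {\<tau>\<in>ball 0 1. g \<tau> \<noteq> Infty} - {0}" unfolding D_def by auto
  have oD: "open D" unfolding D_eq by (intro open_delete op)
  have hG: "G holomorphic_on D" by (rule holomorphic_on_subset[OF op(2)]) (auto simp: D_def)
  have cG: "continuous_on D G" by (rule holomorphic_on_imp_continuous_on[OF hG])
  have DB: "D \<subseteq> ball 0 1" by (auto simp: D_def)
  have gF: "g \<tau> = Fin (G \<tau>)" if "\<tau> \<in> D" for \<tau> using that unfolding D_def G_def by (cases "g \<tau>") (auto simp: inv_f_f inj_def)
  have Hu: "H \<tau> = u \<tau> + f \<tau>" if "\<tau> \<in> D" for \<tau>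
    using gF[OF that] by (simp add: H_def PF_def u_def f_def)
  have cf: "continuous_on D f" unfolding f_def fs_potential_def
    by (intro continuous_intros cG ballI) (simp add: add_nonneg_eq_0_iff)
  have iu: "set_integrable lborel K u" "set_integrable lborel K f" if "compact K" "K \<subseteq> D" for K
  proof -
    show "set_integrable lborel K u" using wd that DB unfolding weak_ddc_eq_def u_def by (meson order_trans)
    show "set_integrable lborel K f" unfolding set_integrable_def
      by (rule borel_integrable_compact[OF that(1) continuous_on_subset[OF cf that(2)]])
  qed
  have lap: "has_lap D f L" unfolding f_def L_def by (rule has_lap_fs_potential[OF oD hG])
  interpret weakly_harmonic_usc D H
  proof
    show "open D" by (rule oD)
    show "set_integrable lborel K H" if K: "compact K" "K \<subseteq> D" for K
    proof -
      have "set_integrable lborel K (\<lambda>\<tau>. u \<tau> + f \<tau>)" by (rule set_integral_add(1)[OF iu[OF K]])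
      moreover have "(\<lambda>\<tau>. indicator K \<tau> *\<^sub>R (u \<tau> + f \<tau>)) = (\<lambda>\<tau>. indicator K \<tau> *\<^sub>R H \<tau>)"
        using Hu K(2) by (auto simp: fun_eq_iff indicator_def)
      ultimately show ?thesis unfolding set_integrable_def by simp
    qed
    show "(LINT z|lborel. H z * rad_lap a r z) = 0" if r: "0 < r" and sub: "cball a r \<subseteq> D" for a r
    proof -
      have z0: "rad a r z = 0" "rad_lap a r z = 0" if "z \<notin> cball a r" for z
        using that by (auto intro!: rad_zero[OF r] simp: dist_norm norm_minus_commute)
      have "test_function (ball 0 1) (rad a r)" by (rule test_function_rad[OF r]) (use sub DB in blast)
      then have "(LINT z|lborel. u z * ddc (rad a r) z) = (LINT z|lborel. rad a r z * - fs_pullback g z)"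
        using wd unfolding weak_ddc_eq_def u_def by blast
      moreover have "u z * ddc (rad a r) z = (u z * rad_lap a r z) / (4 * pi)" for z
        using ddc_rad[of r a z] r by simp
      moreover have "rad a r z * - fs_pullback g z = - (L z * rad a r z) / (4 * pi)" for z
      proof (cases "z \<in> cball a r")
        case True
        then have "g z \<noteq> Infty" using sub by (auto simp: D_def)
        then have "fs_pullback g z = L z / (4 * pi)"
          unfolding fs_pullback_def L_def Let_def fs_density_eq G_def by simp
        then show ?thesis by simp
      qed (simp add: z0)
      ultimately have "(LINT z|lborel. u z * rad_lap a r z) / (4 * pi) = - (LINT z|lborel. L z * rad a r z) / (4 * pi)" by simp
      then have "(LINT z|lborel. u z * rad_lap a r z) = - (LINT z|lborel. L z * rad a r z)"
        unfolding divide_cancel_right by simp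
      moreover have "(LINT z|lborel. f z * rad_lap a r z) = (LINT z|lborel. L z * rad a r z)"
        by (rule green_rad(1)[OF oD sub r lap])
      moreover have "H z * rad_lap a r z = u z * rad_lap a r z + f z * rad_lap a r z" for z
        using Hu[of z] z0[of z] sub by (cases "z \<in> cball a r") (auto simp: distrib_right)
      moreover have "integrable lborel (\<lambda>z. u z * rad_lap a r z)" "integrable lborel (\<lambda>z. f z * rad_lap a r z)"
        by (rule integrable_kernel(1)[OF iu(1)[OF compact_cball sub] compact_cball continuous_on_rad(3) z0(2)], assumption)
           (rule integrable_kernel(1)[OF iu(2)[OF compact_cball sub] compact_cball continuous_on_rad(3) z0(2)], assumption)
      ultimately show ?thesis by simp
    qed
    show "usc_on D (\<lambda>\<tau>. ereal (H \<tau>))"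
      unfolding H_def by (rule PF_usc[OF cG continuous_on_id]) (use DB in auto)
    show "sub_at (\<lambda>\<tau>. ereal (H \<tau>)) b" if "b \<in> D" for b
      unfolding H_def by (rule PF_sub_at[OF oD that hG]) (use DB in \<open>auto intro: holomorphic_intros\<close>)
  qed
  show ?thesis
    by (rule no_disc[OF g]) (use continuous super_mean in \<open>simp_all add: D_def H_def G_def\<close>)
qed

lemma open_bad_set: "open bad_set"
proof -
  define V where "V = {x :: complex \<times> complex. snd x \<noteq> 0 \<and> 1 - snd x * fst x \<noteq> 1 \<and>
      cmod (1 - snd x * fst x + of_real E) < sqrt E * cmod (snd x * fst x) \<and>
      (cmod (snd x * fst x))\<^sup>2 < Tq E (1 - snd x * fst x) * (cmod (snd x))\<^sup>2 * M}"
  have "open V" unfolding V_def Tq_def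
    by (intro open_Collect_conj open_Collect_neq open_Collect_less continuous_intros)
  moreover have "bad_set = (\<lambda>(z, \<tau>). (Fin z, \<tau>)) ` V" unfolding bad_set_def V_def by auto
  ultimately show ?thesis using open_chart_prod_image[OF Fin_in_charts] by simp
qed

text \<open>The point y = -E over \<tau> = 1: there y + E vanishes, so it lies well inside Buzano's
  range, and it is not a contact point, so the last inequality is strict.\<close>

lemma bad_set_boundary: "(Fin (of_real (1 + E)), 1) \<in> bad_set"
proof -
  have y: "1 - 1 * of_real (1 + E) = - complex_of_real E" by simp
  have c: "cmod (complex_of_real (1 + E)) = 1 + E" "cmod (- complex_of_real E) = E" using E0 by (simp_all del: of_real_add)
  have Msq: "M\<^sup>2 = 1 / E + 4 / (1 - E)\<^sup>2" unfolding M_def using E0 by (simp add: add_nonneg_nonneg)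
  have "(1 - E)\<^sup>2 * E - 2 * E * (1 + E\<^sup>2) = - E * (1 + E)\<^sup>2" by (simp add: power2_eq_square algebra_simps)
  then have "0 < ((1 - E)\<^sup>2 * E - 2 * E * (1 + E\<^sup>2))\<^sup>2 / (E * (1 - E)\<^sup>2)" using E0 E1 by (simp add: power2_eq_square)
  then have "(1 + E) ^ 4 < M\<^sup>2 * (Tq E (- of_real E))\<^sup>2" using M_identity[of E] unfolding Msq Tq_sq c by simp
  then have "((1 + E)\<^sup>2)\<^sup>2 < (Tq E (- of_real E) * M)\<^sup>2" by (simp add: power_mult_distrib mult.commute)
  then have "(1 + E)\<^sup>2 < Tq E (- of_real E) * M"
    by (rule power2_less_imp_less) (use M_pos Tq_pos[of "- of_real E"] in simp)
  moreover have "0 < sqrt E * (1 + E)" using E0 by simp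
  ultimately show ?thesis unfolding bad_set_def
    using E0 c y by (auto simp del: of_real_add)
qed

end

section \<open>Regularity of the boundary data\<close>

lemma C_k_chart:
  assumes "c \<in> charts"
  shows "C_k k (\<lambda>x :: complex \<times> real. (cmod (lY c (fst x)))\<^sup>2)"
    "C_k k (\<lambda>x :: complex \<times> real. (cmod (lY c (fst x) - cis (snd x) * lX c (fst x)))\<^sup>2)"
proof -
  have re: "C_k k (\<lambda>x :: complex \<times> real. Re (fst x))" and im: "C_k k (\<lambda>x :: complex \<times> real. Im (fst x))"
    using C_k_linear[OF bounded_linear_compose[OF bounded_linear_Re bounded_linear_fst]]
      C_k_linear[OF bounded_linear_compose[OF bounded_linear_Im bounded_linear_fst]] by auto
  have sc: "C_k k (\<lambda>x :: complex \<times> real. sin (snd x))" "C_k k (\<lambda>x :: complex \<times> real. cos (snd x))"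
    using C_k_sin_cos[OF C_k_linear[OF bounded_linear_snd]] by auto
  show "C_k k (\<lambda>x :: complex \<times> real. (cmod (lY c (fst x)))\<^sup>2)"
    using assms by (cases rule: charts_cases) (auto simp: cmod_power2 intro!: C_k_add C_k_power2 re im)
  show "C_k k (\<lambda>x :: complex \<times> real. (cmod (lY c (fst x) - cis (snd x) * lX c (fst x)))\<^sup>2)"
    using assms by (cases rule: charts_cases)
      (auto simp: cmod_power2 intro!: C_k_add C_k_power2 C_k_diff C_k_minus C_k_mult re im sc)
qed

lemma chart_form_pos:
  assumes c: "c \<in> charts" and t: "\<tau> \<noteq> 0" and ab: "0 < a" "0 < b"
  shows "0 < a * (cmod (lY c z))\<^sup>2 + b * (cmod (lY c z - \<tau> * lX c z))\<^sup>2"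
proof (cases "lY c z = 0")
  case True
  have "lX c z \<noteq> 0" using c True by (cases rule: charts_cases) auto
  then show ?thesis using True ab t by simp
qed (use ab in \<open>simp add: add_pos_nonneg\<close>)

lemma data_smooth:
  assumes E: "0 < E" and c: "c \<in> charts"
  shows "smooth (\<lambda>(z, \<theta>::real). data E (c z, cis \<theta>))"
proof -
  have pos: "0 < a * (cmod (lY c z))\<^sup>2 + b * (cmod (lY c z - cis \<theta> * lX c z))\<^sup>2" if "0 < a" "0 < b" for a b z \<theta>
    by (rule chart_form_pos[OF c _ that]) simp
  have "data E (c z, cis \<theta>) = (1/2) * ln (S1 E (lX c z) (lY c z) (cis \<theta>)) + (1/2) * ln (S2 E (lX c z) (lY c z) (cis \<theta>)) - ln (1 + (cmod z)\<^sup>2)" for z \<theta>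
  proof -
    have s: "0 < S1 E (lX c z) (lY c z) (cis \<theta>)" "0 < S2 E (lX c z) (lY c z) (cis \<theta>)"
      using pos[of E 1 z \<theta>] pos[of 1 E z \<theta>] E by (simp_all add: S1_def S2_def)
    show ?thesis using s one_plus_sq_pos[of z] unfolding data_def
      by (simp add: chart_hom2[OF c hom2_Th]) (simp add: Th_def ln_div ln_sqrt ln_mult)
  qed
  then have eq: "(\<lambda>(z, \<theta>::real). data E (c z, cis \<theta>)) = (\<lambda>x. (1/2) * ln (S1 E (lX c (fst x)) (lY c (fst x)) (cis (snd x)))
      + (1/2) * ln (S2 E (lX c (fst x)) (lY c (fst x)) (cis (snd x))) - ln (1 + (cmod (fst x))\<^sup>2))"
    by (auto simp: fun_eq_iff)
  have re: "C_k k (\<lambda>x :: complex \<times> real. 1 + (cmod (fst x))\<^sup>2)" for k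
    using C_k_chart(1)[OF chart_Infty_in_charts, of k] by (auto intro: C_k_add)
  show ?thesis unfolding smooth_def eq
  proof
    fix k
    have "C_k k (\<lambda>x :: complex \<times> real. ln (S1 E (lX c (fst x)) (lY c (fst x)) (cis (snd x))))"
      "C_k k (\<lambda>x :: complex \<times> real. ln (S2 E (lX c (fst x)) (lY c (fst x)) (cis (snd x))))"
      unfolding S1_def S2_def using pos[of E 1] pos[of 1 E] E
      by (auto intro!: C_k_ln C_k_add C_k_mult C_k_chart[OF c])
    moreover have "C_k k (\<lambda>x :: complex \<times> real. ln (1 + (cmod (fst x))\<^sup>2))" by (rule C_k_ln[OF one_plus_sq_pos re])
    ultimately show "C_k k (\<lambda>x :: complex \<times> real. (1/2) * ln (S1 E (lX c (fst x)) (lY c (fst x)) (cis (snd x)))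
      + (1/2) * ln (S2 E (lX c (fst x)) (lY c (fst x)) (cis (snd x))) - ln (1 + (cmod (fst x))\<^sup>2))"
      by (intro C_k_diff C_k_add C_k_mult C_k_const)
  qed
qed

text \<open>Square roots of a and b make the form a sum |\<alpha> Y|^2 + |\<beta> (Y - \<tau> X)|^2
  for \<open>has_lap_ln\<close>; the Wronskian has the constant modulus |\<alpha> \<beta>
  \<tau>|.\<close>

lemma has_lap_chart:
  assumes c: "c \<in> charts" and t: "cmod \<tau> = 1" and ab: "0 < a" "0 < b"
  shows "has_lap UNIV (\<lambda>z. ln (a * (cmod (lY c z))\<^sup>2 + b * (cmod (lY c z - \<tau> * lX c z))\<^sup>2))
    (\<lambda>z. 4 * (a * b) / (a * (cmod (lY c z))\<^sup>2 + b * (cmod (lY c z - \<tau> * lX c z))\<^sup>2)\<^sup>2)"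
proof -
  define \<alpha> \<beta> where "\<alpha> = complex_of_real (sqrt a)" and "\<beta> = complex_of_real (sqrt b)"
  have sq: "(cmod \<alpha>)\<^sup>2 = a" "(cmod \<beta>)\<^sup>2 = b" "\<alpha> \<noteq> 0" "\<beta> \<noteq> 0" using ab by (simp_all add: \<alpha>_def \<beta>_def)
  have t0: "\<tau> \<noteq> 0" using t by auto
  have n: "(cmod (\<alpha> * w))\<^sup>2 = a * (cmod w)\<^sup>2" "(cmod (\<beta> * w))\<^sup>2 = b * (cmod w)\<^sup>2" for w
    using sq by (simp_all add: norm_mult power_mult_distrib)
  have ab': "(cmod (\<alpha> * (\<beta> * \<tau>)))\<^sup>2 = a * b" unfolding n using t by simp
  show ?thesis using c
  proof (cases rule: charts_cases)
    case Fin
    have "deriv (\<lambda>z. \<beta> * (1 - \<tau> * z)) z = - (\<beta> * \<tau>)" for z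
      by (rule DERIV_imp_deriv) (auto intro!: derivative_eq_intros)
    moreover have "has_lap UNIV (\<lambda>z. ln ((cmod (\<alpha> * 1))\<^sup>2 + (cmod (\<beta> * (1 - \<tau> * z)))\<^sup>2))
      (\<lambda>z. 4 * (cmod ((\<alpha> * 1) * deriv (\<lambda>z. \<beta> * (1 - \<tau> * z)) z - (\<beta> * (1 - \<tau> * z)) * deriv (\<lambda>z. \<alpha> * 1) z))\<^sup>2
        / ((cmod (\<alpha> * 1))\<^sup>2 + (cmod (\<beta> * (1 - \<tau> * z)))\<^sup>2)\<^sup>2)"
      by (rule has_lap_ln) (use sq in \<open>auto intro!: holomorphic_intros\<close>)
    ultimately show ?thesis unfolding n using ab' by (simp add: Fin sq)
  next
    case Infty
    have "deriv (\<lambda>z. \<beta> * (z - \<tau>)) z = \<beta>" "deriv (\<lambda>z. \<alpha> * z) z = \<alpha>" for z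
      by (rule DERIV_imp_deriv, auto intro!: derivative_eq_intros)+
    moreover have "has_lap UNIV (\<lambda>z. ln ((cmod (\<alpha> * z))\<^sup>2 + (cmod (\<beta> * (z - \<tau>)))\<^sup>2))
      (\<lambda>z. 4 * (cmod ((\<alpha> * z) * deriv (\<lambda>z. \<beta> * (z - \<tau>)) z - (\<beta> * (z - \<tau>)) * deriv (\<lambda>z. \<alpha> * z) z))\<^sup>2
        / ((cmod (\<alpha> * z))\<^sup>2 + (cmod (\<beta> * (z - \<tau>)))\<^sup>2)\<^sup>2)"
      by (rule has_lap_ln) (use sq t0 in \<open>auto intro!: holomorphic_intros\<close>)
    moreover have "\<alpha> * z * \<beta> - \<beta> * (z - \<tau>) * \<alpha> = \<alpha> * (\<beta> * \<tau>)" for z by (simp add: algebra_simps)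
    ultimately show ?thesis unfolding n using ab' by (simp add: Infty)
  qed
qed

text \<open>The Fubini-Study potential cancels, leaving a positive multiple of the Laplacians of ln
  n1 and ln n2, both of which are positive.\<close>

lemma data_kaehler:
  assumes E: "0 < E" and c: "c \<in> charts" and t: "\<tau> \<in> sphere 0 1"
  shows "0 < fs_density z + ddc (\<lambda>z. data E (c z, \<tau>)) z"
proof -
  have t1: "cmod \<tau> = 1" using t by simp
  define n1 where "n1 = (\<lambda>z. S1 E (lX c z) (lY c z) \<tau>)"
  define n2 where "n2 = (\<lambda>z. S2 E (lX c z) (lY c z) \<tau>)"
  have "\<tau> \<noteq> 0" using t1 by auto
  from chart_form_pos[OF c this E, of 1] chart_form_pos[OF c this _ E, of 1]
  have pos: "0 < n1 z" "0 < n2 z" for z unfolding n1_def n2_def S1_def S2_def by simp_all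
  have d: "(\<lambda>z. data E (c z, \<tau>)) = (\<lambda>z. ((1/2) * ln (n1 z) + (1/2) * ln (n2 z)) + (- 1) * fs_potential z)"
  proof
    fix z
    show "data E (c z, \<tau>) = ((1/2) * ln (n1 z) + (1/2) * ln (n2 z)) + (- 1) * fs_potential z"
      using pos[of z] one_plus_sq_pos[of z] unfolding data_def fs_potential_def
      by (simp add: chart_hom2[OF c hom2_Th]) (simp add: Th_def n1_def n2_def ln_div ln_sqrt ln_mult)
  qed
  have l: "has_lap UNIV (\<lambda>z. ln (n1 z)) (\<lambda>z. 4 * E / (n1 z)\<^sup>2)" "has_lap UNIV (\<lambda>z. ln (n2 z)) (\<lambda>z. 4 * E / (n2 z)\<^sup>2)"
    using has_lap_chart[OF c t1 E, of 1] has_lap_chart[OF c t1 _ E, of 1] by (simp_all add: n1_def n2_def S1_def S2_def)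
  have fs: "has_lap UNIV (\<lambda>z. fs_potential z) (\<lambda>z. 4 * (cmod (deriv (\<lambda>z. z) z))\<^sup>2 / (1 + (cmod z)\<^sup>2)\<^sup>2)"
    by (rule has_lap_fs_potential) (auto intro: holomorphic_intros)
  have "laplacian (\<lambda>z. data E (c z, \<tau>)) z = ((1/2) * (4 * E / (n1 z)\<^sup>2) + (1/2) * (4 * E / (n2 z)\<^sup>2)) + (- 1) * (4 * (cmod (deriv (\<lambda>z. z) z))\<^sup>2 / (1 + (cmod z)\<^sup>2)\<^sup>2)"
    unfolding d by (rule has_lap_laplacian[OF has_lap_add[OF has_lap_add[OF has_lap_cmult[OF l(1)] has_lap_cmult[OF l(2)]] has_lap_cmult[OF fs]]]) auto
  then have "fs_density z + ddc (\<lambda>z. data E (c z, \<tau>)) z = (2 * E / (n1 z)\<^sup>2 + 2 * E / (n2 z)\<^sup>2) / (4 * pi)"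
    unfolding ddc_def fs_density_eq by (simp add: add_divide_distrib diff_divide_distrib)
  also have "0 < \<dots>" using pos[of z] E by (intro divide_pos_pos add_pos_pos) auto
  finally show ?thesis .
qed

theorem theorem2:
  shows "\<exists>\<phi> :: p1 \<times> complex \<Rightarrow> real.
    smooth_boundary_data \<phi> \<and>
    (\<exists>U. openin (top_of_set (UNIV \<times> cball 0 1)) U \<and>
         U \<inter> (UNIV \<times> sphere 0 1) \<noteq> {} \<and>
         (\<forall>g. harmonic_disc (hmae_solution \<phi>) g \<longrightarrow> disc_graph g \<inter> U = {}))"
proof -
  \<comment> \<open>Then E exp (8 \<pi>) = 1/4, which is below ln 2 / 2 because ln 2 \<ge>
    2/3.\<close>
  define E :: real where "E = exp (- 8 * pi) / 4"
  have ex: "E * exp (8 * pi) = 1/4" unfolding E_def by (simp add: exp_minus)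
  interpret hele_shaw E
  proof
    show "0 < E" by (simp add: E_def)
    have "exp (- 8 * pi) \<le> exp (- 8 :: real)" using pi_gt3 by simp
    also have "\<dots> \<le> 1 / 9" using exp_ge_add_one_self[of 8] by (simp add: exp_minus field_simps)
    finally show "E < 1 / 10" by (simp add: E_def)
    show "E * exp (8 * pi) < ln 2 / 2" unfolding ex using ln2_ge_two_thirds by simp
  qed
  let ?U = "(UNIV \<times> cball 0 1) \<inter> bad_set"
  have "smooth_boundary_data (data E)"
    unfolding smooth_boundary_data_def using data_smooth[OF E0] data_kaehler[OF E0] by blast
  moreover have "openin (top_of_set (UNIV \<times> cball 0 1)) ?U" by (intro openin_open_Int open_bad_set)
  moreover have "?U \<inter> (UNIV \<times> sphere 0 1) \<noteq> {}" using bad_set_boundary by force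
  moreover have "disc_graph g \<inter> ?U = {}" if "harmonic_disc (hmae_solution (data E)) g" for g
    using harmonic_disc_bad_set[of g] that by blast
  ultimately show ?thesis by blast
qed

end
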